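(* Let $\Omega\subset\mathbb{R}^2$ be a bounded Lipschitz polygon (not necessarily convex) and suppose that the regularity assumption $\mathbf{R}(\Omega)$ holds with exponent $s$. Let $\pi_h$ be a regular triangulation of $\Omega$ with mesh diameter $h$. For $\mathbf{f}\in\mathbf{L}^2(\Omega)$ let $\mathbf{w}\in\mathbf{H}^{1+s}(\Omega)$ be the solution of $$\mathbf{w}\in\mathbf{H}^1_0(\Omega),\qquad a(\mathbf{w},\mathbf{v})=b(\mathbf{f},\mathbf{v})\quad\forall\,\mathbf{v}\in\mathbf{H}^1_0(\Omega),$$ and let $D_h(\mathbf{w},\mathbf{v})=a_h(\mathbf{w},\mathbf{v})-b(\mathbf{f},\mathbf{v})$. Then $$|D_h(\mathbf{w},\mathbf{v})|\le C\,h^{s}\,\|\mathbf{f}\|_{\mathbf{L}^2(\Omega)}\,\|\mathbf{v}\|_h\qquad\forall\,\mathbf{v}\in\mathbf{H}(h),$$ where $C>0$ is independent of $\mu$, $\lambda$ and $h$.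
   Context: Bold symbols denote $\mathbb{R}^2$-valued functions and product Sobolev spaces. The Lamé parameters satisfy $(\mu,\lambda)\in[\mu_0,\mu_1]\times(0,+\infty)$ with fixed $0<\mu_0<\mu_1<\infty$. $b(\mathbf{u},\mathbf{v})=\int_\Omega\mathbf{u}\cdot\mathbf{v}\,d\mathbf{x}$ and $a(\mathbf{u},\mathbf{v})=\int_\Omega(\mu\nabla\mathbf{u}:\nabla\mathbf{v}+(\mu+\lambda)\,\mathrm{div}\,\mathbf{u}\,\mathrm{div}\,\mathbf{v})d\mathbf{x}$, with $A:B=\mathrm{tr}(AB^T)$. Assumption $\mathbf{R}(\Omega)$: for any $\mathbf{f}\in\mathbf{L}^2(\Omega)$ there exists $\mathbf{w}\in\mathbf{H}^{1+s}(\Omega)\cap\mathbf{W}^{2,p}(\Omega)\cap\mathbf{H}^1_0(\Omega)$ with $a(\mathbf{w},\mathbf{v})=b(\mathbf{f},\mathbf{v})$ for all $\mathbf{v}\in\mathbf{H}^1_0(\Omega)$ and $\|\mathbf{w}\|_{\mathbf{H}^{1+s}(\Omega)}+\lambda\|\mathrm{div}\,\mathbf{w}\|_{s,\Omega}\le C_\Omega\|\mathbf{f}\|_{\mathbf{L}^2(\Omega)}$, for some $\frac12-\varepsilon<s\le1$, where $\varepsilon>0$ is an arbitrarily small constant, $p=\frac{2}{2-s}$, and $C_\Omega$ is independent of $\mu,\lambda,\mathbf{f}$. $\pi_h=\{\kappa\}$ is a triangulation of $\Omega$ into triangles, regular in the sense that $h_\kappa/\rho_\kappa\le\nu$ with $\nu$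 fixed ($h_\kappa$ the diameter of $\kappa$, $\rho_\kappa$ the supremum of diameters of circles in $\kappa$); $h=\max_\kappa h_\kappa$. Let $\mathcal{E}_h^i,\mathcal{E}_h^b$ be the sets of interior and boundary edges, and $[[v]]$ the jump of $v$ across an interior edge. The Crouzeix–Raviart space is $$S_0^h(\Omega)=\{v\in L^2(\Omega): v|_\kappa\in P_1(\kappa)\ \forall\kappa\in\pi_h,\ \int_\ell[[v]]ds=0\ \forall\ell\in\mathcal{E}_h^i,\ \int_\ell v\,ds=0\ \forall\ell\in\mathcal{E}_h^b\},$$ $\mathbf{S}_0^h(\Omega)=S_0^h(\Omega)^2$, and $\mathbf{H}(h)=\mathbf{S}_0^h(\Omega)+\mathbf{H}^1_0(\Omega)$. For $\mathbf{u},\mathbf{v}\in\mathbf{H}(h)$, $a_h(\mathbf{u},\mathbf{v})=\mu\int_\Omega\nabla_h\mathbf{u}:\nabla_h\mathbf{v}\,d\mathbf{x}+(\mu+\lambda)\int_\Omega\mathrm{div}_h\mathbf{u}\,\mathrm{div}_h\mathbf{v}\,d\mathbf{x}$, where $\nabla_h,\mathrm{div}_h$ are the elementwise gradient and divergence, and $\|\mathbf{v}\|_h=\sqrt{a_h(\mathbf{v},\mathbf{v})}$. The constant $C$ is also independent of $\mathbf{f}$ and $\mathbf{v}$; it may depend on $\Omega,\nu,s,\mu_0,\mu_1$. *)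

theory Defs
  imports "HOL-Analysis.Analysis"
begin

text \<open>Members of function spaces on a planar set are total functions on the plane; only their values
  almost everywhere on that set matter.\<close>

type_synonym point = "real^2"
type_synonym scalar_field = "point \<Rightarrow> real"
type_synonym vector_field = "point \<Rightarrow> real^2"

section \<open>Bounded Lipschitz polygons\<close>

text \<open>Near each boundary point the domain is, in a suitable orthonormal frame \<open>(e\<^sub>1, e\<^sub>2)\<close>,
  the strict epigraph of a Lipschitz function.\<close>

definition lipschitz_boundary :: "point set \<Rightarrow> bool" where
  "lipschitz_boundary \<Omega> \<longleftrightarrow>
     (\<forall>x\<in>frontier \<Omega>. \<exists>r>0. \<exists>L \<gamma> e\<^sub>1 e\<^sub>2.
        L-lipschitz_on (UNIV :: real set) (\<gamma> :: real \<Rightarrow> real) \<and>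
        norm e\<^sub>1 = 1 \<and> norm e\<^sub>2 = 1 \<and> e\<^sub>1 \<bullet> e\<^sub>2 = 0 \<and>
        \<Omega> \<inter> ball x r = {y \<in> ball x r. \<gamma> ((y - x) \<bullet> e\<^sub>1) < (y - x) \<bullet> e\<^sub>2})"

definition polygonal_boundary :: "point set \<Rightarrow> bool" where
  "polygonal_boundary \<Omega> \<longleftrightarrow>
     (\<exists>S. finite S \<and> frontier \<Omega> = (\<Union>(a, b)\<in>S. closed_segment a b))"

definition bounded_lipschitz_polygon :: "point set \<Rightarrow> bool" where
  "bounded_lipschitz_polygon \<Omega> \<longleftrightarrow>
     open \<Omega> \<and> connected \<Omega> \<and> \<Omega> \<noteq> {} \<and> bounded \<Omega> \<and>
     lipschitz_boundary \<Omega> \<and> polygonal_boundary \<Omega>"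

section \<open>Weak derivatives and Sobolev spaces\<close>

definition partial :: "2 \<Rightarrow> scalar_field \<Rightarrow> scalar_field" where
  "partial i \<phi> x = frechet_derivative \<phi> (at x) (axis i 1)"

primrec Ck :: "nat \<Rightarrow> scalar_field \<Rightarrow> bool" where
  "Ck 0 \<phi> \<longleftrightarrow> continuous_on UNIV \<phi>"
| "Ck (Suc k) \<phi> \<longleftrightarrow> (\<forall>x. \<phi> differentiable (at x)) \<and> (\<forall>i. Ck k (partial i \<phi>))"

definition test_functions :: "point set \<Rightarrow> scalar_field set" where
  "test_functions \<Omega> =
     {\<phi>. (\<forall>k. Ck k \<phi>) \<and> compact (closure {x. \<phi> x \<noteq> 0}) \<and> closure {x. \<phi> x \<noteq> 0} \<subseteq> \<Omega>}"

definition locally_integrable :: "point set \<Rightarrow> scalar_field \<Rightarrow> bool" where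
  "locally_integrable \<Omega> u \<longleftrightarrow> (\<forall>K. compact K \<and> K \<subseteq> \<Omega> \<longrightarrow> u absolutely_integrable_on K)"

definition has_weak_partial :: "point set \<Rightarrow> 2 \<Rightarrow> scalar_field \<Rightarrow> scalar_field \<Rightarrow> bool" where
  "has_weak_partial \<Omega> i u g \<longleftrightarrow>
     locally_integrable \<Omega> u \<and> locally_integrable \<Omega> g \<and>
     (\<forall>\<phi>\<in>test_functions \<Omega>.
        (LINT x|lebesgue_on \<Omega>. u x * partial i \<phi> x) = - (LINT x|lebesgue_on \<Omega>. g x * \<phi> x))"

text \<open>Weak derivatives are unique up to null sets; this selects a representative whenever one
  exists.\<close>

definition weak_partial :: "point set \<Rightarrow> 2 \<Rightarrow> scalar_field \<Rightarrow> scalar_field" where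
  "weak_partial \<Omega> i u = (SOME g. has_weak_partial \<Omega> i u g)"

definition Lp :: "point set \<Rightarrow> real \<Rightarrow> scalar_field set" where
  "Lp \<Omega> p = {u. u \<in> borel_measurable (lebesgue_on \<Omega>) \<and>
                 integrable (lebesgue_on \<Omega>) (\<lambda>x. \<bar>u x\<bar> powr p)}"

primrec sobolev :: "point set \<Rightarrow> nat \<Rightarrow> real \<Rightarrow> scalar_field set" where
  "sobolev \<Omega> 0 p = Lp \<Omega> p"
| "sobolev \<Omega> (Suc k) p =
     {u \<in> Lp \<Omega> p. \<forall>i. \<exists>g\<in>sobolev \<Omega> k p. has_weak_partial \<Omega> i u g}"

abbreviation L2 :: "point set \<Rightarrow> scalar_field set" where
  "L2 \<Omega> \<equiv> Lp \<Omega> 2"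

abbreviation H1 :: "point set \<Rightarrow> scalar_field set" where
  "H1 \<Omega> \<equiv> sobolev \<Omega> 1 2"

definition L2_norm :: "point set \<Rightarrow> scalar_field \<Rightarrow> real" where
  "L2_norm \<Omega> u = sqrt (LINT x|lebesgue_on \<Omega>. (u x)\<^sup>2)"

definition H1_norm :: "point set \<Rightarrow> scalar_field \<Rightarrow> real" where
  "H1_norm \<Omega> u = sqrt ((L2_norm \<Omega> u)\<^sup>2 + (\<Sum>i\<in>UNIV. (L2_norm \<Omega> (weak_partial \<Omega> i u))\<^sup>2))"

definition H10 :: "point set \<Rightarrow> scalar_field set" where
  "H10 \<Omega> = {u \<in> H1 \<Omega>. \<forall>\<epsilon>>0. \<exists>\<phi>\<in>test_functions \<Omega>. H1_norm \<Omega> (\<lambda>x. u x - \<phi> x) < \<epsilon>}"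

text \<open>Sobolev--Slobodeckij spaces \<open>H\<^sup>s\<close> and \<open>H\<^sup>1\<^sup>+\<^sup>s\<close>. They are meant for \<open>0 < s \<le> 1\<close> only, with
  \<open>s = 1\<close> giving \<open>H\<^sup>1\<close> and \<open>H\<^sup>2\<close>.\<close>

definition slobodeckij_quotient :: "real \<Rightarrow> scalar_field \<Rightarrow> point \<times> point \<Rightarrow> real" where
  "slobodeckij_quotient s u = (\<lambda>(x, y). (u x - u y)\<^sup>2 / norm (x - y) powr (2 + 2 * s))"

definition Hs :: "point set \<Rightarrow> real \<Rightarrow> scalar_field set" where
  "Hs \<Omega> s =
     (if s = 1 then H1 \<Omega>
      else {u \<in> L2 \<Omega>. integrable (lebesgue_on \<Omega> \<Otimes>\<^sub>M lebesgue_on \<Omega>) (slobodeckij_quotient s u)})"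

definition Hs_norm :: "point set \<Rightarrow> real \<Rightarrow> scalar_field \<Rightarrow> real" where
  "Hs_norm \<Omega> s u =
     (if s = 1 then H1_norm \<Omega> u
      else sqrt ((L2_norm \<Omega> u)\<^sup>2 +
             (LINT z|(lebesgue_on \<Omega> \<Otimes>\<^sub>M lebesgue_on \<Omega>). slobodeckij_quotient s u z)))"

definition H1s :: "point set \<Rightarrow> real \<Rightarrow> scalar_field set" where
  "H1s \<Omega> s = {u \<in> H1 \<Omega>. \<forall>i. weak_partial \<Omega> i u \<in> Hs \<Omega> s}"

definition H1s_norm :: "point set \<Rightarrow> real \<Rightarrow> scalar_field \<Rightarrow> real" where
  "H1s_norm \<Omega> s u =
     sqrt ((L2_norm \<Omega> u)\<^sup>2 + (\<Sum>i\<in>UNIV. (Hs_norm \<Omega> s (weak_partial \<Omega> i u))\<^sup>2))"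

definition vec_space :: "scalar_field set \<Rightarrow> vector_field set" where
  "vec_space V = {u. \<forall>i. (\<lambda>x. u x $ i) \<in> V}"

definition vec_norm :: "(scalar_field \<Rightarrow> real) \<Rightarrow> vector_field \<Rightarrow> real" where
  "vec_norm N u = sqrt (\<Sum>i\<in>UNIV. (N (\<lambda>x. u x $ i))\<^sup>2)"

section \<open>The elasticity problem\<close>

definition weak_grad :: "point set \<Rightarrow> vector_field \<Rightarrow> point \<Rightarrow> real^2^2" where
  "weak_grad \<Omega> u x = (\<chi> i j. weak_partial \<Omega> j (\<lambda>y. u y $ i) x)"

definition weak_div :: "point set \<Rightarrow> vector_field \<Rightarrow> scalar_field" where
  "weak_div \<Omega> u x = (\<Sum>i\<in>UNIV. weak_partial \<Omega> i (\<lambda>y. u y $ i) x)"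

definition frobenius :: "real^2^2 \<Rightarrow> real^2^2 \<Rightarrow> real" where
  "frobenius A B = trace (A ** transpose B)"

definition b_form :: "point set \<Rightarrow> vector_field \<Rightarrow> vector_field \<Rightarrow> real" where
  "b_form \<Omega> u v = (LINT x|lebesgue_on \<Omega>. u x \<bullet> v x)"

definition a_form :: "point set \<Rightarrow> real \<Rightarrow> real \<Rightarrow> vector_field \<Rightarrow> vector_field \<Rightarrow> real" where
  "a_form \<Omega> \<mu> lam u v =
     (LINT x|lebesgue_on \<Omega>. \<mu> * frobenius (weak_grad \<Omega> u x) (weak_grad \<Omega> v x) +
                             (\<mu> + lam) * (weak_div \<Omega> u x * weak_div \<Omega> v x))"

definition weak_solution ::
  "point set \<Rightarrow> real \<Rightarrow> real \<Rightarrow> vector_field \<Rightarrow> vector_field \<Rightarrow> bool" where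
  "weak_solution \<Omega> \<mu> lam f w \<longleftrightarrow>
     w \<in> vec_space (H10 \<Omega>) \<and>
     (\<forall>v\<in>vec_space (H10 \<Omega>). a_form \<Omega> \<mu> lam w v = b_form \<Omega> f v)"

definition regularity_assumption ::
  "point set \<Rightarrow> real \<Rightarrow> real \<Rightarrow> real \<Rightarrow> real \<Rightarrow> bool" where
  "regularity_assumption \<Omega> \<mu>\<^sub>0 \<mu>\<^sub>1 \<epsilon> s \<longleftrightarrow>
     1/2 - \<epsilon> < s \<and> s \<le> 1 \<and>
     (\<exists>C\<^sub>\<Omega>>0. \<forall>\<mu>\<in>{\<mu>\<^sub>0..\<mu>\<^sub>1}. \<forall>lam>0. \<forall>f\<in>vec_space (L2 \<Omega>).
        \<exists>w. w \<in> vec_space (H1s \<Omega> s) \<and> w \<in> vec_space (sobolev \<Omega> 2 (2 / (2 - s))) \<and>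
            weak_solution \<Omega> \<mu> lam f w \<and>
            vec_norm (H1s_norm \<Omega> s) w + lam * Hs_norm \<Omega> s (weak_div \<Omega> w)
              \<le> C\<^sub>\<Omega> * vec_norm (L2_norm \<Omega>) f)"

section \<open>Triangulations\<close>

definition mesh :: "point set \<Rightarrow> point set set \<Rightarrow> bool" where
  "mesh \<Omega> \<T> \<longleftrightarrow> triangulation \<T> \<and> (\<forall>\<kappa>\<in>\<T>. 2 simplex \<kappa>) \<and> \<Union>\<T> = closure \<Omega>"

definition inner_diameter :: "point set \<Rightarrow> real" where
  "inner_diameter \<kappa> = Sup {diameter (cball c r) | c r. 0 < r \<and> cball c r \<subseteq> \<kappa>}"

definition regular_mesh :: "real \<Rightarrow> point set set \<Rightarrow> bool" where
  "regular_mesh \<nu> \<T> \<longleftrightarrow> (\<forall>\<kappa>\<in>\<T>. diameter \<kappa> / inner_diameter \<kappa> \<le> \<nu>)"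

definition mesh_size :: "point set set \<Rightarrow> real" where
  "mesh_size \<T> = Max (diameter ` \<T>)"

definition boundary_edges :: "point set \<Rightarrow> point set set \<Rightarrow> point set set" where
  "boundary_edges \<Omega> \<T> = {e. (\<exists>\<kappa>\<in>\<T>. e facet_of \<kappa>) \<and> e \<subseteq> frontier \<Omega>}"

definition interior_edges :: "point set \<Rightarrow> point set set \<Rightarrow> point set set" where
  "interior_edges \<Omega> \<T> = {e. (\<exists>\<kappa>\<in>\<T>. e facet_of \<kappa>) \<and> \<not> e \<subseteq> frontier \<Omega>}"

text \<open>Arc-length integral over a segment; the choice of orientation is immaterial.\<close>

definition edge_integral :: "point set \<Rightarrow> scalar_field \<Rightarrow> real" where
  "edge_integral e g =
     (let (a, b) = (SOME (a, b). e = closed_segment a b)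
      in norm (b - a) * integral {0..1} (\<lambda>t. g (linepath a b t)))"

section \<open>The Crouzeix--Raviart element\<close>

definition P1 :: "scalar_field set" where
  "P1 = {q. \<exists>c d. \<forall>x. q x = c \<bullet> x + d}"

text \<open>As \<open>v\<close> is only determined up to null sets, its trace on an edge of \<open>\<kappa>\<close> is that of the affine
  function \<open>q \<kappa>\<close> with which it agrees on \<open>\<kappa>\<close>. The sign of the jump is immaterial, so both
  orderings of the two adjacent triangles are allowed.\<close>

definition crouzeix_raviart :: "point set \<Rightarrow> point set set \<Rightarrow> scalar_field set" where
  "crouzeix_raviart \<Omega> \<T> =
     {v \<in> L2 \<Omega>. \<exists>q :: point set \<Rightarrow> scalar_field.
        (\<forall>\<kappa>\<in>\<T>. q \<kappa> \<in> P1 \<and> (AE x in lebesgue_on (interior \<kappa>). v x = q \<kappa> x)) \<and>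
        (\<forall>e\<in>interior_edges \<Omega> \<T>. \<forall>\<kappa>\<in>\<T>. \<forall>\<kappa>'\<in>\<T>.
           \<kappa> \<noteq> \<kappa>' \<and> e facet_of \<kappa> \<and> e facet_of \<kappa>' \<longrightarrow>
           edge_integral e (\<lambda>x. q \<kappa> x - q \<kappa>' x) = 0) \<and>
        (\<forall>e\<in>boundary_edges \<Omega> \<T>. \<forall>\<kappa>\<in>\<T>. e facet_of \<kappa> \<longrightarrow> edge_integral e (q \<kappa>) = 0)}"

definition Hh :: "point set \<Rightarrow> point set set \<Rightarrow> vector_field set" where
  "Hh \<Omega> \<T> = {(\<lambda>x. u x + z x) | u z.
               u \<in> vec_space (crouzeix_raviart \<Omega> \<T>) \<and> z \<in> vec_space (H10 \<Omega>)}"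

text \<open>Elementwise weak derivatives, set to zero on the null set of element boundaries.\<close>

definition broken_grad :: "point set set \<Rightarrow> vector_field \<Rightarrow> point \<Rightarrow> real^2^2" where
  "broken_grad \<T> u x =
     (\<Sum>\<kappa>\<in>\<T>. indicat_real (interior \<kappa>) x *\<^sub>R weak_grad (interior \<kappa>) u x)"

definition broken_div :: "point set set \<Rightarrow> vector_field \<Rightarrow> scalar_field" where
  "broken_div \<T> u x =
     (\<Sum>\<kappa>\<in>\<T>. indicat_real (interior \<kappa>) x * weak_div (interior \<kappa>) u x)"

definition ah_form ::
  "point set \<Rightarrow> point set set \<Rightarrow> real \<Rightarrow> real \<Rightarrow> vector_field \<Rightarrow> vector_field \<Rightarrow> real" where
  "ah_form \<Omega> \<T> \<mu> lam u v =
     \<mu> * (LINT x|lebesgue_on \<Omega>. frobenius (broken_grad \<T> u x) (broken_grad \<T> v x)) +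
     (\<mu> + lam) * (LINT x|lebesgue_on \<Omega>. broken_div \<T> u x * broken_div \<T> v x)"

definition h_norm :: "point set \<Rightarrow> point set set \<Rightarrow> real \<Rightarrow> real \<Rightarrow> vector_field \<Rightarrow> real" where
  "h_norm \<Omega> \<T> \<mu> lam v = sqrt (ah_form \<Omega> \<T> \<mu> lam v v)"

definition Dh ::
  "point set \<Rightarrow> point set set \<Rightarrow> real \<Rightarrow> real \<Rightarrow> vector_field \<Rightarrow> vector_field \<Rightarrow> vector_field \<Rightarrow> real"
  where
  "Dh \<Omega> \<T> \<mu> lam f w v = ah_form \<Omega> \<T> \<mu> lam w v - b_form \<Omega> f v"

end

(* Only the restriction of the stress to single triangles and the weak equation tested with smooth
   functions are used, so neither traces nor a Gauss theorem for rough fields are needed. On each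
   triangle let c be the mean of v over one of its edges, computed from v and its weak gradient by
   Gauss' theorem; by the Crouzeix-Raviart conditions it is the same from both sides and vanishes on
   boundary edges. A smooth companion E_k of v is built which near every edge is the corresponding
   constant, multiplied by cutoffs that vanish near the vertices; it is a test function, so D_h(w,v)
   is a sum over the triangles of the integrals of tau.(grad v - grad E_k) - f(v - E_k), tau being a
   row of the stress. As grad v - grad E_k has asymptotically mean zero on each triangle, tau may be
   replaced by its deviation from its mean, and the singularity of order 1/r of grad E_k at the
   vertices is absorbed by a Hardy inequality, since the Slobodeckij seminorm controls the mean
   oscillation of tau over the corners of the triangle (a Campanato condition). *)
theory Submission
  imports Defs "HOL-Computational_Algebra.Polynomial"
begin

text \<open>The classical argument integrates by parts on each triangle and pairs the normal stress
  with the jumps of v. Subtracting a test function avoids traces, but a function with different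
  constants on the edges that meet at a vertex has a gradient of order 1/r there, which is not
  square integrable: paired with a stress that is merely in L^2 the bound diverges logarithmically.
  The smoothness s > 0 pays for this logarithm, whence the factor \<open>hardy_const s\<close> in
  the constant. The gradient of a vertex cutoff is multiplied by the full value of the companion,
  including the mean of v, and is not small; it disappears only as k tends to infinity. So the limit
  is taken on every triangle first and the estimate is made afterwards. Robustness in lambda comes
  from the stress: lambda multiplies only the divergence of w, and the regularity assumption bounds
  lambda times the norm of the divergence directly.\<close>

abbreviation lint :: "'a measure => ('a => real) => real" where
 "lint \<equiv> integral\<^sup>L"

abbreviation tri :: "point => point => point => point set" where
 "tri p q r \<equiv> convex hull {p, q, r}"

abbreviation ind :: "'a set => 'a => real" where
 "ind \<equiv> indicat_real"

abbreviation leb :: "point set => point measure" where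
 "leb \<equiv> lebesgue_on"

lemmas Bintegrable_add = Bochner_Integration.integrable_add
 and Bintegrable_bound = Bochner_Integration.integrable_bound
 and Bintegrable_diff = Bochner_Integration.integrable_diff
 and Bintegrable_sum = Bochner_Integration.integrable_sum
 and Bintegral_add = Bochner_Integration.integral_add
 and Bintegral_diff = Bochner_Integration.integral_diff
 and Bintegral_nonneg = Bochner_Integration.integral_nonneg
 and Bintegral_sum = Bochner_Integration.integral_sum

section \<open>Smooth functions on open sets and a smooth step\<close>

text \<open>Localised form of \<open>Ck\<close>: the companions contain quotients that are smooth
  only away from the vertices. Derivatives are taken over full neighbourhoods, so
  \<open>smooth_on\<close> asks for an open set.\<close>

primrec Ck_on :: "nat => point set => scalar_field => bool" where
 "Ck_on 0 U \<phi> \<longleftrightarrow> continuous_on U \<phi>"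
| "Ck_on (Suc k) U \<phi> \<longleftrightarrow> (\<forall>x\<in>U. \<phi> differentiable (at x)) \<and> (\<forall>i. Ck_on k U (partial i \<phi>))"

definition smooth_on :: "point set => scalar_field => bool" where
 "smooth_on U \<phi> \<longleftrightarrow> open U \<and> (\<forall>k. Ck_on k U \<phi>)"

lemma partial_eq: "(\<phi> has_derivative D) (at x) ==> partial i \<phi> x = D (axis i 1)"
 unfolding partial_def by (metis frechet_derivative_at)

lemma Ck_on_UNIV: "Ck_on k UNIV \<phi> = Ck k \<phi>"
 by (induction k arbitrary: \<phi>) auto

lemma partial_cong_open:
 assumes "open U" "x \<in> U" "!!y. y \<in> U ==> \<phi> y = \<psi> y"
 shows "partial i \<phi> x = partial i \<psi> x" and "\<phi> differentiable (at x) \<longleftrightarrow> \<psi> differentiable (at x)"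
proof -
 have "(\<phi> has_derivative D) (at x) \<longleftrightarrow> (\<psi> has_derivative D) (at x)" for D
  using has_derivative_transform_within_open[OF _ assms(1,2)] assms(3) by metis
 then show "partial i \<phi> x = partial i \<psi> x" "\<phi> differentiable (at x) \<longleftrightarrow> \<psi> differentiable (at x)"
  unfolding partial_def frechet_derivative_def differentiable_def by simp_all
qed

lemma Ck_on_cong:
 assumes "open U" "!!y. y \<in> U ==> \<phi> y = \<psi> y" "Ck_on k U \<phi>"
 shows "Ck_on k U \<psi>"
 using assms(2,3)
proof (induction k arbitrary: \<phi> \<psi>)
 case 0
 then show ?case using continuous_on_cong by force
next
 case (Suc k)
 then show ?case using partial_cong_open[OF assms(1), of _ \<phi> \<psi>] by (auto simp: ) blast
qed

lemma Ck_on_subset: "Ck_on k U \<phi> ==> V \<subseteq> U ==> Ck_on k V \<phi>"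
 by (induction k arbitrary: \<phi>) (auto intro: continuous_on_subset)

lemma Ck_on_local:
 assumes "!!x. x \<in> U ==> \<exists>V. open V \<and> x \<in> V \<and> Ck_on k V \<phi>"
 shows "Ck_on k U \<phi>"
 using assms
proof (induction k arbitrary: \<phi>)
 case 0
 have "continuous (at x within U) \<phi>" if xU: "x \<in> U" for x
 proof -
  obtain V where V: "open V" "x \<in> V" "continuous_on V \<phi>" using 0[OF xU] by (metis Ck_on.simps(1))
  then have "isCont \<phi> x" by (simp add: continuous_on_eq_continuous_at)
  then show ?thesis by (rule continuous_at_imp_continuous_at_within)
 qed
 then show ?case by (simp add: continuous_on_eq_continuous_within)
next
 case (Suc k)
 have "\<phi> differentiable (at x)" if "x \<in> U" for x using Suc.prems[OF that] by auto
 moreover have "Ck_on k U (partial i \<phi>)" for i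
  by (rule Suc.IH) (use Suc.prems in fastforce)
 ultimately show ?case by simp
qed

lemma Ck_on_Suc_imp: "Ck_on (Suc k) U \<phi> ==> Ck_on k U \<phi>"
proof (induction k arbitrary: \<phi>)
 case 0
 then have "isCont \<phi> x" if "x \<in> U" for x using that differentiable_imp_continuous_within by auto
 then show ?case by (simp add: continuous_at_imp_continuous_on)
next
 case (Suc k)
 then show ?case by (metis Ck_on.simps(2))
qed

lemma Ck_on_const: "Ck_on k U (%x. c)"
proof (induction k arbitrary: c)
 case (Suc k)
 have "partial i (%x. c) = (%x. 0)" for i
  by (rule ext, subst partial_eq[OF has_derivative_const]) simp
 then show ?case using Suc by simp
qed auto

lemma Ck_on_inner: "Ck_on k U (%x. c \<bullet> x)"
proof (cases k)
 case (Suc m)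
 have "partial i (%x. c \<bullet> x) = (%x. c \<bullet> axis i 1)" for i
  by (rule ext, rule partial_eq) (auto intro!: derivative_eq_intros)
 moreover have "(%x. c \<bullet> x) differentiable at x" for x :: point
  by (auto intro!: derivative_intros)
 ultimately show ?thesis using Suc Ck_on_const by simp
qed (auto intro!: continuous_intros)

lemma Ck_on_add:
 assumes "open U" "Ck_on k U \<phi>" "Ck_on k U \<psi>"
 shows "Ck_on k U (%x. \<phi> x + \<psi> x)"
 using assms(2,3)
proof (induction k arbitrary: \<phi> \<psi>)
 case 0 then show ?case by (auto intro: continuous_intros)
next
 case (Suc k)
 have "partial i \<phi> x + partial i \<psi> x = partial i (%x. \<phi> x + \<psi> x) x" if "x \<in> U" for x i
 proof -
  have "(\<phi> has_derivative frechet_derivative \<phi> (at x)) (at x)" "(\<psi> has_derivative frechet_derivative \<psi> (at x)) (at x)"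
   using Suc.prems that by (auto simp: frechet_derivative_works[symmetric])
  from partial_eq[OF has_derivative_add[OF this]] show ?thesis by (simp add: partial_def)
 qed
 from Ck_on_cong[OF assms(1) this Suc.IH] Suc.prems show ?case by (auto intro: derivative_intros)
qed

lemma Ck_on_mult:
 assumes "open U" "Ck_on k U \<phi>" "Ck_on k U \<psi>"
 shows "Ck_on k U (%x. \<phi> x * \<psi> x)"
 using assms(2,3)
proof (induction k arbitrary: \<phi> \<psi>)
 case 0 then show ?case by (auto intro: continuous_intros)
next
 case (Suc k)
 have eq: "\<phi> x * partial i \<psi> x + partial i \<phi> x * \<psi> x = partial i (%x. \<phi> x * \<psi> x) x" if "x \<in> U" for x i
 proof -
  have "(\<phi> has_derivative frechet_derivative \<phi> (at x)) (at x)" "(\<psi> has_derivative frechet_derivative \<psi> (at x)) (at x)"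
   using Suc.prems that by (auto simp: frechet_derivative_works[symmetric])
  from partial_eq[OF has_derivative_mult[OF this]] show ?thesis by (simp add: partial_def)
 qed
 have "Ck_on k U \<phi>" "Ck_on k U \<psi>" using Suc.prems Ck_on_Suc_imp by blast+
 then have "Ck_on k U (%x. \<phi> x * partial i \<psi> x + partial i \<phi> x * \<psi> x)" for i
  using Suc.IH Suc.prems by (auto intro!: Ck_on_add[OF assms(1)])
 then have "Ck_on k U (partial i (%x. \<phi> x * \<psi> x))" for i
  by (rule Ck_on_cong[OF assms(1) eq, rotated])
 then show ?case using Suc.prems by (auto intro: derivative_intros)
qed

lemma partial_compose:
 assumes "(F has_real_derivative d) (at (\<phi> x))" "\<phi> differentiable (at x)"
 shows "partial i (%x. F (\<phi> x)) x = d * partial i \<phi> x" and "(%x. F (\<phi> x)) differentiable (at x)"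
proof -
 have *: "((%x. F (\<phi> x)) has_derivative (%y. d * frechet_derivative \<phi> (at x) y)) (at x)"
  using has_derivative_compose[OF frechet_derivative_works[THEN iffD1, OF assms(2)], of F "(*) d"] assms(1)
  by (simp add: has_field_derivative_def)
 then show "partial i (%x. F (\<phi> x)) x = d * partial i \<phi> x"
  by (subst partial_eq[OF *]) (simp add: partial_def)
 show "(%x. F (\<phi> x)) differentiable (at x)" using * differentiable_def by blast
qed

text \<open>The hypothesis supplies the whole chain of derivatives \<open>D n\<close>, because the
  induction on \<open>k\<close> moves from \<open>D n\<close> to \<open>D (Suc n)\<close>.\<close>

lemma Ck_on_compose:
 fixes D :: "nat => real => real"
 assumes "open U" "!!n t. t \<in> W ==> (D n has_real_derivative D (Suc n) t) (at t)"
  and "!!x. x \<in> U ==> \<phi> x \<in> W" "Ck_on k U \<phi>"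
 shows "Ck_on k U (%x. D n (\<phi> x))"
 using assms(4)
proof (induction k arbitrary: n)
 case 0
 have "continuous_on W (D n)"
  by (intro continuous_at_imp_continuous_on ballI DERIV_isCont[OF assms(2)])
 then show ?case using 0 continuous_on_compose2 assms(3) by (metis Ck_on.simps(1) image_subsetI)
next
 case (Suc k)
 have eq: "D (Suc n) (\<phi> x) * partial i \<phi> x = partial i (%x. D n (\<phi> x)) x" if "x \<in> U" for x i
  using partial_compose(1)[where \<phi>=\<phi>, OF assms(2)[OF assms(3)[OF that]]] Suc.prems that by simp
 have "(%x. D n (\<phi> x)) differentiable (at x)" if "x \<in> U" for x
  using partial_compose(2)[where \<phi>=\<phi>, OF assms(2)[OF assms(3)[OF that]]] Suc.prems that by simp
 moreover have "Ck_on k U (partial i (%x. D n (\<phi> x)))" for i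
  using Suc.IH[OF Ck_on_Suc_imp[OF Suc.prems]] Suc.prems
  by (intro Ck_on_cong[OF assms(1) eq] Ck_on_mult[OF assms(1)]) auto
 ultimately show ?case by simp
qed

lemma smooth_on_const: "open U ==> smooth_on U (%x. c)"
 and smooth_on_inner: "open U ==> smooth_on U (%x. a \<bullet> x)"
 and smooth_on_add: "smooth_on U \<phi> ==> smooth_on U \<psi> ==> smooth_on U (%x. \<phi> x + \<psi> x)"
 and smooth_on_mult: "smooth_on U \<phi> ==> smooth_on U \<psi> ==> smooth_on U (%x. \<phi> x * \<psi> x)"
 by (auto simp: smooth_on_def Ck_on_const Ck_on_inner Ck_on_add Ck_on_mult)

lemma smooth_on_minus: "smooth_on U \<phi> ==> smooth_on U (%x. - \<phi> x)"
 using smooth_on_mult[OF smooth_on_const[of U "-1"], of \<phi>] by (simp add: smooth_on_def)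

lemma smooth_on_diff: "smooth_on U \<phi> ==> smooth_on U \<psi> ==> smooth_on U (%x. \<phi> x - \<psi> x)"
 using smooth_on_add[OF _ smooth_on_minus, of U \<phi> \<psi>] by simp

lemma smooth_on_sum:
 assumes "open U" "!!i. i \<in> I ==> smooth_on U (\<phi> i)"
 shows "smooth_on U (%x. \<Sum>i\<in>I. \<phi> i x)"
 using assms(2)
 by (induction I rule: infinite_finite_induct) (auto intro: smooth_on_add smooth_on_const assms(1))

lemma smooth_on_prod:
 assumes "open U" "!!i. i \<in> I ==> smooth_on U (\<phi> i)"
 shows "smooth_on U (%x. \<Prod>i\<in>I. \<phi> i x)"
 using assms(2)
 by (induction I rule: infinite_finite_induct) (auto intro: smooth_on_mult smooth_on_const assms(1))

lemma smooth_on_cong: "smooth_on U \<phi> ==> (!!x. x \<in> U ==> \<phi> x = \<psi> x) ==> smooth_on U \<psi>"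
 using Ck_on_cong unfolding smooth_on_def by metis

lemma smooth_on_subset: "smooth_on U \<phi> ==> open V ==> V \<subseteq> U ==> smooth_on V \<phi>"
 using Ck_on_subset unfolding smooth_on_def by metis

lemma smooth_on_local:
 assumes "open U" "!!x. x \<in> U ==> \<exists>V. x \<in> V \<and> smooth_on V \<phi>"
 shows "smooth_on U \<phi>"
 using assms Ck_on_local unfolding smooth_on_def by metis

lemma smooth_on_compose:
 fixes D :: "nat => real => real"
 assumes "smooth_on U \<phi>" "!!n t. t \<in> W ==> (D n has_real_derivative D (Suc n) t) (at t)"
  and "!!x. x \<in> U ==> \<phi> x \<in> W"
 shows "smooth_on U (%x. D n (\<phi> x))"
 using assms Ck_on_compose unfolding smooth_on_def by metis

lemma smooth_on_inverse:
 assumes "smooth_on U \<phi>" "!!x. x \<in> U ==> \<phi> x ~= 0"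
 shows "smooth_on U (%x. inverse (\<phi> x))"
proof -
 define D :: "nat => real => real" where "D = (%n t. (-1)^n * fact n * inverse t ^ Suc n)"
 have "(D n has_real_derivative D (Suc n) t) (at t)" if "t \<in> - {0}" for n t
  unfolding D_def using that
  by (intro DERIV_cong[OF DERIV_cmult[OF DERIV_power[OF DERIV_inverse]]]) (auto simp: algebra_simps)
 from smooth_on_compose[of U \<phi> "-{0}" D 0, OF assms(1) this] assms(2) show ?thesis
  by (simp add: D_def)
qed

lemma smooth_on_divide:
 assumes "smooth_on U \<phi>" "smooth_on U \<psi>" "!!x. x \<in> U ==> \<psi> x ~= 0"
 shows "smooth_on U (%x. \<phi> x / \<psi> x)"
 using smooth_on_mult[OF assms(1) smooth_on_inverse[OF assms(2,3)]] by (simp add: divide_inverse)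

lemma smooth_on_differentiable: "smooth_on U \<phi> ==> x \<in> U ==> \<phi> differentiable (at x)"
 unfolding smooth_on_def by (metis Ck_on.simps(2))

lemma smooth_on_partial: "smooth_on U \<phi> ==> smooth_on U (partial i \<phi>)"
 unfolding smooth_on_def by (metis Ck_on.simps(2))

lemma smooth_on_continuous_on: "smooth_on U \<phi> ==> continuous_on U \<phi>"
 unfolding smooth_on_def by (metis Ck_on.simps(1))

text \<open>The n-th derivative of exp(-1/t) for t > 0 is this polynomial evaluated at 1/t, times
  exp(-1/t). With y = 1/t, differentiation in t produces the factor y^2 and the difference p -
  p'.\<close>

fun flat_poly :: "nat => real poly" where
 "flat_poly 0 = 1"
| "flat_poly (Suc n) = [:0, 0, 1:] * (flat_poly n - pderiv (flat_poly n))"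

definition flat_deriv :: "nat => real => real" where
 "flat_deriv n t = (if t <= 0 then 0 else poly (flat_poly n) (inverse t) * exp (- inverse t))"

text \<open>Generalised over the power \<open>k\<close>, since passing to the next coefficient of
  the polynomial costs one more factor y.\<close>

lemma power_poly_exp_tendsto_0: "((%y::real. y ^ k * poly q y * exp (- y)) \<longlongrightarrow> 0) at_top"
proof (induction q arbitrary: k)
 case (pCons a q)
 have "((%y::real. a * (y ^ k / exp y) + y ^ Suc k * poly q y * exp (- y)) \<longlongrightarrow> a * 0 + 0) at_top"
  by (intro tendsto_intros pCons.IH tendsto_power_div_exp_0)
 then show ?case by (simp add: algebra_simps exp_minus divide_inverse)
qed auto

lemma flat_deriv_DERIV: "(flat_deriv n has_real_derivative flat_deriv (Suc n) t) (at t)"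
proof -
 consider "t < 0" | "t > 0" | "t = 0" by linarith
 then show ?thesis
 proof cases
  case 1
  then have "flat_deriv (Suc n) t = 0" by (simp add: flat_deriv_def)
  moreover have "(flat_deriv n has_real_derivative 0) (at t)"
   by (rule has_field_derivative_transform_within_open[where S="{..<0}" and f="%_. 0"])
    (use 1 in \<open>auto simp: flat_deriv_def\<close>)
  ultimately show ?thesis by simp
 next
  case 2
  have "((%t. poly (flat_poly n) (inverse t) * exp (- inverse t)) has_real_derivative
    flat_deriv (Suc n) t) (at t)"
   using 2 by (auto intro!: derivative_eq_intros DERIV_chain'[OF _ poly_DERIV] simp: flat_deriv_def algebra_simps power2_eq_square)
  then show ?thesis
   by (rule has_field_derivative_transform_within_open[where S="{0<..}"]) (use 2 in \<open>auto simp: flat_deriv_def\<close>)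
 next
  case 3
  \<comment> \<open>Dividing by h is one more factor y = 1/h, which the exponential absorbs as y
    tends to infinity.\<close>
  have "((%h. flat_deriv n h / h) \<longlongrightarrow> 0) (at_right 0)"
  proof -
   have "((%h. inverse h ^ 1 * poly (flat_poly n) (inverse h) * exp (- inverse h)) \<longlongrightarrow> 0) (at_right 0)"
    using filterlim_compose[OF power_poly_exp_tendsto_0 filterlim_inverse_at_top_right] .
   moreover have "\<forall>\<^sub>F h in at_right 0. inverse h ^ 1 * poly (flat_poly n) (inverse h) * exp (- inverse h) = flat_deriv n h / h"
    unfolding eventually_at_filter by (auto simp: flat_deriv_def divide_inverse)
   ultimately show ?thesis by (rule Lim_transform_eventually)
  qed
  moreover have "((%h. flat_deriv n h / h) \<longlongrightarrow> 0) (at_left 0)"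
   by (rule Lim_transform_eventually[OF tendsto_const])
    (auto simp: eventually_at_filter flat_deriv_def)
  ultimately have "((%h. flat_deriv n h / h) \<longlongrightarrow> 0) (at 0)"
   by (simp add: filterlim_split_at)
  then show ?thesis using 3 by (simp add: DERIV_def flat_deriv_def)
 qed
qed

definition flat :: "real => real" where "flat t = (if t <= 0 then 0 else exp (- inverse t))"

lemma flat_eq: "flat = flat_deriv 0"
 by (auto simp: flat_def flat_deriv_def)

lemma smooth_on_flat: "smooth_on U \<phi> ==> smooth_on U (%x. flat (\<phi> x))"
 unfolding flat_eq by (rule smooth_on_compose[where W=UNIV]) (auto intro: flat_deriv_DERIV)

lemma flat_nonneg: "0 <= flat t" and flat_pos: "0 < t ==> 0 < flat t" and flat_zero: "t <= 0 ==> flat t = 0"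
 and flat_le_1: "flat t <= 1"
 by (auto simp: flat_def)

text \<open>Smooth transition with genuine plateaus: 0 up to 1/2 and 1 from 3/4 on. The plateaus
  make a companion exactly constant in a neighbourhood of an open edge, so that pieces from two
  triangles fit together smoothly.\<close>

definition smooth_step :: "real => real" where
 "smooth_step t = flat (t - 1/2) / (flat (t - 1/2) + flat (3/4 - t))"

lemma smooth_step_denominator_pos: "0 < flat (t - 1/2) + flat (3/4 - t)"
 using flat_pos[of "t - 1/2"] flat_pos[of "3/4 - t"] flat_nonneg[of "t - 1/2"] flat_nonneg[of "3/4 - t"]
 by (cases "t > 1/2") (auto intro: add_pos_nonneg add_nonneg_pos)

lemma smooth_on_step: "smooth_on U \<phi> ==> smooth_on U (%x. smooth_step (\<phi> x))"
 unfolding smooth_step_def using smooth_step_denominator_pos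
 by (intro smooth_on_divide smooth_on_add smooth_on_flat smooth_on_diff smooth_on_const)
  (auto simp: smooth_on_def less_le)

lemma smooth_step_0: "t <= 1/2 ==> smooth_step t = 0"
 and smooth_step_1: "3/4 <= t ==> smooth_step t = 1"
 and smooth_step_nonneg: "0 <= smooth_step t"
 and smooth_step_le_1: "smooth_step t <= 1"
 using smooth_step_denominator_pos[of t] flat_nonneg[of "t-1/2"] flat_nonneg[of "3/4-t"]
 by (auto simp: smooth_step_def flat_zero divide_simps)

definition smooth_step_deriv :: "real => real" where
 "smooth_step_deriv t = (SOME d. (smooth_step has_real_derivative d) (at t))"

text \<open>The derivative is continuous on [0,1] and vanishes outside, where the step is locally
  constant; hence the uniform bound.\<close>

lemma smooth_step_DERIV: "(smooth_step has_real_derivative smooth_step_deriv t) (at t)"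
 and smooth_step_deriv_bounded: "\<exists>B>0. \<forall>t. \<bar>smooth_step_deriv t\<bar> <= B"
proof -
 define d where "d t = (let f1 = flat (t - 1/2); f2 = flat (3/4 - t) in
   (flat_deriv 1 (t - 1/2) * (f1 + f2) - f1 * (flat_deriv 1 (t - 1/2) - flat_deriv 1 (3/4 - t))) / (f1 + f2)^2)" for t
 have D: "(smooth_step has_real_derivative d t) (at t)" for t
 proof -
  have fl: "(flat has_real_derivative flat_deriv 1 t) (at t)" for t
   unfolding flat_eq using flat_deriv_DERIV[of 0] by simp
  have "((%t. flat (t - 1/2)) has_real_derivative flat_deriv 1 (t-1/2) * 1) (at t)"
   by (rule DERIV_chain'[OF _ fl]) (auto intro!: derivative_eq_intros)
  moreover have "((%t. flat (3/4 - t)) has_real_derivative flat_deriv 1 (3/4-t) * (-1)) (at t)"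
   by (rule DERIV_chain'[OF _ fl]) (auto intro!: derivative_eq_intros)
  ultimately show ?thesis unfolding smooth_step_def d_def using smooth_step_denominator_pos[of t]
   by (auto intro!: derivative_eq_intros simp: Let_def power2_eq_square)
 qed
 have eq: "smooth_step_deriv = d"
 proof (rule ext)
  fix t
  show "smooth_step_deriv t = d t"
   unfolding smooth_step_deriv_def by (rule some_equality) (use D DERIV_unique in blast)+
 qed
 show "(smooth_step has_real_derivative smooth_step_deriv t) (at t)" using D eq by simp
 have cf: "isCont (flat_deriv n) t" for n t using flat_deriv_DERIV DERIV_isCont by blast
 have "continuous_on {0..1} d"
  unfolding d_def Let_def flat_eq using smooth_step_denominator_pos[unfolded flat_eq]
  by (auto intro!: continuous_intros continuous_on_compose2[OF continuous_at_imp_continuous_on[of UNIV "flat_deriv _"]] cf simp: less_le)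
 then have "compact (d ` {0..1})" by (intro compact_continuous_image) auto
 then obtain B where B: "!!t. t \<in> {0..1} ==> \<bar>d t\<bar> <= B"
  using compact_imp_bounded[THEN bounded_pos[THEN iffD1]] by (metis image_eqI real_norm_def)
 have "d t = 0" if t01: "t \<notin> {0..1}" for t
 proof -
  consider "t < 1/2" | "t > 3/4" using t01 by fastforce
  then show ?thesis
  proof cases
   case 1
   have "(smooth_step has_real_derivative 0) (at t)"
    by (rule has_field_derivative_transform_within_open[where S="{..<1/2}" and f="%_. 0"])
     (use 1 smooth_step_0 in auto)
   then show ?thesis using D DERIV_unique by blast
  next
   case 2
   have "(smooth_step has_real_derivative 0) (at t)"
    by (rule has_field_derivative_transform_within_open[where S="{3/4<..}" and f="%_. 1"])
     (use 2 smooth_step_1 in auto)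
   then show ?thesis using D DERIV_unique by blast
  qed
 qed
 then have "\<bar>d t\<bar> <= max B 1" for t using B[of t] by (cases "t \<in> {0..1}") auto
 then show "\<exists>B>0. \<forall>t. \<bar>smooth_step_deriv t\<bar> <= B" unfolding eq by (metis max.strict_coboundedI2 zero_less_one)
qed

section \<open>Test functions and integrals over plane sets\<close>

lemma test_functionsI:
 assumes "smooth_on UNIV \<phi>" "compact (closure {x. \<phi> x ~= 0})" "closure {x. \<phi> x ~= 0} \<subseteq> U"
 shows "\<phi> \<in> test_functions U"
 using assms by (auto simp: test_functions_def smooth_on_def Ck_on_UNIV)

lemma test_functions_smooth: "\<phi> \<in> test_functions U ==> smooth_on UNIV \<phi>"
 by (auto simp: test_functions_def smooth_on_def Ck_on_UNIV)

lemma integrable_lebesgue_on_iff: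
 fixes f :: "point => real"
 assumes "S \<in> sets lebesgue"
 shows "integrable (leb S) f \<longleftrightarrow> integrable lebesgue (%x. ind S x * f x)"
 using integrable_restrict_space[of S lebesgue f] assms by (simp add: real_scaleR_def)

lemma integral_lebesgue_on:
 fixes f :: "point => real"
 assumes "S \<in> sets lebesgue"
 shows "lint (leb S) f = lint lebesgue (%x. ind S x * f x)"
 using integral_restrict_space[of S lebesgue f] assms by simp

lemma integrable_lebesgue_on_subset:
 fixes f :: "point => real"
 assumes "T \<in> sets lebesgue" "S \<in> sets lebesgue" "T \<subseteq> S" "integrable (leb S) f"
 shows "integrable (leb T) f"
proof -
 have "integrable lebesgue (%x. ind T x * (ind S x * f x))"
  using integrable_mult_indicator[OF assms(1), of "%x. ind S x * f x"] assms integrable_lebesgue_on_iff by simp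
 moreover have "ind T x * (ind S x * f x) = ind T x * f x" for x
  using assms(3) by (auto simp: indicator_def)
 ultimately show ?thesis using assms integrable_lebesgue_on_iff by simp
qed

lemma integral_lebesgue_on_subset:
 fixes f :: "point => real"
 assumes "T \<in> sets lebesgue" "S \<in> sets lebesgue" "T \<subseteq> S"
 shows "lint (leb S) (%x. ind T x * f x) = lint (leb T) f"
proof -
 have "ind S x * (ind T x * f x) = ind T x * f x" for x
  using assms(3) by (auto simp: indicator_def)
 then show ?thesis unfolding integral_lebesgue_on[OF assms(1)] integral_lebesgue_on[OF assms(2)] by presburger
qed

lemma integral_lebesgue_on_superset_zero:
 fixes f :: "point => real"
 assumes "T \<in> sets lebesgue" "S \<in> sets lebesgue" "T \<subseteq> S" "!!x. x \<in> S - T ==> f x = 0"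
 shows "lint (leb S) f = lint (leb T) f"
proof -
 have "ind S x * f x = ind T x * f x" for x
  using assms(3,4) by (auto simp: indicator_def)
 then show ?thesis unfolding integral_lebesgue_on[OF assms(1)] integral_lebesgue_on[OF assms(2)] by presburger
qed

lemma AE_lebesgue_on_iff:
 assumes "S \<in> sets lebesgue"
 shows "(AE x in leb S. P x) \<longleftrightarrow> (AE x in lebesgue. x \<in> S --> P x)"
 using AE_restrict_space_iff[of S lebesgue P] assms by simp

lemma borel_measurable_lebesgue_on_subset:
 fixes f :: "point => real"
 assumes "f \<in> borel_measurable (leb S)" "T \<subseteq> S" "T \<in> sets lebesgue" "S \<in> sets lebesgue"
 shows "f \<in> borel_measurable (leb T)"
 using assms measurable_restrict_mono by blast

lemma zero_outside_support: "x \<notin> closure {x. \<phi> x ~= 0} ==> \<phi> x = 0" for \<phi> :: scalar_field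
 using closure_subset[of "{x. \<phi> x ~= 0}"] by auto

lemma partial_zero_outside_support:
 assumes "x \<notin> closure {x. \<phi> x ~= 0}"
 shows "partial i \<phi> x = 0"
proof -
 have "partial i \<phi> x = partial i (%_. 0) x"
 proof (rule partial_cong_open(1))
  show "open (- closure {x. \<phi> x ~= 0})" by (rule open_Compl[OF closed_closure])
 qed (use assms zero_outside_support in blast)+
 also have "\<dots> = 0" by (rule partial_eq[OF has_derivative_const])
 finally show ?thesis .
qed

lemma closure_support_subset:
 assumes "!!x. x \<notin> closure {x. \<phi> x ~= 0} ==> \<psi> x = 0"
 shows "closure {x. \<psi> x ~= 0} \<subseteq> closure {x. \<phi> x ~= 0}"
 by (rule closure_minimal[OF _ closed_closure]) (use assms in blast)

lemma test_functions_zero: "\<phi> \<in> test_functions U ==> x \<notin> U ==> \<phi> x = 0"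
 unfolding test_functions_def using closure_subset[of "{x. \<phi> x ~= 0}"] by blast

lemma test_functionsI':
 assumes "smooth_on UNIV \<psi>" "\<phi> \<in> test_functions U" "!!x. x \<notin> closure {x. \<phi> x ~= 0} ==> \<psi> x = 0"
 shows "\<psi> \<in> test_functions U"
proof (rule test_functionsI[OF assms(1)])
 have s: "closure {x. \<psi> x ~= 0} \<subseteq> closure {x. \<phi> x ~= 0}" by (rule closure_support_subset) (rule assms(3))
 then show "compact (closure {x. \<psi> x ~= 0})" "closure {x. \<psi> x ~= 0} \<subseteq> U"
  using assms(2) compact_Int_closed[OF _ closed_closure, of "closure {x. \<phi> x ~= 0}" "{x. \<psi> x ~= 0}"]
  by (auto simp: test_functions_def Int_absorb1)
qed

lemma in_closure_support: "\<phi> x ~= 0 ==> x \<in> closure {x. \<phi> x ~= 0}" for \<phi> :: scalar_field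
 using closure_subset[of "{x. \<phi> x ~= 0}"] by auto

lemma partial_test_function: "\<phi> \<in> test_functions U ==> partial i \<phi> \<in> test_functions U"
 by (rule test_functionsI'[OF smooth_on_partial[OF test_functions_smooth]]) (assumption | rule partial_zero_outside_support)+

lemma smooth_mult_test_function: "smooth_on UNIV q ==> \<phi> \<in> test_functions U ==> (%x. q x * \<phi> x) \<in> test_functions U"
proof (rule test_functionsI'[OF smooth_on_mult[OF _ test_functions_smooth]])
 fix x assume "x \<notin> closure {x. \<phi> x ~= 0}"
 then have "\<phi> x = 0" by (rule zero_outside_support)
 then show "q x * \<phi> x = 0" by simp
qed

lemma test_functions_mono: "U \<subseteq> V ==> test_functions U \<subseteq> test_functions V"
 by (auto simp: test_functions_def)

lemma test_function_bounded:
 assumes "\<phi> \<in> test_functions U"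
 obtains B where "0 < B" "!!x. \<bar>\<phi> x\<bar> <= B"
proof -
 have "compact (\<phi> ` closure {x. \<phi> x ~= 0})"
  using assms continuous_on_subset[OF smooth_on_continuous_on[OF test_functions_smooth[OF assms]] subset_UNIV]
  by (intro compact_continuous_image) (auto simp: test_functions_def)
 then obtain B where B: "0 < B" "!!x. x \<in> closure {x. \<phi> x ~= 0} ==> \<bar>\<phi> x\<bar> <= B"
  using compact_imp_bounded[THEN bounded_pos[THEN iffD1]] by (metis image_eqI real_norm_def)
 have "\<bar>\<phi> x\<bar> <= B" for x using B closure_subset[of "{x. \<phi> x ~= 0}"] by (cases "\<phi> x = 0") auto
 with B(1) that show ?thesis by blast
qed

lemma test_function_borel: "\<phi> \<in> test_functions U ==> \<phi> \<in> borel_measurable borel"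
 using test_functions_smooth smooth_on_continuous_on borel_measurable_continuous_onI by blast

lemma borel_measurable_lebesgue_onI: "f \<in> borel_measurable borel ==> f \<in> borel_measurable (leb S)"
 by (intro measurable_restrict_space1 measurable_completion) simp

lemma integrable_bounded_support:
 fixes f :: "point => real"
 assumes "f \<in> borel_measurable lebesgue" "compact K" "!!x. x \<notin> K ==> f x = 0" "!!x. \<bar>f x\<bar> <= B"
 shows "integrable lebesgue f"
proof (rule Bintegrable_bound)
 show "integrable lebesgue (%x. B * ind K x)"
  using lmeasurable_compact[OF assms(2)] by (intro integrable_mult_right integrable_real_indicator) (auto simp: fmeasurable_def)
 have "0 <= B" using assms(4)[of 0] by linarith
 then show "AE x in lebesgue. norm (f x) <= norm (B * ind K x)"
  using assms(3,4) by (intro AE_I2) (auto simp: indicator_def)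
qed (use assms in auto)

lemma test_function_integrable:
 assumes "\<phi> \<in> test_functions U"
 shows "integrable lebesgue \<phi>"
proof -
 obtain B where "!!x. \<bar>\<phi> x\<bar> <= B" using test_function_bounded[OF assms] by blast
 then show ?thesis
  using assms test_function_borel[OF assms]
  by (intro integrable_bounded_support[where K="closure {x. \<phi> x ~= 0}" and B=B] zero_outside_support)
   (auto simp: test_functions_def intro: measurable_completion)
qed

lemma has_real_derivative_along:
 assumes "\<phi> differentiable (at (x + t *\<^sub>R k))"
 shows "((%t. \<phi> (x + t *\<^sub>R k)) has_real_derivative (\<Sum>i\<in>UNIV. k $ i * partial i \<phi> (x + t *\<^sub>R k))) (at t)"
proof -
 let ?D = "frechet_derivative \<phi> (at (x + t *\<^sub>R k))"
 have D: "(\<phi> has_derivative ?D) (at (x + t *\<^sub>R k))" using assms frechet_derivative_works by blast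
 then have lin: "linear ?D" using has_derivative_linear by blast
 have "((%t. x + t *\<^sub>R k) has_derivative (%s. s *\<^sub>R k)) (at t)" by (auto intro!: derivative_eq_intros)
 from has_derivative_compose[OF this D] have "((%t. \<phi> (x + t *\<^sub>R k)) has_derivative (%s. ?D (s *\<^sub>R k))) (at t)" .
 moreover have "?D (s *\<^sub>R k) = (\<Sum>i\<in>UNIV. k $ i * partial i \<phi> (x + t *\<^sub>R k)) * s" for s
 proof -
  have "k = (\<Sum>i\<in>UNIV. k $ i *\<^sub>R axis i 1)" by (simp add: basis_expansion scalar_mult_eq_scaleR[symmetric])
  then have "?D k = ?D (\<Sum>i\<in>UNIV. k $ i *\<^sub>R axis i 1)" by (rule arg_cong)
  also have "\<dots> = (\<Sum>i\<in>UNIV. k $ i * ?D (axis i 1))"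
   by (simp add: linear_sum[OF lin] linear_scale[OF lin])
  finally have "?D k = (\<Sum>i\<in>UNIV. k $ i * ?D (axis i 1))" .
  then show ?thesis using linear_scale[OF lin] by (simp add: partial_def)
 qed
 ultimately show ?thesis by (simp add: has_field_derivative_def)
qed

lemma sum_axis_mult: "(\<Sum>j\<in>UNIV. axis i (1::real) $ j * f j) = f i"
 by (simp add: axis_def if_distrib[of "%c. c * _"] cong: if_cong)

lemma integral_lebesgue_translate:
 fixes f :: "point => real"
 assumes "f \<in> borel_measurable borel"
 shows "lint lebesgue (%x. f (x + k)) = lint lebesgue f"
proof -
 have "lint lborel f = lint (distr lborel borel ((+) k)) f" by (simp add: lborel_distr_plus)
 also have "\<dots> = lint lborel (%x. f (k + x))" by (rule integral_distr) (use assms in auto)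
 finally have "lint lborel (%x. f (x + k)) = lint lborel f" by (simp add: add.commute)
 then show ?thesis using assms by (simp add: integral_completion)
qed

lemma integrable_lebesgue_translate:
 fixes f :: "point => real"
 assumes "integrable lebesgue f" "f \<in> borel_measurable borel"
 shows "integrable lebesgue (%x. f (x + k))"
proof -
 have m: "(%x. f (x + k)) \<in> borel_measurable borel" using assms(2) by measurable
 have "integrable (distr lborel borel ((+) k)) f"
  unfolding lborel_distr_plus using assms by (simp add: integrable_completion)
 then have "integrable lborel (%x. f (k + x))" by (rule integrable_distr[rotated]) simp
 then show ?thesis using m by (simp add: integrable_completion add.commute)
qed

text \<open>The difference quotients in direction i have integral zero by translation invariance,
  and they converge to the partial derivative under a common bound with compact support.\<close>

lemma integral_partial_test_function:
 assumes "\<phi> \<in> test_functions U"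
 shows "lint lebesgue (partial i \<phi>) = 0"
proof -
 define e :: point where "e = axis i 1"
 let ?K = "closure {x. \<phi> x ~= 0}"
 have K: "compact ?K" using assms by (auto simp: test_functions_def)
 obtain R where R: "!!x. x \<in> ?K ==> norm x <= R" using compact_imp_bounded[OF K] bounded_iff by blast
 obtain B where B: "0 < B" "!!x. \<bar>partial i \<phi> x\<bar> <= B" using test_function_bounded[OF partial_test_function[OF assms]] by blast
 define h where "h n x = (\<phi> (x + (1 / real (Suc n)) *\<^sub>R e) - \<phi> x) / (1 / real (Suc n))" for n x
 have d: "((%t. \<phi> (x + t *\<^sub>R e)) has_real_derivative partial i \<phi> (x + t *\<^sub>R e)) (at t)" for x t
  using has_real_derivative_along[of \<phi> x t e] smooth_on_differentiable[OF test_functions_smooth[OF assms]]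
  by (simp add: e_def sum_axis_mult)
 have meas: "\<phi> \<in> borel_measurable borel" by (rule test_function_borel[OF assms])
 have mh: "h n \<in> borel_measurable borel" for n
  unfolding h_def using meas by measurable
 have "(%n. lint lebesgue (h n)) \<longlonglongrightarrow> lint lebesgue (partial i \<phi>)"
 proof (rule integral_dominated_convergence[where w="%x. B * ind (cball 0 (R+1)) x"])
  show "partial i \<phi> \<in> borel_measurable lebesgue" "!!n. h n \<in> borel_measurable lebesgue"
   using mh test_function_borel[OF partial_test_function[OF assms]] by (auto intro: measurable_completion)
  show "integrable lebesgue (%x. B * ind (cball 0 (R+1)) x)"
   using lmeasurable_compact[OF compact_cball, of 0 "R+1"]
   by (intro integrable_mult_right integrable_real_indicator) (auto simp: fmeasurable_def)
  show "AE x in lebesgue. (%n. h n x) \<longlonglongrightarrow> partial i \<phi> x"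
  proof (rule AE_I2)
   fix x
   have "((%t. (\<phi> (x + t *\<^sub>R e) - \<phi> x) / t) \<longlongrightarrow> partial i \<phi> x) (at 0)"
    using d[of x 0] by (simp add: DERIV_def)
   moreover have "filterlim (%n. 1 / real (Suc n)) (at 0) sequentially"
    using LIMSEQ_inverse_real_of_nat by (intro filterlim_atI) (auto simp: divide_inverse)
   ultimately show "(%n. h n x) \<longlonglongrightarrow> partial i \<phi> x" unfolding h_def by (rule filterlim_compose)
  qed
  show "AE x in lebesgue. norm (h n x) <= B * ind (cball 0 (R+1)) x" for n
  proof (rule AE_I2)
   fix x
   let ?t = "1 / real (Suc n)"
   show "norm (h n x) <= B * ind (cball 0 (R+1)) x"
   proof (cases "x \<in> cball 0 (R+1)")
    case True
    obtain z where "\<phi> (x + ?t *\<^sub>R e) - \<phi> (x + 0 *\<^sub>R e) = (?t - 0) * partial i \<phi> (x + z *\<^sub>R e)"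
     using MVT2[of 0 ?t "%t. \<phi> (x + t *\<^sub>R e)" "%t. partial i \<phi> (x + t *\<^sub>R e)"] d by auto
    then have "h n x = partial i \<phi> (x + z *\<^sub>R e)" by (simp add: h_def)
    then show ?thesis using True B by simp
   next
    \<comment> \<open>A shift by at most 1 cannot reach the support from outside the enlarged ball,
      so the quotient vanishes there.\<close>
    case False
    then have nx: "norm x > R + 1" by simp
    have "norm (?t *\<^sub>R e) <= 1" by (simp add: e_def divide_simps)
    then have "norm (x + ?t *\<^sub>R e) > R" using nx norm_diff_ineq[of x "?t *\<^sub>R e"] by linarith
    moreover have "norm x > R" using nx by simp
    ultimately have "x \<notin> ?K" "x + ?t *\<^sub>R e \<notin> ?K" using R[of x] R[of "x + ?t *\<^sub>R e"] by linarith+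
    then have "\<phi> x = 0" "\<phi> (x + ?t *\<^sub>R e) = 0" using in_closure_support by blast+
    then show ?thesis using False by (simp add: h_def)
   qed
  qed
 qed
 moreover have "lint lebesgue (h n) = 0" for n
 proof -
  have i: "integrable lebesgue \<phi>" by (rule test_function_integrable[OF assms])
  have "integrable lebesgue (%x. \<phi> (x + t *\<^sub>R e))" for t
   by (rule integrable_lebesgue_translate[OF i meas])
  then have "lint lebesgue (%x. \<phi> (x + (1 / real (Suc n)) *\<^sub>R e) - \<phi> x) =
    lint lebesgue (%x. \<phi> (x + (1 / real (Suc n)) *\<^sub>R e)) - lint lebesgue \<phi>"
   by (rule Bintegral_diff[OF _ i])
  also have "\<dots> = 0" by (subst integral_lebesgue_translate[OF meas]) simp
  finally show ?thesis unfolding h_def integral_divide_zero by simp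
 qed
 ultimately show ?thesis by (simp add: LIMSEQ_const_iff)
qed

section \<open>The fundamental lemma of the calculus of variations\<close>

text \<open>Smooth functions between 0 and 1 that tend pointwise to the indicator of the open box as
  \<open>n\<close> grows: every factor flat(n t) tends to 1 for t > 0 and is 0 for t <= 0.\<close>

definition box_bump :: "point => point => nat => scalar_field" where
 "box_bump a b n x = (\<Prod>i\<in>UNIV. flat (real n * (axis i 1 \<bullet> x - a $ i)) * flat (real n * (b $ i - axis i 1 \<bullet> x)))"

lemma box_bump_zero: "x \<notin> box a b ==> box_bump a b n x = 0"
proof -
 assume "x \<notin> box a b"
 then obtain i where "x $ i <= a $ i \<or> b $ i <= x $ i" by (auto simp: mem_box_cart not_less)
 then have "flat (real n * (axis i 1 \<bullet> x - a $ i)) * flat (real n * (b $ i - axis i 1 \<bullet> x)) = 0"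
  by (auto simp: inner_axis' flat_zero mult_nonneg_nonpos)
 then show ?thesis unfolding box_bump_def by (meson UNIV_I finite prod_zero)
qed

lemma box_bump_bounds: "0 <= box_bump a b n x" "box_bump a b n x <= 1"
 unfolding box_bump_def by (auto intro!: prod_nonneg prod_le_1 mult_nonneg_nonneg mult_le_one flat_nonneg flat_le_1)

lemma box_bump_tendsto: "x \<in> box a b ==> (%n. box_bump a b n x) \<longlonglongrightarrow> 1"
proof -
 assume x: "x \<in> box a b"
 have fl: "(%n. flat (real n * t)) \<longlonglongrightarrow> 1" if t: "t > 0" for t
 proof -
  have "(%n. exp (- inverse (real n * t))) \<longlonglongrightarrow> exp (- 0)"
  proof (intro tendsto_intros)
   have "filterlim (%n. real n * t) at_top sequentially"
    using filterlim_tendsto_pos_mult_at_top[OF tendsto_const t filterlim_real_sequentially] by (simp add: mult.commute)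
   then show "(%n. inverse (real n * t)) \<longlonglongrightarrow> 0"
    using filterlim_compose tendsto_inverse_0_at_top by blast
  qed
  then have "(%n. exp (- inverse (real n * t))) \<longlonglongrightarrow> 1" by simp
  moreover have "\<forall>\<^sub>F n in sequentially. exp (- inverse (real n * t)) = flat (real n * t)"
   using eventually_gt_at_top[of 0] by eventually_elim (use t in \<open>auto simp: flat_def mult_le_0_iff\<close>)
  ultimately show ?thesis by (rule Lim_transform_eventually)
 qed
 have "(%n. box_bump a b n x) \<longlonglongrightarrow> (\<Prod>i\<in>(UNIV::2 set). 1 * 1)"
  unfolding box_bump_def using x
  by (intro tendsto_prod tendsto_mult fl) (auto simp: mem_box_cart inner_axis')
 then show ?thesis by simp
qed

lemma box_bump_test_function:
 assumes "cbox a b \<subseteq> U"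
 shows "box_bump a b n \<in> test_functions U"
proof (rule test_functionsI)
 show "smooth_on UNIV (box_bump a b n)"
  unfolding box_bump_def
  by (intro smooth_on_prod smooth_on_mult smooth_on_flat smooth_on_const smooth_on_diff smooth_on_inner) auto
 have "{x. box_bump a b n x ~= 0} \<subseteq> cbox a b" using box_bump_zero box_subset_cbox by blast
 then have c: "closure {x. box_bump a b n x ~= 0} \<subseteq> cbox a b" by (rule closure_minimal) (rule closed_cbox)
 then show "closure {x. box_bump a b n x ~= 0} \<subseteq> U" using assms by blast
 show "compact (closure {x. box_bump a b n x ~= 0})"
  using c compact_Int_closed[OF compact_cbox closed_closure] by (metis Int_absorb1)
qed

text \<open>Open boxes are stable under intersection and generate the Borel sets, so by a Dynkin
  argument the integral of f over every Borel set vanishes.\<close>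

lemma AE_zero_if_box_integrals_zero:
 fixes f :: "point => real"
 assumes f: "integrable lborel f" and 0: "!!a b. lint lborel (%x. ind (box a b) x * f x) = 0"
 shows "AE x in lborel. f x = 0"
proof -
 let ?I = "%A. lint lborel (%x. ind A x * f x)"
 let ?G = "range (%(a, b). box a b :: point set)"
 have int: "integrable lborel (%x. ind A x * f x)" if "A \<in> sets borel" for A
  using integrable_mult_indicator[of A lborel f] that f by simp
 \<comment> \<open>Closure of the Dynkin system under complements needs the integral over the whole
   plane, which is the limit over growing boxes.\<close>
 have total: "lint lborel f = 0"
 proof -
  have "(%n. ?I (box (\<chi> i. - real n) ((\<chi> i. real n)))) \<longlonglongrightarrow> lint lborel f"
  proof (rule integral_dominated_convergence[where w="%x. \<bar>f x\<bar>"])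
   show "AE x in lborel. (%n. ind (box (\<chi> i. - real n) ((\<chi> i. real n))) x * f x) \<longlonglongrightarrow> f x"
   proof (rule AE_I2)
    fix x :: point
    obtain N :: nat where N: "norm x < real N" using reals_Archimedean2 by blast
    have "x \<in> box (\<chi> i. - real n) ((\<chi> i. real n))" if "n \<ge> N" for n
    proof -
     have "\<bar>x $ i\<bar> < real n" for i using component_le_norm_cart[of x i] N that by linarith
     then show ?thesis by (simp add: mem_box_cart abs_less_iff minus_less_iff)
    qed
    then have "\<forall>\<^sub>F n in sequentially. ind (box (\<chi> i. - real n) ((\<chi> i. real n))) x * f x = f x"
     by (auto simp: eventually_sequentially intro!: exI[of _ N])
    then show "(%n. ind (box (\<chi> i. - real n) ((\<chi> i. real n))) x * f x) \<longlonglongrightarrow> f x"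
     by (rule tendsto_eventually)
   qed
  qed (use f int in \<open>auto simp: indicator_def\<close>)
  then show ?thesis using 0 by (simp add: LIMSEQ_const_iff)
 qed
 have "?I A = 0" if "A \<in> sigma_sets UNIV ?G" for A
 proof (rule sigma_sets_induct_disjoint[OF _ _ that])
  show "Int_stable ?G"
   by (rule Int_stableI) (force simp: box_Int_box)
  show "?G \<subseteq> Pow UNIV" by simp
 next
  fix A assume "A \<in> ?G" then show "?I A = 0" using 0 by auto
 next
  fix A assume A: "A \<in> sigma_sets UNIV ?G" "?I A = 0"
  then have "A \<in> sets borel" by (simp add: borel_eq_box)
  then have "lint lborel (%x. f x - ind A x * f x) = 0"
   using A total f int by (subst Bintegral_diff) auto
  moreover have "f x - ind A x * f x = ind (UNIV - A) x * f x" for x by (auto simp: indicator_def)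
  ultimately show "?I (UNIV - A) = 0" by simp
 next
  fix A :: "nat => point set" assume A: "disjoint_family A" "range A \<subseteq> sigma_sets UNIV ?G" "!!i. ?I (A i) = 0"
  then have m: "A i \<in> sets borel" for i by (auto simp: borel_eq_box)
  have "(LINT x:(\<Union>i. A i)|lborel. f x) = (\<Sum>i. (LINT x:(A i)|lborel. f x))"
   by (rule lebesgue_integral_countable_add)
    (use m A(1) int[of "\<Union>i. A i"] in \<open>auto simp: disjoint_family_on_def set_integrable_def sets.countable_UN\<close>)
  then show "?I (\<Union>i. A i) = 0" using A(3) by (simp add: set_lebesgue_integral_def)
 qed simp
 then have "?I A = 0" if "A \<in> sets borel" for A using that by (simp add: borel_eq_box)
 then show ?thesis
  by (intro density_unique_real) (use f in \<open>auto simp: set_lebesgue_integral_def\<close>)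
qed

text \<open>Bumps give vanishing integrals over all boxes whose closure lies in U. On one closed box
  the previous lemma applies to a Borel representative of f cut off there, and U is a countable
  union of closed boxes.\<close>

lemma fundamental_lemma:
 fixes f :: "point => real"
 assumes U: "open U" and f: "locally_integrable U f"
  and 0: "!!\<phi>. \<phi> \<in> test_functions U ==> lint (leb U) (%x. f x * \<phi> x) = 0"
 shows "AE x in leb U. f x = 0"
proof -
 have Um: "U \<in> sets lebesgue" using U by simp
 have intK: "integrable lebesgue (%x. ind K x * f x)" if "compact K" "K \<subseteq> U" for K
  using f that by (simp add: locally_integrable_def set_integrable_def)
 have box0: "lint lebesgue (%x. ind (box a b) x * f x) = 0" if ab: "cbox a b \<subseteq> U" for a b
 proof -
  have "(%n. lint lebesgue (%x. box_bump a b n x * f x)) \<longlonglongrightarrow> lint lebesgue (%x. ind (box a b) x * f x)"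
  proof (rule integral_dominated_convergence[where w="%x. \<bar>ind (cbox a b) x * f x\<bar>"])
   have m: "(%x. ind (cbox a b) x * f x) \<in> borel_measurable lebesgue"
    using intK[OF compact_cbox ab] by (rule borel_measurable_integrable)
   have eq: "ind (box a b) x * f x = ind (box a b) x * (ind (cbox a b) x * f x)"
     "box_bump a b n x * f x = box_bump a b n x * (ind (cbox a b) x * f x)" for x n
    using box_subset_cbox box_bump_zero[of x a b n] by (auto simp: indicator_def)
   show "(%x. ind (box a b) x * f x) \<in> borel_measurable lebesgue"
    unfolding eq(1) by (rule borel_measurable_times[OF borel_measurable_indicator m]) auto
   show "(%x. box_bump a b n x * f x) \<in> borel_measurable lebesgue" for n
    unfolding eq(2) using test_function_borel[OF box_bump_test_function[OF ab]]
    by (intro borel_measurable_times[OF _ m]) (auto intro: measurable_completion)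
   show "integrable lebesgue (%x. \<bar>ind (cbox a b) x * f x\<bar>)"
    using intK[OF compact_cbox ab] by simp
   show "AE x in lebesgue. (%n. box_bump a b n x * f x) \<longlonglongrightarrow> ind (box a b) x * f x"
    using box_bump_tendsto box_bump_zero by (intro AE_I2 tendsto_intros) (auto simp: indicator_def)
   show "AE x in lebesgue. norm (box_bump a b n x * f x) <= \<bar>ind (cbox a b) x * f x\<bar>" for n
   proof (rule AE_I2)
    fix x
    show "norm (box_bump a b n x * f x) <= \<bar>ind (cbox a b) x * f x\<bar>"
    proof (cases "x \<in> box a b")
     case True
     then have "x \<in> cbox a b" using box_subset_cbox by blast
     then show ?thesis using box_bump_bounds[of a b n x] by (simp add: abs_mult mult_left_le_one_le)
    qed (simp add: box_bump_zero)
   qed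
  qed
  moreover have "lint lebesgue (%x. box_bump a b n x * f x) = 0" for n
  proof -
   have t: "box_bump a b n \<in> test_functions U" by (rule box_bump_test_function[OF ab])
   have "ind U x * (f x * box_bump a b n x) = box_bump a b n x * f x" for x
    using test_functions_zero[OF t, of x] by (auto simp: indicator_def)
   then show ?thesis using 0[OF t] unfolding integral_lebesgue_on[OF Um] by presburger
  qed
  ultimately show ?thesis by (simp add: LIMSEQ_const_iff)
 qed
 have AEbox: "AE x in lebesgue. x \<in> cbox c d --> f x = 0" if cd: "cbox c d \<subseteq> U" for c d
 proof -
  let ?g = "%x. ind (cbox c d) x * f x"
  have ig: "integrable lebesgue ?g" by (rule intK[OF compact_cbox cd])
  obtain g where g: "g \<in> borel_measurable lborel" "AE x in lborel. ?g x = g x"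
   using completion_ex_borel_measurable_real[OF borel_measurable_integrable[OF ig]] by blast
  have gl: "AE x in lebesgue. ?g x = g x" using g(2) by (rule AE_completion)
  have gm: "g \<in> borel_measurable lebesgue" using g(1) by (rule measurable_completion)
  have "integrable lebesgue g" by (rule integrable_cong_AE_imp[OF ig gm gl])
  then have gi: "integrable lborel g" using g(1) by (simp add: integrable_completion)
  have "lint lborel (%x. ind (box a b) x * g x) = 0" for a b
  proof -
   \<comment> \<open>An arbitrary box meets the open box from c to d again in a box, possibly empty,
     with closure inside U; the boundary that separates open from closed box is null.\<close>
   let ?a = "\<chi> i. max (a $ i) (c $ i)" and ?b = "\<chi> i. min (b $ i) (d $ i)"
   have "box ?a ?b = box a b \<inter> box c d" by (auto simp: mem_box_cart)
   moreover have "cbox ?a ?b \<subseteq> U" using cd by (auto simp: mem_box_cart subset_iff)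
   ultimately have z: "lint lebesgue (%x. ind (box a b \<inter> box c d) x * f x) = 0"
    using box0[of ?a ?b] by simp
   have "negligible (cbox c d - box c d)" by (rule negligible_frontier_interval)
   then have "AE x in lebesgue. x \<notin> cbox c d - box c d"
    using AE_not_in negligible_iff_null_sets by blast
   then have "AE x in lebesgue. ind (box a b) x * g x = ind (box a b \<inter> box c d) x * f x"
    using gl by eventually_elim (use box_subset_cbox[of c d] in \<open>auto simp: indicator_def split: if_splits\<close>)
   then have "lint lebesgue (%x. ind (box a b) x * g x) = lint lebesgue (%x. ind (box a b \<inter> box c d) x * f x)"
   proof (rule integral_cong_AE[rotated 2])
    show *: "(%x. ind (box a b) x * g x) \<in> borel_measurable lebesgue"
     using gm by (intro borel_measurable_times borel_measurable_indicator) auto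
    have "(%x. ind (box a b \<inter> box c d) x * ?g x) \<in> borel_measurable lebesgue"
     by (rule borel_measurable_times[OF borel_measurable_indicator borel_measurable_integrable[OF ig]]) auto
    moreover have "ind (box a b \<inter> box c d) x * ?g x = ind (box a b \<inter> box c d) x * f x" for x
     using box_subset_cbox[of c d] by (auto simp: indicator_def)
    ultimately show "(%x. ind (box a b \<inter> box c d) x * f x) \<in> borel_measurable lebesgue" by simp
   qed
   then show ?thesis using z g(1) by (subst integral_completion[symmetric]) auto
  qed
  from AE_zero_if_box_integrals_zero[OF gi this] have "AE x in lebesgue. g x = 0" by (rule AE_completion)
  with gl show ?thesis by eventually_elim (auto simp: indicator_def)
 qed
 obtain D where D: "countable D" "D \<subseteq> Pow U" "!!X. X \<in> D ==> \<exists>a b. X = cbox a b" "\<Union>D = U"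
  using open_countable_Union_open_cbox[OF U] by metis
 have "AE x in lebesgue. x \<in> X --> f x = 0" if X: "X \<in> D" for X
 proof -
  obtain a b where ab: "X = cbox a b" using D(3)[OF X] by metis
  then show ?thesis using AEbox[of a b] X D(2) by auto
 qed
 then have "AE x in lebesgue. \<forall>X\<in>D. x \<in> X --> f x = 0" by (subst AE_ball_countable[OF D(1)]) blast
 then have "AE x in lebesgue. x \<in> U --> f x = 0" by eventually_elim (use D(4) in auto)
 then show ?thesis by (simp add: AE_lebesgue_on_iff[OF Um])
qed

section \<open>Square-integrable functions and weak derivatives\<close>

definition sq_int :: "'a measure => ('a => real) => bool" where
 "sq_int M u \<longleftrightarrow> u \<in> borel_measurable M \<and> integrable M (%x. (u x)\<^sup>2)"

lemma sq_int_measurable: "sq_int M u ==> u \<in> borel_measurable M"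
 and sq_int_square: "sq_int M u ==> integrable M (%x. (u x)\<^sup>2)"
 by (auto simp: sq_int_def)

lemma L2_iff: "u \<in> L2 \<Omega> \<longleftrightarrow> sq_int (leb \<Omega>) u"
 by (simp add: Lp_def sq_int_def)

lemma sq_int_mult:
 assumes "sq_int M u" "sq_int M v"
 shows "integrable M (%x. u x * v x)"
proof (rule Bintegrable_bound[where f="%x. (u x)\<^sup>2 + (v x)\<^sup>2"])
 show "AE x in M. norm (u x * v x) <= norm ((u x)\<^sup>2 + (v x)\<^sup>2)"
 proof (rule AE_I2)
  fix x
  have "2 * (\<bar>u x\<bar> * \<bar>v x\<bar>) <= (u x)\<^sup>2 + (v x)\<^sup>2" using sum_squares_bound[of "\<bar>u x\<bar>" "\<bar>v x\<bar>"] by simp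
  then show "norm (u x * v x) <= norm ((u x)\<^sup>2 + (v x)\<^sup>2)" by (simp add: abs_mult)
   (smt (verit) mult_nonneg_nonneg abs_ge_zero)
 qed
qed (use assms in \<open>auto simp: sq_int_def\<close>)

lemma sq_int_cmult: "sq_int M u ==> sq_int M (%x. c * u x)"
 by (auto simp: sq_int_def power_mult_distrib)

lemma sq_int_add:
 assumes "sq_int M u" "sq_int M v"
 shows "sq_int M (%x. u x + v x)"
proof -
 have "integrable M (%x. (u x)\<^sup>2 + (v x)\<^sup>2 + 2 * (u x * v x))"
  using assms sq_int_mult[OF assms] by (auto simp: sq_int_def)
 then have "integrable M (%x. (u x + v x)\<^sup>2)" by (simp add: power2_sum algebra_simps)
 then show ?thesis using assms by (auto simp: sq_int_def)
qed

lemma sq_int_diff: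
 "sq_int M u ==> sq_int M v ==> sq_int M (%x. u x - v x)"
 using sq_int_add[OF _ sq_int_cmult[of M v "-1"], of u] by simp

lemma sq_int_sum:
 "(!!i. i \<in> I ==> sq_int M (u i)) ==> sq_int M (%x. \<Sum>i\<in>I. u i x)"
 by (induction I rule: infinite_finite_induct) (auto intro: sq_int_add simp: sq_int_def[of M "%_. 0"])

lemma sq_int_cong_AE:
 assumes "sq_int M u" "v \<in> borel_measurable M" "AE x in M. u x = v x"
 shows "sq_int M v"
 unfolding sq_int_def
proof
 show "integrable M (%x. (v x)\<^sup>2)"
  by (rule integrable_cong_AE_imp[OF sq_int_square[OF assms(1)]]) (use assms in auto)
qed (rule assms)

lemma sq_int_bounded:
 assumes "finite_measure M" "u \<in> borel_measurable M" "!!x. x \<in> space M ==> \<bar>u x\<bar> <= B"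
 shows "sq_int M u"
 unfolding sq_int_def
proof
 show "integrable M (%x. (u x)\<^sup>2)"
 proof (rule finite_measure.integrable_const_bound[OF assms(1), where B="B\<^sup>2"])
  show "AE x in M. norm ((u x)\<^sup>2) <= B\<^sup>2"
   using assms(3) by (intro AE_I2) (metis abs_ge_zero norm_power power2_abs power_mono real_norm_def)
 qed (use assms in auto)
qed (rule assms)

lemma sq_int_integrable:
 assumes "finite_measure M" "sq_int M u"
 shows "integrable M u"
 using sq_int_mult[OF assms(2) sq_int_bounded[OF assms(1), of "%_. 1" 1]] by simp

lemma Cauchy_Schwarz_integral:
 assumes "sq_int M u" "sq_int M v"
 shows "\<bar>lint M (%x. u x * v x)\<bar> <= sqrt (lint M (%x. (u x)\<^sup>2)) * sqrt (lint M (%x. (v x)\<^sup>2))"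
proof -
 define a b c where "a = lint M (%x. (u x)\<^sup>2)" and "b = lint M (%x. (v x)\<^sup>2)"
  and "c = lint M (%x. u x * v x)"
 have ab: "a \<ge> 0" "b \<ge> 0" by (auto simp: a_def b_def)
 have i: "integrable M (%x. (u x)\<^sup>2)" "integrable M (%x. (v x)\<^sup>2)" "integrable M (%x. u x * v x)"
  using assms sq_int_mult by (auto simp: sq_int_def)
 have "c\<^sup>2 <= a * b"
 proof (cases "a = 0")
  case True
  then have "AE x in M. (u x)\<^sup>2 = 0" using integral_nonneg_eq_0_iff_AE[OF i(1)] by (simp add: a_def)
  then have "AE x in M. u x * v x = 0" by eventually_elim simp
  then have "c = 0" unfolding c_def by (subst integral_cong_AE[of _ _ "%_. 0"]) (use i in auto)
  then show ?thesis using True by simp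
 next
  case False
  \<comment> \<open>The integral of this square is a (a b - c^2), so dividing by a > 0 gives the
    claim.\<close>
  have "0 <= lint M (%x. (a * v x - c * u x)\<^sup>2)" by simp
  also have "(%x. (a * v x - c * u x)\<^sup>2) = (%x. a\<^sup>2 * (v x)\<^sup>2 - 2 * a * c * (u x * v x) + c\<^sup>2 * (u x)\<^sup>2)"
   by (auto simp: power2_eq_square algebra_simps)
  also have "lint M \<dots> = a\<^sup>2 * b - 2 * a * c * c + c\<^sup>2 * a"
   using i by (simp add: a_def b_def c_def)
  also have "\<dots> = a * (a * b - c\<^sup>2)" by (simp add: power2_eq_square algebra_simps)
  finally show ?thesis using False ab(1) by (simp add: zero_le_mult_iff)
 qed
 then have "\<bar>c\<bar> <= sqrt (a * b)" by (simp add: real_le_rsqrt)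
 then show ?thesis by (simp add: a_def b_def c_def real_sqrt_mult)
qed

lemma sq_int_subset:
 fixes u :: "point => real"
 assumes "sq_int (leb S) u" "T \<subseteq> S" "T \<in> sets lebesgue" "S \<in> sets lebesgue"
 shows "sq_int (leb T) u"
 unfolding sq_int_def
proof
 show "u \<in> borel_measurable (leb T)"
  by (rule borel_measurable_lebesgue_on_subset[OF sq_int_measurable[OF assms(1)] assms(2-4)])
 show "integrable (leb T) (%x. (u x)\<^sup>2)"
  by (rule integrable_lebesgue_on_subset[OF assms(3,4,2) sq_int_square[OF assms(1)]])
qed

lemma L2_locally_integrable:
 assumes "open U" "sq_int (leb U) u"
 shows "locally_integrable U u"
 unfolding locally_integrable_def
proof (intro allI impI)
 fix K assume K: "compact K \<and> K \<subseteq> U"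
 then have Km: "K \<in> lmeasurable" by (simp add: lmeasurable_compact)
 have "integrable (leb K) u"
  using sq_int_integrable[OF finite_measure_lebesgue_on[OF Km] sq_int_subset[OF assms(2)]] K Km assms(1)
  by (simp add: fmeasurableD)
 then show "u absolutely_integrable_on K"
  using Km by (simp add: set_integrable_def integrable_lebesgue_on_iff fmeasurableD)
qed

lemma locally_integrable_mult_test:
 assumes "open U" "locally_integrable U g" "\<phi> \<in> test_functions U"
 shows "integrable (leb U) (%x. g x * \<phi> x)"
proof -
 let ?K = "closure {x. \<phi> x ~= 0}"
 have K: "compact ?K" "?K \<subseteq> U" using assms(3) by (auto simp: test_functions_def)
 then have i: "integrable lebesgue (%x. ind ?K x * g x)"
  using assms(2) by (simp add: locally_integrable_def set_integrable_def)
 obtain B where B: "!!x. \<bar>\<phi> x\<bar> <= B" using test_function_bounded[OF assms(3)] by blast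
 have "integrable lebesgue (%x. \<phi> x * (ind ?K x * g x))"
 proof (rule Bintegrable_bound[OF integrable_mult_right[OF i, of B]])
  show "(%x. \<phi> x * (ind ?K x * g x)) \<in> borel_measurable lebesgue"
   using test_function_borel[OF assms(3)]
   by (intro borel_measurable_times[OF _ borel_measurable_integrable[OF i]]) (auto intro: measurable_completion)
  have "B \<ge> 0" using B[of 0] by linarith
  then show "AE x in lebesgue. norm (\<phi> x * (ind ?K x * g x)) <= norm (B * (ind ?K x * g x))"
   using B by (intro AE_I2) (simp add: abs_mult mult_right_mono)
 qed
 moreover have "\<phi> x * (ind ?K x * g x) = ind U x * (g x * \<phi> x)" for x
 proof (cases "\<phi> x = 0")
  case False
  then have "x \<in> ?K" by (rule in_closure_support)
  then show ?thesis using K(2) by auto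
 qed simp
 ultimately show ?thesis using assms(1) by (simp add: integrable_lebesgue_on_iff)
qed

lemma locally_integrable_lincomb:
 assumes "locally_integrable U u" "locally_integrable U v"
 shows "locally_integrable U (%x. a * u x + b * v x)"
 using assms unfolding locally_integrable_def by (auto intro!: set_integral_add(1) set_integrable_mult_right)

lemma locally_integrable_subset: "locally_integrable U u ==> V \<subseteq> U ==> locally_integrable V u"
 unfolding locally_integrable_def by blast

lemma locally_integrable_cong_AE:
 assumes "open U" "locally_integrable U u" "AE x in leb U. u x = v x"
 shows "locally_integrable U v"
 unfolding locally_integrable_def
proof (intro allI impI)
 fix K assume K: "compact K \<and> K \<subseteq> U"
 have ae: "AE x in lebesgue. x \<in> U --> u x = v x" using assms(1,3) by (simp add: AE_lebesgue_on_iff)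
 have i: "integrable lebesgue (%x. ind K x * u x)"
  using assms(2) K by (simp add: locally_integrable_def set_integrable_def)
 have ae': "AE x in lebesgue. ind K x * u x = ind K x * v x"
  using ae by eventually_elim (use K in \<open>auto simp: indicator_def\<close>)
 have m: "(%x. ind K x * v x) \<in> borel_measurable lebesgue"
  using borel_measurable_integrable[OF i] ae' by (rule borel_measurable_AE)
 show "v absolutely_integrable_on K"
  using integrable_cong_AE_imp[OF i m ae'] by (simp add: set_integrable_def)
qed

lemma has_weak_partial_unique:
 assumes U: "open U" and g: "has_weak_partial U i u g" "has_weak_partial U i u g'"
 shows "AE x in leb U. g x = g' x"
proof -
 have l: "locally_integrable U g" "locally_integrable U g'" using g by (auto simp: has_weak_partial_def)
 have "AE x in leb U. 1 * g x + (-1) * g' x = 0"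
 proof (rule fundamental_lemma[OF U locally_integrable_lincomb[OF l]])
  fix \<phi> assume p: "\<phi> \<in> test_functions U"
  have "(%x. (1 * g x + (-1) * g' x) * \<phi> x) = (%x. g x * \<phi> x - g' x * \<phi> x)" by (auto simp: algebra_simps)
  moreover have "lint (leb U) (%x. g x * \<phi> x) = lint (leb U) (%x. g' x * \<phi> x)"
   using g p unfolding has_weak_partial_def by fastforce
  ultimately show "lint (leb U) (%x. (1 * g x + (-1) * g' x) * \<phi> x) = 0"
   using locally_integrable_mult_test[OF U _ p] l by (simp add: Bintegral_diff)
 qed
 then show ?thesis by eventually_elim simp
qed

text \<open>Measurability need not be assumed: by completeness f and g are measurable together, and
  if they are not, both integrals have the same default value.\<close>

lemma integral_cong_AE_lebesgue_on:
 fixes f g :: "point => real"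
 assumes "AE x in leb U. f x = g x" "U \<in> sets lebesgue"
 shows "lint (leb U) f = lint (leb U) g"
proof (cases "f \<in> borel_measurable (leb U)")
 case True
 have "(%x. ind U x * f x) \<in> borel_measurable lebesgue"
  using True borel_measurable_restrict_space_iff[of U lebesgue f] assms(2) by simp
 then have "(%x. ind U x * g x) \<in> borel_measurable lebesgue"
 proof (rule borel_measurable_AE)
  show "AE x in lebesgue. ind U x * f x = ind U x * g x"
   using assms(1) unfolding AE_lebesgue_on_iff[OF assms(2)] by eventually_elim (auto simp: indicator_def)
 qed
 then have "g \<in> borel_measurable (leb U)"
  using borel_measurable_restrict_space_iff[of U lebesgue g] assms(2) by simp
 then show ?thesis using assms True by (intro integral_cong_AE) auto
next
 case False
 have "g \<notin> borel_measurable (leb U)"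
 proof
  assume g: "g \<in> borel_measurable (leb U)"
  have "(%x. ind U x * g x) \<in> borel_measurable lebesgue"
   using g borel_measurable_restrict_space_iff[of U lebesgue g] assms(2) by simp
  then have "(%x. ind U x * f x) \<in> borel_measurable lebesgue"
  proof (rule borel_measurable_AE)
   show "AE x in lebesgue. ind U x * g x = ind U x * f x"
    using assms(1) unfolding AE_lebesgue_on_iff[OF assms(2)] by eventually_elim (auto simp: indicator_def)
  qed
  then show False using borel_measurable_restrict_space_iff[of U lebesgue f] assms(2) False by simp
 qed
 then show ?thesis using False by (metis borel_measurable_integrable not_integrable_integral_eq)
qed

lemma borel_measurable_cong_AE_lebesgue_on:
 fixes f g :: "point => real"
 assumes "AE x in leb U. f x = g x" "U \<in> sets lebesgue" "f \<in> borel_measurable (leb U)"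
 shows "g \<in> borel_measurable (leb U)"
proof -
 have "(%x. ind U x * f x) \<in> borel_measurable lebesgue"
  using assms(3) borel_measurable_restrict_space_iff[of U lebesgue f] assms(2) by simp
 then have "(%x. ind U x * g x) \<in> borel_measurable lebesgue"
 proof (rule borel_measurable_AE)
  show "AE x in lebesgue. ind U x * f x = ind U x * g x"
   using assms(1) unfolding AE_lebesgue_on_iff[OF assms(2)] by eventually_elim (auto simp: indicator_def)
 qed
 then show "g \<in> borel_measurable (leb U)"
  using borel_measurable_restrict_space_iff[of U lebesgue g] assms(2) by simp
qed

lemma has_weak_partial_cong_AE:
 assumes U: "open U" and h: "has_weak_partial U i u g"
  and ae: "AE x in leb U. u x = u' x" "AE x in leb U. g x = g' x"
 shows "has_weak_partial U i u' g'"
proof -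
 have Um: "U \<in> sets lebesgue" using U by simp
 have "(LINT x|leb U. u x * f x) = (LINT x|leb U. u' x * f x)" for f
  by (rule integral_cong_AE_lebesgue_on[OF _ Um]) (use ae(1) in \<open>eventually_elim, simp\<close>)
 moreover have "(LINT x|leb U. g x * f x) = (LINT x|leb U. g' x * f x)" for f
  by (rule integral_cong_AE_lebesgue_on[OF _ Um]) (use ae(2) in \<open>eventually_elim, simp\<close>)
 ultimately show ?thesis
  using h ae locally_integrable_cong_AE[OF U] unfolding has_weak_partial_def by fastforce
qed

lemma has_weak_partial_lincomb:
 assumes U: "open U" and "has_weak_partial U i u g" "has_weak_partial U i v h"
 shows "has_weak_partial U i (%x. a * u x + b * v x) (%x. a * g x + b * h x)"
proof -
 have l: "locally_integrable U u" "locally_integrable U v" "locally_integrable U g" "locally_integrable U h"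
  using assms by (auto simp: has_weak_partial_def)
 have *: "(LINT x|leb U. (a * u1 x + b * v1 x) * \<phi> x) =
   a * (LINT x|leb U. u1 x * \<phi> x) + b * (LINT x|leb U. v1 x * \<phi> x)"
  if "locally_integrable U u1" "locally_integrable U v1" "\<phi> \<in> test_functions U" for u1 v1 \<phi>
 proof -
  have "(%x. (a * u1 x + b * v1 x) * \<phi> x) = (%x. a * (u1 x * \<phi> x) + b * (v1 x * \<phi> x))" by (auto simp: algebra_simps)
  then show ?thesis using locally_integrable_mult_test[OF U _ that(3)] that by simp
 qed
 show ?thesis unfolding has_weak_partial_def
 proof (intro conjI ballI locally_integrable_lincomb l)
  fix \<phi> assume p: "\<phi> \<in> test_functions U"
  show "(LINT x|leb U. (a * u x + b * v x) * partial i \<phi> x) = - (LINT x|leb U. (a * g x + b * h x) * \<phi> x)"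
   using assms(2,3) p by (simp add: *[OF l(1,2) partial_test_function[OF p]] *[OF l(3,4) p] has_weak_partial_def)
 qed
qed

lemma has_weak_partial_subset:
 assumes "open U" "open V" "V \<subseteq> U" "has_weak_partial U i u g"
 shows "has_weak_partial V i u g"
 unfolding has_weak_partial_def
proof (intro conjI ballI)
 show "locally_integrable V u" "locally_integrable V g"
  using assms locally_integrable_subset by (auto simp: has_weak_partial_def)
 fix \<phi> assume p: "\<phi> \<in> test_functions V"
 then have p': "\<phi> \<in> test_functions U" using test_functions_mono[OF assms(3)] by blast
 have "(LINT x|leb U. f x * \<psi> x) = (LINT x|leb V. f x * \<psi> x)" if "\<psi> \<in> test_functions V" for f \<psi>
  by (rule integral_lebesgue_on_superset_zero) (use assms test_functions_zero[OF that] in auto)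
 note * = this[OF p, of g] this[OF partial_test_function[OF p], of u]
 show "(LINT x|leb V. u x * partial i \<phi> x) = - (LINT x|leb V. g x * \<phi> x)"
  using assms(4) p' unfolding has_weak_partial_def *[symmetric] by blast
qed

lemma continuous_locally_integrable:
 assumes "continuous_on UNIV q"
 shows "locally_integrable U q"
 unfolding locally_integrable_def
proof (intro allI impI)
 fix K assume K: "compact K \<and> K \<subseteq> U"
 have "continuous_on K q" using assms continuous_on_subset by blast
 then have "integrable lborel (%x. ind K x *\<^sub>R q x)" using K by (intro borel_integrable_compact) auto
 then show "q absolutely_integrable_on K"
  unfolding set_integrable_def using integrable_completion borel_measurable_integrable by blast
qed

text \<open>By the product rule the two sides differ by the integral of a partial derivative of the
  test function q times phi, which vanishes.\<close>

lemma has_weak_partial_smooth: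
 assumes U: "open U" and q: "smooth_on UNIV q"
 shows "has_weak_partial U i q (partial i q)"
 unfolding has_weak_partial_def
proof (intro conjI ballI)
 show l: "locally_integrable U q" "locally_integrable U (partial i q)"
  using q smooth_on_partial smooth_on_continuous_on continuous_locally_integrable by blast+
 fix \<phi> assume p: "\<phi> \<in> test_functions U"
 have Um: "U \<in> sets lebesgue" using U by simp
 have t: "(%x. q x * \<phi> x) \<in> test_functions U" by (rule smooth_mult_test_function[OF q p])
 have eq: "partial i (%x. q x * \<phi> x) x = q x * partial i \<phi> x + partial i q x * \<phi> x" for x
 proof -
  have "(q has_derivative frechet_derivative q (at x)) (at x)" "(\<phi> has_derivative frechet_derivative \<phi> (at x)) (at x)"
   using smooth_on_differentiable[OF q] smooth_on_differentiable[OF test_functions_smooth[OF p]]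
   by (auto simp: frechet_derivative_works[symmetric])
  from partial_eq[OF has_derivative_mult[OF this]] show ?thesis by (simp add: partial_def)
 qed
 have "(LINT x|leb U. q x * partial i \<phi> x + partial i q x * \<phi> x) = (LINT x|leb U. partial i (%x. q x * \<phi> x) x)"
  by (simp add: eq)
 also have "\<dots> = (LINT x|lebesgue. partial i (%x. q x * \<phi> x) x)"
  using integral_lebesgue_on_superset_zero[of U UNIV "partial i (%x. q x * \<phi> x)"] Um test_functions_zero[OF partial_test_function[OF t]]
  by (simp add: lebesgue_on_UNIV_eq)
 also have "\<dots> = 0" by (rule integral_partial_test_function[OF t])
 finally show "(LINT x|leb U. q x * partial i \<phi> x) = - (LINT x|leb U. partial i q x * \<phi> x)"
  using locally_integrable_mult_test[OF U l(1) partial_test_function[OF p]] locally_integrable_mult_test[OF U l(2) p]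
  by simp
qed

lemma weak_partial_works:
 "has_weak_partial U i u g ==> has_weak_partial U i u (weak_partial U i u)"
 unfolding weak_partial_def by (rule someI[of "has_weak_partial U i u"])

lemma weak_partial_AE:
 "open U ==> has_weak_partial U i u g ==> AE x in leb U. weak_partial U i u x = g x"
 using has_weak_partial_unique weak_partial_works by blast

lemma H1D:
 assumes "open U" "u \<in> H1 U"
 shows "sq_int (leb U) u" "has_weak_partial U i u (weak_partial U i u)"
  "sq_int (leb U) (weak_partial U i u)"
proof -
 show "sq_int (leb U) u" using assms by (simp add: L2_iff)
 obtain g where g: "sq_int (leb U) g" "has_weak_partial U i u g"
  using assms(2) unfolding One_nat_def sobolev.simps Bex_def L2_iff by blast
 show w: "has_weak_partial U i u (weak_partial U i u)" by (rule weak_partial_works[OF g(2)])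
 have ae: "AE x in leb U. g x = weak_partial U i u x" by (rule has_weak_partial_unique[OF assms(1) g(2) w])
 show "sq_int (leb U) (weak_partial U i u)"
  using sq_int_cong_AE[OF g(1) borel_measurable_cong_AE_lebesgue_on[OF ae _ sq_int_measurable[OF g(1)]] ae] assms(1)
  by simp
qed

lemma H1I:
 assumes "sq_int (leb U) u" "!!i. has_weak_partial U i u (g i)"
  "!!i. sq_int (leb U) (g i)"
 shows "u \<in> H1 U"
 using assms unfolding One_nat_def sobolev.simps Bex_def L2_iff by blast

lemma test_function_sq_int:
 assumes "\<phi> \<in> test_functions U" "S \<in> sets lebesgue"
 shows "sq_int (leb S) \<phi>"
proof -
 have "integrable lebesgue (%x. (\<phi> x)\<^sup>2)"
  using test_function_integrable[OF smooth_mult_test_function[OF test_functions_smooth[OF assms(1)] assms(1)]]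
  by (simp add: power2_eq_square)
 then have "integrable (leb S) (%x. (\<phi> x)\<^sup>2)"
  using integrable_lebesgue_on_subset[of S UNIV] assms(2) by (simp add: lebesgue_on_UNIV_eq)
 then show ?thesis
  using borel_measurable_lebesgue_onI[OF test_function_borel[OF assms(1)]] by (simp add: sq_int_def)
qed

lemma test_function_H1:
 assumes "open U" "\<phi> \<in> test_functions U"
 shows "\<phi> \<in> H1 U"
 using assms by (intro H1I[where g="%i. partial i \<phi>"])
  (auto intro: test_function_sq_int partial_test_function has_weak_partial_smooth test_functions_smooth)

lemma L2_norm_nonneg: "0 <= L2_norm U u" by (simp add: L2_norm_def)

lemma L2_norm_cong_AE:
 assumes "AE x in leb U. u x = v x" "U \<in> sets lebesgue"
 shows "L2_norm U u = L2_norm U v"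
proof -
 have "AE x in leb U. (u x)\<^sup>2 = (v x)\<^sup>2" using assms(1) by eventually_elim simp
 from integral_cong_AE_lebesgue_on[OF this assms(2)] show ?thesis by (simp add: L2_norm_def)
qed

lemma test_function_H10:
 assumes U: "open U" and p: "\<phi> \<in> test_functions U"
 shows "\<phi> \<in> H10 U"
proof -
 have Um: "U \<in> sets lebesgue" using U by simp
 have "H1_norm U (%x. \<phi> x - \<phi> x) = 0"
 proof -
  have "has_weak_partial U i (%x. 0) (%x. 0)" for i
   using has_weak_partial_lincomb[OF U has_weak_partial_smooth[OF U test_functions_smooth[OF p]] has_weak_partial_smooth[OF U test_functions_smooth[OF p]], where a=0 and b=0]
   by simp
  from weak_partial_AE[OF U this] have "L2_norm U (weak_partial U i (%x. 0)) = L2_norm U (%x. 0)" for i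
   by (intro L2_norm_cong_AE Um)
  then show ?thesis by (simp add: H1_norm_def L2_norm_def)
 qed
 then show ?thesis using test_function_H1[OF U p] p unfolding H10_def by force
qed

text \<open>Unfolds the norm of the difference: by uniqueness the selected weak partial of z - phi
  agrees almost everywhere with the difference of the two partials.\<close>

lemma H10_approx:
 assumes U: "open U" and z: "z \<in> H10 U" and e: "0 < \<epsilon>"
 obtains \<phi> where "\<phi> \<in> test_functions U" "L2_norm U (%x. z x - \<phi> x) < \<epsilon>"
  "!!i. L2_norm U (%x. weak_partial U i z x - partial i \<phi> x) < \<epsilon>"
proof -
 obtain \<phi> where p: "\<phi> \<in> test_functions U" "H1_norm U (%x. z x - \<phi> x) < \<epsilon>"
  using z e by (auto simp: H10_def)
 have zH: "z \<in> H1 U" using z by (simp add: H10_def)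
 have "has_weak_partial U i (%x. 1 * z x + (-1) * \<phi> x) (%x. 1 * weak_partial U i z x + (-1) * partial i \<phi> x)" for i
  by (rule has_weak_partial_lincomb[OF U H1D(2)[OF U zH] has_weak_partial_smooth[OF U test_functions_smooth[OF p(1)]]])
 then have w: "has_weak_partial U i (%x. z x - \<phi> x) (%x. weak_partial U i z x - partial i \<phi> x)" for i by simp
 have eq: "L2_norm U (weak_partial U i (%x. z x - \<phi> x)) = L2_norm U (%x. weak_partial U i z x - partial i \<phi> x)" for i
  by (rule L2_norm_cong_AE[OF weak_partial_AE[OF U w]]) (use U in simp)
 have "(L2_norm U (%x. weak_partial U i z x - partial i \<phi> x))\<^sup>2 <= (\<Sum>i\<in>UNIV. (L2_norm U (weak_partial U i (%x. z x - \<phi> x)))\<^sup>2)" for i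
  unfolding eq by (rule member_le_sum) auto
 then have "sqrt ((L2_norm U (%x. weak_partial U i z x - partial i \<phi> x))\<^sup>2) <= H1_norm U (%x. z x - \<phi> x)" for i
  unfolding H1_norm_def by (intro real_sqrt_le_mono) (meson add_increasing zero_le_power2)
 then have "L2_norm U (%x. weak_partial U i z x - partial i \<phi> x) <= H1_norm U (%x. z x - \<phi> x)" for i
  by (simp add: L2_norm_nonneg)
 then have "L2_norm U (%x. weak_partial U i z x - partial i \<phi> x) < \<epsilon>" for i
  using p(2) by (rule le_less_trans)
 moreover have "sqrt ((L2_norm U (%x. z x - \<phi> x))\<^sup>2) <= H1_norm U (%x. z x - \<phi> x)"
  unfolding H1_norm_def by (intro real_sqrt_le_mono) (simp add: sum_nonneg)
 then have "L2_norm U (%x. z x - \<phi> x) < \<epsilon>" using p(2) L2_norm_nonneg by (simp add: le_less_trans)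
 ultimately show ?thesis using that p(1) by blast
qed

section \<open>Mean oscillation, translations and the Poincare inequality\<close>

text \<open>Expand (t - u)^2 about the mean of u; the cross term integrates to zero and the variance
  is nonnegative.\<close>

lemma variance_le:
 assumes M: "finite_measure M" and u: "sq_int M u" and V: "0 < measure M (space M)"
 defines "m \<equiv> lint M u / measure M (space M)"
 shows "measure M (space M) * (t - m)\<^sup>2 <= lint M (%y. (t - u y)\<^sup>2)"
  "lint M (%y. u y - m) = 0"
proof -
 let ?V = "measure M (space M)"
 interpret finite_measure M by (rule M)
 have i: "integrable M u" by (rule sq_int_integrable[OF M u])
 show 0: "lint M (%y. u y - m) = 0" using i V by (simp add: m_def)
 have um: "sq_int M (%y. u y - m)"
  by (rule sq_int_diff[OF u sq_int_bounded[OF M, of "%_. m" "\<bar>m\<bar>"]]) auto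
 have "(%y. (t - u y)\<^sup>2) = (%y. (t - m)\<^sup>2 + (u y - m)\<^sup>2 - 2 * (t - m) * (u y - m))"
  by (auto simp: power2_eq_square algebra_simps)
 then have "lint M (%y. (t - u y)\<^sup>2) = ?V * (t - m)\<^sup>2 + lint M (%y. (u y - m)\<^sup>2) - 2 * (t - m) * lint M (%y. u y - m)"
  using sq_int_square[OF um] i by simp
 moreover have "0 <= lint M (%y. (u y - m)\<^sup>2)" by simp
 ultimately show "?V * (t - m)\<^sup>2 <= lint M (%y. (t - u y)\<^sup>2)" using 0 by simp
qed

text \<open>Put t = u x in \<open>variance_le\<close> and integrate over x. The double integral of
  squared differences is the common form in which the gradient and the Slobodeckij seminorm are
  brought in below.\<close>

lemma variance_le_double_integral:
 assumes M: "finite_measure M" and u: "sq_int M u" and V: "0 < measure M (space M)"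
  and Q: "(\<integral>\<^sup>+x. (\<integral>\<^sup>+y. ennreal ((u x - u y)\<^sup>2) \<partial>M) \<partial>M) <= ennreal q" "0 <= q"
 defines "m \<equiv> lint M u / measure M (space M)"
 shows "lint M (%x. (u x - m)\<^sup>2) <= q / measure M (space M)"
proof -
 let ?V = "measure M (space M)"
 interpret finite_measure M by (rule M)
 have c: "sq_int M (%_. c)" for c :: real by (rule sq_int_bounded[OF M, of _ "\<bar>c\<bar>"]) auto
 have um: "sq_int M (%y. u y - m)" by (rule sq_int_diff[OF u c])
 have "ennreal (?V * lint M (%x. (u x - m)\<^sup>2)) = (\<integral>\<^sup>+x. ennreal (?V * (u x - m)\<^sup>2) \<partial>M)"
  using sq_int_square[OF um] by (subst nn_integral_eq_integral) auto
 also have "\<dots> <= (\<integral>\<^sup>+x. (\<integral>\<^sup>+y. ennreal ((u x - u y)\<^sup>2) \<partial>M) \<partial>M)"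
 proof (rule nn_integral_mono)
  fix x
  have "(\<integral>\<^sup>+y. ennreal ((u x - u y)\<^sup>2) \<partial>M) = ennreal (lint M (%y. (u x - u y)\<^sup>2))"
   using sq_int_square[OF sq_int_diff[OF c u]] by (intro nn_integral_eq_integral) auto
  then show "ennreal (?V * (u x - m)\<^sup>2) <= (\<integral>\<^sup>+y. ennreal ((u x - u y)\<^sup>2) \<partial>M)"
   using variance_le(1)[OF M u V, of "u x"] by (simp add: m_def ennreal_leI)
 qed
 also have "\<dots> <= ennreal q" by (rule Q)
 finally have "?V * lint M (%x. (u x - m)\<^sup>2) <= q" using Q(2) by (simp add: ennreal_le_iff)
 then show ?thesis using V by (simp add: field_simps)
qed

lemma partial_translate:
 assumes "\<phi> differentiable (at (x - c))"
 shows "partial i (%y. \<phi> (y - c)) x = partial i \<phi> (x - c)" "(%y. \<phi> (y - c)) differentiable (at x)"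
proof -
 let ?D = "frechet_derivative \<phi> (at (x - c))"
 have D: "(\<phi> has_derivative ?D) (at (x - c))" using assms frechet_derivative_works by blast
 have "((%y. y - c) has_derivative (%h. h)) (at x)" by (auto intro!: derivative_eq_intros)
 from has_derivative_compose[OF this D] have "((%y. \<phi> (y - c)) has_derivative ?D) (at x)" .
 then show "partial i (%y. \<phi> (y - c)) x = partial i \<phi> (x - c)" "(%y. \<phi> (y - c)) differentiable (at x)"
  unfolding partial_eq[OF \<open>((%y. \<phi> (y - c)) has_derivative ?D) (at x)\<close>] by (auto simp: partial_def differentiable_def)
qed

lemma Ck_on_translate: "Ck_on k UNIV \<phi> ==> Ck_on k UNIV (%y. \<phi> (y - c))"
proof (induction k arbitrary: \<phi>)
 case 0
 have "continuous_on UNIV (%y. y - c)" by (intro continuous_intros)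
 then show ?case using 0 continuous_on_compose2[of UNIV \<phi> UNIV "%y. y - c"] by simp
next
 case (Suc k)
 have "partial i (%y. \<phi> (y - c)) = (%y. partial i \<phi> (y - c))" for i
  using partial_translate(1) Suc.prems by (intro ext) simp
 then show ?case using Suc partial_translate(2) by simp
qed

lemma translate_test_function:
 assumes p: "\<phi> \<in> test_functions V" and "!!x. x \<in> V ==> x + c \<in> U"
 shows "(%y. \<phi> (y - c)) \<in> test_functions U"
proof (rule test_functionsI)
 show "smooth_on UNIV (%y. \<phi> (y - c))"
  using test_functions_smooth[OF p] Ck_on_translate unfolding smooth_on_def by blast
 have "{y. \<phi> (y - c) ~= 0} = (+) c ` {x. \<phi> x ~= 0}"
  by (auto simp: image_iff) (metis add_diff_cancel_left' diff_add_cancel add.commute)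
 then have cl: "closure {y. \<phi> (y - c) ~= 0} = (+) c ` closure {x. \<phi> x ~= 0}"
  by (simp add: closure_translation)
 show "compact (closure {y. \<phi> (y - c) ~= 0})"
  unfolding cl using p by (intro compact_translation) (simp add: test_functions_def)
 show "closure {y. \<phi> (y - c) ~= 0} \<subseteq> U"
  unfolding cl using p assms(2) by (auto simp: test_functions_def add.commute)
qed

lemma nn_integral_lborel_translate:
 fixes f :: "point => ennreal"
 assumes "f \<in> borel_measurable borel"
 shows "(\<integral>\<^sup>+x. f (x + k) \<partial>lborel) = (\<integral>\<^sup>+x. f x \<partial>lborel)"
proof -
 have "(\<integral>\<^sup>+x. f x \<partial>lborel) = (\<integral>\<^sup>+x. f x \<partial>distr lborel borel ((+) k))" by (simp add: lborel_distr_plus)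
 also have "\<dots> = (\<integral>\<^sup>+x. f (k + x) \<partial>lborel)" by (rule nn_integral_distr) (use assms in auto)
 finally show ?thesis by (simp add: add.commute)
qed

lemma integral_lborel_translate:
 fixes f :: "point => real"
 assumes "f \<in> borel_measurable borel"
 shows "lint lborel (%x. f (x + k)) = lint lborel f"
proof -
 have "lint lborel f = lint (distr lborel borel ((+) k)) f" by (simp add: lborel_distr_plus)
 also have "\<dots> = lint lborel (%x. f (k + x))" by (rule integral_distr) (use assms in auto)
 finally show ?thesis by (simp add: add.commute)
qed

text \<open>By Tonelli the inner integral over x is, for every t, the same integral of the modulus
  of g.\<close>

lemma integrable_along_segments:
 fixes g :: "point => real"
 assumes g: "g \<in> borel_measurable borel" "integrable lborel g"
 shows "integrable (lborel \<Otimes>\<^sub>M lborel) (%(x, t). ind {0..1} t * g (x + t *\<^sub>R k))"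
proof (rule integrableI_bounded)
 show m: "(%(x, t). ind {0..1} t * g (x + t *\<^sub>R k)) \<in> borel_measurable (lborel \<Otimes>\<^sub>M lborel)"
  using g(1) by measurable
 have "(\<integral>\<^sup>+z. ennreal (norm (case z of (x, t) => ind {0..1} t * g (x + t *\<^sub>R k))) \<partial>(lborel \<Otimes>\<^sub>M lborel))
   = (\<integral>\<^sup>+t. (\<integral>\<^sup>+x. ennreal \<bar>ind {0..1} t * g (x + t *\<^sub>R k)\<bar> \<partial>lborel) \<partial>lborel)"
  using lborel_pair.nn_integral_snd[of "%z. ennreal (norm (case z of (x, t) => ind {0..1} t * g (x + t *\<^sub>R k)))"] m
  by simp
 also have "\<dots> = (\<integral>\<^sup>+(t::real). indicator {0..1} t * (\<integral>\<^sup>+x. ennreal \<bar>g x\<bar> \<partial>lborel) \<partial>lborel)"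
 proof (rule nn_integral_cong)
  fix t :: real
  have gt: "(%x. g (x + t *\<^sub>R k)) \<in> borel_measurable borel" by (rule measurable_compose[OF _ g(1)]) measurable
  have "(\<integral>\<^sup>+x. ennreal \<bar>ind {0..1} t * g (x + t *\<^sub>R k)\<bar> \<partial>lborel)
    = (\<integral>\<^sup>+x. indicator {0..1} t * ennreal \<bar>g (x + t *\<^sub>R k)\<bar> \<partial>lborel)"
   by (intro nn_integral_cong) (simp add: indicator_def)
  also have "\<dots> = indicator {0..1} t * (\<integral>\<^sup>+x. ennreal \<bar>g (x + t *\<^sub>R k)\<bar> \<partial>lborel)"
   using gt by (intro nn_integral_cmult) auto
  also have "(\<integral>\<^sup>+x. ennreal \<bar>g (x + t *\<^sub>R k)\<bar> \<partial>lborel) = (\<integral>\<^sup>+x. ennreal \<bar>g x\<bar> \<partial>lborel)"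
   by (rule nn_integral_lborel_translate[of "%x. ennreal \<bar>g x\<bar>"]) (use g(1) in measurable)
  finally show "(\<integral>\<^sup>+x. ennreal \<bar>ind {0..1} t * g (x + t *\<^sub>R k)\<bar> \<partial>lborel)
    = indicator {0..1} t * (\<integral>\<^sup>+x. ennreal \<bar>g x\<bar> \<partial>lborel)" .
 qed
 also have "\<dots> = (\<integral>\<^sup>+x. ennreal \<bar>g x\<bar> \<partial>lborel)"
  by (subst nn_integral_multc) auto
 also have "\<dots> < \<infinity>" using g(2) by (simp add: integrable_iff_bounded)
 finally show "(\<integral>\<^sup>+z. ennreal (norm (case z of (x, t) => ind {0..1} t * g (x + t *\<^sub>R k))) \<partial>(lborel \<Otimes>\<^sub>M lborel)) < \<infinity>" .
qed

text \<open>The fundamental theorem of calculus along segments, for weak derivatives. The difference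
  W of both sides is tested with phi: for every t the weak derivative is moved to a translate of
  phi, integration over t is exchanged by Fubini, and the classical theorem applied to phi closes
  the identity.\<close>

lemma weak_partial_translation_identity:
 fixes u :: "point => real" and g :: "2 => point => real"
 assumes A: "open A" "convex A"
  and u: "u \<in> borel_measurable borel" "integrable lborel u" "\<forall>x. x \<notin> A --> u x = 0"
  and g: "!!i. g i \<in> borel_measurable borel" "!!i. integrable lborel (g i)" "\<forall>i x. x \<notin> A --> g i x = 0"
  and w: "!!i. has_weak_partial A i u (g i)"
 shows "AE x in lborel. x \<in> A --> x + k \<in> A -->
  u (x + k) - u x = lint lborel (%t. ind {0..1} t * (\<Sum>i\<in>UNIV. k $ i * g i (x + t *\<^sub>R k)))"
proof -
 \<comment> \<open>The points whose shift by k is again in A; by convexity the whole segment then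
   lies in A.\<close>
 define V where "V = A \<inter> (%x. x + k) -` A"
 have V: "open V" unfolding V_def using A(1) by (intro open_Int open_vimage continuous_intros)
 have Vm: "V \<in> sets lebesgue" "A \<in> sets lebesgue" using V A by auto
 define G where "G x = (\<Sum>i\<in>UNIV. k $ i * g i x)" for x
 define H where "H x = lint lborel (%t. ind {0..1} t * G (x + t *\<^sub>R k))" for x
 have G: "G \<in> borel_measurable borel" "integrable lborel G"
  unfolding G_def using g by auto
 have segint: "integrable (lborel \<Otimes>\<^sub>M lborel) (%(x, t). ind {0..1} t * G (x + t *\<^sub>R k))"
  by (rule integrable_along_segments[OF G])
 have Hi: "integrable lborel H" unfolding H_def using lborel_pair.integrable_fst'[OF segint] by simp
 have uk: "(%x. u (x + k)) \<in> borel_measurable borel" using u(1) by measurable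
 have uki: "integrable lborel (%x. u (x + k))"
  using integrable_lebesgue_translate[of u k] u uk by (simp add: integrable_completion)
 define W where "W x = u (x + k) - u x - H x" for x
 have Wi: "integrable lborel W" unfolding W_def using uki u Hi by auto
 have "AE x in leb V. W x = 0"
 proof (rule fundamental_lemma[OF V])
  show "locally_integrable V W"
   unfolding locally_integrable_def
  proof (intro allI impI)
   fix K assume "compact K \<and> K \<subseteq> V"
   then have "K \<in> sets lborel" by (simp add: compact_imp_closed)
   then have "integrable lborel (%x. ind K x *\<^sub>R W x)" using Wi by (rule integrable_mult_indicator)
   then show "W absolutely_integrable_on K"
    unfolding set_integrable_def using integrable_completion borel_measurable_integrable by blast
  qed
  fix \<phi> assume p: "\<phi> \<in> test_functions V"
  have pb: "\<phi> \<in> borel_measurable borel" by (rule test_function_borel[OF p])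
  obtain B where B: "0 < B" "!!x. \<bar>\<phi> x\<bar> <= B" using test_function_bounded[OF p] by blast
  define d where "d x = (\<Sum>i\<in>UNIV. k $ i * partial i \<phi> x)" for x
  have db: "d \<in> borel_measurable borel" unfolding d_def
   using test_function_borel[OF partial_test_function[OF p]] by measurable
  have dt: "d \<in> test_functions V"
  proof (rule test_functionsI'[OF _ p])
   show "smooth_on UNIV d" unfolding d_def
    by (intro smooth_on_sum smooth_on_mult smooth_on_const smooth_on_partial test_functions_smooth[OF p] open_UNIV)
   fix x assume "x \<notin> closure {x. \<phi> x ~= 0}"
   from partial_zero_outside_support[OF this] show "d x = 0" by (simp only: d_def mult_zero_right sum.neutral_const)
  qed
  obtain B' where B': "0 < B'" "!!x. \<bar>d x\<bar> <= B'" using test_function_bounded[OF dt] by blast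
  have bi: "integrable lborel (%x. f x * \<psi> x)" if "integrable lborel f" "\<psi> \<in> borel_measurable borel" "!!x. \<bar>\<psi> x\<bar> <= C"
   for f \<psi> :: "point => real" and C
  proof (rule Bintegrable_bound[OF integrable_mult_right[OF that(1), of C]])
   have C: "0 <= C" using that(3)[of 0] by linarith
   show "AE x in lborel. norm (f x * \<psi> x) <= norm (C * f x)"
    using C that(3) by (intro AE_I2) (simp add: abs_mult mult.commute mult_right_mono)
   show "(%x. f x * \<psi> x) \<in> borel_measurable lborel" using that by auto
  qed
  \<comment> \<open>The translate of phi by t k is a test function on A because convexity keeps V +
    t k inside A for t in [0,1]; so the weak derivative may be tested with it.\<close>
  have weak: "lint lborel (%y. u y * d (y - t *\<^sub>R k)) = - lint lborel (%y. G y * \<phi> (y - t *\<^sub>R k))"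
   if t: "0 <= t" "t <= 1" for t
  proof -
   have "x + t *\<^sub>R k \<in> A" if "x \<in> V" for x
   proof -
    have "x \<in> A" "x + k \<in> A" using that by (auto simp: V_def)
    then have "(1 - t) *\<^sub>R x + t *\<^sub>R (x + k) \<in> A" using A(2) t by (simp add: convex_alt)
    then show ?thesis by (simp add: algebra_simps)
   qed
   from translate_test_function[OF p this]
   have q: "(%y. \<phi> (y - t *\<^sub>R k)) \<in> test_functions A" .
   have dp: "partial i (%y. \<phi> (y - t *\<^sub>R k)) y = partial i \<phi> (y - t *\<^sub>R k)" for i y
    by (rule partial_translate(1)) (use smooth_on_differentiable[OF test_functions_smooth[OF p]] in simp)
   have toA: "lint (leb A) f = lint lborel f" if "f \<in> borel_measurable borel" "!!x. x \<notin> A ==> f x = 0" for f :: "point => real"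
   proof -
    have "lint lebesgue f = lint (leb A) f"
     using integral_lebesgue_on_superset_zero[of A UNIV f] Vm(2) that by (simp add: lebesgue_on_UNIV_eq)
    then show ?thesis using that(1) by (simp add: integral_completion)
   qed
   have pt: "(%y. \<phi> (y - t *\<^sub>R k)) \<in> borel_measurable borel" by (rule test_function_borel[OF q])
   have pit: "(%y. partial i \<phi> (y - t *\<^sub>R k)) \<in> borel_measurable borel" for i
    by (subst measurable_cong[OF dp[symmetric]]) (rule test_function_borel[OF partial_test_function[OF q]])
   have one: "lint lborel (%y. u y * partial i \<phi> (y - t *\<^sub>R k)) = - lint lborel (%y. g i y * \<phi> (y - t *\<^sub>R k))" for i
   proof -
    have "lint (leb A) (%y. u y * partial i (%y. \<phi> (y - t *\<^sub>R k)) y) = - lint (leb A) (%y. g i y * \<phi> (y - t *\<^sub>R k))"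
     using w[of i] q unfolding has_weak_partial_def by blast
    moreover have "lint (leb A) (%y. u y * partial i \<phi> (y - t *\<^sub>R k)) = lint lborel (%y. u y * partial i \<phi> (y - t *\<^sub>R k))"
     by (rule toA) (use u pit in auto)
    moreover have "lint (leb A) (%y. g i y * \<phi> (y - t *\<^sub>R k)) = lint lborel (%y. g i y * \<phi> (y - t *\<^sub>R k))"
     by (rule toA) (use g pt in auto)
    ultimately show ?thesis by (simp add: dp)
   qed
   have "lint lborel (%y. u y * d (y - t *\<^sub>R k)) = lint lborel (%y. \<Sum>i\<in>UNIV. k $ i * (u y * partial i \<phi> (y - t *\<^sub>R k)))"
    by (simp add: d_def sum_distrib_left algebra_simps)
   also have "\<dots> = (\<Sum>i\<in>UNIV. k $ i * lint lborel (%y. u y * partial i \<phi> (y - t *\<^sub>R k)))"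
   proof (subst Bintegral_sum)
    fix i :: 2
    obtain C where "!!x. \<bar>partial i \<phi> x\<bar> <= C" using test_function_bounded[OF partial_test_function[OF p]] by blast
    then show "integrable lborel (%y. k $ i * (u y * partial i \<phi> (y - t *\<^sub>R k)))"
     by (intro integrable_mult_right bi[OF u(2) pit, of _ C]) auto
   qed simp
   also have "\<dots> = - (\<Sum>i\<in>UNIV. k $ i * lint lborel (%y. g i y * \<phi> (y - t *\<^sub>R k)))"
    by (simp add: one sum_negf)
   also have "(\<Sum>i\<in>UNIV. k $ i * lint lborel (%y. g i y * \<phi> (y - t *\<^sub>R k))) = lint lborel (%y. \<Sum>i\<in>UNIV. k $ i * (g i y * \<phi> (y - t *\<^sub>R k)))"
    by (subst Bintegral_sum) (use bi[OF g(2) pt, of B] B in auto)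
   also have "\<dots> = lint lborel (%y. G y * \<phi> (y - t *\<^sub>R k))"
    by (simp add: G_def sum_distrib_left sum_distrib_right mult_ac)
   finally show ?thesis .
  qed
  have int1: "integrable (lborel \<Otimes>\<^sub>M lborel) (%(x, t). ind {0..1} t * G (x + t *\<^sub>R k) * \<phi> x)"
  proof (rule Bintegrable_bound[OF integrable_mult_right[OF segint, of B]])
   show "(%(x, t). ind {0..1} t * G (x + t *\<^sub>R k) * \<phi> x) \<in> borel_measurable (lborel \<Otimes>\<^sub>M lborel)"
    using G(1) pb by measurable
   show "AE z in lborel \<Otimes>\<^sub>M lborel. norm (case z of (x, t) => ind {0..1} t * G (x + t *\<^sub>R k) * \<phi> x)
     <= norm (B * (case z of (x, t) => ind {0..1} t * G (x + t *\<^sub>R k)))"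
    using B by (intro AE_I2) (auto simp: abs_mult mult.commute[of B] intro!: mult_left_mono split: prod.split)
  qed
  have int2: "integrable (lborel \<Otimes>\<^sub>M lborel) (%(y, t). ind {0..1} t * u y * d (y - t *\<^sub>R k))"
  proof (rule Bintegrable_bound[OF integrable_mult_right[OF integrable_along_segments[OF u(1,2), of 0], of B']])
   show "(%(y, t). ind {0..1} t * u y * d (y - t *\<^sub>R k)) \<in> borel_measurable (lborel \<Otimes>\<^sub>M lborel)"
    using u(1) db by measurable
   show "AE z in lborel \<Otimes>\<^sub>M lborel. norm (case z of (x, t) => ind {0..1} t * u x * d (x - t *\<^sub>R k))
     <= norm (B' * (case z of (x, t) => ind {0..1} t * u (x + t *\<^sub>R 0)))"
    using B' by (intro AE_I2) (auto simp: abs_mult mult.commute[of B'] intro!: mult_left_mono split: prod.split)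
  qed
  \<comment> \<open>The integral of the directional derivative of phi over the segment from y - k to
    y.\<close>
  have ftc: "lint lborel (%t. ind {0..1} t * d (y - t *\<^sub>R k)) = \<phi> y - \<phi> (y - k)" for y
  proof -
   have der: "((%t. - \<phi> (y - t *\<^sub>R k)) has_real_derivative d (y - t *\<^sub>R k)) (at t)" for t
    using has_real_derivative_along[of \<phi> y t "- k"] smooth_on_differentiable[OF test_functions_smooth[OF p]]
    by (auto simp: d_def sum_negf intro!: derivative_eq_intros)
   have cd: "isCont d y" for y using smooth_on_continuous_on[OF test_functions_smooth[OF dt]] by (simp add: continuous_on_eq_continuous_at)
   have "isCont (%t. d (y - t *\<^sub>R k)) t" for t by (rule isCont_o2[OF _ cd]) (intro continuous_intros)
   then show ?thesis using integral_FTC_Icc_real[of 0 1 "%t. - \<phi> (y - t *\<^sub>R k)" "%t. d (y - t *\<^sub>R k)"] der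
    by (simp add: mult.commute)
  qed
  have "lint lborel (%x. H x * \<phi> x) = lint lborel (%x. lint lborel (%t. ind {0..1} t * G (x + t *\<^sub>R k) * \<phi> x))"
   by (simp add: H_def)
  also have "\<dots> = lint lborel (%t. lint lborel (%x. ind {0..1} t * G (x + t *\<^sub>R k) * \<phi> x))"
   by (rule lborel_pair.Fubini_integral[symmetric]) (use int1 in \<open>simp add: case_prod_unfold\<close>)
  also have "\<dots> = lint lborel (%t. lint lborel (%y. - (ind {0..1} t * u y * d (y - t *\<^sub>R k))))"
  proof (rule Bochner_Integration.integral_cong[OF refl])
   fix t :: real
   show "lint lborel (%x. ind {0..1} t * G (x + t *\<^sub>R k) * \<phi> x) = lint lborel (%y. - (ind {0..1} t * u y * d (y - t *\<^sub>R k)))"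
   proof (cases "t \<in> {0..1}")
    case True
    have "lint lborel (%x. G (x + t *\<^sub>R k) * \<phi> x) = lint lborel (%y. G y * \<phi> (y - t *\<^sub>R k))"
     using integral_lborel_translate[of "%y. G y * \<phi> (y - t *\<^sub>R k)" "t *\<^sub>R k"] G(1) pb by simp
    then show ?thesis using weak[of t] True by simp
   qed simp
  qed
  also have "\<dots> = lint lborel (%y. lint lborel (%t. - (ind {0..1} t * u y * d (y - t *\<^sub>R k))))"
   by (rule lborel_pair.Fubini_integral) (use int2 in \<open>simp add: case_prod_unfold\<close>)
  also have "\<dots> = lint lborel (%y. u y * \<phi> (y - k) - u y * \<phi> y)"
  proof (rule Bochner_Integration.integral_cong[OF refl])
   fix y
   have "lint lborel (%t. - (ind {0..1} t * u y * d (y - t *\<^sub>R k))) = lint lborel (%t. - u y * (ind {0..1} t * d (y - t *\<^sub>R k)))"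
    by (simp add: algebra_simps)
   also have "\<dots> = - u y * (\<phi> y - \<phi> (y - k))" by (simp add: ftc)
   finally show "lint lborel (%t. - (ind {0..1} t * u y * d (y - t *\<^sub>R k))) = u y * \<phi> (y - k) - u y * \<phi> y"
    by (simp add: algebra_simps)
  qed
  also have "\<dots> = lint lborel (%y. u y * \<phi> (y - k)) - lint lborel (%y. u y * \<phi> y)"
  proof (rule Bintegral_diff)
   have "(%y. \<phi> (y - k)) \<in> borel_measurable borel" using pb by measurable
   then show "integrable lborel (%y. u y * \<phi> (y - k))" using bi[OF u(2), of _ B] B by blast
   show "integrable lborel (%y. u y * \<phi> y)" using bi[OF u(2) pb B(2)] .
  qed
  also have "lint lborel (%y. u y * \<phi> (y - k)) = lint lborel (%x. u (x + k) * \<phi> x)"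
   using integral_lborel_translate[of "%y. u y * \<phi> (y - k)" k] u(1) pb by simp
  finally have Hphi: "lint lborel (%x. H x * \<phi> x) = lint lborel (%x. u (x + k) * \<phi> x) - lint lborel (%y. u y * \<phi> y)" .
  have Wb: "W \<in> borel_measurable borel" using borel_measurable_integrable[OF Wi] by simp
  have "lint (leb V) (%x. W x * \<phi> x) = lint lebesgue (%x. W x * \<phi> x)"
   using integral_lebesgue_on_superset_zero[of V UNIV "%x. W x * \<phi> x"] Vm test_functions_zero[OF p]
   by (simp add: lebesgue_on_UNIV_eq)
  also have "\<dots> = lint lborel (%x. W x * \<phi> x)" using Wb pb by (simp add: integral_completion)
  also have "\<dots> = lint lborel (%x. u (x + k) * \<phi> x - u x * \<phi> x - H x * \<phi> x)"
   by (simp add: W_def algebra_simps)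
  also have "\<dots> = lint lborel (%x. u (x + k) * \<phi> x) - lint lborel (%x. u x * \<phi> x) - lint lborel (%x. H x * \<phi> x)"
   using bi[OF uki pb B(2)] bi[OF u(2) pb B(2)] bi[OF Hi pb B(2)] by simp
  also have "\<dots> = 0" using Hphi by simp
  finally show "lint (leb V) (%x. W x * \<phi> x) = 0" .
 qed
 then have "AE x in lebesgue. x \<in> V --> W x = 0" by (simp add: AE_lebesgue_on_iff[OF Vm(1)])
 then have "AE x in lborel. x \<in> V --> W x = 0" by (simp add: AE_completion_iff)
 then show ?thesis by eventually_elim (auto simp: V_def W_def H_def G_def)
qed

lemma norm_power2_eq_sum: "(norm k)\<^sup>2 = (\<Sum>i\<in>UNIV. (k $ i)\<^sup>2)" for k :: "real^'n"
 by (simp add: norm_vec_def L2_set_def sum_nonneg)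

lemma sum_mult_le_norm: "(\<Sum>i\<in>UNIV. k $ i * a i)\<^sup>2 <= (norm k)\<^sup>2 * (\<Sum>i\<in>UNIV. (a i)\<^sup>2)" for k :: "real^'n"
 using Cauchy_Schwarz_ineq_sum[of "%i. k $ i" a UNIV] by (simp add: norm_power2_eq_sum)

text \<open>Cauchy-Schwarz on the unit interval. The right side is a nonnegative integral, so square
  integrability of h along the segment need not be known.\<close>

lemma square_integral_unit_interval_le:
 fixes h :: "real => real"
 assumes "h \<in> borel_measurable borel"
 shows "ennreal ((lint lborel (%t. ind {0..1} t * h t))\<^sup>2) <= (\<integral>\<^sup>+t. ennreal (ind {0..1} t * (h t)\<^sup>2) \<partial>lborel)"
proof (cases "(\<integral>\<^sup>+t. ennreal (ind {0..1} t * (h t)\<^sup>2) \<partial>lborel) = \<infinity>")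
 case False
 let ?I = "%t. ind {0..1::real} t"
 have sq: "(?I t * h t)\<^sup>2 = ?I t * (h t)\<^sup>2" for t by (simp add: indicator_def)
 have i: "integrable lborel (%t. ?I t * (h t)\<^sup>2)"
  using assms False by (intro integrableI_nonneg) (auto simp: top.not_eq_extremum)
 have s1: "sq_int lborel (%t. ?I t * h t)"
  unfolding sq_int_def sq using i assms by simp
 have s2: "sq_int lborel ?I"
 proof -
  have "(?I t)\<^sup>2 = ?I t" for t by (simp add: indicator_def)
  moreover have "integrable lborel ?I" by (intro integrable_real_indicator) auto
  ultimately show ?thesis by (simp add: sq_int_def)
 qed
 have "\<bar>lint lborel (%t. ?I t * h t * ?I t)\<bar> <= sqrt (lint lborel (%t. (?I t * h t)\<^sup>2)) * sqrt (lint lborel (%t. (?I t)\<^sup>2))"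
  by (rule Cauchy_Schwarz_integral[OF s1 s2])
 moreover have "?I t * h t * ?I t = ?I t * h t" "(?I t)\<^sup>2 = ?I t" for t by (auto simp: indicator_def)
 ultimately have "\<bar>lint lborel (%t. ?I t * h t)\<bar> <= sqrt (lint lborel (%t. ?I t * (h t)\<^sup>2))"
  by (simp add: sq)
 then have "(lint lborel (%t. ?I t * h t))\<^sup>2 <= lint lborel (%t. ?I t * (h t)\<^sup>2)"
  using power_mono[of "\<bar>lint lborel (%t. ?I t * h t)\<bar>" "sqrt (lint lborel (%t. ?I t * (h t)\<^sup>2))" 2]
   Bintegral_nonneg[of lborel "%t. ?I t * (h t)\<^sup>2"] by simp
 then show ?thesis using i by (subst nn_integral_eq_integral) (auto intro: ennreal_leI)
qed auto

text \<open>Square the segment identity and integrate over x. After exchanging the integrals every t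
  contributes the same amount by translation invariance, since the g i live on the whole plane and
  vanish off A.\<close>

lemma translation_estimate:
 fixes u :: "point => real" and g :: "2 => point => real"
 assumes A: "open A" "convex A"
  and u: "u \<in> borel_measurable borel" "integrable lborel u" "\<forall>x. x \<notin> A --> u x = 0"
  and g: "!!i. g i \<in> borel_measurable borel" "!!i. integrable lborel (g i)" "\<forall>i x. x \<notin> A --> g i x = 0"
  and w: "!!i. has_weak_partial A i u (g i)"
 shows "(\<integral>\<^sup>+x. indicator A x * indicator A (x + k) * ennreal ((u (x + k) - u x)\<^sup>2) \<partial>lborel)
  <= ennreal ((norm k)\<^sup>2) * (\<integral>\<^sup>+x. ennreal (\<Sum>i\<in>UNIV. (g i x)\<^sup>2) \<partial>lborel)"
proof -
 define G where "G x = (\<Sum>i\<in>UNIV. k $ i * g i x)" for x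
 have Gm: "G \<in> borel_measurable borel" unfolding G_def using g by auto
 define N where "N x = (norm k)\<^sup>2 * (\<Sum>i\<in>UNIV. (g i x)\<^sup>2)" for x
 have Nm: "N \<in> borel_measurable borel" unfolding N_def using g by auto
 have GN: "(G x)\<^sup>2 <= N x" for x unfolding G_def N_def by (rule sum_mult_le_norm)
 have "(\<integral>\<^sup>+x. indicator A x * indicator A (x + k) * ennreal ((u (x + k) - u x)\<^sup>2) \<partial>lborel)
   <= (\<integral>\<^sup>+x. (\<integral>\<^sup>+t. ennreal (ind {0..1} t * N (x + t *\<^sub>R k)) \<partial>lborel) \<partial>lborel)"
 proof (rule nn_integral_mono_AE)
  from weak_partial_translation_identity[OF A u g w, of k]
  show "AE x in lborel. indicator A x * indicator A (x + k) * ennreal ((u (x + k) - u x)\<^sup>2)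
    <= (\<integral>\<^sup>+t. ennreal (ind {0..1} t * N (x + t *\<^sub>R k)) \<partial>lborel)"
  proof eventually_elim
   case (elim x)
   show ?case
   proof (cases "x \<in> A \<and> x + k \<in> A")
    case True
    then have "u (x + k) - u x = lint lborel (%t. ind {0..1} t * G (x + t *\<^sub>R k))"
     using elim by (simp add: G_def)
    moreover have "(%t. G (x + t *\<^sub>R k)) \<in> borel_measurable borel" by (rule measurable_compose[OF _ Gm]) measurable
    ultimately have "ennreal ((u (x + k) - u x)\<^sup>2) <= (\<integral>\<^sup>+t. ennreal (ind {0..1} t * (G (x + t *\<^sub>R k))\<^sup>2) \<partial>lborel)"
     using square_integral_unit_interval_le by simp
    also have "\<dots> <= (\<integral>\<^sup>+t. ennreal (ind {0..1} t * N (x + t *\<^sub>R k)) \<partial>lborel)"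
     using GN by (intro nn_integral_mono ennreal_leI mult_left_mono) auto
    finally show ?thesis using True by simp
   qed (auto simp: indicator_def)
  qed
 qed
 also have "\<dots> = (\<integral>\<^sup>+t. (\<integral>\<^sup>+x. ennreal (ind {0..1} t * N (x + t *\<^sub>R k)) \<partial>lborel) \<partial>lborel)"
 proof (rule lborel_pair.Fubini')
  show "(%(t, x). ennreal (ind {0..1} t * N (x + t *\<^sub>R k))) \<in> borel_measurable (lborel \<Otimes>\<^sub>M lborel)"
   using Nm by measurable
 qed
 also have "\<dots> = (\<integral>\<^sup>+(t::real). indicator {0..1} t * (\<integral>\<^sup>+x. ennreal (N x) \<partial>lborel) \<partial>lborel)"
 proof (rule nn_integral_cong)
  fix t :: real
  have Nt: "(%x. N (x + t *\<^sub>R k)) \<in> borel_measurable borel" by (rule measurable_compose[OF _ Nm]) measurable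
  have "(\<integral>\<^sup>+x. ennreal (ind {0..1} t * N (x + t *\<^sub>R k)) \<partial>lborel)
    = (\<integral>\<^sup>+x. indicator {0..1} t * ennreal (N (x + t *\<^sub>R k)) \<partial>lborel)"
   by (intro nn_integral_cong) (simp add: indicator_def)
  also have "\<dots> = indicator {0..1} t * (\<integral>\<^sup>+x. ennreal (N (x + t *\<^sub>R k)) \<partial>lborel)"
   using Nt by (intro nn_integral_cmult) auto
  also have "(\<integral>\<^sup>+x. ennreal (N (x + t *\<^sub>R k)) \<partial>lborel) = (\<integral>\<^sup>+x. ennreal (N x) \<partial>lborel)"
   by (rule nn_integral_lborel_translate[of "%x. ennreal (N x)"]) (use Nm in measurable)
  finally show "(\<integral>\<^sup>+x. ennreal (ind {0..1} t * N (x + t *\<^sub>R k)) \<partial>lborel) = indicator {0..1} t * (\<integral>\<^sup>+x. ennreal (N x) \<partial>lborel)" .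
 qed
 also have "\<dots> = (\<integral>\<^sup>+x. ennreal (N x) \<partial>lborel)"
  by (subst nn_integral_multc) auto
 also have "\<dots> = ennreal ((norm k)\<^sup>2) * (\<integral>\<^sup>+x. ennreal (\<Sum>i\<in>UNIV. (g i x)\<^sup>2) \<partial>lborel)"
  unfolding N_def using g(1) by (subst nn_integral_cmult[symmetric]) (auto simp: ennreal_mult sum_nonneg)
 finally show ?thesis .
qed

text \<open>The enclosing square suffices; it is the origin of the constant 4 in the Poincare
  inequality.\<close>

lemma emeasure_cball_plane_le: "0 <= d ==> emeasure lborel (cball (0::point) d) <= ennreal (4 * d\<^sup>2)"
proof -
 assume d: "0 <= d"
 have "cball (0::point) d \<subseteq> cbox (\<chi> i. - d) (\<chi> i. d)"
 proof
  fix x :: point assume "x \<in> cball 0 d"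
  then have "\<bar>x $ i\<bar> <= d" for i using component_le_norm_cart[of x i] by (simp add: dist_norm)
  then show "x \<in> cbox (\<chi> i. - d) (\<chi> i. d)" by (simp add: mem_box_cart abs_le_iff minus_le_iff)
 qed
 then have "emeasure lborel (cball (0::point) d) <= emeasure lborel (cbox (\<chi> i. - d) (\<chi> i. d) :: point set)"
  by (rule emeasure_mono) simp
 also have "\<dots> = ennreal (measure lborel (cbox (\<chi> i. - d) (\<chi> i. d) :: point set))"
  by (rule emeasure_eq_ennreal_measure) (simp add: emeasure_lborel_cbox_eq)
 also have "measure lborel (cbox (\<chi> i. - d) (\<chi> i. d) :: point set) = 4 * d\<^sup>2"
 proof -
  have "measure lborel (cbox (\<chi> i. - d) (\<chi> i. d) :: point set) = (\<Prod>i\<in>(UNIV::2 set). 2 * d)"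
   using content_cbox_cart[of "(\<chi> i. - d) :: point" "\<chi> i. d"] d by (auto simp: interval_ne_empty_cart)
  then show ?thesis by (simp add: power2_eq_square)
 qed
 finally show ?thesis .
qed

text \<open>Fubini and translations are applied to Borel functions on \<open>lborel\<close>. The
  representative vanishes off A so that integrals may run over the plane.\<close>

lemma sq_int_borel_representative:
 assumes A: "open A" and u: "sq_int (leb A) u"
 obtains u' where "u' \<in> borel_measurable borel" "\<forall>x. x \<notin> A --> u' x = 0" "AE x in leb A. u x = u' x"
proof -
 have Am: "A \<in> sets lebesgue" using A by simp
 have "(%x. ind A x * u x) \<in> borel_measurable lebesgue"
  using sq_int_measurable[OF u] borel_measurable_restrict_space_iff[of A lebesgue u] Am by simp
 then obtain v where v: "v \<in> borel_measurable lborel" "AE x in lborel. ind A x * u x = v x"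
  using completion_ex_borel_measurable_real by blast
 have vl: "AE x in lebesgue. ind A x * u x = v x" using v(2) by (rule AE_completion)
 show thesis
 proof (rule that)
  have "A \<in> sets borel" using A by simp
  then show "(%x. ind A x * v x) \<in> borel_measurable borel" using v(1) by simp
  show "AE x in leb A. u x = ind A x * v x"
   unfolding AE_lebesgue_on_iff[OF Am] using vl by eventually_elim auto
 qed simp
qed

lemma nn_integral_lebesgue_on:
 assumes "A \<in> sets lebesgue"
 shows "(\<integral>\<^sup>+x. f x \<partial>leb A) = (\<integral>\<^sup>+x. f x * indicator A x \<partial>lebesgue)"
 using assms by (subst nn_integral_restrict_space) auto

text \<open>Substitute y = x + k. Only shifts with norm at most d contribute, each at most d^2 times
  the gradient energy, and these shifts fill an area of at most 4 d^2.\<close>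

lemma double_integral_le_gradient:
 assumes A: "open A" "convex A" "bounded A" and d: "0 <= d" "\<forall>x\<in>A. \<forall>y\<in>A. norm (x - y) <= d"
  and u: "sq_int (leb A) u" and g: "!!i. sq_int (leb A) (g i)"
  and w: "!!i. has_weak_partial A i u (g i)"
 shows "(\<integral>\<^sup>+x. (\<integral>\<^sup>+y. ennreal ((u x - u y)\<^sup>2) \<partial>leb A) \<partial>leb A)
  <= ennreal (4 * d ^ 4 * (\<Sum>i\<in>UNIV. lint (leb A) (%x. (g i x)\<^sup>2)))"
proof -
 have Am: "A \<in> sets lebesgue" "A \<in> sets borel" using A by auto
 have Alm: "A \<in> lmeasurable" using A(1,3) by (simp add: lmeasurable_open)
 obtain u' where u': "u' \<in> borel_measurable borel" "\<forall>x. x \<notin> A --> u' x = 0" "AE x in leb A. u x = u' x"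
  using sq_int_borel_representative[OF A(1) u] by blast
 have "\<exists>g'. g' \<in> borel_measurable borel \<and> (\<forall>x. x \<notin> A --> g' x = 0) \<and> (AE x in leb A. g i x = g' x)" for i
  using sq_int_borel_representative[OF A(1) g[of i]] by metis
 then obtain g' where g': "!!i. g' i \<in> borel_measurable borel" "\<forall>i x. x \<notin> A --> g' i x = 0" "!!i. AE x in leb A. g i x = g' i x"
  by metis
 have sq: "integrable lborel v \<and> integrable lborel (%x. (v x)\<^sup>2)"
  if "sq_int (leb A) v0" "v \<in> borel_measurable borel" "\<forall>x. x \<notin> A --> v x = 0" "AE x in leb A. v0 x = v x"
  for v v0 :: "point => real"
 proof -
  have s: "sq_int (leb A) v"
   by (rule sq_int_cong_AE[OF that(1) borel_measurable_lebesgue_onI[OF that(2)] that(4)])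
  have "(%x. ind A x * v x) = v" "(%x. ind A x * (v x)\<^sup>2) = (%x. (v x)\<^sup>2)"
   using that(3) by (auto simp: indicator_def fun_eq_iff)
  then have "integrable lebesgue v" "integrable lebesgue (%x. (v x)\<^sup>2)"
   using sq_int_integrable[OF finite_measure_lebesgue_on[OF Alm] s] sq_int_square[OF s]
   unfolding integrable_lebesgue_on_iff[OF Am(1)] by presburger+
  then show ?thesis using that(2) by (simp add: integrable_completion)
 qed
 have u'i: "integrable lborel u'" using sq[OF u u'] by blast
 have g'i: "integrable lborel (g' i)" "integrable lborel (%x. (g' i x)\<^sup>2)" for i using sq[OF g g'(1) _ g'(3)] g'(2) by blast+
 have w': "has_weak_partial A i u' (g' i)" for i by (rule has_weak_partial_cong_AE[OF A(1) w u'(3) g'(3)])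
 have lae: "AE x in lebesgue. x \<in> A --> u x = u' x" using u'(3) by (simp add: AE_lebesgue_on_iff[OF Am(1)])
 let ?S = "\<integral>\<^sup>+x. ennreal (\<Sum>i\<in>UNIV. (g' i x)\<^sup>2) \<partial>lborel"
 have "(\<integral>\<^sup>+x. (\<integral>\<^sup>+y. ennreal ((u x - u y)\<^sup>2) \<partial>leb A) \<partial>leb A)
   = (\<integral>\<^sup>+x. (\<integral>\<^sup>+y. ennreal ((u x - u y)\<^sup>2) * indicator A y \<partial>lebesgue) * indicator A x \<partial>lebesgue)"
  by (simp add: nn_integral_lebesgue_on[OF Am(1)])
 also have "\<dots> = (\<integral>\<^sup>+x. (\<integral>\<^sup>+y. ennreal ((u' x - u' y)\<^sup>2) * indicator A y \<partial>lebesgue) * indicator A x \<partial>lebesgue)"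
 proof (rule nn_integral_cong_AE)
  show "AE x in lebesgue. (\<integral>\<^sup>+y. ennreal ((u x - u y)\<^sup>2) * indicator A y \<partial>lebesgue) * indicator A x = (\<integral>\<^sup>+y. ennreal ((u' x - u' y)\<^sup>2) * indicator A y \<partial>lebesgue) * indicator A x"
   using lae
  proof eventually_elim
   case (elim x)
   have "(\<integral>\<^sup>+y. ennreal ((u x - u y)\<^sup>2) * indicator A y \<partial>lebesgue) = (\<integral>\<^sup>+y. ennreal ((u' x - u' y)\<^sup>2) * indicator A y \<partial>lebesgue)" if "x \<in> A"
   proof (rule nn_integral_cong_AE)
    show "AE y in lebesgue. ennreal ((u x - u y)\<^sup>2) * indicator A y = ennreal ((u' x - u' y)\<^sup>2) * indicator A y"
     using lae by eventually_elim (use elim that in \<open>auto simp: indicator_def\<close>)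
   qed
   then show ?case by (auto simp: indicator_def)
  qed
 qed
 also have "\<dots> = (\<integral>\<^sup>+x. (\<integral>\<^sup>+y. ennreal ((u' x - u' y)\<^sup>2) * indicator A y * indicator A x \<partial>lborel) \<partial>lborel)"
  using Am(2) u'(1) by (simp add: nn_integral_completion nn_integral_multc)
 also have "\<dots> = (\<integral>\<^sup>+x. (\<integral>\<^sup>+k. ennreal ((u' x - u' (x + k))\<^sup>2) * indicator A (x + k) * indicator A x \<partial>lborel) \<partial>lborel)"
 proof (rule nn_integral_cong)
  fix x :: point
  have "(%y. ennreal ((u' x - u' y)\<^sup>2) * indicator A y * indicator A x) \<in> borel_measurable borel"
   using u'(1) Am(2) by measurable
  from nn_integral_lborel_translate[OF this, of x]
  show "(\<integral>\<^sup>+y. ennreal ((u' x - u' y)\<^sup>2) * indicator A y * indicator A x \<partial>lborel) = (\<integral>\<^sup>+k. ennreal ((u' x - u' (x + k))\<^sup>2) * indicator A (x + k) * indicator A x \<partial>lborel)"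
   by (simp add: add.commute)
 qed
 also have "\<dots> = (\<integral>\<^sup>+k. (\<integral>\<^sup>+x. ennreal ((u' x - u' (x + k))\<^sup>2) * indicator A (x + k) * indicator A x \<partial>lborel) \<partial>lborel)"
 proof (rule lborel_pair.Fubini')
  have "(%z::point \<times> point. snd z + fst z) \<in> borel_measurable (lborel \<Otimes>\<^sub>M lborel)" by measurable
  then have a: "(%z. u' (snd z + fst z)) \<in> borel_measurable (lborel \<Otimes>\<^sub>M lborel)" "(%z. indicator A (snd z + fst z) :: ennreal) \<in> borel_measurable (lborel \<Otimes>\<^sub>M lborel)"
   using measurable_compose[OF _ u'(1)] measurable_compose[OF _ borel_measurable_indicator[OF Am(2)]] by blast+
  show "(%(k, x). ennreal ((u' x - u' (x + k))\<^sup>2) * indicator A (x + k) * indicator A x) \<in> borel_measurable (lborel \<Otimes>\<^sub>M lborel)"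
   unfolding case_prod_unfold using a u'(1) Am(2) by measurable
 qed
 also have "\<dots> <= (\<integral>\<^sup>+(k::point). ennreal (d\<^sup>2) * ?S * indicator (cball 0 d) k \<partial>lborel)"
 proof (rule nn_integral_mono)
  fix k :: point
  show "(\<integral>\<^sup>+x. ennreal ((u' x - u' (x + k))\<^sup>2) * indicator A (x + k) * indicator A x \<partial>lborel) <= ennreal (d\<^sup>2) * ?S * indicator (cball 0 d) k"
  proof (cases "k \<in> cball 0 d")
   case True
   have "(\<integral>\<^sup>+x. ennreal ((u' x - u' (x + k))\<^sup>2) * indicator A (x + k) * indicator A x \<partial>lborel)
     = (\<integral>\<^sup>+x. indicator A x * indicator A (x + k) * ennreal ((u' (x + k) - u' x)\<^sup>2) \<partial>lborel)"
    by (intro nn_integral_cong) (simp add: power2_commute mult_ac)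
   also have "\<dots> <= ennreal ((norm k)\<^sup>2) * ?S"
    by (rule translation_estimate[OF A(1,2) u'(1) u'i u'(2) g'(1) g'i(1) g'(2) w'])
   also have "\<dots> <= ennreal (d\<^sup>2) * ?S" using True by (intro mult_right_mono ennreal_leI power_mono) auto
   finally show ?thesis using True by simp
  next
   case False
   have "ennreal ((u' x - u' (x + k))\<^sup>2) * indicator A (x + k) * indicator A x = 0" for x
    using d(2) False by (force simp: indicator_def)
   then have "(\<integral>\<^sup>+x. ennreal ((u' x - u' (x + k))\<^sup>2) * indicator A (x + k) * indicator A x \<partial>lborel) = (\<integral>\<^sup>+(x::point). 0 \<partial>lborel)"
    by presburger
   then show ?thesis by simp
  qed
 qed
 also have "\<dots> = ennreal (d\<^sup>2) * ?S * emeasure lborel (cball (0::point) d)" by (subst nn_integral_cmult_indicator) auto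
 also have "\<dots> <= ennreal (d\<^sup>2) * ?S * ennreal (4 * d\<^sup>2)" by (intro mult_left_mono emeasure_cball_plane_le d) auto
 also have "?S = ennreal (\<Sum>i\<in>UNIV. lint lborel (%x. (g' i x)\<^sup>2))"
  using g'i(2) by (subst nn_integral_eq_integral) (auto simp: sum_nonneg)
 also have "(\<Sum>i\<in>UNIV. lint lborel (%x. (g' i x)\<^sup>2)) = (\<Sum>i\<in>UNIV. lint (leb A) (%x. (g i x)\<^sup>2))"
 proof (rule sum.cong[OF refl])
  fix i :: 2
  have "lint (leb A) (%x. (g i x)\<^sup>2) = lint (leb A) (%x. (g' i x)\<^sup>2)"
   by (rule integral_cong_AE_lebesgue_on[OF _ Am(1)]) (use g'(3)[of i] in \<open>eventually_elim, simp\<close>)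
  also have "\<dots> = lint lebesgue (%x. (g' i x)\<^sup>2)"
   using integral_lebesgue_on_superset_zero[of A UNIV "%x. (g' i x)\<^sup>2"] Am g'(2) by (simp add: lebesgue_on_UNIV_eq)
  also have "\<dots> = lint lborel (%x. (g' i x)\<^sup>2)" using g'(1)[of i] by (simp add: integral_completion)
  finally show "lint lborel (%x. (g' i x)\<^sup>2) = lint (leb A) (%x. (g i x)\<^sup>2)" by simp
 qed
 also have "ennreal (d\<^sup>2) * ennreal (\<Sum>i\<in>UNIV. lint (leb A) (%x. (g i x)\<^sup>2)) * ennreal (4 * d\<^sup>2) =
   ennreal (4 * d ^ 4 * (\<Sum>i\<in>UNIV. lint (leb A) (%x. (g i x)\<^sup>2)))"
 proof -
  have e: "ennreal a * ennreal q * ennreal (4 * a) = ennreal (4 * (a * a) * q)" if "0 <= a" "0 <= q" for a q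
   using that by (simp add: ennreal_mult[symmetric] mult_ac)
  have "d\<^sup>2 * d\<^sup>2 = d ^ 4" by (simp add: power4_eq_xxxx power2_eq_square)
  then show ?thesis using e[of "d\<^sup>2" "\<Sum>i\<in>UNIV. lint (leb A) (%x. (g i x)\<^sup>2)"] by (simp add: sum_nonneg)
 qed
 finally show ?thesis .
qed

text \<open>The factor d^4 divided by the area is not sharp for thin sets, but on regular triangles
  and their corners it is of order d^2.\<close>

lemma poincare_convex:
 assumes A: "open A" "convex A" "bounded A" "A ~= {}" and d: "0 <= d" "\<forall>x\<in>A. \<forall>y\<in>A. norm (x - y) <= d"
  and u: "sq_int (leb A) u" and g: "!!i. sq_int (leb A) (g i)"
  and w: "!!i. has_weak_partial A i u (g i)"
 shows "lint (leb A) (%x. (u x - lint (leb A) u / measure lebesgue A)\<^sup>2)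
  <= 4 * d ^ 4 * (\<Sum>i\<in>UNIV. lint (leb A) (%x. (g i x)\<^sup>2)) / measure lebesgue A"
proof -
 have Alm: "A \<in> lmeasurable" using A(1,3) by (simp add: lmeasurable_open)
 have "measure lebesgue A > 0"
  using open_not_negligible[OF A(1,4)] Alm by (metis negligible_iff_measure zero_less_measure_iff)
 moreover have "measure (leb A) (space (leb A)) = measure lebesgue A"
  using Alm by (simp add: measure_restrict_space fmeasurableD)
 ultimately show ?thesis
  using variance_le_double_integral[OF finite_measure_lebesgue_on[OF Alm] u _ double_integral_le_gradient[OF A(1-3) d u g w]] d(1)
  by (simp add: sum_nonneg)
qed

text \<open>On A x A the denominator of the quotient is at most d^(2+2s). The indicator of A x A
  stays inside the integral over Omega x Omega, so that the shares of disjoint triangles can be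
  added later.\<close>

lemma double_integral_le_slobodeckij:
 assumes A: "A \<in> sets lebesgue" "A \<subseteq> \<Omega>" and Om: "\<Omega> \<in> lmeasurable" and d: "0 <= d" "\<forall>x\<in>A. \<forall>y\<in>A. norm (x - y) <= d"
  and s: "0 < s" and q: "integrable (leb \<Omega> \<Otimes>\<^sub>M leb \<Omega>) (slobodeckij_quotient s u)"
 shows "(\<integral>\<^sup>+x. (\<integral>\<^sup>+y. ennreal ((u x - u y)\<^sup>2) \<partial>leb A) \<partial>leb A)
  <= ennreal (d powr (2 + 2 * s) * lint (leb \<Omega> \<Otimes>\<^sub>M leb \<Omega>) (%z. ind (A \<times> A) z * slobodeckij_quotient s u z))"
proof -
 let ?M = "leb \<Omega>"
 interpret M: finite_measure ?M by (rule finite_measure_lebesgue_on[OF Om])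
 interpret P: pair_sigma_finite ?M ?M ..
 have AM: "A \<in> sets ?M" using A Om by (auto simp: sets_restrict_space_iff fmeasurableD)
 have AA: "A \<times> A \<in> sets (?M \<Otimes>\<^sub>M ?M)" using AM by simp
 have r: "leb A = restrict_space ?M A"
  using A(2) Om by (subst restrict_restrict_space) (auto simp: Int_absorb1 A(1) fmeasurableD inf.absorb2)
 have nn: "(\<integral>\<^sup>+x. f x \<partial>leb A) = (\<integral>\<^sup>+x. f x * indicator A x \<partial>?M)" for f
  unfolding r using AM A(2) by (subst nn_integral_restrict_space) (auto simp: Int_absorb2)
 have i: "integrable (?M \<Otimes>\<^sub>M ?M) (%z. ind (A \<times> A) z * slobodeckij_quotient s u z)"
  using integrable_mult_indicator[OF AA q] by simp
 have pos: "0 <= slobodeckij_quotient s u z" for z by (auto simp: slobodeckij_quotient_def split: prod.split)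
 have meas: "(%z. ennreal (d powr (2 + 2 * s) * (ind (A \<times> A) z * slobodeckij_quotient s u z))) \<in> borel_measurable (?M \<Otimes>\<^sub>M ?M)"
  using borel_measurable_integrable[OF i] by measurable
 have "(\<integral>\<^sup>+x. (\<integral>\<^sup>+y. ennreal ((u x - u y)\<^sup>2) \<partial>leb A) \<partial>leb A)
   <= (\<integral>\<^sup>+x. (\<integral>\<^sup>+y. ennreal (d powr (2 + 2 * s) * (ind (A \<times> A) (x, y) * slobodeckij_quotient s u (x, y))) \<partial>?M) \<partial>?M)"
  unfolding nn
 proof (rule nn_integral_mono)
  fix x
  show "(\<integral>\<^sup>+y. ennreal ((u x - u y)\<^sup>2) * indicator A y \<partial>?M) * indicator A x
   <= (\<integral>\<^sup>+y. ennreal (d powr (2 + 2 * s) * (ind (A \<times> A) (x, y) * slobodeckij_quotient s u (x, y))) \<partial>?M)"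
  proof (cases "x \<in> A")
   case True
   have "(\<integral>\<^sup>+y. ennreal ((u x - u y)\<^sup>2) * indicator A y \<partial>?M) <= (\<integral>\<^sup>+y. ennreal (d powr (2 + 2 * s) * (ind (A \<times> A) (x, y) * slobodeckij_quotient s u (x, y))) \<partial>?M)"
   proof (rule nn_integral_mono)
    fix y
    show "ennreal ((u x - u y)\<^sup>2) * indicator A y <= ennreal (d powr (2 + 2 * s) * (ind (A \<times> A) (x, y) * slobodeckij_quotient s u (x, y)))"
    \<comment> \<open>On the diagonal the left side is zero, so the vanishing denominator does no
      harm.\<close>
    proof (cases "y \<in> A \<and> x ~= y")
     case y: True
     have "0 < norm (x - y)" using y by simp
     moreover have "norm (x - y) powr (2 + 2 * s) <= d powr (2 + 2 * s)"
      using d(2) True y s by (intro powr_mono2) auto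
     ultimately have "(u x - u y)\<^sup>2 <= d powr (2 + 2 * s) * ((u x - u y)\<^sup>2 / norm (x - y) powr (2 + 2 * s))"
      by (simp add: pos_le_divide_eq mult_left_mono mult.commute)
     then show ?thesis using y True by (auto simp: slobodeckij_quotient_def intro!: ennreal_leI)
    qed (auto simp: indicator_def)
   qed
   then show ?thesis using True by simp
  qed simp
 qed
 also have "\<dots> = (\<integral>\<^sup>+z. ennreal (d powr (2 + 2 * s) * (ind (A \<times> A) z * slobodeckij_quotient s u z)) \<partial>(?M \<Otimes>\<^sub>M ?M))"
  by (rule M.nn_integral_fst[OF meas])
 also have "\<dots> = ennreal (d powr (2 + 2 * s) * lint (?M \<Otimes>\<^sub>M ?M) (%z. ind (A \<times> A) z * slobodeckij_quotient s u z))"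
  using i pos by (subst nn_integral_eq_integral) auto
 finally show ?thesis .
qed

lemma variance_le_slobodeckij:
 assumes A: "open A" "A ~= {}" "A \<subseteq> \<Omega>" and Om: "\<Omega> \<in> lmeasurable" and d: "0 <= d" "\<forall>x\<in>A. \<forall>y\<in>A. norm (x - y) <= d"
  and s: "0 < s" and u: "sq_int (leb A) u"
  and q: "integrable (leb \<Omega> \<Otimes>\<^sub>M leb \<Omega>) (slobodeckij_quotient s u)"
 shows "lint (leb A) (%x. (u x - lint (leb A) u / measure lebesgue A)\<^sup>2)
  <= d powr (2 + 2 * s) * lint (leb \<Omega> \<Otimes>\<^sub>M leb \<Omega>) (%z. ind (A \<times> A) z * slobodeckij_quotient s u z) / measure lebesgue A"
proof -
 have Am: "A \<in> sets lebesgue" using A by simp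
 have Alm: "A \<in> lmeasurable" using fmeasurableI2[OF Om A(3) Am] .
 have "measure lebesgue A > 0"
  using open_not_negligible[OF A(1,2)] Alm by (metis negligible_iff_measure zero_less_measure_iff)
 moreover have "measure (leb A) (space (leb A)) = measure lebesgue A"
  using Alm by (simp add: measure_restrict_space fmeasurableD)
 moreover have "0 <= lint (leb \<Omega> \<Otimes>\<^sub>M leb \<Omega>) (%z. ind (A \<times> A) z * slobodeckij_quotient s u z)"
  by (intro integral_nonneg_AE AE_I2) (auto simp: slobodeckij_quotient_def split: prod.split)
 ultimately show ?thesis
  using variance_le_double_integral[OF finite_measure_lebesgue_on[OF Alm] u _ double_integral_le_slobodeckij[OF Am A(3) Om d s q]]
  by simp
qed

section \<open>Barycentric coordinates and integrals over triangles\<close>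

text \<open>Twice the signed area of the triangle with vertices 0, u and v.\<close>

definition cross2 :: "point => point => real" where
 "cross2 u v = u $ 1 * v $ 2 - u $ 2 * v $ 1"

definition noncollinear :: "point => point => point => bool" where
 "noncollinear p q r \<longleftrightarrow> cross2 (q - p) (r - p) ~= 0"

text \<open>Barycentric coordinate belonging to the vertex p, as a ratio of signed areas. The other
  two coordinates are obtained by rotating the arguments, so most lemmas treat one of them
  only.\<close>

definition bary :: "point => point => point => point => real" where
 "bary p q r x = cross2 (q - x) (r - x) / cross2 (q - p) (r - p)"

text \<open>The constant gradient of \<open>bary p q r\<close>.\<close>

definition bary_grad :: "point => point => point => point" where
 "bary_grad p q r = (1 / cross2 (q - p) (r - p)) *\<^sub>R vector [q $ 2 - r $ 2, r $ 1 - q $ 1]"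

lemma cross2_rotate: "cross2 (r - q) (p - q) = cross2 (q - p) (r - p)"
 and cross2_swap: "cross2 (r - p) (q - p) = - cross2 (q - p) (r - p)"
 by (simp_all add: cross2_def algebra_simps)

lemma noncollinear_rotate: "noncollinear p q r ==> noncollinear q r p"
 and noncollinear_swap: "noncollinear p q r ==> noncollinear p r q"
 unfolding noncollinear_def by (metis cross2_rotate) (metis cross2_swap neg_equal_0_iff_equal)

lemma bary_swap: "bary p q r = bary p r q"
 by (rule ext) (metis bary_def cross2_swap minus_divide_divide)

lemma bary_denominators:
 "bary p q r x = cross2 (q - x) (r - x) / cross2 (q - p) (r - p)"
 "bary q r p x = cross2 (r - x) (p - x) / cross2 (q - p) (r - p)"
 "bary r p q x = cross2 (p - x) (q - x) / cross2 (q - p) (r - p)"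
 by (simp_all add: bary_def cross2_def algebra_simps)

lemma bary_sum:
 assumes "noncollinear p q r"
 shows "bary p q r x + bary q r p x + bary r p q x = 1"
proof -
 have "cross2 (q - x) (r - x) + cross2 (r - x) (p - x) + cross2 (p - x) (q - x) = cross2 (q - p) (r - p)"
  by (simp add: cross2_def algebra_simps)
 then show ?thesis
  using assms unfolding bary_denominators[where p=p and q=q and r=r] noncollinear_def add_divide_distrib[symmetric] by simp
qed

lemma bary_comb:
 assumes "noncollinear p q r"
 shows "bary p q r x *\<^sub>R p + bary q r p x *\<^sub>R q + bary r p q x *\<^sub>R r = x"
proof -
 let ?D = "cross2 (q - p) (r - p)"
 have D: "?D ~= 0" using assms by (simp add: noncollinear_def)
 have "cross2 (q - x) (r - x) * p $ i + cross2 (r - x) (p - x) * q $ i + cross2 (p - x) (q - x) * r $ i = ?D * x $ i" for i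
  using exhaust_2[of i] by (auto simp: cross2_def algebra_simps)
 then have "(cross2 (q - x) (r - x) * p $ i + cross2 (r - x) (p - x) * q $ i + cross2 (p - x) (q - x) * r $ i) / ?D = x $ i" for i
  using D by simp
 then have "bary p q r x * p $ i + bary q r p x * q $ i + bary r p q x * r $ i = x $ i" for i
  unfolding bary_denominators[where p=p and q=q and r=r] by (simp only: add_divide_distrib times_divide_eq_left)
 then show ?thesis by (simp only: vec_eq_iff vector_add_component vector_scaleR_component real_scaleR_def simp_thms)
qed

lemma bary_vertex: "noncollinear p q r ==> bary p q r p = 1" "bary p q r q = 0" "bary p q r r = 0"
 by (auto simp: bary_def noncollinear_def cross2_def)

lemma bary_affine:
 assumes "noncollinear p q r"
 shows "bary p q r x = 1 + bary_grad p q r \<bullet> (x - p)"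
proof -
 let ?D = "cross2 (q - p) (r - p)"
 have "cross2 (q - x) (r - x) = ?D + ((q $ 2 - r $ 2) * (x $ 1 - p $ 1) + (r $ 1 - q $ 1) * (x $ 2 - p $ 2))"
  by (simp add: cross2_def algebra_simps)
 moreover have "bary_grad p q r \<bullet> (x - p) = ((q $ 2 - r $ 2) * (x $ 1 - p $ 1) + (r $ 1 - q $ 1) * (x $ 2 - p $ 2)) / ?D"
  by (simp add: bary_grad_def inner_vec_def sum_2 add_divide_distrib)
 ultimately show ?thesis using assms by (simp add: bary_def noncollinear_def add_divide_distrib)
qed

lemma bary_affine': "noncollinear p q r ==> bary p q r x = bary p q r y + bary_grad p q r \<bullet> (x - y)"
 by (simp add: bary_affine inner_diff_right)

lemma bary_unique:
 assumes "noncollinear p q r" "a + b + c = 1" "x = a *\<^sub>R p + b *\<^sub>R q + c *\<^sub>R r"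
 shows "bary p q r x = a"
proof -
 have "a = 1 - b - c" using assms(2) by simp
 then have x: "x - p = b *\<^sub>R (q - p) + c *\<^sub>R (r - p)"
  using assms(3) by (simp add: \<open>a = 1 - b - c\<close> algebra_simps)
 have "bary_grad p q r \<bullet> (q - p) = -1" "bary_grad p q r \<bullet> (r - p) = -1"
  using bary_affine[OF assms(1), of q] bary_affine[OF assms(1), of r] bary_vertex[of p q r] by auto
 then have "bary p q r x = 1 - b - c"
  unfolding bary_affine[OF assms(1)] x by (simp add: inner_add_right)
 then show ?thesis using assms(2) by simp
qed

text \<open>Gradients of the two identities that the coordinates add up to 1 and reproduce x from
  the vertices, the latter paired with y. They turn the three edge means into the mean
  gradient.\<close>

lemma bary_grad_sum:
 assumes "noncollinear p q r"
 shows "bary_grad p q r + bary_grad q r p + bary_grad r p q = 0"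
  "(p \<bullet> y) *\<^sub>R bary_grad p q r + (q \<bullet> y) *\<^sub>R bary_grad q r p + (r \<bullet> y) *\<^sub>R bary_grad r p q = y"
proof -
 let ?D = "cross2 (q - p) (r - p)"
 have D: "?D ~= 0" using assms by (simp add: noncollinear_def)
 have e: "cross2 (r - q) (p - q) = ?D" "cross2 (p - r) (q - r) = ?D" using cross2_rotate by metis+
 show "bary_grad p q r + bary_grad q r p + bary_grad r p q = 0"
  unfolding bary_grad_def e scaleR_add_right[symmetric] by (simp add: vec_eq_iff forall_2)
 have "(p \<bullet> y) * (q $ 2 - r $ 2) + (q \<bullet> y) * (r $ 2 - p $ 2) + (r \<bullet> y) * (p $ 2 - q $ 2) = ?D * y $ 1"
  "(p \<bullet> y) * (r $ 1 - q $ 1) + (q \<bullet> y) * (p $ 1 - r $ 1) + (r \<bullet> y) * (q $ 1 - p $ 1) = ?D * y $ 2"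
  by (simp_all add: inner_vec_def sum_2 cross2_def algebra_simps)
 then have "((p \<bullet> y) * (q $ 2 - r $ 2) + (q \<bullet> y) * (r $ 2 - p $ 2) + (r \<bullet> y) * (p $ 2 - q $ 2)) / ?D = y $ 1"
  "((p \<bullet> y) * (r $ 1 - q $ 1) + (q \<bullet> y) * (p $ 1 - r $ 1) + (r \<bullet> y) * (q $ 1 - p $ 1)) / ?D = y $ 2"
  using D by auto
 then show "(p \<bullet> y) *\<^sub>R bary_grad p q r + (q \<bullet> y) *\<^sub>R bary_grad q r p + (r \<bullet> y) *\<^sub>R bary_grad r p q = y"
  unfolding bary_grad_def e by (simp add: vec_eq_iff forall_2 add_divide_distrib)
qed

text \<open>This is the reciprocal of the height of p over the edge from q to r.\<close>

lemma norm_bary_grad: "norm (bary_grad p q r) = norm (q - r) / \<bar>cross2 (q - p) (r - p)\<bar>"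
proof -
 have "norm (vector [q $ 2 - r $ 2, r $ 1 - q $ 1] :: point) = norm (q - r)"
  by (simp add: norm_eq_sqrt_inner inner_vec_def sum_2 algebra_simps)
 then show ?thesis by (simp add: bary_grad_def)
qed

lemma noncollinear_iff: "noncollinear p q r \<longleftrightarrow> \<not> collinear {p, q, r}"
proof
 assume n: "noncollinear p q r"
 show "\<not> collinear {p, q, r}"
 proof
  assume "collinear {p, q, r}"
  then have "p = r \<or> (\<exists>u. q = u *\<^sub>R p + (1 - u) *\<^sub>R r)" by (simp add: collinear_3_expand)
  then show False
  proof
   assume "\<exists>u. q = u *\<^sub>R p + (1 - u) *\<^sub>R r"
   then obtain u where "q = u *\<^sub>R p + (1 - u) *\<^sub>R r" by blast
   then have "q - p = (1 - u) *\<^sub>R (r - p)" by (simp add: algebra_simps)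
   then have "cross2 (q - p) (r - p) = cross2 ((1 - u) *\<^sub>R (r - p)) (r - p)" by (rule arg_cong)
   then have "cross2 (q - p) (r - p) = 0" by (simp add: cross2_def)
   then show False using n by (simp add: noncollinear_def)
  qed (use n in \<open>simp add: noncollinear_def cross2_def\<close>)
 qed
next
 assume c: "\<not> collinear {p, q, r}"
 show "noncollinear p q r" unfolding noncollinear_def
 proof
  assume D: "cross2 (q - p) (r - p) = 0"
  have qp: "r - p ~= 0" using c by (auto simp: insert_commute)
  let ?u = "r - p" and ?v = "q - p"
  have "?u \<bullet> ?u ~= 0" using qp by simp
  moreover have "(?u \<bullet> ?u) *\<^sub>R ?v = (?u \<bullet> ?v) *\<^sub>R ?u"
  proof -
   have "(u \<bullet> u) *\<^sub>R v = (u \<bullet> v) *\<^sub>R u" if "cross2 v u = 0" for u v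
   proof -
    have "v $ 1 * u $ 2 = v $ 2 * u $ 1" using that by (simp add: cross2_def)
    then have "(u $ 1 * u $ 1 + u $ 2 * u $ 2) * v $ 1 = (u $ 1 * v $ 1 + u $ 2 * v $ 2) * u $ 1"
     "(u $ 1 * u $ 1 + u $ 2 * u $ 2) * v $ 2 = (u $ 1 * v $ 1 + u $ 2 * v $ 2) * u $ 2" by algebra+
    then show ?thesis by (simp add: vec_eq_iff forall_2 inner_vec_def sum_2)
   qed
   then show ?thesis using D by blast
  qed
  moreover from this have "(1 / (?u \<bullet> ?u)) *\<^sub>R ((?u \<bullet> ?u) *\<^sub>R ?v) = (1 / (?u \<bullet> ?u)) *\<^sub>R ((?u \<bullet> ?v) *\<^sub>R ?u)"
   by (rule arg_cong)
  ultimately have "?v = ((1 / (?u \<bullet> ?u)) * (?u \<bullet> ?v)) *\<^sub>R ?u" unfolding scaleR_scaleR by simp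
  then obtain c where "q - p = c *\<^sub>R (r - p)" by blast
  then have "q = c *\<^sub>R (r - p) + p" by (simp only: diff_eq_eq)
  then have "q = (1 - c) *\<^sub>R p + (1 - (1 - c)) *\<^sub>R r"
   by (simp add: algebra_simps)
  then have "collinear {p, q, r}" unfolding collinear_3_expand by blast
  then show False using c by simp
 qed
qed

lemma triangle_eq_bary:
 assumes n: "noncollinear p q r"
 shows "tri p q r = {x. 0 <= bary p q r x \<and> 0 <= bary q r p x \<and> 0 <= bary r p q x}" (is "_ = ?B")
  "interior (tri p q r) = {x. 0 < bary p q r x \<and> 0 < bary q r p x \<and> 0 < bary r p q x}" (is "_ = ?I")
proof -
 have u: "bary p q r x = a \<and> bary q r p x = b \<and> bary r p q x = c"
  if "a + b + c = 1" "x = a *\<^sub>R p + b *\<^sub>R q + c *\<^sub>R r" for a b c x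
  using bary_unique[OF n that] bary_unique[OF noncollinear_rotate[OF n], of b c a x]
   bary_unique[OF noncollinear_rotate[OF noncollinear_rotate[OF n]], of c a b x] that
  by (simp add: algebra_simps)
 show "tri p q r = ?B"
 proof (intro equalityI subsetI)
  fix x assume "x \<in> tri p q r"
  then obtain a b c where *: "x = a *\<^sub>R p + b *\<^sub>R q + c *\<^sub>R r" "0 <= a" "0 <= b" "0 <= c" "a + b + c = 1"
   unfolding convex_hull_3 by blast
  from u[OF *(5,1)] *(2-4) show "x \<in> ?B" by simp
 next
  fix x assume x: "x \<in> ?B"
  have "x = bary p q r x *\<^sub>R p + bary q r p x *\<^sub>R q + bary r p q x *\<^sub>R r" using bary_comb[OF n, of x] by (rule sym)
  then show "x \<in> tri p q r" unfolding convex_hull_3 using bary_sum[OF n, of x] x by blast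
 qed
 have "\<not> collinear {p, q, r}" using n by (simp add: noncollinear_iff)
 then have i: "interior (tri p q r) = {v. \<exists>x y z. 0 < x \<and> 0 < y \<and> 0 < z \<and> x + y + z = 1 \<and> x *\<^sub>R p + y *\<^sub>R q + z *\<^sub>R r = v}"
  by (rule interior_convex_hull_3_minimal) simp
 show "interior (tri p q r) = ?I"
 proof (intro equalityI subsetI)
  fix x assume "x \<in> interior (tri p q r)"
  then obtain a b c where *: "a *\<^sub>R p + b *\<^sub>R q + c *\<^sub>R r = x" "0 < a" "0 < b" "0 < c" "a + b + c = 1"
   unfolding i by blast
  from u[OF *(5) *(1)[symmetric]] *(2-4) show "x \<in> ?I" by simp
 next
  fix x assume "x \<in> ?I" then show "x \<in> interior (tri p q r)"
   unfolding i using bary_sum[OF n, of x] bary_comb[OF n, of x] by blast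
 qed
qed

definition ref_triangle :: "point set" where
 "ref_triangle = {x. 0 <= x $ 1 \<and> 0 <= x $ 2 \<and> x $ 1 + x $ 2 <= 1}"

definition edge_map :: "point => point => point => point" where
 "edge_map u v x = (x $ 1) *\<^sub>R u + (x $ 2) *\<^sub>R v"

lemma compact_ref_triangle: "compact ref_triangle"
proof -
 have "closed ref_triangle"
  unfolding ref_triangle_def by (intro closed_Collect_conj closed_Collect_le continuous_intros)
 moreover have "ref_triangle \<subseteq> cbox 0 (\<chi> i. 1)"
  unfolding ref_triangle_def by (auto simp: mem_box_cart forall_2)
 ultimately show ?thesis unfolding compact_eq_bounded_closed using bounded_subset[OF bounded_cbox] by simp
qed

lemma linear_edge_map: "linear (edge_map u v)"
 by (rule linearI) (auto simp: edge_map_def algebra_simps)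

lemma det_edge_map: "det (matrix (edge_map u v)) = cross2 u v"
 by (simp add: det_2 matrix_def edge_map_def cross2_def axis_def)

lemma triangle_eq_image:
 "tri p q r = (+) p ` edge_map (q - p) (r - p) ` ref_triangle"
proof (intro equalityI subsetI)
 fix x assume "x \<in> tri p q r"
 then obtain a b c where x: "x = a *\<^sub>R p + b *\<^sub>R q + c *\<^sub>R r" and abc: "0 <= a" "0 <= b" "0 <= c" "a + b + c = 1"
  unfolding convex_hull_3 by blast
 have "a = 1 - b - c" using abc(4) by simp
 then have "x = (1 - b - c) *\<^sub>R p + b *\<^sub>R q + c *\<^sub>R r" using x by (rule subst)
 then have "x = p + edge_map (q - p) (r - p) (vector [b, c])"
  by (simp add: edge_map_def algebra_simps)
 moreover have "vector [b, c] \<in> ref_triangle" using abc by (simp add: ref_triangle_def)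
 ultimately show "x \<in> (+) p ` edge_map (q - p) (r - p) ` ref_triangle" by blast
next
 fix x assume "x \<in> (+) p ` edge_map (q - p) (r - p) ` ref_triangle"
 then obtain y where y: "x = p + edge_map (q - p) (r - p) y" "y \<in> ref_triangle" by blast
 then have "x = (1 - y $ 1 - y $ 2) *\<^sub>R p + (y $ 1) *\<^sub>R q + (y $ 2) *\<^sub>R r"
  by (simp add: edge_map_def algebra_simps)
 then show "x \<in> tri p q r" using y(2) unfolding convex_hull_3 ref_triangle_def
  by (intro CollectI exI[of _ "1 - y $ 1 - y $ 2"] exI[of _ "y $ 1"] exI[of _ "y $ 2"]) auto
qed

lemma set_integrable_continuous_compact:
 fixes f :: "point => 'b::{banach, second_countable_topology}"
 assumes "continuous_on UNIV f" "compact K"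
 shows "set_integrable lborel K f"
 unfolding set_integrable_def using assms continuous_on_subset by (intro borel_integrable_compact) auto

lemma absolutely_integrable_continuous_compact:
 fixes f :: "point => 'b::euclidean_space"
 assumes "continuous_on UNIV f" "compact K"
 shows "f absolutely_integrable_on K"
proof -
 have "integrable lborel (%x. ind K x *\<^sub>R f x)"
  using set_integrable_continuous_compact[OF assms] by (simp only: set_integrable_def)
 then show ?thesis
  unfolding set_integrable_def by (subst integrable_completion[OF borel_measurable_integrable])
qed

lemma integral_linear_image:
 fixes F :: "point => real"
 assumes L: "linear L" and F: "continuous_on UNIV F" and K: "compact K"
 shows "(LINT x:L ` K|lborel. F x) = \<bar>det (matrix L)\<bar> * (LINT x:K|lborel. F (L x))"
proof -
 have cL: "continuous_on A L" for A using L by (rule linear_continuous_on[OF linear_conv_bounded_linear[THEN iffD1]])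
 have KL: "compact (L ` K)" using cL K by (rule compact_continuous_image)
 \<comment> \<open>The linear change of variables takes vector-valued integrands, so F is embedded
   into \<open>real^1\<close>.\<close>
 let ?f = "%x. vec (F x) :: real^1"
 have cf: "continuous_on UNIV ?f" unfolding vec_def using F by (intro continuous_intros)
 have cFL: "continuous_on UNIV (%x. F (L x))" using continuous_on_compose2[OF F cL] by simp
 have cfL: "continuous_on UNIV (%x. ?f (L x))" using continuous_on_compose2[OF cf cL] by simp
 have i1: "?f absolutely_integrable_on (L ` K)" "F absolutely_integrable_on (L ` K)"
   "(%x. ?f (L x)) absolutely_integrable_on K" "(%x. F (L x)) absolutely_integrable_on K"
  by (rule absolutely_integrable_continuous_compact[OF cf KL] absolutely_integrable_continuous_compact[OF F KL]
   absolutely_integrable_continuous_compact[OF cfL K] absolutely_integrable_continuous_compact[OF cFL K])+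
 have "integral (L ` K) ?f = \<bar>det (matrix L)\<bar> *\<^sub>R integral K (%x. ?f (L x))"
  using integral_change_of_variables_linear[OF L disjI1[OF i1(1)]] by (simp add: o_def)
 then have "integral (L ` K) ?f $ 1 = \<bar>det (matrix L)\<bar> * integral K (%x. ?f (L x)) $ 1" by simp
 moreover have "integral (L ` K) ?f $ 1 = integral (L ` K) F" "integral K (%x. ?f (L x)) $ 1 = integral K (%x. F (L x))"
  using integral_component_eq_cart[of ?f "L ` K" 1] integral_component_eq_cart[of "%x. ?f (L x)" K 1] i1
  by (auto simp: absolutely_integrable_on_def)
 ultimately show ?thesis
  using set_borel_integral_eq_integral(2)[OF set_integrable_continuous_compact[OF F KL]]
   set_borel_integral_eq_integral(2)[OF set_integrable_continuous_compact[OF cFL K]] by simp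
qed

lemma continuous_on_vector_2: "continuous_on UNIV (%z::real\<times>real. vector [fst z, snd z] :: point)"
proof -
 have "continuous_on UNIV (%z::real\<times>real. \<chi> i::2. if i = 1 then fst z else snd z)"
 proof (intro continuous_on_vec_lambda)
  fix i :: 2
  have "continuous_on UNIV (fst :: real\<times>real => real)" "continuous_on UNIV (snd :: real\<times>real => real)"
   by (intro continuous_on_fst continuous_on_snd continuous_on_id)+
  then show "continuous_on UNIV (%z::real\<times>real. if i = 1 then fst z else snd z)" by (cases "i = 1") simp_all
 qed
 moreover have "(\<chi> i::2. if i = 1 then fst z else snd z) = vector [fst z, snd z]" for z :: "real \<times> real"
  by (simp add: vec_eq_iff forall_2)
 ultimately show ?thesis by simp
qed

lemma measurable_vector_2: "(%(s, t). vector [s, t] :: point) \<in> borel_measurable (lborel \<Otimes>\<^sub>M lborel)"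
proof -
 have "(%z::real\<times>real. vector [fst z, snd z] :: point) \<in> borel_measurable borel"
  by (rule borel_measurable_continuous_onI[OF continuous_on_vector_2])
 then have "(%z::real\<times>real. vector [fst z, snd z] :: point) \<in> borel_measurable (lborel \<Otimes>\<^sub>M lborel)"
  unfolding lborel_prod by simp
 then show ?thesis by (simp only: case_prod_unfold)
qed

lemma prod_Basis_plane: "(\<Prod>b\<in>Basis. (x :: point) \<bullet> b) = x $ 1 * x $ 2"
proof -
 have "(Basis :: point set) = (%i. axis i 1) ` UNIV" by (auto simp: Basis_vec_def)
 moreover have "inj (%i::2. axis i (1::real))" by (auto simp: inj_on_def axis_eq_axis)
 ultimately have "(\<Prod>b\<in>Basis. x \<bullet> b) = (\<Prod>i\<in>UNIV. x $ i)"
  by (intro prod.reindex_cong[of "%i. axis i 1"]) (auto simp: inner_axis)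
 then show ?thesis by (simp add: UNIV_2)
qed

text \<open>Both measures give a box the product of its side lengths. This makes Fubini available
  for functions on \<open>real^2\<close>.\<close>

lemma lborel_plane_eq_distr: "(lborel :: point measure) = distr (lborel \<Otimes>\<^sub>M lborel) borel (%(s, t). vector [s, t])"
proof (rule lborel_eqI)
 fix l u :: point assume lu: "!!b. b \<in> Basis ==> l \<bullet> b <= u \<bullet> b"
 have l12: "l $ i <= u $ i" for i using lu[of "axis i 1"] by (simp add: inner_axis)
 let ?f = "%(s, t). vector [s, t] :: point"
 have e1: "emeasure (distr (lborel \<Otimes>\<^sub>M lborel) borel ?f) (box l u) =
  emeasure (lborel \<Otimes>\<^sub>M lborel) (?f -` box l u \<inter> space (lborel \<Otimes>\<^sub>M lborel))"
  using measurable_vector_2 by (rule emeasure_distr) simp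
 have e2: "?f -` box l u \<inter> space (lborel \<Otimes>\<^sub>M lborel) = {l $ 1<..<u $ 1} \<times> {l $ 2<..<u $ 2}"
  by (auto simp: mem_box_cart forall_2 space_pair_measure)
 have "emeasure (lborel \<Otimes>\<^sub>M lborel) ({l $ 1<..<u $ 1} \<times> {l $ 2<..<u $ 2}) = emeasure lborel {l $ 1<..<u $ 1} * emeasure lborel {l $ 2<..<u $ 2}"
  by (rule lborel.emeasure_pair_measure_Times) auto
 also have "\<dots> = ennreal (u $ 1 - l $ 1) * ennreal (u $ 2 - l $ 2)"
  using l12[of 1] l12[of 2] by simp
 also have "\<dots> = ennreal (\<Prod>b\<in>Basis. (u - l) \<bullet> b)"
  unfolding prod_Basis_plane using l12[of 1] l12[of 2] by (simp add: ennreal_mult)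
 finally show "emeasure (distr (lborel \<Otimes>\<^sub>M lborel) borel ?f) (box l u) = ennreal (\<Prod>b\<in>Basis. (u - l) \<bullet> b)"
  unfolding e1 e2 .
qed simp

text \<open>Both orders are needed: in the edge formula each of the two divergence terms is
  integrated first in its own coordinate.\<close>

lemma integral_ref_triangle:
 fixes F :: "point => real"
 assumes F: "continuous_on UNIV F"
 shows "(LINT x:ref_triangle|lborel. F x) = (LINT s:{0..1}|lborel. (LINT t:{0..1-s}|lborel. F (vector [s, t])))"
  "(LINT x:ref_triangle|lborel. F x) = (LINT t:{0..1}|lborel. (LINT s:{0..1-t}|lborel. F (vector [s, t])))"
proof -
 have cv: "continuous_on UNIV (%z. vector [fst z, snd z] :: point)" by (rule continuous_on_vector_2)
 have Fz: "continuous_on UNIV (%z. F (vector [fst z, snd z]))"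
  using continuous_on_compose2[OF F cv] by simp
 let ?R = "{z::real \<times> real. 0 <= fst z \<and> 0 <= snd z \<and> fst z + snd z <= 1}"
 have cR: "compact ?R"
 proof -
  have "closed ?R" by (intro closed_Collect_conj closed_Collect_le continuous_intros)
  moreover have "?R \<subseteq> cbox (0, 0) (1, 1)" by (auto simp: cbox_Pair_eq)
  ultimately show ?thesis unfolding compact_eq_bounded_closed using bounded_subset[OF bounded_cbox] by simp
 qed
 have i: "integrable (lborel \<Otimes>\<^sub>M lborel) (%(s, t). ind ?R (s, t) * F (vector [s, t]))"
  using borel_integrable_compact[OF cR continuous_on_subset[OF Fz subset_UNIV]]
  by (simp add: lborel_prod case_prod_unfold)
 note m = measurable_vector_2
 have mF: "(%x. ind ref_triangle x *\<^sub>R F x) \<in> borel_measurable borel"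
  using F compact_ref_triangle by (intro borel_measurable_scaleR borel_measurable_indicator borel_measurable_continuous_onI) (auto simp: compact_imp_closed)
 let ?f = "%x. ind ref_triangle x *\<^sub>R F x"
 have e1: "lint lborel ?f = lint (distr (lborel \<Otimes>\<^sub>M lborel) borel (%(s, t). vector [s, t])) ?f"
  by (rule arg_cong[OF lborel_plane_eq_distr])
 have e2: "lint (distr (lborel \<Otimes>\<^sub>M lborel) borel (%(s, t). vector [s, t])) ?f = lint (lborel \<Otimes>\<^sub>M lborel) (%z. ?f (case z of (s, t) => vector [s, t]))"
  by (rule integral_distr[OF m mF])
 have e3: "lint (lborel \<Otimes>\<^sub>M lborel) (%z. ?f (case z of (s, t) => vector [s, t])) = lint (lborel \<Otimes>\<^sub>M lborel) (%(s, t). ind ?R (s, t) * F (vector [s, t]))"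
  by (intro Bochner_Integration.integral_cong) (auto simp: indicator_def ref_triangle_def)
 have eq: "(LINT x:ref_triangle|lborel. F x) = lint (lborel \<Otimes>\<^sub>M lborel) (%(s, t). ind ?R (s, t) * F (vector [s, t]))"
  unfolding set_lebesgue_integral_def by (rule trans[OF e1 trans[OF e2 e3]])
 have "lint (lborel \<Otimes>\<^sub>M lborel) (%(s, t). ind ?R (s, t) * F (vector [s, t])) = (LBINT s. LBINT t. ind ?R (s, t) * F (vector [s, t]))"
  by (subst lborel_pair.integral_fst'[OF i, symmetric]) (simp only: prod.case)
 also have "\<dots> = (LINT s:{0..1}|lborel. (LINT t:{0..1-s}|lborel. F (vector [s, t])))"
  unfolding set_lebesgue_integral_def
 proof (rule Bochner_Integration.integral_cong[OF refl])
  fix s :: real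
  have "(LBINT t. ind ?R (s, t) * F (vector [s, t])) = (LBINT t. ind {0..1} s * (ind {0..1 - s} t * F (vector [s, t])))"
   by (intro Bochner_Integration.integral_cong) (auto simp: indicator_def)
  then show "(LBINT t. ind ?R (s, t) * F (vector [s, t])) = ind {0..1} s *\<^sub>R (LBINT t. ind {0..1 - s} t *\<^sub>R F (vector [s, t]))"
   by simp
 qed
 finally show "(LINT x:ref_triangle|lborel. F x) = (LINT s:{0..1}|lborel. (LINT t:{0..1-s}|lborel. F (vector [s, t])))"
  using eq by simp
 have "lint (lborel \<Otimes>\<^sub>M lborel) (%(s, t). ind ?R (s, t) * F (vector [s, t])) = (LBINT t. LBINT s. ind ?R (s, t) * F (vector [s, t]))"
  using lborel_pair.integral_snd[OF i] by (rule sym)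
 also have "\<dots> = (LINT t:{0..1}|lborel. (LINT s:{0..1-t}|lborel. F (vector [s, t])))"
  unfolding set_lebesgue_integral_def
 proof (rule Bochner_Integration.integral_cong[OF refl])
  fix t :: real
  have "(LBINT s. ind ?R (s, t) * F (vector [s, t])) = (LBINT s. ind {0..1} t * (ind {0..1 - t} s * F (vector [s, t])))"
   by (intro Bochner_Integration.integral_cong) (auto simp: indicator_def)
  then show "(LBINT s. ind ?R (s, t) * F (vector [s, t])) = ind {0..1} t *\<^sub>R (LBINT s. ind {0..1 - t} s *\<^sub>R F (vector [s, t]))"
   by simp
 qed
 finally show "(LINT x:ref_triangle|lborel. F x) = (LINT t:{0..1}|lborel. (LINT s:{0..1-t}|lborel. F (vector [s, t])))"
  using eq by simp
qed

text \<open>On the reference triangle \<open>2\<phi> + (x - p) \<bullet> \<nabla>\<phi>\<close> is the divergence of \<open>(x - p) \<phi>\<close>, whose normal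
 component vanishes on the two edges through \<open>p\<close>.\<close>

lemma integral_triangle_edge:
 assumes ph: "smooth_on UNIV \<phi>"
 shows "(LINT x:tri p q r|lborel. 2 * \<phi> x + (\<Sum>i\<in>UNIV. (x - p) $ i * partial i \<phi> x)) =
  \<bar>cross2 (q - p) (r - p)\<bar> * (LINT t:{0..1}|lborel. \<phi> (linepath q r t))"
proof -
 define u v where "u = q - p" and "v = r - p"
 define T where "T x = p + edge_map u v x" for x
 define d where "d w x = (\<Sum>i\<in>UNIV. w $ i * partial i \<phi> x)" for w x
 have cphi: "continuous_on UNIV \<phi>" by (rule smooth_on_continuous_on[OF ph])
 have cpar: "continuous_on UNIV (partial i \<phi>)" for i by (rule smooth_on_continuous_on[OF smooth_on_partial[OF ph]])
 have diff: "\<phi> differentiable (at x)" for x by (rule smooth_on_differentiable[OF ph]) simp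
 define F where "F x = 2 * \<phi> x + (\<Sum>i\<in>UNIV. (x - p) $ i * partial i \<phi> x)" for x
 have cF: "continuous_on UNIV F" unfolding F_def using cphi cpar by (intro continuous_intros)
 have cpF: "continuous_on UNIV (%x. F (p + x))" using continuous_on_compose2[OF cF, of UNIV "%x. p + x"] by (simp add: continuous_intros)
 have cTm: "continuous_on UNIV (edge_map u v)" by (rule linear_continuous_on[OF linear_conv_bounded_linear[THEN iffD1, OF linear_edge_map]])
 have cT: "continuous_on UNIV T" unfolding T_def using cTm by (intro continuous_intros)
 let ?E = "edge_map u v ` ref_triangle"
 have cE: "compact ?E" using cTm compact_ref_triangle compact_continuous_image continuous_on_subset by blast
 have k: "tri p q r = (+) p ` ?E" using triangle_eq_image[of p q r] by (simp add: u_def v_def)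
 have kb: "(+) p ` ?E \<in> sets borel" using cE compact_translation compact_imp_closed borel_closed by blast
 have "(LINT x:tri p q r|lborel. F x) = lint lborel (%x. ind ((+) p ` ?E) (x + p) * F (x + p))"
  unfolding k set_lebesgue_integral_def
  using integral_lborel_translate[of "%x. ind ((+) p ` ?E) x * F x" p] kb borel_measurable_continuous_onI[OF cF] by simp
 also have "\<dots> = (LINT x:?E|lborel. F (p + x))"
  unfolding set_lebesgue_integral_def
  by (intro Bochner_Integration.integral_cong) (auto simp: indicator_def add.commute)
 also have "\<dots> = \<bar>cross2 u v\<bar> * (LINT x:ref_triangle|lborel. F (T x))"
  using integral_linear_image[OF linear_edge_map cpF compact_ref_triangle, of u v] by (simp add: det_edge_map T_def)
 also have "(LINT x:ref_triangle|lborel. F (T x)) =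
   (LINT x:ref_triangle|lborel. \<phi> (T x) + x $ 1 * d u (T x)) + (LINT x:ref_triangle|lborel. \<phi> (T x) + x $ 2 * d v (T x))"
 proof -
  have c: "continuous_on UNIV (%x. \<phi> (T x) + x $ i * d w (T x))" for i w
   unfolding d_def using continuous_on_compose2[OF cphi cT] continuous_on_compose2[OF cpar cT]
   by (intro continuous_intros) auto
  have i: "set_integrable lborel ref_triangle (%x. \<phi> (T x) + x $ 1 * d u (T x))" "set_integrable lborel ref_triangle (%x. \<phi> (T x) + x $ 2 * d v (T x))"
   using set_integrable_continuous_compact[OF c compact_ref_triangle] by auto
  \<comment> \<open>Each summand is an exact derivative in one reference coordinate, namely of s phi
    and of t phi respectively.\<close>
  have "F (T x) = \<phi> (T x) + x $ 1 * d u (T x) + (\<phi> (T x) + x $ 2 * d v (T x))" for x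
   by (simp add: F_def d_def T_def edge_map_def sum_2 algebra_simps)
  then show ?thesis using set_integral_add(2)[OF i] by simp
 qed
 also have "(LINT x:ref_triangle|lborel. \<phi> (T x) + x $ 1 * d u (T x)) = (LINT t:{0..1}|lborel. (1 - t) * \<phi> (linepath q r t))"
 proof -
  have c: "continuous_on UNIV (%x. \<phi> (T x) + x $ 1 * d u (T x))"
   unfolding d_def using continuous_on_compose2[OF cphi cT] continuous_on_compose2[OF cpar cT]
   by (intro continuous_intros) auto
  have "(LINT s:{0..1-t}|lborel. \<phi> (T (vector [s, t])) + s * d u (T (vector [s, t]))) = (1 - t) * \<phi> (linepath q r t)" if t: "t \<in> {0..1}" for t
  proof -
   have T: "T (vector [s, t]) = (p + t *\<^sub>R v) + s *\<^sub>R u" for s by (simp add: T_def edge_map_def algebra_simps)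
   have der: "((%s. s * \<phi> ((p + t *\<^sub>R v) + s *\<^sub>R u)) has_real_derivative \<phi> (T (vector [s, t])) + s * d u (T (vector [s, t]))) (at s)" for s
    unfolding T d_def using has_real_derivative_along[OF diff, where x="p + t *\<^sub>R v" and t=s and k=u] by (auto intro!: derivative_eq_intros)
   have "continuous_on UNIV (%s. vector [s, t] :: point)"
    using continuous_on_compose2[OF continuous_on_vector_2, of UNIV "%s. (s, t)"] by (simp add: continuous_intros)
   from continuous_on_compose2[OF c this]
   have "continuous_on UNIV (%s. \<phi> (T (vector [s, t])) + s * d u (T (vector [s, t])))" by simp
   then have "(LBINT s. ind {0..1 - t} s *\<^sub>R (\<phi> (T (vector [s, t])) + s * d u (T (vector [s, t])))) = (1 - t) * \<phi> ((p + t *\<^sub>R v) + (1 - t) *\<^sub>R u)"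
    using integral_FTC_Icc_real[of 0 "1 - t" "%s. s * \<phi> ((p + t *\<^sub>R v) + s *\<^sub>R u)", OF _ der] t
    by (simp add: mult.commute continuous_on_eq_continuous_at)
   moreover have "(p + t *\<^sub>R v) + (1 - t) *\<^sub>R u = linepath q r t" by (simp add: linepath_def u_def v_def algebra_simps)
   ultimately show ?thesis by (simp add: set_lebesgue_integral_def)
  qed
  then show ?thesis unfolding integral_ref_triangle(2)[OF c]
   by (auto intro!: set_lebesgue_integral_cong)
 qed
 also have "(LINT x:ref_triangle|lborel. \<phi> (T x) + x $ 2 * d v (T x)) = (LINT t:{0..1}|lborel. t * \<phi> (linepath q r t))"
 proof -
  have c: "continuous_on UNIV (%x. \<phi> (T x) + x $ 2 * d v (T x))"
   unfolding d_def using continuous_on_compose2[OF cphi cT] continuous_on_compose2[OF cpar cT]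
   by (intro continuous_intros) auto
  have "(LINT t:{0..1-s}|lborel. \<phi> (T (vector [s, t])) + t * d v (T (vector [s, t]))) = (1 - s) * \<phi> (linepath r q s)" if t: "s \<in> {0..1}" for s
  proof -
   have T: "T (vector [s, t]) = (p + s *\<^sub>R u) + t *\<^sub>R v" for t by (simp add: T_def edge_map_def algebra_simps)
   have der: "((%t. t * \<phi> ((p + s *\<^sub>R u) + t *\<^sub>R v)) has_real_derivative \<phi> (T (vector [s, t])) + t * d v (T (vector [s, t]))) (at t)" for t
    unfolding T d_def using has_real_derivative_along[OF diff, where x="p + s *\<^sub>R u" and t=t and k=v] by (auto intro!: derivative_eq_intros)
   have "continuous_on UNIV (%t. vector [s, t] :: point)"
    using continuous_on_compose2[OF continuous_on_vector_2, of UNIV "%t. (s, t)"] by (simp add: continuous_intros)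
   from continuous_on_compose2[OF c this]
   have "continuous_on UNIV (%t. \<phi> (T (vector [s, t])) + t * d v (T (vector [s, t])))" by simp
   then have "(LBINT t. ind {0..1 - s} t *\<^sub>R (\<phi> (T (vector [s, t])) + t * d v (T (vector [s, t])))) = (1 - s) * \<phi> ((p + s *\<^sub>R u) + (1 - s) *\<^sub>R v)"
    using integral_FTC_Icc_real[of 0 "1 - s" "%t. t * \<phi> ((p + s *\<^sub>R u) + t *\<^sub>R v)", OF _ der] t
    by (simp add: mult.commute continuous_on_eq_continuous_at)
   moreover have "(p + s *\<^sub>R u) + (1 - s) *\<^sub>R v = linepath r q s" by (simp add: linepath_def u_def v_def algebra_simps)
   ultimately show ?thesis by (simp add: set_lebesgue_integral_def)
  qed
  then have "(LINT x:ref_triangle|lborel. \<phi> (T x) + x $ 2 * d v (T x)) = (LINT s:{0..1}|lborel. (1 - s) * \<phi> (linepath r q s))"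
   unfolding integral_ref_triangle(1)[OF c] by (auto intro!: set_lebesgue_integral_cong)
  \<comment> \<open>Reversing the edge, s to 1 - s, brings both contributions to the parametrisation
    from q to r.\<close>
  also have "\<dots> = (LBINT s. ind {0..1} (1 + (-1) * s) *\<^sub>R ((1 + (-1) * s) * \<phi> (linepath q r (1 + (-1) * s))))"
   unfolding set_lebesgue_integral_def
   by (intro Bochner_Integration.integral_cong) (auto simp: indicator_def linepath_def algebra_simps)
  also have "\<dots> = (LINT t:{0..1}|lborel. t * \<phi> (linepath q r t))"
   unfolding set_lebesgue_integral_def
   using lborel_integral_real_affine[of "-1" "%t. ind {0..1} t *\<^sub>R (t * \<phi> (linepath q r t))" 1] by simp
  finally show ?thesis .
 qed
 \<comment> \<open>The weights 1 - t and t left over from the two integrations add up to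
   one.\<close>
 also have "(LINT t:{0..1}|lborel. (1 - t) * \<phi> (linepath q r t)) + (LINT t:{0..1}|lborel. t * \<phi> (linepath q r t)) = (LINT t:{0..1}|lborel. \<phi> (linepath q r t))"
 proof -
  have "continuous_on {0..1} (%t. \<phi> (linepath q r t))"
   using continuous_on_compose2[OF cphi continuous_on_linepath[of "{0..1}" q r]] by simp
  then have "set_integrable lborel {0..1} (%t. f t * \<phi> (linepath q r t))" if "continuous_on {0..1} f" for f :: "real => real"
   unfolding set_integrable_def using that by (intro borel_integrable_compact continuous_intros) auto
  note * = this
  have c: "continuous_on {0..1} (%t::real. 1 - t)" by (intro continuous_intros)
  have i: "set_integrable lborel {0..1} (%t. (1 - t) * \<phi> (linepath q r t))" "set_integrable lborel {0..1} (%t. t * \<phi> (linepath q r t))"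
   by (rule *[OF c], rule *[OF continuous_on_id])
  have "(1 - t) * \<phi> (linepath q r t) + t * \<phi> (linepath q r t) = \<phi> (linepath q r t)" for t by (simp add: algebra_simps)
  then show ?thesis using set_integral_add(2)[OF i] by simp
 qed
 finally show ?thesis by (simp add: F_def u_def v_def)
qed

text \<open>The edge formula with phi = 1: twice the area on the left, the determinant on the
  right.\<close>

lemma measure_triangle: "measure lborel (tri p q r) = \<bar>cross2 (q - p) (r - p)\<bar> / 2"
proof -
 have b: "tri p q r \<in> sets borel" "emeasure lborel (tri p q r) < \<infinity>"
  using finite_imp_compact_convex_hull[of "{p, q, r}"] emeasure_bounded_finite[of "tri p q r"]
  by (auto simp: compact_imp_closed compact_imp_bounded)
 have "partial i (%_. 1) x = 0" for i x by (rule partial_eq[OF has_derivative_const])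
 then have "(LINT x:tri p q r|lborel. 2) = \<bar>cross2 (q - p) (r - p)\<bar> * (LINT t:{0..1::real}|lborel. 1::real)"
  using integral_triangle_edge[OF smooth_on_const[OF open_UNIV, of 1], of p q r] by simp
 then show ?thesis using b by (simp add: set_integral_const measure_def)
qed

section \<open>Corners of a triangle and the Hardy inequality\<close>

definition open_triangle :: "point => point => point => point set" where
 "open_triangle p q r = interior (tri p q r)"

text \<open>The open triangle shrunk by the factor t towards its vertex p, as
  \<open>corner_eq_image\<close> shows.\<close>

definition corner :: "point => point => point => real => point set" where
 "corner p q r t = {x \<in> open_triangle p q r. 1 - t < bary p q r x}"

lemma smooth_on_bary:
 assumes "noncollinear p q r" "open U"
 shows "smooth_on U (bary p q r)"
proof -
 have "smooth_on U (%x. bary_grad p q r \<bullet> x + (1 - bary_grad p q r \<bullet> p))"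
  by (rule smooth_on_add[OF smooth_on_inner[OF assms(2)] smooth_on_const[OF assms(2)]])
 then show ?thesis by (rule smooth_on_cong) (simp add: bary_affine[OF assms(1)] inner_diff_right)
qed

lemma continuous_on_bary: "noncollinear p q r ==> continuous_on U (bary p q r)"
 using continuous_on_subset[OF smooth_on_continuous_on[OF smooth_on_bary[OF _ open_UNIV]] subset_UNIV] .

lemma open_triangle_iff:
 "noncollinear p q r ==> x \<in> open_triangle p q r \<longleftrightarrow> 0 < bary p q r x \<and> 0 < bary q r p x \<and> 0 < bary r p q x"
 unfolding open_triangle_def by (subst triangle_eq_bary(2)) auto

lemma open_triangle_rotate: "open_triangle q r p = open_triangle p q r"
 unfolding open_triangle_def by (simp add: insert_commute)

lemma open_open_triangle: "open (open_triangle p q r)"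
 by (simp add: open_triangle_def)

lemma convex_open_triangle: "convex (open_triangle p q r)"
 by (simp add: open_triangle_def convex_interior)

lemma compact_triangle: "compact (convex hull {p, q, r :: point})"
 by (rule finite_imp_compact_convex_hull) simp

lemma bounded_open_triangle: "bounded (open_triangle p q r)"
 unfolding open_triangle_def
 by (rule bounded_subset[OF compact_imp_bounded[OF compact_triangle] interior_subset])

lemma lmeasurable_open_triangle: "open_triangle p q r \<in> lmeasurable"
 by (rule lmeasurable_open[OF bounded_open_triangle open_open_triangle])

lemma measure_open_triangle: "measure lebesgue (open_triangle p q r) = \<bar>cross2 (q - p) (r - p)\<bar> / 2"
proof -
 have "measure lebesgue (open_triangle p q r) = measure lebesgue (tri p q r)"
  unfolding open_triangle_def
  by (rule measure_interior[OF compact_imp_bounded[OF compact_triangle] negligible_convex_frontier[OF convex_convex_hull]])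
 also have "\<dots> = measure lborel (tri p q r)"
  using compact_triangle[of p q r] by (simp add: compact_imp_closed)
 finally show ?thesis by (simp add: measure_triangle)
qed

lemma measure_open_triangle_pos: "noncollinear p q r ==> 0 < measure lebesgue (open_triangle p q r)"
 by (simp add: measure_open_triangle noncollinear_def)

text \<open>The homothety with centre p and ratio t multiplies the coordinates of q and r by t and
  sends that of p to t times it plus 1 - t. Convexity, area and diameter of a corner follow by
  scaling.\<close>

lemma corner_eq_image:
 assumes n: "noncollinear p q r" and t: "0 < t" "t <= 1"
 shows "corner p q r t = (%x. t *\<^sub>R x + (1 - t) *\<^sub>R p) ` open_triangle p q r"
proof -
 note n2 = noncollinear_rotate[OF n] note n3 = noncollinear_rotate[OF n2]
 have b: "bary p q r (t *\<^sub>R x + (1 - t) *\<^sub>R p) = t * bary p q r x + (1 - t)"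
  "bary q r p (t *\<^sub>R x + (1 - t) *\<^sub>R p) = t * bary q r p x"
  "bary r p q (t *\<^sub>R x + (1 - t) *\<^sub>R p) = t * bary r p q x" for x
 proof -
  have d: "t *\<^sub>R x + (1 - t) *\<^sub>R p - p = t *\<^sub>R (x - p)" by (simp add: algebra_simps)
  have z: "bary q r p p = 0" "bary r p q p = 0" by (rule bary_vertex(3), rule bary_vertex(2))
  show "bary p q r (t *\<^sub>R x + (1 - t) *\<^sub>R p) = t * bary p q r x + (1 - t)"
   unfolding bary_affine[OF n] d by (simp add: algebra_simps)
  show "bary q r p (t *\<^sub>R x + (1 - t) *\<^sub>R p) = t * bary q r p x"
   using bary_affine'[OF n2, of "t *\<^sub>R x + (1 - t) *\<^sub>R p" p] bary_affine'[OF n2, of x p] unfolding d z by simp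
  show "bary r p q (t *\<^sub>R x + (1 - t) *\<^sub>R p) = t * bary r p q x"
   using bary_affine'[OF n3, of "t *\<^sub>R x + (1 - t) *\<^sub>R p" p] bary_affine'[OF n3, of x p] unfolding d z by simp
 qed
 show ?thesis
 proof (intro equalityI subsetI)
  fix y assume y: "y \<in> corner p q r t"
  define x where "x = (1 / t) *\<^sub>R (y - (1 - t) *\<^sub>R p)"
  have yx: "y = t *\<^sub>R x + (1 - t) *\<^sub>R p" using t by (simp add: x_def)
  have "x \<in> open_triangle p q r"
   using y t unfolding corner_def open_triangle_iff[OF n] yx mem_Collect_eq b by (auto simp: zero_less_mult_iff)
  then show "y \<in> (%x. t *\<^sub>R x + (1 - t) *\<^sub>R p) ` open_triangle p q r" unfolding yx by (rule imageI)
 next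
  fix y assume "y \<in> (%x. t *\<^sub>R x + (1 - t) *\<^sub>R p) ` open_triangle p q r"
  then obtain x where yx: "y = t *\<^sub>R x + (1 - t) *\<^sub>R p" and x: "x \<in> open_triangle p q r" by (rule imageE)
  have "0 < t * bary p q r x" "0 < t * bary q r p x" "0 < t * bary r p q x"
   using x t unfolding open_triangle_iff[OF n] by auto
  then show "y \<in> corner p q r t"
   using t unfolding corner_def open_triangle_iff[OF n] yx mem_Collect_eq b by auto
 qed
qed

lemma corner_subset: "corner p q r t \<subseteq> open_triangle p q r"
 by (auto simp: corner_def)

lemma corner_mono: "t <= t' ==> corner p q r t \<subseteq> corner p q r t'"
 by (auto simp: corner_def)

lemma corner_1: "noncollinear p q r ==> corner p q r 1 = open_triangle p q r"
 by (auto simp: corner_def open_triangle_iff)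

lemma open_corner: "noncollinear p q r ==> open (corner p q r t)"
proof -
 assume n: "noncollinear p q r"
 have "corner p q r t = open_triangle p q r \<inter> {x. 1 - t < bary p q r x}" by (auto simp: corner_def)
 moreover have "open {x. 1 - t < bary p q r x}"
  by (rule open_Collect_less[OF continuous_on_const continuous_on_bary[OF n]])
 ultimately show ?thesis by (simp add: open_Int open_open_triangle)
qed

lemma convex_corner:
 assumes "noncollinear p q r" "0 < t" "t <= 1"
 shows "convex (corner p q r t)"
 unfolding corner_eq_image[OF assms]
 using convex_affinity[OF convex_open_triangle, of "(1 - t) *\<^sub>R p" t p q r] by (simp add: add.commute)

lemma lmeasurable_corner: "noncollinear p q r ==> corner p q r t \<in> lmeasurable"
 by (rule lmeasurable_open[OF bounded_subset[OF bounded_open_triangle corner_subset] open_corner])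

lemma measure_corner:
 assumes "noncollinear p q r" "0 < t" "t <= 1"
 shows "measure lebesgue (corner p q r t) = t\<^sup>2 * measure lebesgue (open_triangle p q r)"
 unfolding corner_eq_image[OF assms] using measure_lebesgue_affine[of t "(1 - t) *\<^sub>R p" "open_triangle p q r"] by simp

lemma corner_dist:
 assumes "noncollinear p q r" "0 < t" "t <= 1" "\<forall>x\<in>open_triangle p q r. \<forall>y\<in>open_triangle p q r. norm (x - y) <= h"
 shows "\<forall>x\<in>corner p q r t. \<forall>y\<in>corner p q r t. norm (x - y) <= t * h"
 unfolding corner_eq_image[OF assms(1-3)]
proof (intro ballI)
 fix x y assume "x \<in> (%x. t *\<^sub>R x + (1 - t) *\<^sub>R p) ` open_triangle p q r" "y \<in> (%x. t *\<^sub>R x + (1 - t) *\<^sub>R p) ` open_triangle p q r"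
 then obtain x' y' where *: "x = t *\<^sub>R x' + (1 - t) *\<^sub>R p" "y = t *\<^sub>R y' + (1 - t) *\<^sub>R p" "x' \<in> open_triangle p q r" "y' \<in> open_triangle p q r"
  by (elim imageE)
 have "x - y = t *\<^sub>R (x' - y')" unfolding * by (simp add: algebra_simps)
 then show "norm (x - y) <= t * h" using assms(2,4) *(3,4) by (simp add: mult_left_mono)
qed

abbreviation mean_on :: "point set => scalar_field => real" where
 "mean_on A u \<equiv> lint (leb A) u / measure lebesgue A"

text \<open>The oscillation over the corners at p decays like t^(2s). The parameter t is relative to
  the triangle, so powers of the diameter are contained in \<open>K\<close>. With t = 1 it is a
  bound for the variance over the whole triangle.\<close>

definition campanato_at :: "point => point => point => real => real => scalar_field => bool" where
 "campanato_at p q r s K u \<longleftrightarrow> sq_int (leb (open_triangle p q r)) u \<and>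
   (\<forall>t. 0 < t \<and> t <= 1 -->
    lint (leb (corner p q r t)) (%x. (u x - mean_on (corner p q r t) u)\<^sup>2) <= K * t powr (2 * s))"

lemma integral_abs_le:
 assumes "finite_measure M" "sq_int M u"
 shows "lint M (%x. \<bar>u x\<bar>) <= sqrt (measure M (space M)) * sqrt (lint M (%x. (u x)\<^sup>2))"
proof -
 interpret finite_measure M by (rule assms)
 have a: "sq_int M (%x. \<bar>u x\<bar>)" using assms(2) by (auto simp: sq_int_def)
 have o: "sq_int M (%x. 1)" by (rule sq_int_bounded[OF assms(1), of _ 1]) auto
 show ?thesis using Cauchy_Schwarz_integral[OF o a] by simp
qed

lemma exists_dyadic:
 assumes "0 < r" "r < (1::real)"
 obtains j :: nat where "(1/2) ^ Suc j <= r" "r < (1/2) ^ j"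
proof -
 obtain n :: nat where n: "(1/2) ^ n < r" using real_arch_pow_inv[OF assms(1), of "1/2"] by auto
 define k where "k = (LEAST n. (1/2) ^ n <= r)"
 have k: "(1/2) ^ k <= r" unfolding k_def by (rule LeastI[of _ n]) (use n in simp)
 have "k ~= 0" using k assms(2) by (cases k) auto
 then obtain j where j: "k = Suc j" using not0_implies_Suc by blast
 have "\<not> (1/2) ^ j <= r" using not_less_Least[of j "%n. (1/2) ^ n <= r"] j by (simp add: k_def)
 then show ?thesis using that[of j] k j by simp
qed

lemma ennreal_le_suminf: "f j <= suminf f" for f :: "nat => ennreal"
 using sum_le_suminf[OF summableI, of "{j}" f] by simp

text \<open>Constant of the dyadic summation in \<open>hardy_corner\<close>. With Q = 2^(1-s/2), the
  term 4 / (Q - 1) bounds the drift of the means over successive corners; with y = 2^(-s/2), the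
  factor 1 / (1 - y) sums the dyadic layers.\<close>

definition hardy_const :: "real => real" where
 "hardy_const s = 2 * (1 + 4 / (2 powr (1 - s/2) - 1)) / (1 - 2 powr (- s/2))"

text \<open>The weight is of order 1/r at p. On the j-th dyadic layer it is at most 2^(j+1), while
  the integral of |u - mean| over the j-th corner is of order 2^(-j) y^j with y < 1, so the layers
  form a convergent geometric series.\<close>

lemma hardy_corner:
 assumes n: "noncollinear p q r" and s: "0 < s" "s <= 1" and K: "0 <= K" and u: "campanato_at p q r s K u"
 defines "A \<equiv> open_triangle p q r"
 shows "integrable (leb A) (%x. \<bar>u x - mean_on A u\<bar> / (1 - bary p q r x))" (is ?int)
  "lint (leb A) (%x. \<bar>u x - mean_on A u\<bar> / (1 - bary p q r x)) <= hardy_const s * sqrt (measure lebesgue A) * sqrt K" (is ?le)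
proof -
 define a where "a = measure lebesgue A"
 have a: "0 < a" using measure_open_triangle_pos[OF n] by (simp add: a_def A_def)
 define c where "c j = corner p q r ((1/2) ^ j)" for j :: nat
 define m where "m j = mean_on (c j) u" for j
 define Q where "Q = 2 powr (1 - s/2)"
 have Q1: "1 < Q" unfolding Q_def using s by (intro gr_one_powr) auto
 have half: "0 < (1/2::real) ^ j" "(1/2::real) ^ j <= 1" for j by (auto simp: power_le_one)
 have cl: "c j \<in> lmeasurable" for j unfolding c_def by (rule lmeasurable_corner[OF n])
 have cs: "c j \<in> sets lebesgue" for j using cl fmeasurableD by blast
 have As: "A \<in> sets lebesgue" "A \<in> lmeasurable" unfolding A_def using lmeasurable_open_triangle fmeasurableD by blast+
 have cA: "c j \<subseteq> A" for j unfolding c_def A_def by (rule corner_subset)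
 have cmono: "c (Suc j) \<subseteq> c j" for j unfolding c_def by (rule corner_mono) simp
 have mc: "measure lebesgue (c j) = a / 4 ^ j" for j
 proof -
  have "((1/2::real) ^ j)\<^sup>2 = ((1/2)\<^sup>2) ^ j" by (simp only: power_mult[symmetric] mult.commute)
  also have "\<dots> = (1/4) ^ j" by (simp add: power2_eq_square)
  also have "\<dots> = 1 / 4 ^ j" by (rule power_one_over)
  finally show ?thesis unfolding c_def a_def A_def measure_corner[OF n half] by simp
 qed
 have mcpos: "0 < measure lebesgue (c j)" for j unfolding mc using a by simp
 have ms: "measure (leb (c j)) (space (leb (c j))) = measure lebesgue (c j)" for j
  using cs by (simp add: measure_restrict_space)
 have fm: "finite_measure (leb (c j))" for j by (rule finite_measure_lebesgue_on[OF cl])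
 have uA: "sq_int (leb A) u" using u by (simp add: campanato_at_def A_def)
 have uc: "sq_int (leb (c j)) u" for j by (rule sq_int_subset[OF uA cA cs As(1)])
 have ucd: "sq_int (leb (c j)) (%x. u x - d)" for j d
  by (rule sq_int_diff[OF uc sq_int_bounded[OF fm, of _ _ "\<bar>d\<bar>"]]) auto
 have ui: "integrable (leb (c j)) (%x. \<bar>u x - d\<bar>)" for j d
  using sq_int_integrable[OF fm ucd] by simp
 define E where "E = sqrt (a * K)"
 have E0: "0 <= E" using a K by (simp add: E_def)
 \<comment> \<open>Cauchy-Schwarz on the j-th corner, whose area is a / 4^j, together with the
   Campanato bound at t = 2^(-j).\<close>
 have w: "lint (leb (c j)) (%x. \<bar>u x - m j\<bar>) <= E / (2 ^ j * 2 powr (s * j))" for j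
 proof -
  have "lint (leb (c j)) (%x. \<bar>u x - m j\<bar>) <= sqrt (measure lebesgue (c j)) * sqrt (lint (leb (c j)) (%x. (u x - m j)\<^sup>2))"
   using integral_abs_le[OF fm ucd] ms by simp
  also have "lint (leb (c j)) (%x. (u x - m j)\<^sup>2) <= K * ((1/2) ^ j) powr (2 * s)"
   using u half unfolding campanato_at_def c_def m_def by blast
  also have "((1/2::real) ^ j) powr (2 * s) = 1 / (2 powr (s * j))\<^sup>2"
  proof -
   have "((1/2::real) ^ j) powr (2 * s) = (1/2) powr (real j * (2 * s))" by (simp add: powr_powr flip: powr_realpow)
   also have "\<dots> = 1 / 2 powr (real j * (2 * s))" by (simp add: powr_divide)
   also have "2 powr (real j * (2 * s)) = (2 powr (s * j))\<^sup>2" by (simp add: powr_power mult_ac)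
   finally show ?thesis .
  qed
  finally have "lint (leb (c j)) (%x. \<bar>u x - m j\<bar>) <= sqrt (a / 4 ^ j) * sqrt (K * (1 / (2 powr (s * j))\<^sup>2))"
   using a by (simp add: mc mult_left_mono)
  also have "\<dots> = E / (2 ^ j * 2 powr (s * j))"
  proof -
   have "(2 ^ j)\<^sup>2 = ((2::real)\<^sup>2) ^ j" by (simp only: power_mult[symmetric] mult.commute)
   then have "(4::real) ^ j = (2 ^ j)\<^sup>2" by simp
   then show ?thesis by (simp add: E_def real_sqrt_mult real_sqrt_divide)
  qed
  finally show ?thesis .
 qed
 \<comment> \<open>The mean over the smaller corner is compared with that over the larger one by
   integrating |u - m j| over the smaller; the area ratio contributes the factor 4.\<close>
 have step: "\<bar>m (Suc j) - m j\<bar> <= 4 * (E / a) * Q ^ j" for j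
 proof -
  have i: "integrable (leb (c (Suc j))) u" by (rule sq_int_integrable[OF fm uc])
  have "measure lebesgue (c (Suc j)) * (m (Suc j) - m j) = lint (leb (c (Suc j))) (%x. u x - m j)"
  proof -
   interpret finite_measure "leb (c (Suc j))" by (rule fm)
   have "lint (leb (c (Suc j))) (%x. u x - m j) = lint (leb (c (Suc j))) u - measure lebesgue (c (Suc j)) * m j"
    using i ms[of "Suc j"] by simp
   then show ?thesis using mcpos[of "Suc j"] by (simp add: m_def[of "Suc j"] right_diff_distrib)
  qed
  then have "measure lebesgue (c (Suc j)) * \<bar>m (Suc j) - m j\<bar> = \<bar>lint (leb (c (Suc j))) (%x. u x - m j)\<bar>"
   by (metis abs_mult abs_of_pos mcpos)
  also have "\<dots> <= lint (leb (c (Suc j))) (%x. \<bar>u x - m j\<bar>)" by (rule integral_abs_bound)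
  also have "\<dots> = lint (leb (c j)) (%x. ind (c (Suc j)) x * \<bar>u x - m j\<bar>)"
   by (rule integral_lebesgue_on_subset[OF cs cs cmono, symmetric])
  also have "\<dots> <= lint (leb (c j)) (%x. \<bar>u x - m j\<bar>)"
  proof (rule Bochner_Integration.integral_mono)
   have "integrable lebesgue (%x. ind (c j) x * (ind (c (Suc j)) x * \<bar>u x - m j\<bar>))"
   proof -
    have "ind (c j) x * (ind (c (Suc j)) x * \<bar>u x - m j\<bar>) = ind (c (Suc j)) x * \<bar>u x - m j\<bar>" for x
     using cmono[of j] by (auto simp: indicator_def)
    then show ?thesis using ui[of "Suc j" "m j"] unfolding integrable_lebesgue_on_iff[OF cs] by presburger
   qed
   then show "integrable (leb (c j)) (%x. ind (c (Suc j)) x * \<bar>u x - m j\<bar>)"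
    by (simp add: integrable_lebesgue_on_iff[OF cs])
  qed (auto simp: ui indicator_def)
  also have "\<dots> <= E / (2 ^ j * 2 powr (s * j))" by (rule w)
  finally have "a / 4 ^ Suc j * \<bar>m (Suc j) - m j\<bar> <= E / (2 ^ j * 2 powr (s * j))" unfolding mc .
  then have "\<bar>m (Suc j) - m j\<bar> <= (4 ^ Suc j / a) * (E / (2 ^ j * 2 powr (s * j)))"
   using a by (simp add: field_simps)
  also have "\<dots> = 4 * (E / a) * (4 ^ j / (2 ^ j * 2 powr (s * j)))" by simp
  also have "(4::real) ^ j / (2 ^ j * 2 powr (s * j)) = 2 powr ((1 - s) * j)"
  proof -
   have "(2 * 2) ^ j = 2 ^ j * (2::real) ^ j" by (rule power_mult_distrib)
   then have "(4::real) ^ j = 2 ^ j * 2 ^ j" by simp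
   then have "(4::real) ^ j / (2 ^ j * 2 powr (s * j)) = 2 ^ j / 2 powr (s * j)" by simp
   also have "\<dots> = 2 powr (real j - s * j)" by (simp add: powr_diff powr_realpow)
   finally show ?thesis by (simp add: algebra_simps)
  qed
  also have "4 * (E / a) * 2 powr ((1 - s) * j) <= 4 * (E / a) * Q ^ j"
  proof (rule mult_left_mono)
   have "2 powr ((1 - s) * j) <= 2 powr ((1 - s/2) * j)" using s by (intro powr_mono mult_right_mono) auto
   also have "\<dots> = Q ^ j" by (simp add: Q_def powr_power mult.commute)
   finally show "2 powr ((1 - s) * j) <= Q ^ j" .
  qed (use E0 a in simp)
  finally show ?thesis .
 qed
 \<comment> \<open>The differences grow geometrically with ratio Q > 1, so their sum is controlled
   by the last term.\<close>
 have tele: "\<bar>m j - m 0\<bar> <= 4 / (Q - 1) * (E / a) * Q ^ j" for j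
 proof (induction j)
  case 0 then show ?case using Q1 E0 a by simp
 next
  case (Suc j)
  have "\<bar>m (Suc j) - m 0\<bar> <= 4 * (E / a) * Q ^ j + 4 / (Q - 1) * (E / a) * Q ^ j" using step[of j] Suc by linarith
  also have "\<dots> = (4 + 4 / (Q - 1)) * ((E / a) * Q ^ j)" by (simp add: algebra_simps)
  also have "4 + 4 / (Q - 1) = 4 / (Q - 1) * Q" using Q1 by (simp add: field_simps)
  finally show ?case by (simp add: mult_ac)
 qed
 define C where "C = 1 + 4 / (Q - 1)"
 have C0: "0 <= C" using Q1 by (simp add: C_def)
 \<comment> \<open>Oscillation about the own mean of the corner, plus the drift of that mean away
   from the mean over the whole triangle.\<close>
 have bj: "lint (leb (c j)) (%x. \<bar>u x - m 0\<bar>) <= C * E * ((1/2) ^ j * (2 powr (- s/2)) ^ j)" for j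
 proof -
  interpret finite_measure "leb (c j)" by (rule fm)
  have "lint (leb (c j)) (%x. \<bar>u x - m 0\<bar>) <= lint (leb (c j)) (%x. \<bar>u x - m j\<bar> + \<bar>m j - m 0\<bar>)"
   by (rule Bochner_Integration.integral_mono) (use ui in auto)
  also have "\<dots> = lint (leb (c j)) (%x. \<bar>u x - m j\<bar>) + measure lebesgue (c j) * \<bar>m j - m 0\<bar>"
   using ui ms[of j] by simp
  also have "\<dots> <= E / (2 ^ j * 2 powr (s * j)) + (a / 4 ^ j) * (4 / (Q - 1) * (E / a) * Q ^ j)"
   unfolding mc using a by (intro add_mono w mult_left_mono tele) auto
  also have "(a / 4 ^ j) * (4 / (Q - 1) * (E / a) * Q ^ j) = 4 / (Q - 1) * E * (Q ^ j / 4 ^ j)" using a by (simp add: mult_ac)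
  also have "Q ^ j / 4 ^ j = (1/2) ^ j * (2 powr (- s/2)) ^ j"
  proof -
   have "Q / 4 = (1/2) * 2 powr (- s/2)" unfolding Q_def by (simp add: powr_diff powr_minus_divide)
   then have "(Q / 4) ^ j = ((1/2) * 2 powr (- s/2)) ^ j" by (rule arg_cong)
   then show ?thesis by (simp only: power_divide power_mult_distrib)
  qed
  also have "E / (2 ^ j * 2 powr (s * j)) <= E * ((1/2) ^ j * (2 powr (- s/2)) ^ j)"
  proof -
   have "(2 powr (- s/2)) ^ j = 2 powr (real j * (- s/2))" by (rule powr_power) simp
   also have "\<dots> = 2 powr (- (s / 2 * j))" by (simp add: mult.commute)
   also have "\<dots> = 1 / 2 powr (s / 2 * j)" by (rule powr_minus_divide)
   finally have "(2 powr (- s/2)) ^ j = 1 / 2 powr (s / 2 * j)" .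
   moreover have "2 powr (s / 2 * j) <= 2 powr (s * j)" using s by (intro powr_mono mult_right_mono) auto
   then have "1 / 2 powr (s * j) <= 1 / 2 powr (s / 2 * j)" by (intro divide_left_mono) auto
   ultimately have "1 / 2 powr (s * j) <= (2 powr (- s/2)) ^ j" by simp
   then have "E * ((1/2) ^ j * (1 / 2 powr (s * j))) <= E * ((1/2) ^ j * (2 powr (- s/2)) ^ j)"
    using E0 by (intro mult_left_mono) auto
   then show ?thesis by (simp add: power_one_over)
  qed
  finally show ?thesis by (simp add: C_def algebra_simps)
 qed
 have m0: "m 0 = mean_on A u" unfolding m_def c_def A_def using corner_1[OF n] by simp
 define y where "y = 2 powr (- s/2)"
 have y: "0 < y" "y < 1" using s powr_less_mono[of "- s/2" 0 2] by (auto simp: y_def)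
 let ?g = "%x. \<bar>u x - mean_on A u\<bar>"
 let ?rho = "%x. 1 - bary p q r x"
 have rpos: "0 < ?rho x \<and> ?rho x < 1" if "x \<in> A" for x
  using that bary_sum[OF n, of x] unfolding A_def open_triangle_iff[OF n] by linarith
 have gm: "?g \<in> borel_measurable (leb A)" using sq_int_measurable[OF uA] by measurable
 have bm: "?rho \<in> borel_measurable (leb A)"
  by (intro borel_measurable_diff borel_measurable_const borel_measurable_lebesgue_onI borel_measurable_continuous_onI continuous_on_bary[OF n])
 have fm': "(%x. ?g x / ?rho x) \<in> borel_measurable (leb A)" using gm bm by measurable
 have cind: "ind (c j) \<in> borel_measurable (leb A)" for j
  using cs cA by (intro borel_measurable_indicator) (auto simp: sets_restrict_space_iff As)
 have nn: "(\<integral>\<^sup>+x. ennreal (?g x / ?rho x) \<partial>leb A) <= ennreal (hardy_const s * E)"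
 proof -
  \<comment> \<open>The sum runs over all corners that contain x; the single term of the layer of x
    already dominates the left side.\<close>
  have "(\<integral>\<^sup>+x. ennreal (?g x / ?rho x) \<partial>leb A) <= (\<integral>\<^sup>+x. (\<Sum>j. ennreal (2 ^ Suc j * (ind (c j) x * ?g x))) \<partial>leb A)"
  proof (rule nn_integral_mono)
   fix x assume "x \<in> space (leb A)"
   then have x: "x \<in> A" by simp
   obtain j where j: "(1/2) ^ Suc j <= ?rho x" "?rho x < (1/2) ^ j" using exists_dyadic rpos[OF x] by metis
   have xc: "x \<in> c j" using x j(2) unfolding c_def corner_def A_def by auto
   have "1 / ?rho x <= 1 / (1/2) ^ Suc j" using j(1) rpos[OF x] by (intro divide_left_mono) auto
   then have "1 / ?rho x <= 2 ^ Suc j" by (simp add: power_one_over)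
   then have "?g x * (1 / ?rho x) <= ?g x * 2 ^ Suc j" by (rule mult_left_mono) simp
   then have "ennreal (?g x / ?rho x) <= ennreal (2 ^ Suc j * (ind (c j) x * ?g x))"
    using xc by (intro ennreal_leI) (simp add: mult.commute)
   also have "\<dots> <= (\<Sum>j. ennreal (2 ^ Suc j * (ind (c j) x * ?g x)))"
    by (rule ennreal_le_suminf[of "%j. ennreal (2 ^ Suc j * (ind (c j) x * ?g x))"])
   finally show "ennreal (?g x / ?rho x) <= (\<Sum>j. ennreal (2 ^ Suc j * (ind (c j) x * ?g x)))" .
  qed
  also have "\<dots> = (\<Sum>j. (\<integral>\<^sup>+x. ennreal (2 ^ Suc j * (ind (c j) x * ?g x)) \<partial>leb A))"
  proof (rule nn_integral_suminf)
   fix j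
   have "(%x. 2 ^ Suc j * (ind (c j) x * ?g x)) \<in> borel_measurable (leb A)"
    by (intro borel_measurable_times borel_measurable_const cind gm)
   then show "(%x. ennreal (2 ^ Suc j * (ind (c j) x * ?g x))) \<in> borel_measurable (leb A)"
    by (rule measurable_compose[OF _ measurable_ennreal])
  qed
  also have "\<dots> <= (\<Sum>j. ennreal (2 * C * E * y ^ j))"
  proof (rule suminf_le)
   fix j
   have ig: "integrable (leb A) (%x. ind (c j) x * ?g x)"
   proof -
    have "ind A x * (ind (c j) x * ?g x) = ind (c j) x * ?g x" for x
     using cA[of j] by (auto simp: indicator_def)
    then show ?thesis using ui[of j "mean_on A u"] unfolding integrable_lebesgue_on_iff[OF cs] integrable_lebesgue_on_iff[OF As(1)] by presburger
   qed
   have "(\<integral>\<^sup>+x. ennreal (2 ^ Suc j * (ind (c j) x * ?g x)) \<partial>leb A) = ennreal (lint (leb A) (%x. 2 ^ Suc j * (ind (c j) x * ?g x)))"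
    using ig by (intro nn_integral_eq_integral integrable_mult_right) auto
   also have "lint (leb A) (%x. 2 ^ Suc j * (ind (c j) x * ?g x)) = 2 ^ Suc j * lint (leb (c j)) ?g"
    using integral_lebesgue_on_subset[OF cs As(1) cA, of j ?g] by simp
   also have "\<dots> <= 2 ^ Suc j * (C * E * ((1/2) ^ j * y ^ j))"
    using bj[of j] unfolding m0 y_def by (intro mult_left_mono) auto
   also have "2 ^ Suc j * (C * E * ((1/2) ^ j * y ^ j)) = 2 * C * E * y ^ j" by (simp add: power_one_over)
   finally show "(\<integral>\<^sup>+x. ennreal (2 ^ Suc j * (ind (c j) x * ?g x)) \<partial>leb A) <= ennreal (2 * C * E * y ^ j)"
    by (simp add: ennreal_leI)
  qed auto
  also have "\<dots> = ennreal (\<Sum>j. 2 * C * E * y ^ j)"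
   using y C0 E0 by (intro suminf_ennreal2) (auto intro!: summable_mult summable_geometric)
  also have "(\<Sum>j. 2 * C * E * y ^ j) = 2 * C * E * (1 / (1 - y))"
   using y suminf_geometric[of y] by (subst suminf_mult) (auto intro!: summable_geometric)
  also have "\<dots> = hardy_const s * E" by (simp add: hardy_const_def C_def Q_def y_def)
  finally show ?thesis .
 qed
 have pos: "0 <= ?g x / ?rho x" if "x \<in> A" for x using rpos[OF that] by simp
 show i: ?int
 proof (rule integrableI_nonneg[OF fm'])
  show "AE x in leb A. 0 <= ?g x / ?rho x" using pos by (intro AE_I2) simp
  show "(\<integral>\<^sup>+x. ennreal (?g x / ?rho x) \<partial>leb A) < \<infinity>" using nn by (rule le_less_trans) simp
 qed
 have h0: "0 <= hardy_const s"
  unfolding hardy_const_def using Q1 y by (intro divide_nonneg_nonneg mult_nonneg_nonneg add_nonneg_nonneg) (auto simp: Q_def y_def)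
 have "ennreal (lint (leb A) (%x. ?g x / ?rho x)) = (\<integral>\<^sup>+x. ennreal (?g x / ?rho x) \<partial>leb A)"
  by (rule nn_integral_eq_integral[OF i, symmetric]) (use pos in \<open>intro AE_I2, simp\<close>)
 then have "lint (leb A) (%x. ?g x / ?rho x) <= hardy_const s * E"
 proof -
  have "ennreal (lint (leb A) (%x. ?g x / ?rho x)) <= ennreal (hardy_const s * E)"
   using \<open>ennreal (lint (leb A) (%x. ?g x / ?rho x)) = _\<close> nn by (rule ord_eq_le_trans)
  then show ?thesis using h0 E0 ennreal_le_iff[of "hardy_const s * E"] by simp
 qed
 then show ?le using a K by (simp add: E_def real_sqrt_mult a_def mult.assoc)
qed

section \<open>Edge weights and cutoffs at the vertices\<close>

lemma partial_add:
 assumes "\<phi> differentiable (at x)" "\<psi> differentiable (at x)"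
 shows "partial i (%x. \<phi> x + \<psi> x) x = partial i \<phi> x + partial i \<psi> x"
proof -
 have "(\<phi> has_derivative frechet_derivative \<phi> (at x)) (at x)" "(\<psi> has_derivative frechet_derivative \<psi> (at x)) (at x)"
  using assms by (auto simp: frechet_derivative_works[symmetric])
 from partial_eq[OF has_derivative_add[OF this]] show ?thesis by (simp add: partial_def)
qed

lemma partial_mult:
 assumes "\<phi> differentiable (at x)" "\<psi> differentiable (at x)"
 shows "partial i (%x. \<phi> x * \<psi> x) x = \<phi> x * partial i \<psi> x + partial i \<phi> x * \<psi> x"
proof -
 have "(\<phi> has_derivative frechet_derivative \<phi> (at x)) (at x)" "(\<psi> has_derivative frechet_derivative \<psi> (at x)) (at x)"
  using assms by (auto simp: frechet_derivative_works[symmetric])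
 from partial_eq[OF has_derivative_mult[OF this]] show ?thesis by (simp add: partial_def)
qed

lemma partial_const: "partial i (%x. c) x = 0"
 by (rule partial_eq[OF has_derivative_const])

lemma partial_bary: "noncollinear p q r ==> partial i (bary p q r) x = bary_grad p q r $ i"
proof -
 assume n: "noncollinear p q r"
 have "((%x. 1 + bary_grad p q r \<bullet> (x - p)) has_derivative (%y. bary_grad p q r \<bullet> y)) (at x)"
  by (auto intro!: derivative_eq_intros)
 moreover have "bary p q r = (%x. 1 + bary_grad p q r \<bullet> (x - p))" by (rule ext) (rule bary_affine[OF n])
 ultimately have "(bary p q r has_derivative (%y. bary_grad p q r \<bullet> y)) (at x)" by (simp only:)
 from partial_eq[OF this] show ?thesis by (simp add: inner_axis)
qed

text \<open>The second elementary symmetric polynomial of the coordinates. On the closed triangle it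
  vanishes exactly at the vertices, so quotients by it are singular only there.\<close>

definition bary_pairs :: "point => point => point => scalar_field" where
 "bary_pairs p q r x = bary p q r x * bary q r p x + bary q r p x * bary r p q x + bary r p q x * bary p q r x"

text \<open>Equal to 1 on the edge opposite to \<open>p\<close> and to 0 on the other two, except at the vertices.\<close>

definition edge_weight :: "point => point => point => scalar_field" where
 "edge_weight p q r x = bary q r p x * bary r p q x * inverse (bary_pairs p q r x)"

lemma bary_pairs_rotate: "bary_pairs q r p x = bary_pairs p q r x"
 by (simp add: bary_pairs_def)

text \<open>The sum of the three Hardy weights. It dominates, up to constants, both the gradients of
  the edge weights and the reciprocal distances to the vertices.\<close>

definition vertex_weight :: "point => point => point => scalar_field" where
 "vertex_weight p q r x = 1 / (1 - bary p q r x) + 1 / (1 - bary q r p x) + 1 / (1 - bary r p q x)"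

lemma vertex_weight_rotate: "vertex_weight q r p x = vertex_weight p q r x"
 by (simp add: vertex_weight_def)

lemma triangle_bounds:
 assumes n: "noncollinear p q r" and x: "x \<in> open_triangle p q r"
 shows "0 < bary p q r x" "0 < bary q r p x" "0 < bary r p q x" "bary p q r x < 1" "bary q r p x < 1" "bary r p q x < 1"
 using x bary_sum[OF n, of x] unfolding open_triangle_iff[OF n] by linarith+

lemma bary_pairs_pos:
 assumes "noncollinear p q r" "x \<in> open_triangle p q r"
 shows "0 < bary_pairs p q r x"
 unfolding bary_pairs_def using triangle_bounds[OF assms] by (intro add_pos_pos mult_pos_pos)

text \<open>Some coordinate a is at least 1/3, and the sum of the pairs is at least a (1 - a), hence
  at least (1 - a) / 3.\<close>

lemma inverse_bary_pairs_le:
 assumes n: "noncollinear p q r" and x: "x \<in> open_triangle p q r"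
 shows "inverse (bary_pairs p q r x) <= 3 * vertex_weight p q r x" "3 <= vertex_weight p q r x"
proof -
 define a b c where "a = bary p q r x" and "b = bary q r p x" and "c = bary r p q x"
 have s: "a + b + c = 1" using bary_sum[OF n, of x] by (simp add: a_def b_def c_def)
 have pos: "0 < a" "0 < b" "0 < c" using triangle_bounds[OF n x] by (auto simp: a_def b_def c_def)
 have key: "inverse (a * b + b * c + c * a) <= 3 / (1 - a)" if "a + b + c = 1" "0 < a" "0 < b" "0 < c" "1/3 <= a" for a b c :: real
 proof -
  have "(1/3) * (b + c) <= a * (b + c)" using that by (intro mult_right_mono) auto
  also have "\<dots> <= a * b + b * c + c * a" using that by (simp add: algebra_simps)
  finally have le: "(1 - a) / 3 <= a * b + b * c + c * a" using that(1) by (simp add: field_simps)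
  have "0 < 1 - a" using that by linarith
  then have "0 < (1 - a) / 3" by simp
  then have "inverse (a * b + b * c + c * a) <= inverse ((1 - a) / 3)" using le by (intro le_imp_inverse_le)
  then show ?thesis by (simp add: inverse_eq_divide)
 qed
 have p: "0 <= 3 / (1 - a)" "0 <= 3 / (1 - b)" "0 <= 3 / (1 - c)" using s pos by auto
 have w: "vertex_weight p q r x = 1 / (1 - a) + 1 / (1 - b) + 1 / (1 - c)" "bary_pairs p q r x = a * b + b * c + c * a"
  by (simp_all add: vertex_weight_def bary_pairs_def a_def b_def c_def)
 consider "1/3 <= a" | "1/3 <= b" | "1/3 <= c" using s by linarith
 then have "inverse (a * b + b * c + c * a) <= 3 / (1 - a) + 3 / (1 - b) + 3 / (1 - c)"
 proof cases
  case 1 then show ?thesis using key[OF s pos] p by linarith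
 next
  case 2
  have "inverse (b * c + c * a + a * b) <= 3 / (1 - b)" by (rule key) (use s pos 2 in linarith)+
  moreover have "b * c + c * a + a * b = a * b + b * c + c * a" by simp
  ultimately have "inverse (a * b + b * c + c * a) <= 3 / (1 - b)" by (simp only:)
  then show ?thesis using p by linarith
 next
  case 3
  have "inverse (c * a + a * b + b * c) <= 3 / (1 - c)" by (rule key) (use s pos 3 in linarith)+
  moreover have "c * a + a * b + b * c = a * b + b * c + c * a" by simp
  ultimately have "inverse (a * b + b * c + c * a) <= 3 / (1 - c)" by (simp only:)
  then show ?thesis using p by linarith
 qed
 then show "inverse (bary_pairs p q r x) <= 3 * vertex_weight p q r x" unfolding w by simp
 have "1 <= 1 / (1 - t)" if "0 < t" "t < 1" for t :: real using that by simp
 then show "3 <= vertex_weight p q r x" unfolding w using pos s by (smt (verit))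
qed

lemma smooth_on_edge_weight:
 assumes n: "noncollinear p q r" and U: "open U" "!!x. x \<in> U ==> bary_pairs p q r x ~= 0"
 shows "smooth_on U (edge_weight p q r)"
proof -
 note n2 = noncollinear_rotate[OF n] note n3 = noncollinear_rotate[OF n2]
 have s: "smooth_on U (bary_pairs p q r)" unfolding bary_pairs_def
  by (intro smooth_on_add smooth_on_mult smooth_on_bary n n2 n3 U(1))
 show ?thesis unfolding edge_weight_def
  by (intro smooth_on_mult smooth_on_bary n2 n3 U(1) smooth_on_inverse s U(2))
qed

text \<open>By the quotient rule the derivative is at most 3 gamma / S, where S is the sum of pairs:
  one part from the numerator, two from the denominator, where b c <= S is used. The bound for 1/S
  turns 3 into 9.\<close>

lemma partial_edge_weight_le:
 assumes n: "noncollinear p q r" and x: "x \<in> open_triangle p q r"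
  and g: "norm (bary_grad p q r) <= \<gamma>" "norm (bary_grad q r p) <= \<gamma>" "norm (bary_grad r p q) <= \<gamma>"
 shows "\<bar>partial i (edge_weight p q r) x\<bar> <= 9 * \<gamma> * vertex_weight p q r x"
proof -
 note n2 = noncollinear_rotate[OF n] note n3 = noncollinear_rotate[OF n2]
 define a b c where "a = bary p q r x" and "b = bary q r p x" and "c = bary r p q x"
 define a' b' c' where "a' = bary_grad p q r $ i" and "b' = bary_grad q r p $ i" and "c' = bary_grad r p q $ i"
 define S where "S = bary_pairs p q r x"
 have pos: "0 < a" "0 < b" "0 < c" using triangle_bounds[OF n x] by (auto simp: a_def b_def c_def)
 have s: "a + b + c = 1" using bary_sum[OF n, of x] by (simp add: a_def b_def c_def)
 have Spos: "0 < S" using bary_pairs_pos[OF n x] by (simp add: S_def)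
 have abs: "\<bar>a'\<bar> <= \<gamma>" "\<bar>b'\<bar> <= \<gamma>" "\<bar>c'\<bar> <= \<gamma>"
  using g component_le_norm_cart[of "bary_grad p q r" i] component_le_norm_cart[of "bary_grad q r p" i] component_le_norm_cart[of "bary_grad r p q" i]
  by (auto simp: a'_def b'_def c'_def)
 have g0: "0 <= \<gamma>" using abs(1) by linarith
 have d: "bary p q r differentiable at x" "bary q r p differentiable at x" "bary r p q differentiable at x"
  by (rule smooth_on_differentiable[OF smooth_on_bary[OF _ open_UNIV]], fact, simp)+
 have dS: "bary_pairs p q r differentiable at x" unfolding bary_pairs_def by (intro derivative_intros d)
 have pS: "partial i (bary_pairs p q r) x = (a * b' + a' * b) + (b * c' + b' * c) + (c * a' + c' * a)"
  unfolding bary_pairs_def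
  by (simp add: partial_add partial_mult differentiable_add differentiable_mult d partial_bary n n2 n3 a_def b_def c_def a'_def b'_def c'_def)
 have di: "(%x. inverse (bary_pairs p q r x)) differentiable at x"
  and pinv: "partial i (%x. inverse (bary_pairs p q r x)) x = - (inverse S)\<^sup>2 * partial i (bary_pairs p q r) x"
  using partial_compose[OF DERIV_inverse dS] Spos by (auto simp: S_def power2_eq_square)
 have dN: "(%x. bary q r p x * bary r p q x) differentiable at x" by (intro derivative_intros d)
 have "partial i (edge_weight p q r) x = b * c * (- (inverse S)\<^sup>2 * partial i (bary_pairs p q r) x) + (b * c' + b' * c) * inverse S"
  unfolding edge_weight_def
  by (subst partial_mult[OF dN di]) (simp add: pinv partial_mult d partial_bary n2 n3 b_def c_def b'_def c'_def S_def)
 moreover have "\<bar>(b * c' + b' * c) * inverse S\<bar> <= \<gamma> * inverse S"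
 proof -
  have "\<bar>b * c' + b' * c\<bar> <= b * \<gamma> + \<gamma> * c"
   using abs pos by (intro order_trans[OF abs_triangle_ineq] add_mono) (simp_all add: abs_mult)
  also have "\<dots> = (b + c) * \<gamma>" by (simp add: algebra_simps)
  also have "\<dots> <= 1 * \<gamma>" using s pos g0 by (intro mult_right_mono) auto
  finally show ?thesis using Spos by (simp add: abs_mult)
 qed
 moreover have "\<bar>b * c * (- (inverse S)\<^sup>2 * partial i (bary_pairs p q r) x)\<bar> <= 2 * \<gamma> * inverse S"
 proof -
  have P: "\<bar>partial i (bary_pairs p q r) x\<bar> <= 2 * \<gamma>"
  proof -
   have "\<bar>a * b'\<bar> <= a * \<gamma>" "\<bar>a' * b\<bar> <= b * \<gamma>" "\<bar>b * c'\<bar> <= b * \<gamma>" "\<bar>b' * c\<bar> <= c * \<gamma>" "\<bar>c * a'\<bar> <= c * \<gamma>" "\<bar>c' * a\<bar> <= a * \<gamma>"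
    using abs pos by (simp_all add: abs_mult mult.commute)
   then have "\<bar>partial i (bary_pairs p q r) x\<bar> <= a * \<gamma> + b * \<gamma> + (b * \<gamma> + c * \<gamma>) + (c * \<gamma> + a * \<gamma>)"
    unfolding pS by linarith
   also have "\<dots> = 2 * ((a + b + c) * \<gamma>)" by (simp add: algebra_simps)
   finally show ?thesis using s by simp
  qed
  have N: "b * c * inverse S <= 1"
  proof -
   have "b * c <= S" unfolding S_def bary_pairs_def using pos by (simp add: a_def b_def c_def)
   then show ?thesis using Spos by (simp add: divide_simps)
  qed
  have "\<bar>b * c * (- (inverse S)\<^sup>2 * partial i (bary_pairs p q r) x)\<bar> = (b * c * inverse S) * (inverse S * \<bar>partial i (bary_pairs p q r) x\<bar>)"
   using pos Spos by (simp add: abs_mult power2_eq_square)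
  also have "\<dots> <= 1 * (inverse S * (2 * \<gamma>))"
   using N P Spos pos by (intro mult_mono) auto
  finally show ?thesis by (simp add: mult_ac)
 qed
 ultimately have "\<bar>partial i (edge_weight p q r) x\<bar> <= 3 * \<gamma> * inverse S" by (simp add: algebra_simps)
 also have "\<dots> <= 3 * \<gamma> * (3 * vertex_weight p q r x)"
  using inverse_bary_pairs_le(1)[OF n x] g0 by (intro mult_left_mono) (auto simp: S_def)
 finally show ?thesis by simp
qed

text \<open>The squared distance keeps each factor smooth at w itself. A factor vanishes near w and
  is one beyond distance 1/(n+1).\<close>

definition vertex_cutoff :: "point set => nat => scalar_field" where
 "vertex_cutoff W n x = (\<Prod>w\<in>W. smooth_step ((real (Suc n))\<^sup>2 * (norm (x - w))\<^sup>2))"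

lemma smooth_on_norm_square: "open U ==> smooth_on U (%x::point. c * (norm (x - w))\<^sup>2)"
proof -
 assume U: "open U"
 have "smooth_on U (%x. c * (\<Sum>i\<in>UNIV. (axis i 1 \<bullet> x - w $ i) * (axis i 1 \<bullet> x - w $ i)))"
  by (intro smooth_on_mult smooth_on_const smooth_on_sum smooth_on_diff smooth_on_inner U)
 then show ?thesis
 proof (rule smooth_on_cong)
  fix x
  show "c * (\<Sum>i\<in>UNIV. (axis i 1 \<bullet> x - w $ i) * (axis i 1 \<bullet> x - w $ i)) = c * (norm (x - w))\<^sup>2"
   unfolding norm_power2_eq_sum by (simp add: inner_axis' power2_eq_square)
 qed
qed

lemma smooth_on_vertex_cutoff: "smooth_on UNIV (vertex_cutoff W n)"
 unfolding vertex_cutoff_def by (intro smooth_on_prod smooth_on_step smooth_on_norm_square open_UNIV)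

lemma vertex_cutoff_bounds: "0 <= vertex_cutoff W n x" "vertex_cutoff W n x <= 1"
 unfolding vertex_cutoff_def by (auto intro!: prod_nonneg prod_le_1 smooth_step_nonneg smooth_step_le_1)

lemma vertex_cutoff_zero:
 assumes "finite W" "w \<in> W"
 shows "\<exists>V. open V \<and> w \<in> V \<and> (\<forall>x\<in>V. vertex_cutoff W n x = 0)"
proof (intro exI conjI ballI)
 let ?V = "ball w (1 / (2 * real (Suc n)))"
 show "open ?V" "w \<in> ?V" by auto
 fix x assume "x \<in> ?V"
 then have "real (Suc n) * norm (x - w) <= 1/2" by (simp add: dist_norm norm_minus_commute field_simps)
 then have "(real (Suc n) * norm (x - w))\<^sup>2 <= (1/2)\<^sup>2" by (rule power_mono) simp
 then have "(real (Suc n))\<^sup>2 * (norm (x - w))\<^sup>2 <= 1/2" unfolding power_mult_distrib by (simp add: power2_eq_square)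
 then have "smooth_step ((real (Suc n))\<^sup>2 * (norm (x - w))\<^sup>2) = 0" by (rule smooth_step_0)
 then show "vertex_cutoff W n x = 0" unfolding vertex_cutoff_def using assms by (intro prod_zero) auto
qed

text \<open>The cutoff is one on a whole neighbourhood of x for large n, so its gradient vanishes
  there as well; this removes all cutoff terms in the pointwise limit.\<close>

lemma vertex_cutoff_eventually_1:
 assumes W: "finite W" and x: "x \<notin> W"
 shows "\<forall>\<^sub>F n in sequentially. vertex_cutoff W n x = 1 \<and> partial i (vertex_cutoff W n) x = 0"
proof (cases "W = {}")
 case True
 then have "vertex_cutoff W n = (%_. 1)" for n by (auto simp: vertex_cutoff_def)
 then show ?thesis by (simp add: partial_const)
next
 case False
 define d where "d = Min ((%w. norm (x - w)) ` W)"
 have d: "0 < d" "!!w. w \<in> W ==> d <= norm (x - w)" unfolding d_def using W False x by auto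
 obtain N :: nat where N: "2 / d < real N" using reals_Archimedean2 by blast
 have one: "vertex_cutoff W n y = 1" if n: "N <= n" and y: "y \<in> ball x (d / 2)" for n y
  unfolding vertex_cutoff_def
 proof (rule prod.neutral, rule ballI)
  fix w assume w: "w \<in> W"
  have "norm (x - w) <= norm (x - y) + norm (y - w)" using norm_triangle_ineq[of "x - y" "y - w"] by simp
  then have "d / 2 <= norm (y - w)" using d(2)[OF w] y by (simp add: dist_norm)
  moreover have "2 / d <= real (Suc n)" using N n by simp
  ultimately have "(2 / d) * (d / 2) <= real (Suc n) * norm (y - w)" using d(1) by (intro mult_mono) auto
  then have "1 <= real (Suc n) * norm (y - w)" using d(1) by simp
  then have "1 <= (real (Suc n) * norm (y - w))\<^sup>2" by (rule one_le_power)
  then show "smooth_step ((real (Suc n))\<^sup>2 * (norm (y - w))\<^sup>2) = 1"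
   by (intro smooth_step_1) (simp add: power_mult_distrib)
 qed
 have "vertex_cutoff W n x = 1 \<and> partial i (vertex_cutoff W n) x = 0" if n: "N <= n" for n
 proof
  show "vertex_cutoff W n x = 1" by (rule one[OF n]) (use d in simp)
  have "partial i (vertex_cutoff W n) x = partial i (%_. 1) x"
   by (rule partial_cong_open(1)[of "ball x (d/2)"]) (use d one[OF n] in auto)
  then show "partial i (vertex_cutoff W n) x = 0" by (simp add: partial_const)
 qed
 then show ?thesis unfolding eventually_sequentially by blast
qed

lemma smooth_step_deriv_zero: "1 < t ==> smooth_step_deriv t = 0"
proof -
 assume t: "1 < t"
 have "(smooth_step has_real_derivative 0) (at t)"
  by (rule has_field_derivative_transform_within_open[where S="{3/4<..}" and f="%_. 1"])
   (use t smooth_step_1 in auto)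
 then show ?thesis using smooth_step_DERIV DERIV_unique by blast
qed

text \<open>The bound is uniform in n: the derivative of a factor can be nonzero only where (n+1) |x
  - w| <= 1, and there the large factor (n+1)^2 |x - w| is at most 1/|x - w|. The uniformity is what
  dominated convergence needs.\<close>

lemma partial_vertex_cutoff_le:
 assumes B: "\<forall>t. \<bar>smooth_step_deriv t\<bar> <= B" and W: "finite W" "x \<notin> W"
 shows "\<bar>partial i (vertex_cutoff W n) x\<bar> <= (\<Sum>w\<in>W. 2 * B / norm (x - w))"
 using W
proof (induction W rule: finite_induct)
 case empty
 have "vertex_cutoff {} n = (%_. 1)" by (auto simp: vertex_cutoff_def)
 then show ?case by (simp add: partial_const)
next
 case (insert w W)
 define t where "t y = (real (Suc n))\<^sup>2 * (norm (y - w))\<^sup>2" for y :: point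
 have B0: "0 <= B" using B[rule_format, of 0] by linarith
 have xw: "0 < norm (x - w)" using insert by auto
 have dt: "t differentiable at x" unfolding t_def
  by (rule smooth_on_differentiable[OF smooth_on_norm_square[OF open_UNIV]]) simp
 have pt: "partial i t x = (real (Suc n))\<^sup>2 * (2 * (x - w) $ i)"
 proof -
  have "((%y. (real (Suc n))\<^sup>2 * ((y - w) \<bullet> (y - w))) has_derivative (%h. (real (Suc n))\<^sup>2 * ((x - w) \<bullet> h + h \<bullet> (x - w)))) (at x)"
   by (rule has_derivative_mult_right) (auto intro!: derivative_eq_intros)
  moreover have "t = (%y. (real (Suc n))\<^sup>2 * ((y - w) \<bullet> (y - w)))" by (rule ext) (simp only: t_def power2_norm_eq_inner)
  ultimately have "(t has_derivative (%h. (real (Suc n))\<^sup>2 * ((x - w) \<bullet> h + h \<bullet> (x - w)))) (at x)" by (simp only:)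
  from partial_eq[OF this] show ?thesis by (simp add: inner_axis inner_axis')
 qed
 have e: "vertex_cutoff (insert w W) n = (%y. smooth_step (t y) * vertex_cutoff W n y)"
  using insert by (auto simp: vertex_cutoff_def t_def)
 have dst: "(%y. smooth_step (t y)) differentiable at x" by (rule partial_compose(2)[OF smooth_step_DERIV dt])
 have dW: "vertex_cutoff W n differentiable at x" by (rule smooth_on_differentiable[OF smooth_on_vertex_cutoff]) simp
 have "partial i (vertex_cutoff (insert w W) n) x =
   smooth_step (t x) * partial i (vertex_cutoff W n) x + smooth_step_deriv (t x) * partial i t x * vertex_cutoff W n x"
  unfolding e partial_mult[OF dst dW] partial_compose(1)[OF smooth_step_DERIV dt] ..
 moreover have "\<bar>smooth_step (t x) * partial i (vertex_cutoff W n) x\<bar> <= (\<Sum>w\<in>W. 2 * B / norm (x - w))"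
 proof -
  have "\<bar>smooth_step (t x)\<bar> * \<bar>partial i (vertex_cutoff W n) x\<bar> <= 1 * (\<Sum>w\<in>W. 2 * B / norm (x - w))"
   using smooth_step_nonneg[of "t x"] smooth_step_le_1[of "t x"] insert by (intro mult_mono) auto
  then show ?thesis by (simp add: abs_mult)
 qed
 moreover have "\<bar>smooth_step_deriv (t x) * partial i t x * vertex_cutoff W n x\<bar> <= 2 * B / norm (x - w)"
 proof -
  have "\<bar>smooth_step_deriv (t x) * partial i t x\<bar> <= 2 * B / norm (x - w)"
  proof (cases "1 < t x")
   case True
   then show ?thesis using smooth_step_deriv_zero B0 xw by simp
  next
   case False
   then have "(real (Suc n))\<^sup>2 * (norm (x - w))\<^sup>2 <= 1" by (simp add: t_def)
   then have N: "(real (Suc n))\<^sup>2 * norm (x - w) <= 1 / norm (x - w)"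
    using xw by (simp add: pos_le_divide_eq power2_eq_square mult.assoc)
   have "\<bar>partial i t x\<bar> <= 2 * ((real (Suc n))\<^sup>2 * norm (x - w))"
    unfolding pt abs_mult using component_le_norm_cart[of "x - w" i] mult_left_mono[of "\<bar>(x - w) $ i\<bar>" "norm (x - w)" "(real (Suc n))\<^sup>2"] by simp
   then have "\<bar>partial i t x\<bar> <= 2 * (1 / norm (x - w))" using N by linarith
   then have "\<bar>smooth_step_deriv (t x)\<bar> * \<bar>partial i t x\<bar> <= B * (2 * (1 / norm (x - w)))"
    using B B0 by (intro mult_mono) auto
   then show ?thesis by (simp add: abs_mult mult_ac)
  qed
  then have "\<bar>smooth_step_deriv (t x) * partial i t x\<bar> * \<bar>vertex_cutoff W n x\<bar> <= (2 * B / norm (x - w)) * 1"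
   using vertex_cutoff_bounds[of W n x] B0 by (intro mult_mono) auto
  then show ?thesis by (simp add: abs_mult)
 qed
 ultimately have "\<bar>partial i (vertex_cutoff (insert w W) n) x\<bar> <= 2 * B / norm (x - w) + (\<Sum>w\<in>W. 2 * B / norm (x - w))" by linarith
 then show ?case using insert by simp
qed

text \<open>The coordinate of p is affine with value 1 at p, so 1 - \<open>bary p q r x\<close> is
  at most the length of its gradient times |x - p|.\<close>

lemma inverse_distance_le:
 assumes n: "noncollinear p q r" and x: "x \<in> open_triangle p q r"
 shows "1 / norm (x - p) <= norm (bary_grad p q r) * vertex_weight p q r x"
proof -
 note b = triangle_bounds[OF n x]
 have "1 - bary p q r x = - (bary_grad p q r \<bullet> (x - p))" using bary_affine[OF n, of x] by simp
 also have "\<dots> <= norm (bary_grad p q r) * norm (x - p)"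
  using Cauchy_Schwarz_ineq2[of "bary_grad p q r" "x - p"] by linarith
 finally have le: "1 - bary p q r x <= norm (bary_grad p q r) * norm (x - p)" .
 have xp: "0 < norm (x - p)" using bary_vertex(1)[OF n] b(4) by auto
 have "1 / norm (x - p) <= norm (bary_grad p q r) * (1 / (1 - bary p q r x))"
  using le xp b(4) by (simp add: field_simps)
 also have "\<dots> <= norm (bary_grad p q r) * vertex_weight p q r x"
  unfolding vertex_weight_def using b by (intro mult_left_mono) auto
 finally show ?thesis .
qed

text \<open>W is the set of all vertices of the mesh, and the vertices outside this triangle have
  positive distance from it. C depends on the mesh in an uncontrolled way; it only enters a
  dominating function and never the final bound.\<close>

lemma sum_inverse_distance_le:
 assumes n: "noncollinear p q r" and W: "finite W" "W \<inter> tri p q r \<subseteq> {p, q, r}"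
 obtains C where "0 <= C" "!!x. x \<in> open_triangle p q r ==> (\<Sum>w\<in>W. 1 / norm (x - w)) <= C * vertex_weight p q r x"
proof -
 note n2 = noncollinear_rotate[OF n] note n3 = noncollinear_rotate[OF n2]
 have "\<exists>C\<ge>0. \<forall>x\<in>open_triangle p q r. 1 / norm (x - w) <= C * vertex_weight p q r x" if w: "w \<in> W" for w
 proof (cases "w \<in> tri p q r")
  case True
  then have "w = p \<or> w = q \<or> w = r" using W(2) w by blast
  then show ?thesis
  proof (elim disjE)
   assume "w = p"
   then show ?thesis using inverse_distance_le[OF n] by (intro exI[of _ "norm (bary_grad p q r)"]) auto
  next
   assume "w = q"
   then show ?thesis using inverse_distance_le[OF n2]
    unfolding vertex_weight_rotate[of q r p] open_triangle_rotate[of q r p]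
    by (intro exI[of _ "norm (bary_grad q r p)"]) auto
  next
   assume "w = r"
   then show ?thesis using inverse_distance_le[OF n3]
    unfolding vertex_weight_rotate[of r p q] open_triangle_rotate[of r p q] vertex_weight_rotate[of q r p] open_triangle_rotate[of q r p]
    by (intro exI[of _ "norm (bary_grad r p q)"]) auto
  qed
 next
  case False
  have "closed (tri p q r)" by (rule compact_imp_closed[OF compact_triangle])
  then have "open (- (tri p q r))" by (rule open_Compl)
  moreover have "w \<in> - (tri p q r)" using False by simp
  ultimately obtain e where e: "0 < e" "ball w e \<subseteq> - (tri p q r)" by (rule openE)
  have "1 / norm (x - w) <= (1 / e) * vertex_weight p q r x" if x: "x \<in> open_triangle p q r" for x
  proof -
   have "x \<in> tri p q r" using x interior_subset unfolding open_triangle_def by blast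
   then have "\<not> dist w x < e" using e(2) by auto
   then have "e <= norm (x - w)" by (simp add: dist_norm norm_minus_commute)
   moreover then have "0 < norm (x - w)" using e(1) by linarith
   ultimately have "1 / norm (x - w) <= 1 / e" using e(1) by (intro divide_left_mono mult_pos_pos) auto
   also have "\<dots> <= (1 / e) * vertex_weight p q r x"
    using inverse_bary_pairs_le(2)[OF n x] e(1) by (simp add: divide_right_mono)
   finally show ?thesis .
  qed
  then show ?thesis using e(1) by (intro exI[of _ "1 / e"]) auto
 qed
 then have "\<forall>w\<in>W. \<exists>C. 0 <= C \<and> (\<forall>x\<in>open_triangle p q r. 1 / norm (x - w) <= C * vertex_weight p q r x)" by simp
 from bchoice[OF this] obtain C where C': "\<forall>w\<in>W. 0 <= C w \<and> (\<forall>x\<in>open_triangle p q r. 1 / norm (x - w) <= C w * vertex_weight p q r x)"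
  by (rule exE)
 have C: "0 <= C w" "!!x. x \<in> open_triangle p q r ==> 1 / norm (x - w) <= C w * vertex_weight p q r x" if "w \<in> W" for w
  using bspec[OF C' that] by simp_all
 show thesis
 proof (rule that)
  show "0 <= sum C W" by (rule sum_nonneg) (rule C(1))
  fix x assume x: "x \<in> open_triangle p q r"
  show "(\<Sum>w\<in>W. 1 / norm (x - w)) <= sum C W * vertex_weight p q r x"
   unfolding sum_distrib_right by (rule sum_mono) (rule C(2)[OF _ x])
 qed
qed

section \<open>Edge means and the local estimate on one triangle\<close>

definition edge_mean :: "point => point => point => scalar_field => (2 => scalar_field) => real" where
 "edge_mean p q r v g = mean_on (open_triangle p q r) (%x. v x + (\<Sum>i\<in>UNIV. (x - p) $ i * g i x) / 2)"

lemma edge_mean_smooth: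
 assumes n: "noncollinear p q r" and ph: "smooth_on UNIV \<phi>"
 shows "edge_mean p q r \<phi> (%i. partial i \<phi>) = (LINT t:{0..1}|lborel. \<phi> (linepath q r t))"
proof -
 let ?A = "open_triangle p q r" and ?H = "tri p q r"
 define F where "F x = 2 * \<phi> x + (\<Sum>i\<in>UNIV. (x - p) $ i * partial i \<phi> x)" for x
 have cF: "continuous_on UNIV F" unfolding F_def
  using smooth_on_continuous_on[OF ph] smooth_on_continuous_on[OF smooth_on_partial[OF ph]] by (intro continuous_intros)
 have Fb: "F \<in> borel_measurable borel" by (rule borel_measurable_continuous_onI[OF cF])
 have Am: "?A \<in> sets lebesgue" "?A \<in> sets borel" using open_open_triangle[of p q r] by auto
 have Hm: "?H \<in> sets borel" using compact_triangle[of p q r] by (simp add: compact_imp_closed)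
 have "negligible (frontier ?H)" by (rule negligible_convex_frontier[OF convex_convex_hull])
 then have nf: "AE x in lebesgue. x \<notin> frontier ?H" using AE_not_in negligible_iff_null_sets by blast
 have "lint (leb ?A) F = lint lebesgue (%x. ind ?A x * F x)" by (rule integral_lebesgue_on[OF Am(1)])
 also have "\<dots> = lint lebesgue (%x. ind ?H x * F x)"
 proof (rule integral_cong_AE)
  show "(%x. ind ?A x * F x) \<in> borel_measurable lebesgue" "(%x. ind ?H x * F x) \<in> borel_measurable lebesgue"
   using Am Hm Fb by (auto intro!: measurable_completion)
  show "AE x in lebesgue. ind ?A x * F x = ind ?H x * F x"
   using nf
  proof eventually_elim
   case (elim x)
   have "x \<in> ?A \<longleftrightarrow> x \<in> ?H"
    using elim Hm closure_closed[OF compact_imp_closed[OF compact_triangle[of p q r]]] interior_subset[of ?H]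
    unfolding frontier_def open_triangle_def by blast
   then show ?case by (simp add: indicator_def)
  qed
 qed
 also have "\<dots> = (LINT x:?H|lborel. F x)"
  unfolding set_lebesgue_integral_def using Hm Fb by (simp add: integral_completion)
 also have "\<dots> = \<bar>cross2 (q - p) (r - p)\<bar> * (LINT t:{0..1}|lborel. \<phi> (linepath q r t))"
  unfolding F_def by (rule integral_triangle_edge[OF ph])
 finally have I: "lint (leb ?A) F = 2 * measure lebesgue ?A * (LINT t:{0..1}|lborel. \<phi> (linepath q r t))"
  by (simp add: measure_open_triangle)
 have "(%x. \<phi> x + (\<Sum>i\<in>UNIV. (x - p) $ i * partial i \<phi> x) / 2) = (%x. F x / 2)" by (rule ext) (simp add: F_def)
 then show ?thesis unfolding edge_mean_def
  using I measure_open_triangle_pos[OF n] by simp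
qed

lemma bounded_component_triangle: "\<exists>B. \<forall>x\<in>open_triangle p q r. \<bar>(x - w) $ i\<bar> <= B"
proof -
 obtain B where B: "!!x. x \<in> open_triangle p q r ==> norm x <= B" using bounded_open_triangle bounded_iff by metis
 have "\<bar>(x - w) $ i\<bar> <= B + norm w" if "x \<in> open_triangle p q r" for x
  using component_le_norm_cart[of "x - w" i] norm_triangle_ineq4[of x w] B[OF that] by linarith
 then show ?thesis by blast
qed

lemma component_sq_int:
 "sq_int (leb (open_triangle p q r)) (%x. (x - w) $ i)"
proof -
 obtain B where B: "\<forall>x\<in>open_triangle p q r. \<bar>(x - w) $ i\<bar> <= B" using bounded_component_triangle by blast
 show ?thesis
 proof (rule sq_int_bounded[OF finite_measure_lebesgue_on[OF lmeasurable_open_triangle], where B=B])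
  have "continuous_on UNIV (%x::point. (x - w) $ i)" by (intro continuous_intros)
  then show "(%x. (x - w) $ i) \<in> borel_measurable (leb (open_triangle p q r))"
   by (rule borel_measurable_lebesgue_onI[OF borel_measurable_continuous_onI])
 qed (use B in simp)
qed

lemma smooth_sq_int:
 assumes "smooth_on UNIV \<phi>"
 shows "sq_int (leb (open_triangle p q r)) \<phi>"
proof -
 have c: "continuous_on UNIV \<phi>" by (rule smooth_on_continuous_on[OF assms])
 have "compact (\<phi> ` (tri p q r))"
  by (rule compact_continuous_image[OF continuous_on_subset[OF c subset_UNIV] compact_triangle])
 then obtain B where B: "!!y. y \<in> \<phi> ` (tri p q r) ==> norm y <= B"
  using compact_imp_bounded bounded_iff by metis
 show ?thesis
 proof (rule sq_int_bounded[OF finite_measure_lebesgue_on[OF lmeasurable_open_triangle], where B=B])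
  show "\<phi> \<in> borel_measurable (leb (open_triangle p q r))"
   by (rule borel_measurable_lebesgue_onI[OF borel_measurable_continuous_onI[OF c]])
  fix x assume "x \<in> space (leb (open_triangle p q r))"
  then have "x \<in> tri p q r" using interior_subset unfolding open_triangle_def by auto
  then show "\<bar>\<phi> x\<bar> <= B" using B[of "\<phi> x"] by simp
 qed
qed

lemma open_triangle_finite: "finite_measure (leb (open_triangle p q r))"
 by (rule finite_measure_lebesgue_on[OF lmeasurable_open_triangle])

lemma measure_space_open_triangle:
 "measure (leb (open_triangle p q r)) (space (leb (open_triangle p q r))) = measure lebesgue (open_triangle p q r)"
 using lmeasurable_open_triangle by (simp add: measure_restrict_space fmeasurableD)

lemma edge_mean_integrand:
 assumes "sq_int (leb (open_triangle p q r)) v" "!!i. sq_int (leb (open_triangle p q r)) (g i)"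
 shows "integrable (leb (open_triangle p q r)) v" "integrable (leb (open_triangle p q r)) (%x. (x - w) $ i * g i x)"
  "integrable (leb (open_triangle p q r)) (g i)"
  "lint (leb (open_triangle p q r)) (%x. v x + (\<Sum>i\<in>UNIV. (x - w) $ i * g i x) / 2) =
   lint (leb (open_triangle p q r)) v + (\<Sum>i\<in>UNIV. lint (leb (open_triangle p q r)) (%x. (x - w) $ i * g i x)) / 2"
proof -
 show i1: "integrable (leb (open_triangle p q r)) v" by (rule sq_int_integrable[OF open_triangle_finite assms(1)])
 show i3: "integrable (leb (open_triangle p q r)) (g i)" by (rule sq_int_integrable[OF open_triangle_finite assms(2)])
 have i2: "integrable (leb (open_triangle p q r)) (%x. (x - w) $ i * g i x)" for i
  by (rule sq_int_mult[OF component_sq_int assms(2)])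
 then show "integrable (leb (open_triangle p q r)) (%x. (x - w) $ i * g i x)" .
 show "lint (leb (open_triangle p q r)) (%x. v x + (\<Sum>i\<in>UNIV. (x - w) $ i * g i x) / 2) =
   lint (leb (open_triangle p q r)) v + (\<Sum>i\<in>UNIV. lint (leb (open_triangle p q r)) (%x. (x - w) $ i * g i x)) / 2"
  using i1 i2 by (subst Bintegral_add) (auto simp: Bintegral_sum)
qed

text \<open>Gauss' theorem on a triangle; it is an algebraic identity because \<open>edge_mean\<close> is defined by
 integrals over the triangle.\<close>

lemma integral_gradient_eq_edge_means:
 assumes n: "noncollinear p q r" and v: "sq_int (leb (open_triangle p q r)) v"
  and g: "!!i. sq_int (leb (open_triangle p q r)) (g i)"
 shows "lint (leb (open_triangle p q r)) (g i) = - 2 * measure lebesgue (open_triangle p q r) *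
  (bary_grad p q r $ i * edge_mean p q r v g + bary_grad q r p $ i * edge_mean q r p v g + bary_grad r p q $ i * edge_mean r p q v g)"
proof -
 let ?M = "leb (open_triangle p q r)"
 define a where "a = measure lebesgue (open_triangle p q r)"
 have a: "0 < a" using measure_open_triangle_pos[OF n] by (simp add: a_def)
 define V where "V = lint ?M v"
 define X where "X j = lint ?M (%x. x $ j * g j x)" for j
 define G :: point where "G = (\<chi> j. lint ?M (g j))"
 have comp: "lint ?M (%x. (x - w) $ j * g j x) = X j - w $ j * G $ j" for w j
 proof -
  have "integrable ?M (%x. x $ j * g j x)" using edge_mean_integrand(2)[OF v g, of 0 j] by simp
  moreover have "(%x. (x - w) $ j * g j x) = (%x. x $ j * g j x - w $ j * g j x)" by (rule ext) (simp add: left_diff_distrib)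
  moreover have "integrable ?M (%x. w $ j * g j x)"
   by (rule integrable_mult_right[OF edge_mean_integrand(3)[OF v g]])
  ultimately show ?thesis by (simp add: X_def G_def)
 qed
 have rot: "open_triangle q r p = open_triangle p q r" "open_triangle r p q = open_triangle p q r"
  using open_triangle_rotate by metis+
 \<comment> \<open>The vertex enters an edge mean only through -(w . G)/2. In the combination with
   the barycentric gradients the common part cancels and G is reproduced.\<close>
 have M: "a * edge_mean w q' r' v g = V + (sum X UNIV - w \<bullet> G) / 2" if "open_triangle w q' r' = open_triangle p q r" for w q' r'
 proof -
  have "edge_mean w q' r' v g = (V + (\<Sum>j\<in>UNIV. X j - w $ j * G $ j) / 2) / a"
   unfolding edge_mean_def that edge_mean_integrand(4)[OF v g] comp a_def V_def ..
  then show ?thesis using a by (simp add: sum_subtractf inner_vec_def)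
 qed
 note b = bary_grad_sum[OF n]
 have b1: "bary_grad p q r $ i + bary_grad q r p $ i + bary_grad r p q $ i = 0"
  using arg_cong[OF b(1), of "%z. z $ i"] by simp
 have b2: "(p \<bullet> G) * bary_grad p q r $ i + (q \<bullet> G) * bary_grad q r p $ i + (r \<bullet> G) * bary_grad r p q $ i = G $ i"
  using arg_cong[OF b(2)[of G], of "%z. z $ i"] by simp
 define c where "c = V + sum X UNIV / 2"
 have "a * (bary_grad p q r $ i * edge_mean p q r v g + bary_grad q r p $ i * edge_mean q r p v g + bary_grad r p q $ i * edge_mean r p q v g)
   = bary_grad p q r $ i * (a * edge_mean p q r v g) + bary_grad q r p $ i * (a * edge_mean q r p v g) + bary_grad r p q $ i * (a * edge_mean r p q v g)"
  by (simp add: algebra_simps)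
 also have "\<dots> = bary_grad p q r $ i * (c - (p \<bullet> G) / 2) + bary_grad q r p $ i * (c - (q \<bullet> G) / 2) + bary_grad r p q $ i * (c - (r \<bullet> G) / 2)"
  unfolding M[OF refl] M[OF rot(1)] M[OF rot(2)] c_def by (simp add: diff_divide_distrib add_diff_eq)
 also have "\<dots> = c * (bary_grad p q r $ i + bary_grad q r p $ i + bary_grad r p q $ i) -
   ((p \<bullet> G) * bary_grad p q r $ i + (q \<bullet> G) * bary_grad q r p $ i + (r \<bullet> G) * bary_grad r p q $ i) / 2"
  by (simp add: field_simps)
 also have "\<dots> = - (G $ i) / 2" unfolding b1 b2 by simp
 finally show ?thesis unfolding a_def[symmetric] by (simp add: G_def)
qed

text \<open>The difference is the mean of (x - p) . g / 2, where |x - p| <= h; Cauchy-Schwarz does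
  the rest.\<close>

lemma edge_mean_minus_mean_le:
 assumes n: "noncollinear p q r" and v: "sq_int (leb (open_triangle p q r)) v"
  and g: "!!i. sq_int (leb (open_triangle p q r)) (g i)"
  and h: "\<forall>x\<in>tri p q r. \<forall>y\<in>tri p q r. norm (x - y) <= h"
 defines "A \<equiv> open_triangle p q r"
 shows "\<bar>edge_mean p q r v g - mean_on A v\<bar> <= h / (2 * sqrt (measure lebesgue A)) * (\<Sum>i\<in>UNIV. sqrt (lint (leb A) (%x. (g i x)\<^sup>2)))"
proof -
 define a where "a = measure lebesgue A"
 have a: "0 < a" using measure_open_triangle_pos[OF n] by (simp add: a_def A_def)
 let ?M = "leb A"
 have pA: "p \<in> tri p q r" by (rule hull_inc) simp
 have h0: "0 <= h" using h pA by (metis norm_ge_zero order_trans)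
 have b: "\<bar>lint ?M (%x. (x - p) $ i * g i x)\<bar> <= h * (sqrt a * sqrt (lint ?M (%x. (g i x)\<^sup>2)))" for i
 proof -
  have gi: "integrable ?M (g i)" unfolding A_def by (rule edge_mean_integrand(3)[OF v g])
  have "\<bar>lint ?M (%x. (x - p) $ i * g i x)\<bar> <= lint ?M (%x. \<bar>(x - p) $ i * g i x\<bar>)" by (rule integral_abs_bound)
  also have "\<dots> <= lint ?M (%x. h * \<bar>g i x\<bar>)"
  proof (rule Bochner_Integration.integral_mono)
   show "integrable ?M (%x. \<bar>(x - p) $ i * g i x\<bar>)" using edge_mean_integrand(2)[OF v g] unfolding A_def by (rule integrable_abs)
   show "integrable ?M (%x. h * \<bar>g i x\<bar>)" using gi by simp
   fix x assume "x \<in> space ?M"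
   then have "x \<in> tri p q r" using interior_subset unfolding A_def open_triangle_def by auto
   then have "\<bar>(x - p) $ i\<bar> <= h" using h pA component_le_norm_cart[of "x - p" i] by (meson order_trans)
   then show "\<bar>(x - p) $ i * g i x\<bar> <= h * \<bar>g i x\<bar>" by (simp add: abs_mult mult_right_mono)
  qed
  also have "\<dots> = h * lint ?M (%x. \<bar>g i x\<bar>)" by simp
  also have "\<dots> <= h * (sqrt a * sqrt (lint ?M (%x. (g i x)\<^sup>2)))"
   using integral_abs_le[OF open_triangle_finite g[of i]] h0 unfolding measure_space_open_triangle
   by (intro mult_left_mono) (auto simp: a_def A_def)
  finally show ?thesis .
 qed
 have "edge_mean p q r v g - mean_on A v = (\<Sum>i\<in>UNIV. lint ?M (%x. (x - p) $ i * g i x)) / (2 * a)"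
  unfolding edge_mean_def edge_mean_integrand(4)[OF v g]
  unfolding A_def[symmetric] a_def[symmetric] by (simp add: add_divide_distrib)
 then have "\<bar>edge_mean p q r v g - mean_on A v\<bar> = \<bar>\<Sum>i\<in>UNIV. lint ?M (%x. (x - p) $ i * g i x)\<bar> / (2 * a)"
  using a by (simp add: abs_divide)
 also have "\<dots> <= (\<Sum>i\<in>UNIV. h * (sqrt a * sqrt (lint ?M (%x. (g i x)\<^sup>2)))) / (2 * a)"
  using a by (intro divide_right_mono order_trans[OF sum_abs sum_mono] b) auto
 also have "\<dots> = (h * sqrt a / (2 * a)) * (\<Sum>i\<in>UNIV. sqrt (lint ?M (%x. (g i x)\<^sup>2)))"
  by (simp add: sum_distrib_left[symmetric] mult.assoc)
 also have "h * sqrt a / (2 * a) = h / (2 * sqrt a)"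
 proof -
  have "h * t / (2 * (t * t)) = h / (2 * t)" if "0 < t" for t :: real using that by simp
  from this[of "sqrt a"] show ?thesis using a by simp
 qed
 finally show ?thesis unfolding a_def .
qed

definition step_bound :: real where
 "step_bound = (SOME B. 0 < B \<and> (\<forall>t. \<bar>smooth_step_deriv t\<bar> <= B))"

lemma step_bound: "0 < step_bound" "\<forall>t. \<bar>smooth_step_deriv t\<bar> <= step_bound"
 using someI_ex[OF smooth_step_deriv_bounded] unfolding step_bound_def by blast+

lemma hardy_vertex_weight:
 assumes n: "noncollinear p q r" and s: "0 < s" "s <= 1" and K: "0 <= K"
  and u: "campanato_at p q r s K u" "campanato_at q r p s K u" "campanato_at r p q s K u"
 defines "A \<equiv> open_triangle p q r"
 shows "integrable (leb A) (%x. \<bar>u x - mean_on A u\<bar> * vertex_weight p q r x)"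
  "lint (leb A) (%x. \<bar>u x - mean_on A u\<bar> * vertex_weight p q r x) <= 3 * hardy_const s * sqrt (measure lebesgue A) * sqrt K"
proof -
 note n2 = noncollinear_rotate[OF n] note n3 = noncollinear_rotate[OF n2]
 have rot: "open_triangle q r p = A" "open_triangle r p q = A" unfolding A_def using open_triangle_rotate by metis+
 note h1 = hardy_corner[OF n s K u(1), folded A_def]
 note h2 = hardy_corner[OF n2 s K u(2), unfolded rot]
 note h3 = hardy_corner[OF n3 s K u(3), unfolded rot]
 have eq: "(%x. \<bar>u x - mean_on A u\<bar> * vertex_weight p q r x) = (%x. \<bar>u x - mean_on A u\<bar> / (1 - bary p q r x)
   + \<bar>u x - mean_on A u\<bar> / (1 - bary q r p x) + \<bar>u x - mean_on A u\<bar> / (1 - bary r p q x))"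
  by (rule ext) (simp add: vertex_weight_def distrib_left)
 show "integrable (leb A) (%x. \<bar>u x - mean_on A u\<bar> * vertex_weight p q r x)"
  unfolding eq by (intro Bintegrable_add h1(1) h2(1) h3(1))
 have "lint (leb A) (%x. \<bar>u x - mean_on A u\<bar> * vertex_weight p q r x) =
   lint (leb A) (%x. \<bar>u x - mean_on A u\<bar> / (1 - bary p q r x)) +
   lint (leb A) (%x. \<bar>u x - mean_on A u\<bar> / (1 - bary q r p x)) +
   lint (leb A) (%x. \<bar>u x - mean_on A u\<bar> / (1 - bary r p q x))"
  unfolding eq by (simp only: Bintegral_add Bintegrable_add h1(1) h2(1) h3(1))
 then show "lint (leb A) (%x. \<bar>u x - mean_on A u\<bar> * vertex_weight p q r x) <= 3 * hardy_const s * sqrt (measure lebesgue A) * sqrt K"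
  using h1(2) h2(2) h3(2) by linarith
qed

text \<open>Here \<open>m\<close> is the mean over the triangle and \<open>dp\<close>,
  \<open>dq\<close>, \<open>dr\<close> are the deviations from it of the means over the opposite
  edges. Near an open edge only the step of its own weight is on, so the value there is the mean
  over that edge.\<close>

definition companion :: "point => point => point => real => real => real => real => scalar_field" where
 "companion p q r m dp dq dr x = m + (dp * smooth_step (edge_weight p q r x)
   + (dq * smooth_step (edge_weight q r p x) + dr * smooth_step (edge_weight r p q x)))"

lemma smooth_on_companion:
 assumes n: "noncollinear p q r" and U: "open U" "!!x. x \<in> U ==> bary_pairs p q r x ~= 0"
 shows "smooth_on U (companion p q r m dp dq dr)"
proof -
 note n2 = noncollinear_rotate[OF n] note n3 = noncollinear_rotate[OF n2]
 have "bary_pairs q r p x ~= 0" "bary_pairs r p q x ~= 0" if "x \<in> U" for x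
  using U(2)[OF that] by (auto simp: bary_pairs_def algebra_simps)
 then show ?thesis unfolding companion_def
  by (intro smooth_on_add smooth_on_mult smooth_on_const smooth_on_step smooth_on_edge_weight n n2 n3 U) auto
qed

text \<open>Both bounds are proportional to the deviations and free of \<open>m\<close>; by
  \<open>edge_mean_minus_mean_le\<close> the deviations are controlled by the gradient of v.\<close>

lemma companion_bounds:
 assumes n: "noncollinear p q r" and x: "x \<in> open_triangle p q r"
  and g: "norm (bary_grad p q r) <= \<gamma>" "norm (bary_grad q r p) <= \<gamma>" "norm (bary_grad r p q) <= \<gamma>"
 shows "\<bar>companion p q r m dp dq dr x - m\<bar> <= \<bar>dp\<bar> + \<bar>dq\<bar> + \<bar>dr\<bar>"
  "\<bar>partial i (companion p q r m dp dq dr) x\<bar> <= (\<bar>dp\<bar> + \<bar>dq\<bar> + \<bar>dr\<bar>) * (step_bound * (9 * \<gamma> * vertex_weight p q r x))"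
proof -
 note n2 = noncollinear_rotate[OF n] note n3 = noncollinear_rotate[OF n2]
 have x2: "x \<in> open_triangle q r p" "x \<in> open_triangle r p q" using x open_triangle_rotate by metis+
 have w2: "vertex_weight q r p x = vertex_weight p q r x" "vertex_weight r p q x = vertex_weight p q r x"
  using vertex_weight_rotate by metis+
 have st: "\<bar>d * smooth_step t\<bar> <= \<bar>d\<bar>" for d t
  using smooth_step_nonneg[of t] smooth_step_le_1[of t] by (simp add: abs_mult mult_left_le)
 show "\<bar>companion p q r m dp dq dr x - m\<bar> <= \<bar>dp\<bar> + \<bar>dq\<bar> + \<bar>dr\<bar>"
  unfolding companion_def using st[of dp "edge_weight p q r x"] st[of dq "edge_weight q r p x"] st[of dr "edge_weight r p q x"] by linarith
 have D: "edge_weight p q r differentiable at x" "edge_weight q r p differentiable at x" "edge_weight r p q differentiable at x"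
 proof -
  have "smooth_on (open_triangle p q r) (edge_weight p q r)" "smooth_on (open_triangle q r p) (edge_weight q r p)" "smooth_on (open_triangle r p q) (edge_weight r p q)"
   using smooth_on_edge_weight[OF n open_open_triangle] smooth_on_edge_weight[OF n2 open_open_triangle] smooth_on_edge_weight[OF n3 open_open_triangle]
    bary_pairs_pos[OF n] bary_pairs_pos[OF n2] bary_pairs_pos[OF n3] by (metis less_irrefl)+
  then show "edge_weight p q r differentiable at x" "edge_weight q r p differentiable at x" "edge_weight r p q differentiable at x"
   using x x2 smooth_on_differentiable by blast+
 qed
 have G: "(%x. smooth_step (b x)) differentiable at x" "partial i (%x. smooth_step (b x)) x = smooth_step_deriv (b x) * partial i b x"
  if "b differentiable at x" for b
  using partial_compose[OF smooth_step_DERIV that] by auto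
 have GD: "(%x. d * smooth_step (b x)) differentiable at x" "partial i (%x. d * smooth_step (b x)) x = d * (smooth_step_deriv (b x) * partial i b x)"
  if "b differentiable at x" for b d
  using partial_mult[OF differentiable_const G(1)[OF that], of i d] G[OF that]
  by (auto simp: partial_const intro: derivative_intros)
 have bd: "\<bar>d * (smooth_step_deriv t * z)\<bar> <= \<bar>d\<bar> * (step_bound * Z)" if "\<bar>z\<bar> <= Z" for d t z Z
 proof -
  have "\<bar>smooth_step_deriv t\<bar> * \<bar>z\<bar> <= step_bound * Z" using that step_bound by (intro mult_mono) auto
  then show ?thesis by (simp add: abs_mult mult_left_mono)
 qed
 have "partial i (companion p q r m dp dq dr) x = dp * (smooth_step_deriv (edge_weight p q r x) * partial i (edge_weight p q r) x)
   + (dq * (smooth_step_deriv (edge_weight q r p x) * partial i (edge_weight q r p) x) + dr * (smooth_step_deriv (edge_weight r p q x) * partial i (edge_weight r p q) x))"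
  unfolding companion_def[abs_def]
  by (simp only: partial_add partial_const GD[OF D(1)] GD[OF D(2)] GD[OF D(3)] differentiable_const differentiable_add add_0_left)
 moreover have "\<bar>partial i (edge_weight p q r) x\<bar> <= 9 * \<gamma> * vertex_weight p q r x" by (rule partial_edge_weight_le[OF n x g])
 moreover have "\<bar>partial i (edge_weight q r p) x\<bar> <= 9 * \<gamma> * vertex_weight p q r x" using partial_edge_weight_le[OF n2 x2(1) g(2,3,1)] unfolding w2 .
 moreover have "\<bar>partial i (edge_weight r p q) x\<bar> <= 9 * \<gamma> * vertex_weight p q r x" using partial_edge_weight_le[OF n3 x2(2) g(3,1,2)] unfolding w2 .
 ultimately have "\<bar>partial i (companion p q r m dp dq dr) x\<bar> <= \<bar>dp\<bar> * (step_bound * (9 * \<gamma> * vertex_weight p q r x))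
   + (\<bar>dq\<bar> * (step_bound * (9 * \<gamma> * vertex_weight p q r x)) + \<bar>dr\<bar> * (step_bound * (9 * \<gamma> * vertex_weight p q r x)))"
  by (simp only:) (intro order_trans[OF abs_triangle_ineq] add_mono bd; assumption)
 then show "\<bar>partial i (companion p q r m dp dq dr) x\<bar> <= (\<bar>dp\<bar> + \<bar>dq\<bar> + \<bar>dr\<bar>) * (step_bound * (9 * \<gamma> * vertex_weight p q r x))"
  by (simp add: distrib_right)
qed

text \<open>The source of the asymptotic mean zero: the cutoffs change the edge mean of the
  companion only near the end points, and this effect vanishes in the limit.\<close>

lemma edge_cutoff_tendsto:
 assumes n: "noncollinear p q r" and W: "finite W" "W \<inter> tri p q r \<subseteq> {p, q, r}"
 shows "(%n. LINT t:{0..1}|lborel. vertex_cutoff W n (linepath q r t) * M) \<longlonglongrightarrow> M"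
proof -
 have "(%n. LINT t:{0..1}|lborel. vertex_cutoff W n (linepath q r t) * M) \<longlonglongrightarrow> (LINT t:{0..1::real}|lborel. M)"
  unfolding set_lebesgue_integral_def
 proof (rule integral_dominated_convergence[where w="%t::real. ind {0..1} t *\<^sub>R \<bar>M\<bar>"])
  show "integrable lborel (%t::real. ind {0..1} t *\<^sub>R \<bar>M\<bar>)" by (intro integrable_scaleR_left integrable_real_indicator) auto
  have "continuous_on UNIV (%t. vertex_cutoff W n (linepath q r t))" for n
   using continuous_on_compose2[OF smooth_on_continuous_on[OF smooth_on_vertex_cutoff] continuous_on_linepath] by simp
  then have "(%t. vertex_cutoff W n (linepath q r t)) \<in> borel_measurable borel" for n by (rule borel_measurable_continuous_onI)
  then show "(%t. ind {0..1} t *\<^sub>R (vertex_cutoff W n (linepath q r t) * M)) \<in> borel_measurable lborel" for n by simp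
  show "(%t::real. ind {0..1} t *\<^sub>R M) \<in> borel_measurable lborel" by simp
  have "AE t in lborel. t ~= (0::real) \<and> t ~= 1" using AE_lborel_singleton[of "0::real"] AE_lborel_singleton[of "1::real"] by eventually_elim simp
  then show "AE t in lborel. (%n. ind {0..1} t *\<^sub>R (vertex_cutoff W n (linepath q r t) * M)) \<longlonglongrightarrow> ind {0..1} t *\<^sub>R M"
  proof eventually_elim
   case (elim t)
   show ?case
   proof (cases "t \<in> {0..1}")
    case True
    then have t: "0 < t" "t < 1" using elim by auto
    \<comment> \<open>The barycentric coordinates of an inner point of the edge show that it is none
      of the three vertices, hence no vertex of W.\<close>
    have e: "linepath q r t = 0 *\<^sub>R p + (1 - t) *\<^sub>R q + t *\<^sub>R r" by (simp add: linepath_def)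
    have lam: "bary p q r (linepath q r t) = 0" "bary q r p (linepath q r t) = 1 - t" "bary r p q (linepath q r t) = t"
     using bary_unique[OF n _ e] bary_unique[OF noncollinear_rotate[OF n], of "1 - t" t 0 "linepath q r t"]
      bary_unique[OF noncollinear_rotate[OF noncollinear_rotate[OF n]], of t 0 "1 - t" "linepath q r t"] by (auto simp: linepath_def)
    have "linepath q r t \<in> tri p q r" unfolding triangle_eq_bary(1)[OF n] using lam t by simp
    moreover have "linepath q r t ~= p" using lam(1) bary_vertex(1)[OF n] by auto
    moreover have "linepath q r t ~= q" using lam(2) bary_vertex(1)[OF noncollinear_rotate[OF n]] t by auto
    moreover have "linepath q r t ~= r" using lam(3) bary_vertex(1)[OF noncollinear_rotate[OF noncollinear_rotate[OF n]]] t by auto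
    ultimately have "linepath q r t \<notin> W" using W(2) by blast
    from vertex_cutoff_eventually_1[OF W(1) this, of 1]
    have "\<forall>\<^sub>F n in sequentially. vertex_cutoff W n (linepath q r t) = 1" by eventually_elim simp
    then have "(%n. vertex_cutoff W n (linepath q r t)) \<longlonglongrightarrow> 1" by (rule tendsto_eventually)
    then have "(%n. ind {0..1} t *\<^sub>R (vertex_cutoff W n (linepath q r t) * M)) \<longlonglongrightarrow> ind {0..1} t *\<^sub>R (1 * M)"
     by (intro tendsto_intros)
    then show ?thesis by simp
   qed simp
  qed
  show "AE t in lborel. norm (ind {0..1} t *\<^sub>R (vertex_cutoff W n (linepath q r t) * M)) <= ind {0..1} t *\<^sub>R \<bar>M\<bar>" for n
  proof (rule AE_I2)
   fix t :: real
   have "\<bar>vertex_cutoff W n (linepath q r t)\<bar> * \<bar>M\<bar> <= 1 * \<bar>M\<bar>"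
    using vertex_cutoff_bounds[of W n "linepath q r t"] by (intro mult_right_mono) auto
   then show "norm (ind {0..1} t *\<^sub>R (vertex_cutoff W n (linepath q r t) * M)) <= ind {0..1} t *\<^sub>R \<bar>M\<bar>"
    by (simp add: abs_mult mult_left_mono)
  qed
 qed
 then show ?thesis by (simp add: set_integral_const)
qed

text \<open>Replacing tau by its deviation from its mean costs that mean times the integral of g -
  grad E_k, which tends to zero by the convergence of the edge means. The remaining terms converge
  to expressions in the companion without cutoffs, and only these are estimated; therefore neither
  \<open>m\<close> nor W appears in the bound.\<close>

lemma triangle_local_limit:
 assumes n: "noncollinear p q r" and s: "0 < s" "s <= 1"
  and W: "finite W" "W \<inter> tri p q r \<subseteq> {p, q, r}"
  and h: "\<forall>x\<in>tri p q r. \<forall>y\<in>tri p q r. norm (x - y) <= h"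
  and K: "!!i. 0 <= K i"
  and tau: "!!i. campanato_at p q r s (K i) (\<tau> i)" "!!i. campanato_at q r p s (K i) (\<tau> i)" "!!i. campanato_at r p q s (K i) (\<tau> i)"
  and v: "sq_int (leb (open_triangle p q r)) v"
  and g: "!!i. sq_int (leb (open_triangle p q r)) (g i)" "!!i. has_weak_partial (open_triangle p q r) i v (g i)"
  and f: "sq_int (leb (open_triangle p q r)) f"
  and E: "!!k. smooth_on UNIV (E k)"
  and EA: "!!k x. x \<in> open_triangle p q r ==> E k x = vertex_cutoff W k x *
    companion p q r m (edge_mean p q r v g - m) (edge_mean q r p v g - m) (edge_mean r p q v g - m) x"
  and Ee: "!!k t. t \<in> {0..1} ==> E k (linepath q r t) = vertex_cutoff W k (linepath q r t) * edge_mean p q r v g"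
    "!!k t. t \<in> {0..1} ==> E k (linepath r p t) = vertex_cutoff W k (linepath r p t) * edge_mean q r p v g"
    "!!k t. t \<in> {0..1} ==> E k (linepath p q t) = vertex_cutoff W k (linepath p q t) * edge_mean r p q v g"
  and m: "m = mean_on (open_triangle p q r) v"
 defines "A \<equiv> open_triangle p q r"
 defines "a \<equiv> measure lebesgue A"
 defines "\<Gamma> \<equiv> (\<Sum>i\<in>UNIV. sqrt (lint (leb A) (%x. (g i x)\<^sup>2)))"
 shows "\<exists>L. (%k. lint (leb A) (%x. (\<Sum>i\<in>UNIV. \<tau> i x * (g i x - partial i (E k) x)) - f x * (v x - E k x))) \<longlonglongrightarrow> L \<and>
  \<bar>L\<bar> <= \<Gamma> * ((1 + 21 * step_bound * hardy_const s * (h\<^sup>2 / a)) * (\<Sum>i\<in>UNIV. sqrt (K i)) +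
   (2 * (h\<^sup>2 / sqrt a) + 2 * h) * sqrt (lint (leb A) (%x. (f x)\<^sup>2)))"
proof -
 note n2 = noncollinear_rotate[OF n] note n3 = noncollinear_rotate[OF n2]
 have rot: "open_triangle q r p = A" "open_triangle r p q = A" unfolding A_def using open_triangle_rotate by metis+
 have hull: "tri q r p = tri p q r" "tri r p q = tri p q r" by (simp_all add: insert_commute)
 have Wr: "W \<inter> tri q r p \<subseteq> {q, r, p}" "W \<inter> tri r p q \<subseteq> {r, p, q}" unfolding hull using W(2) by auto
 let ?M = "leb A"
 interpret finite_measure ?M unfolding A_def by (rule open_triangle_finite)
 have Ao: "open A" unfolding A_def by (rule open_open_triangle)
 have Am: "A \<in> sets lebesgue" using Ao by simp
 have a: "0 < a" unfolding a_def A_def by (rule measure_open_triangle_pos[OF n])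
 have inH: "p \<in> tri p q r" "q \<in> tri p q r" "r \<in> tri p q r" by (auto intro: hull_inc)
 have h0: "0 <= h" using h inH by (metis norm_ge_zero order_trans)
 \<comment> \<open>A barycentric gradient has the length of the opposite edge divided by twice the
   area.\<close>
 define \<gamma> where "\<gamma> = h / (2 * a)"
 have aD: "\<bar>cross2 (q - p) (r - p)\<bar> = 2 * a" "\<bar>cross2 (r - q) (p - q)\<bar> = 2 * a" "\<bar>cross2 (p - r) (q - r)\<bar> = 2 * a"
  unfolding a_def A_def measure_open_triangle using cross2_rotate[of r q p] cross2_rotate[of p r q] by simp_all
 have gam: "norm (bary_grad p q r) <= \<gamma>" "norm (bary_grad q r p) <= \<gamma>" "norm (bary_grad r p q) <= \<gamma>"
  unfolding norm_bary_grad aD \<gamma>_def using h inH a by (auto intro!: divide_right_mono)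
 have g0: "0 <= \<gamma>" using h0 a by (simp add: \<gamma>_def)
 define dp dq dr where "dp = edge_mean p q r v g - m" and "dq = edge_mean q r p v g - m" and "dr = edge_mean r p q v g - m"
 define e where "e = companion p q r m dp dq dr"
 define dd where "dd = \<bar>dp\<bar> + \<bar>dq\<bar> + \<bar>dr\<bar>"
 define H where "H = hardy_const s"
 have vA: "sq_int ?M v" and gA: "!!i. sq_int ?M (g i)" and fA: "sq_int ?M f"
  using v g f by (auto simp: A_def)
 have tA: "sq_int ?M (\<tau> i)" for i using tau(1)[of i] by (simp add: campanato_at_def A_def)
 have G0: "0 <= \<Gamma>" unfolding \<Gamma>_def by (intro sum_nonneg) simp
 have dle: "dd <= 3 * (h / (2 * sqrt a) * \<Gamma>)"
 proof -
  have "\<bar>dp\<bar> <= h / (2 * sqrt a) * \<Gamma>"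
   unfolding dp_def m \<Gamma>_def a_def A_def by (rule edge_mean_minus_mean_le[OF n v g(1) h])
  moreover have "\<bar>dq\<bar> <= h / (2 * sqrt a) * \<Gamma>"
  proof -
   have "sq_int (leb (open_triangle q r p)) v" "!!i. sq_int (leb (open_triangle q r p)) (g i)"
    unfolding rot by (rule vA, rule gA)
   from edge_mean_minus_mean_le[OF n2 this] show ?thesis
    unfolding rot hull dq_def m \<Gamma>_def a_def using h by (simp only: A_def simp_thms)
  qed
  moreover have "\<bar>dr\<bar> <= h / (2 * sqrt a) * \<Gamma>"
  proof -
   have "sq_int (leb (open_triangle r p q)) v" "!!i. sq_int (leb (open_triangle r p q)) (g i)"
    unfolding rot by (rule vA, rule gA)
   from edge_mean_minus_mean_le[OF n3 this] show ?thesis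
    unfolding rot hull dr_def m \<Gamma>_def a_def using h by (simp only: A_def simp_thms)
  qed
  ultimately show ?thesis unfolding dd_def by linarith
 qed
 have esm: "smooth_on A e" unfolding e_def
 proof (rule smooth_on_companion[OF n Ao])
  fix x assume "x \<in> A"
  then show "bary_pairs p q r x ~= 0" using bary_pairs_pos[OF n, of x] by (simp add: A_def)
 qed
 have eb: "\<bar>e x - m\<bar> <= dd" "\<bar>partial i e x\<bar> <= dd * (step_bound * (9 * \<gamma> * vertex_weight p q r x))"
  if x: "x \<in> A" for x i
  unfolding e_def dd_def by (rule companion_bounds[OF n x[unfolded A_def] gam])+
 have EAe: "E k x = vertex_cutoff W k x * e x" if "x \<in> A" for k x
  using EA[of x k] that unfolding A_def e_def dp_def dq_def dr_def .
 have pE: "partial i (E k) x = vertex_cutoff W k x * partial i e x + partial i (vertex_cutoff W k) x * e x" if x: "x \<in> A" for i k x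
 proof -
  have "partial i (E k) x = partial i (%x. vertex_cutoff W k x * e x) x"
   by (rule partial_cong_open(1)[OF Ao x]) (rule EAe)
  then show ?thesis
   using partial_mult[OF smooth_on_differentiable[OF smooth_on_vertex_cutoff UNIV_I] smooth_on_differentiable[OF esm x]] by (rule trans)
 qed
 have AW: "x \<notin> W" if x: "x \<in> A" for x
 proof
  assume "x \<in> W"
  have "x \<in> tri p q r" using x interior_subset unfolding A_def open_triangle_def by blast
  then have "x = p \<or> x = q \<or> x = r" using \<open>x \<in> W\<close> W(2) by blast
  then show False using triangle_bounds(4-6)[OF n x[unfolded A_def]] bary_vertex(1)[OF n] bary_vertex(1)[OF n2] bary_vertex(1)[OF n3] by auto
 qed
 have lim_pt: "(%k. E k x) \<longlonglongrightarrow> e x" "(%k. partial i (E k) x) \<longlonglongrightarrow> partial i e x" if x: "x \<in> A" for i x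
 proof -
  from vertex_cutoff_eventually_1[OF W(1) AW[OF x], of i]
  have "\<forall>\<^sub>F k in sequentially. E k x = e x" "\<forall>\<^sub>F k in sequentially. partial i (E k) x = partial i e x"
   by (eventually_elim, simp add: EAe[OF x] pE[OF x])+
  then show "(%k. E k x) \<longlonglongrightarrow> e x" "(%k. partial i (E k) x) \<longlonglongrightarrow> partial i e x" by (auto intro: tendsto_eventually)
 qed
 obtain C where C: "0 <= C" "!!x. x \<in> open_triangle p q r ==> (\<Sum>w\<in>W. 1 / norm (x - w)) <= C * vertex_weight p q r x"
  using sum_inverse_distance_le[OF n W] by metis
 \<comment> \<open>The first term comes from the gradient of the companion, the second from the
   gradient of the cutoff times the companion. It contains m and the mesh-dependent C, which is
   harmless because D only dominates.\<close>
 define D where "D = dd * (step_bound * (9 * \<gamma>)) + 2 * step_bound * C * (\<bar>m\<bar> + dd)"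
 have dd0: "0 <= dd" by (simp add: dd_def)
 have eabs: "\<bar>e x\<bar> <= \<bar>m\<bar> + dd" if "x \<in> A" for x using eb(1)[OF that] by linarith
 have w3: "3 <= vertex_weight p q r x" if "x \<in> A" for x using inverse_bary_pairs_le(2)[OF n] that by (simp add: A_def)
 have Ebd: "\<bar>E k x\<bar> <= \<bar>m\<bar> + dd" if x: "x \<in> A" for k x
 proof -
  have "\<bar>vertex_cutoff W k x\<bar> * \<bar>e x\<bar> <= 1 * (\<bar>m\<bar> + dd)" using vertex_cutoff_bounds[of W k x] eabs[OF x] by (intro mult_mono) auto
  then show ?thesis by (simp add: EAe[OF x] abs_mult)
 qed
 have pEbd: "\<bar>partial i (E k) x\<bar> <= D * vertex_weight p q r x" if x: "x \<in> A" for i k x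
 proof -
  have "\<bar>vertex_cutoff W k x * partial i e x\<bar> <= dd * (step_bound * (9 * \<gamma> * vertex_weight p q r x))"
  proof -
   have "\<bar>vertex_cutoff W k x\<bar> * \<bar>partial i e x\<bar> <= 1 * (dd * (step_bound * (9 * \<gamma> * vertex_weight p q r x)))"
    using vertex_cutoff_bounds[of W k x] eb(2)[OF x, of i] by (intro mult_mono) auto
   then show ?thesis by (simp add: abs_mult)
  qed
  moreover have "\<bar>partial i (vertex_cutoff W k) x * e x\<bar> <= (2 * step_bound * (C * vertex_weight p q r x)) * (\<bar>m\<bar> + dd)"
  proof -
   have "\<bar>partial i (vertex_cutoff W k) x\<bar> <= (\<Sum>w\<in>W. 2 * step_bound / norm (x - w))"
    by (rule partial_vertex_cutoff_le[OF step_bound(2) W(1) AW[OF x]])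
   also have "\<dots> = 2 * step_bound * (\<Sum>w\<in>W. 1 / norm (x - w))" by (simp add: sum_distrib_left)
   also have "\<dots> <= 2 * step_bound * (C * vertex_weight p q r x)"
    using C(2) x step_bound(1) by (intro mult_left_mono) (auto simp: A_def)
   finally have "\<bar>partial i (vertex_cutoff W k) x\<bar> * \<bar>e x\<bar> <= (2 * step_bound * (C * vertex_weight p q r x)) * (\<bar>m\<bar> + dd)"
   proof (rule mult_mono)
    show "0 <= 2 * step_bound * (C * vertex_weight p q r x)"
     using C(1) w3[OF x] step_bound(1) by (intro mult_nonneg_nonneg) auto
   qed (use eabs[OF x] in auto)
   then show ?thesis by (simp add: abs_mult)
  qed
  ultimately have "\<bar>partial i (E k) x\<bar> <= dd * (step_bound * (9 * \<gamma> * vertex_weight p q r x)) + (2 * step_bound * (C * vertex_weight p q r x)) * (\<bar>m\<bar> + dd)"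
   unfolding pE[OF x] by linarith
  also have "\<dots> = D * vertex_weight p q r x" by (simp add: D_def algebra_simps)
  finally show ?thesis .
 qed
 define tm where "tm i = mean_on A (\<tau> i)" for i
 have hw: "integrable ?M (%x. \<bar>\<tau> i x - tm i\<bar> * vertex_weight p q r x)"
   "lint ?M (%x. \<bar>\<tau> i x - tm i\<bar> * vertex_weight p q r x) <= 3 * H * sqrt a * sqrt (K i)" for i
  using hardy_vertex_weight[OF n s K tau] unfolding A_def[symmetric] a_def[symmetric] tm_def H_def by auto
 have Esq: "sq_int ?M (E k)" and pEsq: "sq_int ?M (partial i (E k))" for i k
  unfolding A_def by (rule smooth_sq_int[OF E], rule smooth_sq_int[OF smooth_on_partial[OF E]])
 have em: "e \<in> borel_measurable ?M" and pem: "partial i e \<in> borel_measurable ?M" for i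
 proof -
  have "continuous_on A e" "continuous_on A (partial i e)"
   using smooth_on_continuous_on[OF esm] smooth_on_continuous_on[OF smooth_on_partial[OF esm]] by auto
  then show "e \<in> borel_measurable ?M" "partial i e \<in> borel_measurable ?M"
   by (auto intro: continuous_imp_measurable_on_sets_lebesgue Am)
 qed
 have tmm: "sq_int ?M (%x. \<tau> i x - tm i)" for i
  by (rule sq_int_diff[OF tA sq_int_bounded[OF finite_measure_axioms, of _ "\<bar>tm i\<bar>"]]) auto
 \<comment> \<open>Pointwise the cutoff terms die out; the Hardy inequality provides the integrable
   majorant although the gradients are of order 1/r at the vertices.\<close>
 have lim1: "(%k. lint ?M (%x. (\<tau> i x - tm i) * partial i (E k) x)) \<longlonglongrightarrow> lint ?M (%x. (\<tau> i x - tm i) * partial i e x)" for i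
 proof (rule integral_dominated_convergence[where w="%x. D * (\<bar>\<tau> i x - tm i\<bar> * vertex_weight p q r x)"])
  show "(%x. (\<tau> i x - tm i) * partial i e x) \<in> borel_measurable ?M"
   by (intro borel_measurable_times sq_int_measurable[OF tmm] pem)
  show "(%x. (\<tau> i x - tm i) * partial i (E k) x) \<in> borel_measurable ?M" for k
   by (intro borel_measurable_times sq_int_measurable[OF tmm] sq_int_measurable[OF pEsq])
  show "integrable ?M (%x. D * (\<bar>\<tau> i x - tm i\<bar> * vertex_weight p q r x))" by (rule integrable_mult_right[OF hw(1)])
  show "AE x in ?M. (%k. (\<tau> i x - tm i) * partial i (E k) x) \<longlonglongrightarrow> (\<tau> i x - tm i) * partial i e x"
   using lim_pt(2) by (intro AE_I2 tendsto_mult tendsto_const) auto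
  show "AE x in ?M. norm ((\<tau> i x - tm i) * partial i (E k) x) <= D * (\<bar>\<tau> i x - tm i\<bar> * vertex_weight p q r x)" for k
  proof (rule AE_I2)
   fix x assume "x \<in> space ?M"
   then have x: "x \<in> A" by simp
   have "\<bar>\<tau> i x - tm i\<bar> * \<bar>partial i (E k) x\<bar> <= \<bar>\<tau> i x - tm i\<bar> * (D * vertex_weight p q r x)"
    by (rule mult_left_mono[OF pEbd[OF x]]) simp
   then show "norm ((\<tau> i x - tm i) * partial i (E k) x) <= D * (\<bar>\<tau> i x - tm i\<bar> * vertex_weight p q r x)"
    by (simp add: abs_mult mult_ac)
  qed
 qed
 \<comment> \<open>Mean gradients are combinations of edge means, for E k as well as for v, and the
   edge means of E k tend to those of v.\<close>
 have lim2: "(%k. lint ?M (partial i (E k))) \<longlonglongrightarrow> lint ?M (g i)" for i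
 proof -
  have E1: "(%k. edge_mean p q r (E k) (%i. partial i (E k))) \<longlonglongrightarrow> edge_mean p q r v g"
  proof -
   have "edge_mean p q r (E k) (%i. partial i (E k)) = (LINT t:{0..1}|lborel. vertex_cutoff W k (linepath q r t) * edge_mean p q r v g)" for k
    unfolding edge_mean_smooth[OF n E] by (rule set_lebesgue_integral_cong) (simp_all add: Ee(1))
   then show ?thesis using edge_cutoff_tendsto[OF n W] by simp
  qed
  have E2: "(%k. edge_mean q r p (E k) (%i. partial i (E k))) \<longlonglongrightarrow> edge_mean q r p v g"
  proof -
   have "edge_mean q r p (E k) (%i. partial i (E k)) = (LINT t:{0..1}|lborel. vertex_cutoff W k (linepath r p t) * edge_mean q r p v g)" for k
    unfolding edge_mean_smooth[OF n2 E] by (rule set_lebesgue_integral_cong) (simp_all add: Ee(2))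
   then show ?thesis using edge_cutoff_tendsto[OF n2 W(1) Wr(1)] by simp
  qed
  have E3: "(%k. edge_mean r p q (E k) (%i. partial i (E k))) \<longlonglongrightarrow> edge_mean r p q v g"
  proof -
   have "edge_mean r p q (E k) (%i. partial i (E k)) = (LINT t:{0..1}|lborel. vertex_cutoff W k (linepath p q t) * edge_mean r p q v g)" for k
    unfolding edge_mean_smooth[OF n3 E] by (rule set_lebesgue_integral_cong) (simp_all add: Ee(3))
   then show ?thesis using edge_cutoff_tendsto[OF n3 W(1) Wr(2)] by simp
  qed
  have I: "lint ?M (partial i (E k)) = - 2 * a *
    (bary_grad p q r $ i * edge_mean p q r (E k) (%i. partial i (E k)) + bary_grad q r p $ i * edge_mean q r p (E k) (%i. partial i (E k))
    + bary_grad r p q $ i * edge_mean r p q (E k) (%i. partial i (E k)))" for k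
   unfolding a_def A_def
   by (rule integral_gradient_eq_edge_means[OF n, of "E k" "%i. partial i (E k)"])
    (rule smooth_sq_int[OF E] smooth_sq_int[OF smooth_on_partial[OF E]])+
  have J: "lint ?M (g i) = - 2 * a * (bary_grad p q r $ i * edge_mean p q r v g + bary_grad q r p $ i * edge_mean q r p v g + bary_grad r p q $ i * edge_mean r p q v g)"
   unfolding a_def A_def by (rule integral_gradient_eq_edge_means[OF n v g(1)])
  show ?thesis unfolding I J by (intro tendsto_intros E1 E2 E3)
 qed
 have fi: "integrable ?M f" by (rule sq_int_integrable[OF finite_measure_axioms fA])
 have lim3: "(%k. lint ?M (%x. f x * E k x)) \<longlonglongrightarrow> lint ?M (%x. f x * e x)"
 proof (rule integral_dominated_convergence[where w="%x. (\<bar>m\<bar> + dd) * \<bar>f x\<bar>"])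
  show "(%x. f x * e x) \<in> borel_measurable ?M" by (intro borel_measurable_times sq_int_measurable[OF fA] em)
  show "(%x. f x * E k x) \<in> borel_measurable ?M" for k
   by (intro borel_measurable_times sq_int_measurable[OF fA] sq_int_measurable[OF Esq])
  show "integrable ?M (%x. (\<bar>m\<bar> + dd) * \<bar>f x\<bar>)" using fi by (intro integrable_mult_right integrable_abs)
  show "AE x in ?M. (%k. f x * E k x) \<longlonglongrightarrow> f x * e x"
   using lim_pt(1) by (intro AE_I2 tendsto_mult tendsto_const) auto
  show "AE x in ?M. norm (f x * E k x) <= (\<bar>m\<bar> + dd) * \<bar>f x\<bar>" for k
  proof (rule AE_I2)
   fix x assume "x \<in> space ?M"
   then have "\<bar>f x\<bar> * \<bar>E k x\<bar> <= \<bar>f x\<bar> * (\<bar>m\<bar> + dd)" using Ebd by (intro mult_left_mono) auto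
   then show "norm (f x * E k x) <= (\<bar>m\<bar> + dd) * \<bar>f x\<bar>" by (simp add: abs_mult mult.commute)
  qed
 qed
 have esq: "sq_int ?M e"
  by (rule sq_int_bounded[OF finite_measure_axioms em]) (use eabs in simp)
 have tgi: "integrable ?M (%x. \<tau> i x * g i x)" and tmi: "integrable ?M (%x. (\<tau> i x - tm i) * g i x)" for i
  by (rule sq_int_mult[OF tA gA], rule sq_int_mult[OF tmm gA])
 have gi: "integrable ?M (g i)" for i by (rule sq_int_integrable[OF finite_measure_axioms gA])
 define J where "J i = lint ?M (%x. (\<tau> i x - tm i) * g i x)" for i
 define Z where "Z i = lint ?M (%x. (\<tau> i x - tm i) * partial i e x)" for i
 define L where "L = (\<Sum>i\<in>UNIV. J i - Z i) - (lint ?M (%x. f x * v x) - lint ?M (%x. f x * e x))"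
 \<comment> \<open>The mean of tau is split off; it multiplies a difference of mean gradients that
   tends to zero by \<open>lim2\<close>.\<close>
 have T: "lint ?M (%x. (\<Sum>i\<in>UNIV. \<tau> i x * (g i x - partial i (E k) x)) - f x * (v x - E k x)) =
   (\<Sum>i\<in>UNIV. J i - lint ?M (%x. (\<tau> i x - tm i) * partial i (E k) x) + tm i * (lint ?M (g i) - lint ?M (partial i (E k))))
   - (lint ?M (%x. f x * v x) - lint ?M (%x. f x * E k x))" for k
 proof -
  have pi: "integrable ?M (partial i (E k))" for i by (rule sq_int_integrable[OF finite_measure_axioms pEsq])
  have tpi: "integrable ?M (%x. (\<tau> i x - tm i) * partial i (E k) x)" for i by (rule sq_int_mult[OF tmm pEsq])
  have fv: "integrable ?M (%x. f x * v x)" "integrable ?M (%x. f x * E k x)"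
   by (rule sq_int_mult[OF fA vA], rule sq_int_mult[OF fA Esq])
  have "(%x. (\<Sum>i\<in>UNIV. \<tau> i x * (g i x - partial i (E k) x)) - f x * (v x - E k x)) =
   (%x. (\<Sum>i\<in>UNIV. (\<tau> i x - tm i) * g i x - (\<tau> i x - tm i) * partial i (E k) x + tm i * (g i x - partial i (E k) x)) - (f x * v x - f x * E k x))"
   by (rule ext) (simp add: algebra_simps)
  moreover have "lint ?M (%x. (\<tau> i x - tm i) * g i x - (\<tau> i x - tm i) * partial i (E k) x + tm i * (g i x - partial i (E k) x)) =
   J i - lint ?M (%x. (\<tau> i x - tm i) * partial i (E k) x) + tm i * (lint ?M (g i) - lint ?M (partial i (E k)))" for i
   unfolding J_def by (simp only: Bintegral_add Bintegral_diff integral_mult_right_zero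
     Bintegrable_diff integrable_mult_right tmi tpi gi pi)
  moreover have "integrable ?M (%x. (\<tau> i x - tm i) * g i x - (\<tau> i x - tm i) * partial i (E k) x + tm i * (g i x - partial i (E k) x))" for i
   by (intro Bintegrable_add Bintegrable_diff integrable_mult_right tmi tpi gi pi)
  ultimately show ?thesis
   by (simp only: Bintegral_diff Bintegral_sum Bintegrable_sum Bintegrable_diff fv)
 qed
 have "(%k. (\<Sum>i\<in>UNIV. J i - lint ?M (%x. (\<tau> i x - tm i) * partial i (E k) x) + tm i * (lint ?M (g i) - lint ?M (partial i (E k))))
   - (lint ?M (%x. f x * v x) - lint ?M (%x. f x * E k x))) \<longlonglongrightarrow>
  (\<Sum>i\<in>UNIV. J i - Z i + tm i * (lint ?M (g i) - lint ?M (g i))) - (lint ?M (%x. f x * v x) - lint ?M (%x. f x * e x))"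
  unfolding Z_def by (intro tendsto_intros lim1 lim2 lim3)
 then have conv: "(%k. lint ?M (%x. (\<Sum>i\<in>UNIV. \<tau> i x * (g i x - partial i (E k) x)) - f x * (v x - E k x))) \<longlonglongrightarrow> L"
  unfolding T L_def by simp
 have gle: "sqrt (lint ?M (%x. (g i x)\<^sup>2)) <= \<Gamma>" for i
  unfolding \<Gamma>_def by (rule member_le_sum) auto
 have Jle: "\<bar>J i\<bar> <= sqrt (K i) * \<Gamma>" for i
 proof -
  have "\<bar>J i\<bar> <= sqrt (lint ?M (%x. (\<tau> i x - tm i)\<^sup>2)) * sqrt (lint ?M (%x. (g i x)\<^sup>2))"
   unfolding J_def by (rule Cauchy_Schwarz_integral[OF tmm gA])
  also have "\<dots> <= sqrt (K i) * \<Gamma>"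
  proof (rule mult_mono[OF real_sqrt_le_mono gle])
   \<comment> \<open>The corner with t = 1 is the whole triangle, so the Campanato condition
     contains the variance bound.\<close>
   have "lint (leb (corner p q r 1)) (%x. (\<tau> i x - mean_on (corner p q r 1) (\<tau> i))\<^sup>2) <= K i * 1 powr (2 * s)"
    by (rule mp[OF spec[OF conjunct2[OF tau(1)[of i, unfolded campanato_at_def]]]]) simp
   then show "lint ?M (%x. (\<tau> i x - tm i)\<^sup>2) <= K i" unfolding corner_1[OF n] tm_def A_def by simp
  qed (use K G0 in auto)
  finally show ?thesis .
 qed
 have Hn: "0 <= H"
 proof -
  have "1 < 2 powr (1 - s/2)" using s by (intro gr_one_powr) auto
  moreover have "2 powr (- s/2) < 1" using s powr_less_mono[of "- s/2" 0 2] by auto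
  ultimately show ?thesis unfolding H_def hardy_const_def by (intro divide_nonneg_nonneg mult_nonneg_nonneg add_nonneg_nonneg) auto
 qed
 have sa: "sqrt a * sqrt a = a" "0 < sqrt a" using a by auto
 have Zle: "\<bar>Z i\<bar> <= 21 * step_bound * H * (h\<^sup>2 / a) * (sqrt (K i) * \<Gamma>)" for i
 proof -
  have "\<bar>Z i\<bar> <= lint ?M (%x. \<bar>(\<tau> i x - tm i) * partial i e x\<bar>)" unfolding Z_def by (rule integral_abs_bound)
  also have "\<dots> <= lint ?M (%x. (dd * (step_bound * (9 * \<gamma>))) * (\<bar>\<tau> i x - tm i\<bar> * vertex_weight p q r x))"
  proof (rule integral_mono_AE')
   show "integrable ?M (%x. (dd * (step_bound * (9 * \<gamma>))) * (\<bar>\<tau> i x - tm i\<bar> * vertex_weight p q r x))" by (rule integrable_mult_right[OF hw(1)])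
   show "AE x in ?M. \<bar>(\<tau> i x - tm i) * partial i e x\<bar> <= (dd * (step_bound * (9 * \<gamma>))) * (\<bar>\<tau> i x - tm i\<bar> * vertex_weight p q r x)"
   proof (rule AE_I2)
    fix x assume "x \<in> space ?M"
    then have "\<bar>\<tau> i x - tm i\<bar> * \<bar>partial i e x\<bar> <= \<bar>\<tau> i x - tm i\<bar> * (dd * (step_bound * (9 * \<gamma> * vertex_weight p q r x)))"
     using eb(2) by (intro mult_left_mono) auto
    then show "\<bar>(\<tau> i x - tm i) * partial i e x\<bar> <= (dd * (step_bound * (9 * \<gamma>))) * (\<bar>\<tau> i x - tm i\<bar> * vertex_weight p q r x)"
     by (simp add: abs_mult mult_ac)
   qed
   show "AE x in ?M. 0 <= (dd * (step_bound * (9 * \<gamma>))) * (\<bar>\<tau> i x - tm i\<bar> * vertex_weight p q r x)"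
   proof (rule AE_I2)
    fix x assume "x \<in> space ?M"
    then have "0 <= vertex_weight p q r x" using w3[of x] by simp
    then show "0 <= (dd * (step_bound * (9 * \<gamma>))) * (\<bar>\<tau> i x - tm i\<bar> * vertex_weight p q r x)"
     using dd0 g0 step_bound(1) by (intro mult_nonneg_nonneg) auto
   qed
  qed
  also have "\<dots> = (dd * (step_bound * (9 * \<gamma>))) * lint ?M (%x. \<bar>\<tau> i x - tm i\<bar> * vertex_weight p q r x)" by simp
  also have "\<dots> <= (dd * (step_bound * (9 * \<gamma>))) * (3 * H * sqrt a * sqrt (K i))"
   using dd0 g0 step_bound(1) by (intro mult_left_mono hw(2)) auto
  also have "\<dots> <= (3 * (h / (2 * sqrt a) * \<Gamma>) * (step_bound * (9 * \<gamma>))) * (3 * H * sqrt a * sqrt (K i))"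
   using dle g0 step_bound(1) Hn a K by (intro mult_right_mono) auto
  \<comment> \<open>The product 3/2 * 9/2 * 3 = 81/4 collects the deviations, gamma and the three
    vertices; it is rounded up to 21.\<close>
  also have "\<dots> = (81 / 4) * (step_bound * H * (h\<^sup>2 / a) * (sqrt (K i) * \<Gamma>))"
   using sa a by (simp add: \<gamma>_def power2_eq_square field_simps)
  also have "\<dots> <= 21 * (step_bound * H * (h\<^sup>2 / a) * (sqrt (K i) * \<Gamma>))"
   using step_bound(1) Hn a K G0 by (intro mult_right_mono mult_nonneg_nonneg) auto
  finally show ?thesis by (simp add: mult_ac)
 qed
 have Fle: "\<bar>lint ?M (%x. f x * v x) - lint ?M (%x. f x * e x)\<bar> <= sqrt (lint ?M (%x. (f x)\<^sup>2)) * ((2 * (h\<^sup>2 / sqrt a) + 2 * h) * \<Gamma>)"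
 proof -
  let ?nf = "sqrt (lint ?M (%x. (f x)\<^sup>2))"
  have cst: "sq_int ?M (%x. c)" for c by (rule sq_int_bounded[OF finite_measure_axioms, of _ "\<bar>c\<bar>"]) auto
  have vm: "sq_int ?M (%x. v x - m)" by (rule sq_int_diff[OF vA cst])
  have emd: "sq_int ?M (%x. e x - m)" by (rule sq_int_diff[OF esq cst])
  \<comment> \<open>Both v and its companion are compared with the mean m, the first by the Poincare
    inequality, the second by the bound on the deviations.\<close>
  have "lint ?M (%x. f x * (v x - m)) - lint ?M (%x. f x * (e x - m)) = lint ?M (%x. f x * v x) - lint ?M (%x. f x * e x)"
   using sq_int_mult[OF fA vA] sq_int_mult[OF fA esq] fi by (simp add: right_diff_distrib)
  moreover have "\<bar>lint ?M (%x. f x * (v x - m))\<bar> <= ?nf * (2 * (h\<^sup>2 / sqrt a) * \<Gamma>)"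
  proof -
   have "\<bar>lint ?M (%x. f x * (v x - m))\<bar> <= ?nf * sqrt (lint ?M (%x. (v x - m)\<^sup>2))"
    by (rule Cauchy_Schwarz_integral[OF fA vm])
   also have "\<dots> <= ?nf * (2 * (h\<^sup>2 / sqrt a) * \<Gamma>)"
   proof (rule mult_left_mono)
    have hA: "\<forall>x\<in>A. \<forall>y\<in>A. norm (x - y) <= h" using h interior_subset unfolding A_def open_triangle_def by blast
    have Ane: "A ~= {}" using a unfolding a_def by auto
    have "lint ?M (%x. (v x - m)\<^sup>2) <= 4 * h ^ 4 * (\<Sum>i\<in>UNIV. lint ?M (%x. (g i x)\<^sup>2)) / a"
     unfolding m a_def A_def
     by (rule poincare_convex[OF open_open_triangle convex_open_triangle bounded_open_triangle Ane[unfolded A_def] h0 hA[unfolded A_def] v g])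
    also have "(\<Sum>i\<in>UNIV. lint ?M (%x. (g i x)\<^sup>2)) <= \<Gamma>\<^sup>2"
    proof -
     have "(\<Sum>i\<in>UNIV. (sqrt (lint ?M (%x. (g i x)\<^sup>2)))\<^sup>2) <= \<Gamma>\<^sup>2"
      unfolding \<Gamma>_def sum_2 power2_sum by simp
     then show ?thesis by simp
    qed
    finally have "lint ?M (%x. (v x - m)\<^sup>2) <= 4 * h ^ 4 * \<Gamma>\<^sup>2 / a"
     using a by (simp add: divide_right_mono mult_left_mono)
    also have "\<dots> = (2 * (h\<^sup>2 / sqrt a) * \<Gamma>)\<^sup>2"
     using sa a by (simp add: power_mult_distrib power_divide power4_eq_xxxx power2_eq_square)
    finally show "sqrt (lint ?M (%x. (v x - m)\<^sup>2)) <= 2 * (h\<^sup>2 / sqrt a) * \<Gamma>"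
     using G0 a by (intro real_le_lsqrt) auto
   qed simp
   finally show ?thesis .
  qed
  moreover have "\<bar>lint ?M (%x. f x * (e x - m))\<bar> <= ?nf * (2 * h * \<Gamma>)"
  proof -
   have "\<bar>lint ?M (%x. f x * (e x - m))\<bar> <= ?nf * sqrt (lint ?M (%x. (e x - m)\<^sup>2))"
    by (rule Cauchy_Schwarz_integral[OF fA emd])
   also have "\<dots> <= ?nf * (2 * h * \<Gamma>)"
   proof (rule mult_left_mono)
    have "lint ?M (%x. (e x - m)\<^sup>2) <= lint ?M (%x. dd\<^sup>2)"
    proof (rule Bochner_Integration.integral_mono[OF sq_int_square[OF emd]])
     fix x assume "x \<in> space ?M"
     then show "(e x - m)\<^sup>2 <= dd\<^sup>2" using eb(1) dd0 by (intro abs_le_square_iff[THEN iffD1]) auto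
    qed simp
    also have "\<dots> = a * dd\<^sup>2" using measure_space_open_triangle[of p q r] by (simp add: a_def A_def)
    also have "\<dots> = (sqrt a * dd)\<^sup>2" using a by (simp add: power_mult_distrib)
    finally have "sqrt (lint ?M (%x. (e x - m)\<^sup>2)) <= sqrt a * dd" using a dd0 by (intro real_le_lsqrt) auto
    also have "\<dots> <= sqrt a * (3 * (h / (2 * sqrt a) * \<Gamma>))" using dle a by (intro mult_left_mono) auto
    also have "\<dots> = (3 / 2) * (h * \<Gamma>)" using sa(2) by simp
    also have "\<dots> <= 2 * (h * \<Gamma>)" using h0 G0 by (intro mult_right_mono) auto
    finally show "sqrt (lint ?M (%x. (e x - m)\<^sup>2)) <= 2 * h * \<Gamma>" by (simp add: mult.assoc)
   qed simp
   finally show ?thesis .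
  qed
  ultimately have "\<bar>lint ?M (%x. f x * v x) - lint ?M (%x. f x * e x)\<bar> <= ?nf * (2 * (h\<^sup>2 / sqrt a) * \<Gamma>) + ?nf * (2 * h * \<Gamma>)" by linarith
  then show ?thesis by (simp add: algebra_simps)
 qed
 have "\<bar>L\<bar> <= (\<Sum>i\<in>UNIV. (1 + 21 * step_bound * H * (h\<^sup>2 / a)) * (sqrt (K i) * \<Gamma>)) + sqrt (lint ?M (%x. (f x)\<^sup>2)) * ((2 * (h\<^sup>2 / sqrt a) + 2 * h) * \<Gamma>)"
 proof -
  have "\<bar>\<Sum>i\<in>UNIV. J i - Z i\<bar> <= (\<Sum>i\<in>UNIV. (1 + 21 * step_bound * H * (h\<^sup>2 / a)) * (sqrt (K i) * \<Gamma>))"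
  proof (rule order_trans[OF sum_abs sum_mono])
   fix i :: 2
   have "(1 + 21 * step_bound * H * (h\<^sup>2 / a)) * (sqrt (K i) * \<Gamma>) = sqrt (K i) * \<Gamma> + 21 * step_bound * H * (h\<^sup>2 / a) * (sqrt (K i) * \<Gamma>)"
    by (simp only: distrib_right mult_1)
   then show "\<bar>J i - Z i\<bar> <= (1 + 21 * step_bound * H * (h\<^sup>2 / a)) * (sqrt (K i) * \<Gamma>)" using Jle[of i] Zle[of i] by linarith
  qed
  then show ?thesis unfolding L_def using Fle by linarith
 qed
 also have "\<dots> = \<Gamma> * ((1 + 21 * step_bound * H * (h\<^sup>2 / a)) * (\<Sum>i\<in>UNIV. sqrt (K i)) + (2 * (h\<^sup>2 / sqrt a) + 2 * h) * sqrt (lint ?M (%x. (f x)\<^sup>2)))"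
 proof -
  have "(\<Sum>i\<in>UNIV. c * (sqrt (K i) * \<Gamma>)) = \<Gamma> * (c * (\<Sum>i\<in>UNIV. sqrt (K i)))" for c
   by (simp only: sum_distrib_left) (simp add: mult_ac)
  then show ?thesis by (simp only:) (simp add: algebra_simps)
 qed
 finally have "\<bar>L\<bar> <= \<Gamma> * ((1 + 21 * step_bound * hardy_const s * (h\<^sup>2 / a)) * (\<Sum>i\<in>UNIV. sqrt (K i)) + (2 * (h\<^sup>2 / sqrt a) + 2 * h) * sqrt (lint ?M (%x. (f x)\<^sup>2)))"
  unfolding H_def .
 then show ?thesis by (intro exI[of _ L] conjI conv)
qed

lemma edge_mean_cong_AE:
 assumes "AE x in leb (open_triangle p q r). v x = v' x" "!!i. AE x in leb (open_triangle p q r). g i x = g' i x"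
 shows "edge_mean p q r v g = edge_mean p q r v' g'"
proof -
 have "AE x in leb (open_triangle p q r). \<forall>i. g i x = g' i x" using assms(2) by (simp add: AE_all_countable)
 with assms(1) have "AE x in leb (open_triangle p q r). v x + (\<Sum>i\<in>UNIV. (x - p) $ i * g i x) / 2 = v' x + (\<Sum>i\<in>UNIV. (x - p) $ i * g' i x) / 2"
  by eventually_elim simp
 from integral_cong_AE_lebesgue_on[OF this] show ?thesis
  using open_open_triangle[of p q r] by (simp add: edge_mean_def)
qed

lemma edge_mean_add:
 assumes "sq_int (leb (open_triangle p q r)) v" "!!i. sq_int (leb (open_triangle p q r)) (g i)"
  "sq_int (leb (open_triangle p q r)) v'" "!!i. sq_int (leb (open_triangle p q r)) (g' i)"
 shows "edge_mean p q r (%x. v x + c * v' x) (%i x. g i x + c * g' i x) = edge_mean p q r v g + c * edge_mean p q r v' g'"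
proof -
 have e: "v x + c * v' x + (\<Sum>i\<in>UNIV. (x - p) $ i * (g i x + c * g' i x)) / 2 =
   (v x + (\<Sum>i\<in>UNIV. (x - p) $ i * g i x) / 2) + c * (v' x + (\<Sum>i\<in>UNIV. (x - p) $ i * g' i x) / 2)" for x
  by (simp add: sum_2 field_simps)
 have i: "integrable (leb (open_triangle p q r)) (%x. w x + (\<Sum>i\<in>UNIV. (x - p) $ i * k i x) / 2)"
  if "sq_int (leb (open_triangle p q r)) w" "!!i. sq_int (leb (open_triangle p q r)) (k i)" for w k
 proof -
  have "integrable (leb (open_triangle p q r)) (%x. \<Sum>i\<in>UNIV. (x - p) $ i * k i x)"
   by (rule Bintegrable_sum) (rule edge_mean_integrand(2)[OF that])
  then show ?thesis by (intro Bintegrable_add edge_mean_integrand(1)[OF that] integrable_divide_zero)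
 qed
 have "lint (leb (open_triangle p q r)) (%x. v x + c * v' x + (\<Sum>i\<in>UNIV. (x - p) $ i * (g i x + c * g' i x)) / 2) =
   lint (leb (open_triangle p q r)) (%x. v x + (\<Sum>i\<in>UNIV. (x - p) $ i * g i x) / 2)
   + c * lint (leb (open_triangle p q r)) (%x. v' x + (\<Sum>i\<in>UNIV. (x - p) $ i * g' i x) / 2)"
  unfolding e using i[OF assms(1,2)] i[OF assms(3,4)]
  by (simp only: Bintegral_add integrable_mult_right integral_mult_right_zero)
 then show ?thesis unfolding edge_mean_def by (simp add: add_divide_distrib)
qed

lemma edge_mean_swap: "edge_mean p q r v g = edge_mean p r q v g"
proof -
 have "open_triangle p q r = open_triangle p r q" by (simp add: open_triangle_def insert_commute)
 then show ?thesis by (simp only: edge_mean_def)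
qed

text \<open>Edge means are continuous functionals of v and its gradient in L^2. The constant depends
  on the triangle, which is enough for the density argument in \<open>H10\<close>.\<close>

lemma edge_mean_le:
 assumes n: "noncollinear p q r" and Om: "open \<Omega>" "open_triangle p q r \<subseteq> \<Omega>"
 obtains C where "0 <= C" "!!w k. sq_int (leb \<Omega>) w ==> (!!i. sq_int (leb \<Omega>) (k i)) ==>
  \<bar>edge_mean p q r w k\<bar> <= C * (L2_norm \<Omega> w + (\<Sum>i\<in>UNIV. L2_norm \<Omega> (k i)))"
proof -
 let ?A = "open_triangle p q r"
 let ?M = "leb ?A"
 define a where "a = measure lebesgue ?A"
 have a: "0 < a" unfolding a_def by (rule measure_open_triangle_pos[OF n])
 have Am: "?A \<in> sets lebesgue" "\<Omega> \<in> sets lebesgue" using open_open_triangle[of p q r] Om by auto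
 define c where "c i = sqrt (lint ?M (%x. ((x - p) $ i)\<^sup>2))" for i
 have one: "sq_int ?M (%x. 1)" by (rule sq_int_bounded[OF open_triangle_finite, of _ _ _ _ 1]) auto
 define C where "C = (sqrt a + (\<Sum>i\<in>UNIV. c i)) / a"
 have c0: "0 <= c i" for i by (simp add: c_def)
 show thesis
 proof (rule that)
  show "0 <= C" unfolding C_def using a c0 by (intro divide_nonneg_pos add_nonneg_nonneg sum_nonneg) auto
  fix w :: scalar_field and k :: "2 => scalar_field"
  assume w: "sq_int (leb \<Omega>) w" and k: "!!i. sq_int (leb \<Omega>) (k i)"
  have wA: "sq_int ?M w" and kA: "!!i. sq_int ?M (k i)"
   by (rule sq_int_subset[OF _ Om(2) Am], fact)+
  have le: "sqrt (lint ?M (%x. (z x)\<^sup>2)) <= L2_norm \<Omega> z" if z: "sq_int (leb \<Omega>) z" for z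
  proof -
   have "lint ?M (%x. (z x)\<^sup>2) = lint (leb \<Omega>) (%x. ind ?A x * (z x)\<^sup>2)"
    by (rule integral_lebesgue_on_subset[OF Am Om(2), symmetric])
   also have "\<dots> <= lint (leb \<Omega>) (%x. (z x)\<^sup>2)"
    by (rule integral_mono_AE'[OF sq_int_square[OF z]]) (auto simp: indicator_def)
   finally show ?thesis by (simp add: L2_norm_def)
  qed
  let ?N = "L2_norm \<Omega> w + (\<Sum>i\<in>UNIV. L2_norm \<Omega> (k i))"
  have kN: "L2_norm \<Omega> (k i) <= ?N" for i
   using member_le_sum[of i UNIV "%i. L2_norm \<Omega> (k i)"] L2_norm_nonneg[of \<Omega> w] L2_norm_nonneg by (simp add: add_increasing)
  have wN: "L2_norm \<Omega> w <= ?N" using L2_norm_nonneg by (simp add: sum_nonneg)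
  have N0: "0 <= ?N" using wN L2_norm_nonneg[of \<Omega> w] by linarith
  have i1: "\<bar>lint ?M w\<bar> <= sqrt a * ?N"
  proof -
   have "\<bar>lint ?M (%x. 1 * w x)\<bar> <= sqrt (lint ?M (%x. 1\<^sup>2)) * sqrt (lint ?M (%x. (w x)\<^sup>2))"
    by (rule Cauchy_Schwarz_integral[OF one wA])
   also have "lint ?M (%x. 1\<^sup>2) = a" using measure_space_open_triangle[of p q r] by (simp add: a_def)
   also have "sqrt a * sqrt (lint ?M (%x. (w x)\<^sup>2)) <= sqrt a * ?N"
    using order_trans[OF le[OF w] wN] a by (intro mult_left_mono) auto
   finally show ?thesis by simp
  qed
  have i2: "\<bar>lint ?M (%x. (x - p) $ i * k i x)\<bar> <= c i * ?N" for i
  proof -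
   have "\<bar>lint ?M (%x. (x - p) $ i * k i x)\<bar> <= c i * sqrt (lint ?M (%x. (k i x)\<^sup>2))"
    unfolding c_def by (rule Cauchy_Schwarz_integral[OF component_sq_int kA])
   also have "\<dots> <= c i * ?N" using order_trans[OF le[OF k] kN] c0 by (intro mult_left_mono) auto
   finally show ?thesis .
  qed
  have "\<bar>lint ?M w + (\<Sum>i\<in>UNIV. lint ?M (%x. (x - p) $ i * k i x)) / 2\<bar>
    <= sqrt a * ?N + (\<Sum>i\<in>UNIV. c i * ?N)"
  proof -
   have "\<bar>\<Sum>i\<in>UNIV. lint ?M (%x. (x - p) $ i * k i x)\<bar> <= (\<Sum>i\<in>UNIV. c i * ?N)"
    by (rule order_trans[OF sum_abs sum_mono]) (rule i2)
   then show ?thesis using i1 by linarith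
  qed
  also have "\<dots> = (sqrt a + (\<Sum>i\<in>UNIV. c i)) * ?N" by (simp only: distrib_right sum_distrib_right)
  finally have "\<bar>lint ?M w + (\<Sum>i\<in>UNIV. lint ?M (%x. (x - p) $ i * k i x)) / 2\<bar> / a <= (sqrt a + (\<Sum>i\<in>UNIV. c i)) * ?N / a"
   using a by (simp only: divide_right_mono less_imp_le)
  moreover have "\<bar>edge_mean p q r w k\<bar> = \<bar>lint ?M w + (\<Sum>i\<in>UNIV. lint ?M (%x. (x - p) $ i * k i x)) / 2\<bar> / a"
   unfolding edge_mean_def edge_mean_integrand(4)[OF wA kA] abs_divide using a by (simp add: a_def)
  ultimately show "\<bar>edge_mean p q r w k\<bar> <= C * ?N" unfolding C_def by (simp only: times_divide_eq_left)
 qed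
qed

section \<open>Geometry of the domain and of the mesh\<close>

text \<open>A Lipschitz graph excludes slits: below a boundary point, in the direction of -e2, there
  is an open set that does not meet the domain, so the point is not interior to the closure.\<close>

lemma interior_closure_lipschitz:
 assumes "bounded_lipschitz_polygon \<Omega>"
 shows "interior (closure \<Omega>) = \<Omega>"
proof (intro equalityI subsetI)
 have o: "open \<Omega>" and L: "lipschitz_boundary \<Omega>" using assms by (auto simp: bounded_lipschitz_polygon_def)
 fix x assume "x \<in> \<Omega>" then show "x \<in> interior (closure \<Omega>)"
  using interior_maximal[OF closure_subset o] by blast
next
 have o: "open \<Omega>" and L: "lipschitz_boundary \<Omega>" using assms by (auto simp: bounded_lipschitz_polygon_def)
 fix x assume xi: "x \<in> interior (closure \<Omega>)"
 show "x \<in> \<Omega>"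
 proof (rule ccontr)
  assume xn: "x \<notin> \<Omega>"
  then have "x \<in> frontier \<Omega>" using xi interior_subset o by (auto simp: frontier_def interior_open)
  then obtain r Lc \<gamma> e1 e2 where r: "0 < r" and lip: "Lc-lipschitz_on (UNIV :: real set) (\<gamma> :: real => real)"
   and ee: "norm e1 = 1" "norm e2 = 1" "e1 \<bullet> e2 = 0"
   and eq: "\<Omega> \<inter> ball x r = {y \<in> ball x r. \<gamma> ((y - x) \<bullet> e1) < (y - x) \<bullet> e2}"
   using L unfolding lipschitz_boundary_def by blast
  have "x \<notin> {y \<in> ball x r. \<gamma> ((y - x) \<bullet> e1) < (y - x) \<bullet> e2}" using xn eq by blast
  then have g0: "0 <= \<gamma> 0" using r by simp
  obtain d where d: "0 < d" "ball x d \<subseteq> closure \<Omega>" using xi mem_interior by blast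
  define t where "t = min r d / 2"
  have t: "0 < t" "t < r" "t < d" using r d by (auto simp: t_def)
  \<comment> \<open>Moving down from x keeps the first local coordinate at 0, where gamma is
    nonnegative because x is not in the domain; so y is strictly below the graph.\<close>
  define y where "y = x - t *\<^sub>R e2"
  have cg: "continuous_on UNIV \<gamma>" by (rule lipschitz_on_continuous_on[OF lip])
  define V where "V = ball x r \<inter> {z. (z - x) \<bullet> e2 < \<gamma> ((z - x) \<bullet> e1)}"
  have "open {z. (z - x) \<bullet> e2 < \<gamma> ((z - x) \<bullet> e1)}"
   by (rule open_Collect_less) (intro continuous_intros continuous_on_compose2[OF cg] subset_UNIV)+
  then have Vo: "open V" unfolding V_def by (intro open_Int open_ball)
  have yx: "y - x = - (t *\<^sub>R e2)" by (simp add: y_def)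
  have "(y - x) \<bullet> e2 = - t" "(y - x) \<bullet> e1 = 0" unfolding yx using ee by (auto simp: inner_commute norm_eq_1)
  moreover have "y \<in> ball x r" "y \<in> ball x d" using t ee(2) by (simp_all add: dist_norm y_def)
  ultimately have yV: "y \<in> V" "y \<in> ball x d" unfolding V_def using g0 t by auto
  have "z \<notin> \<Omega>" if z: "z \<in> V" for z
  proof
   assume "z \<in> \<Omega>"
   then have "z \<in> \<Omega> \<inter> ball x r" using z unfolding V_def by blast
   then show False using z unfolding eq V_def by simp
  qed
  then have "V \<inter> \<Omega> = {}" by blast
  then have "V \<inter> closure \<Omega> = {}" using open_Int_closure_eq_empty[OF Vo] by blast
  then show False using yV d(2) by blast
 qed
qed

lemma affine_partial:
 assumes "\<forall>x. q x = c \<bullet> x + d"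
 shows "smooth_on UNIV q" "partial i q x = c $ i"
proof -
 have q: "q = (%x. c \<bullet> x + d)" using assms by (intro ext) simp
 show "smooth_on UNIV q" unfolding q by (intro smooth_on_add smooth_on_inner smooth_on_const open_UNIV)
 have "((%x. c \<bullet> x + d) has_derivative (%h. c \<bullet> h)) (at x)" by (auto intro!: derivative_eq_intros)
 from partial_eq[OF this] show "partial i q x = c $ i" by (simp add: q inner_axis)
qed

lemma affine_edge_integral:
 assumes "\<forall>x. q x = c \<bullet> x + d"
 shows "(LINT t:{0..1}|lborel. q (linepath a b t)) = (q a + q b) / 2"
  "integral {0..1} (%t. q (linepath a b t)) = (q a + q b) / 2"
proof -
 have e: "q (linepath a b t) = q a + t * (q b - q a)" for t
  using assms by (simp add: linepath_def inner_add_right inner_scaleR_right algebra_simps)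
 have "((%t. t * q a + t\<^sup>2 / 2 * (q b - q a)) has_real_derivative q a + t * (q b - q a)) (at t)" for t
  by (auto intro!: derivative_eq_intros)
 from integral_FTC_Icc_real[of 0 1, OF _ this]
 have "(LBINT t. (q a + t * (q b - q a)) * ind {0..1} t) = (q a + q b) / 2"
  by (simp add: field_simps continuous_intros)
 then show L: "(LINT t:{0..1}|lborel. q (linepath a b t)) = (q a + q b) / 2"
  unfolding set_lebesgue_integral_def e by (simp add: mult.commute)
 have "continuous_on {0..1} (%t. q (linepath a b t))" unfolding e by (intro continuous_intros)
 then have "set_integrable lborel {0..1} (%t. q (linepath a b t))"
  unfolding set_integrable_def by (intro borel_integrable_compact) auto
 from set_borel_integral_eq_integral(2)[OF this] show "integral {0..1} (%t. q (linepath a b t)) = (q a + q b) / 2"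
  using L by simp
qed

text \<open>The selected end points are a and b in some order, and the trapezoidal rule is exact for
  affine functions and symmetric in them. Distinctness makes the length factor nonzero.\<close>

lemma edge_integral_affine:
 assumes q: "\<forall>x. q x = c \<bullet> x + d" and z: "edge_integral (closed_segment a b) q = 0" and ab: "a ~= b"
 shows "q a + q b = 0"
proof -
 define P where "P = (%(u::point, w). closed_segment a b = closed_segment u w)"
 have "P (a, b)" by (simp add: P_def)
 then have "P (SOME z. P z)" by (rule someI)
 moreover obtain u w where uw: "(SOME z. P z) = (u, w)" by (metis surj_pair)
 ultimately have "closed_segment a b = closed_segment u w" by (simp add: P_def)
 then have s: "{a, b} = {u, w}" by (simp add: closed_segment_eq)
 have "norm (w - u) * ((q u + q w) / 2) = 0"
  using z uw unfolding edge_integral_def P_def affine_edge_integral(2)[OF q] by simp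
 moreover have "w ~= u" using s ab by (metis doubleton_eq_iff insert_absorb2)
 ultimately have "q u + q w = 0" by simp
 then show ?thesis using s by (metis add.commute doubleton_eq_iff)
qed

lemma triangle_facets:
 assumes n: "noncollinear p q r"
 shows "closed_segment q r facet_of tri p q r"
proof -
 have d: "p ~= q" "p ~= r" "q ~= r" "\<not> affine_dependent {p, q, r}"
  using n unfolding noncollinear_iff collinear_3_eq_affine_dependent by auto
 have "{p, q, r} - {p} = {q, r}" using d(1,2) by blast
 then have "closed_segment q r = convex hull ({p, q, r} - {p})" by (simp only: segment_convex_hull)
 moreover have "closed_segment q r ~= {}" by simp
 ultimately show ?thesis
  unfolding facet_of_convex_hull_affine_independent[OF d(4)] by blast
qed

lemma simplex_2_triangle:
 assumes "2 simplex (\<kappa> :: point set)"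
 obtains p q r where "noncollinear p q r" "\<kappa> = tri p q r"
proof -
 obtain C where C: "\<not> affine_dependent C" "int (card C) = 2 + 1" "\<kappa> = convex hull C"
  using assms unfolding simplex_def by blast
 have "card C = 3" using C(2) by simp
 then obtain p q r where pqr: "C = {p, q, r}" "p ~= q" "q ~= r" "p ~= r" by (auto simp: card_3_iff)
 have "noncollinear p q r" unfolding noncollinear_iff collinear_3_eq_affine_dependent using C(1) pqr by auto
 then show ?thesis using that C(3) pqr(1) by blast
qed

lemma mesh_face: "mesh \<Omega> \<T> ==> \<kappa> \<in> \<T> ==> \<kappa>' \<in> \<T> ==> (\<kappa> \<inter> \<kappa>') face_of \<kappa>"
 and mesh_finite: "mesh \<Omega> \<T> ==> finite \<T>"
 and mesh_Union: "mesh \<Omega> \<T> ==> \<Union>\<T> = closure \<Omega>"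
 by (auto simp: mesh_def triangulation_def)

lemma mesh_triangle:
 assumes "mesh \<Omega> \<T>" "\<kappa> \<in> \<T>"
 obtains p q r where "noncollinear p q r" "\<kappa> = tri p q r"
 using assms simplex_2_triangle unfolding mesh_def by blast

text \<open>The intersection is a face of either triangle, and a face that meets the interior is the
  whole triangle; this is applied from both sides.\<close>

lemma mesh_interior_disjoint:
 assumes m: "mesh \<Omega> \<T>" "\<kappa> \<in> \<T>" "\<kappa>' \<in> \<T>" and x: "x \<in> interior \<kappa>" "x \<in> \<kappa>'"
 shows "\<kappa> = \<kappa>'"
proof -
 have f: "(\<kappa> \<inter> \<kappa>') face_of \<kappa>" "(\<kappa>' \<inter> \<kappa>) face_of \<kappa>'" using mesh_face[OF m(1)] m by blast+
 have "\<kappa> \<inter> \<kappa>' = \<kappa>" using face_of_disjoint_interior[OF f(1)] x interior_subset by blast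
 then have s: "\<kappa> \<subseteq> \<kappa>'" by blast
 then have "x \<in> interior \<kappa>'" using x(1) interior_mono by blast
 moreover have "x \<in> \<kappa>' \<inter> \<kappa>" using x interior_subset by blast
 ultimately have "\<kappa>' \<inter> \<kappa> = \<kappa>'" using face_of_disjoint_interior[OF f(2)] by blast
 then show ?thesis using s by blast
qed

lemma extreme_point_triangle:
 assumes "noncollinear p q r"
 shows "w extreme_point_of (tri p q r) \<longleftrightarrow> w \<in> {p, q, r}"
proof -
 have "\<not> affine_dependent {p, q, r}"
  using assms unfolding noncollinear_iff collinear_3_eq_affine_dependent by simp
 then show ?thesis by (rule extreme_point_of_convex_hull_affine_independent)
qed

definition mesh_vertices :: "point set set => point set" where
 "mesh_vertices \<T> = {w. \<exists>\<kappa>\<in>\<T>. w extreme_point_of \<kappa>}"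

lemma finite_mesh_vertices:
 assumes "mesh \<Omega> \<T>"
 shows "finite (mesh_vertices \<T>)"
proof -
 have "finite {w. w extreme_point_of \<kappa>}" if k: "\<kappa> \<in> \<T>" for \<kappa>
 proof -
  obtain p q r where n: "noncollinear p q r" "\<kappa> = tri p q r" by (rule mesh_triangle[OF assms k])
  show ?thesis unfolding n(2) extreme_point_triangle[OF n(1)] by simp
 qed
 moreover have "mesh_vertices \<T> = (\<Union>\<kappa>\<in>\<T>. {w. w extreme_point_of \<kappa>})" by (auto simp: mesh_vertices_def)
 ultimately show ?thesis using mesh_finite[OF assms] by simp
qed

text \<open>There are no hanging nodes: a vertex of one triangle that lies in another is extreme in
  their common face, hence extreme in the other triangle too.\<close>

lemma mesh_vertices_triangle:
 assumes m: "mesh \<Omega> \<T>" "tri p q r \<in> \<T>" and n: "noncollinear p q r"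
 shows "mesh_vertices \<T> \<inter> tri p q r \<subseteq> {p, q, r}" "{p, q, r} \<subseteq> mesh_vertices \<T>"
proof -
 show "mesh_vertices \<T> \<inter> tri p q r \<subseteq> {p, q, r}"
 proof
  fix w assume w: "w \<in> mesh_vertices \<T> \<inter> tri p q r"
  then obtain \<kappa> where k: "\<kappa> \<in> \<T>" "w extreme_point_of \<kappa>" by (auto simp: mesh_vertices_def)
  then have "w extreme_point_of (\<kappa> \<inter> tri p q r)"
   using w extreme_point_of_face[OF mesh_face[OF m(1) k(1) m(2)]] by (simp add: extreme_point_of_def)
  then have "w extreme_point_of (tri p q r)"
   using extreme_point_of_face[OF mesh_face[OF m(1) m(2) k(1)]] by (simp add: Int_commute)
  then show "w \<in> {p, q, r}" using extreme_point_triangle[OF n] by blast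
 qed
 show "{p, q, r} \<subseteq> mesh_vertices \<T>"
  using m(2) extreme_point_triangle[OF n] unfolding mesh_vertices_def by blast
qed

lemma open_edge_iff:
 assumes n: "noncollinear p q r" and x: "bary p q r x = 0" "0 < bary q r p x" "0 < bary r p q x"
 shows "x \<in> open_segment q r"
proof -
 have s: "bary q r p x + bary r p q x = 1" using bary_sum[OF n, of x] x by simp
 have e: "bary q r p x = 1 - bary r p q x" using s by simp
 have c: "x = (1 - bary r p q x) *\<^sub>R q + bary r p q x *\<^sub>R r" using bary_comb[OF n, of x] x unfolding e by simp
 have "q ~= r" using n by (auto simp: noncollinear_def cross2_def)
 then show ?thesis unfolding in_segment(2) using c x s by (intro conjI exI[of _ "bary r p q x"]) auto
qed

text \<open>The common face contains an inner point of the edge and therefore, being a face, both of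
  its end points; these are then vertices of the second triangle.\<close>

lemma mesh_neighbour:
 assumes m: "mesh \<Omega> \<T>" "tri p q r \<in> \<T>" "\<kappa>' \<in> \<T>" and n: "noncollinear p q r"
  and x: "x \<in> open_segment q r" "x \<in> \<kappa>'"
 obtains p' where "noncollinear p' q r" "\<kappa>' = tri p' q r"
proof -
 let ?k = "tri p q r"
 have f: "(?k \<inter> \<kappa>') face_of ?k" "(\<kappa>' \<inter> ?k) face_of \<kappa>'" using mesh_face[OF m(1)] m by blast+
 have v: "q \<in> ?k" "r \<in> ?k" by (auto intro: hull_inc)
 have "x \<in> ?k" using x(1) v convex_contains_open_segment[of ?k] convex_convex_hull by blast
 then have "q \<in> ?k \<inter> \<kappa>'" "r \<in> ?k \<inter> \<kappa>'" using face_ofD[OF f(1) x(1) v] x(2) by blast+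
 moreover have "q extreme_point_of ?k" "r extreme_point_of ?k" using extreme_point_triangle[OF n] by blast+
 ultimately have "q extreme_point_of (?k \<inter> \<kappa>')" "r extreme_point_of (?k \<inter> \<kappa>')"
  using extreme_point_of_face[OF f(1)] by blast+
 then have e: "q extreme_point_of \<kappa>'" "r extreme_point_of \<kappa>'"
  using extreme_point_of_face[OF f(2)] by (simp_all add: Int_commute)
 obtain a b c where k: "noncollinear a b c" "\<kappa>' = tri a b c" by (rule mesh_triangle[OF m(1,3)])
 have mem: "q \<in> {a, b, c}" "r \<in> {a, b, c}" using e extreme_point_triangle[OF k(1)] unfolding k(2) by blast+
 have qr: "q ~= r" using n by (auto simp: noncollinear_def cross2_def)
 have "{a, q, r} = {a, b, c} \<or> {b, q, r} = {a, b, c} \<or> {c, q, r} = {a, b, c}"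
  using mem qr by (elim insertE emptyE) (simp_all add: insert_commute)
 then obtain p' where p': "{p', q, r} = {a, b, c}" by metis
 have "noncollinear p' q r" using k(1) unfolding noncollinear_iff p' .
 then show thesis using that k(2) p' by metis
qed

text \<open>Both coordinates vanish on the line through q and r, so they are proportional. The sign
  of the factor tells whether p and p' lie on the same side of that line.\<close>

lemma bary_opposite:
 assumes "noncollinear p q r" "noncollinear p' q r"
 shows "bary p' q r y = bary p' q r p * bary p q r y"
 using assms by (simp add: bary_def noncollinear_def)

text \<open>An edge with one inner point outside the open domain lies in the frontier entirely.
  Otherwise some inner point y of the edge is in the domain and a second triangle lies across the
  edge; the two triangles together cover a neighbourhood of x, which contradicts
  \<open>interior_closure_lipschitz\<close>.\<close>

lemma frontier_edge:
 assumes b: "bounded_lipschitz_polygon \<Omega>" and m: "mesh \<Omega> \<T>" "tri p q r \<in> \<T>" and n: "noncollinear p q r"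
  and x: "x \<in> open_segment q r" "x \<notin> \<Omega>" and xb: "0 < bary q r p x" "0 < bary r p q x"
 shows "closed_segment q r \<subseteq> frontier \<Omega>"
proof (rule ccontr)
 assume nf: "\<not> closed_segment q r \<subseteq> frontier \<Omega>"
 let ?k = "tri p q r"
 have o: "open \<Omega>" using b by (simp add: bounded_lipschitz_polygon_def)
 have cl: "\<Union>\<T> = closure \<Omega>" by (rule mesh_Union[OF m(1)])
 have qr: "q ~= r" using n by (auto simp: noncollinear_def cross2_def)
 have "closed_segment q r \<subseteq> ?k" unfolding segment_convex_hull by (rule hull_mono) blast
 then have "closed_segment q r \<subseteq> closure \<Omega>" using m(2) cl by blast
 then have "closed_segment q r \<inter> \<Omega> ~= {}" using nf o by (auto simp: frontier_def interior_open)
 then have "open_segment q r \<inter> \<Omega> ~= {}"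
  using open_Int_closure_eq_empty[OF o, of "open_segment q r"] closure_open_segment[of q r] qr by (metis inf_commute)
 then obtain y where y: "y \<in> open_segment q r" "y \<in> \<Omega>" by blast
 \<comment> \<open>The triangles that miss y are removed, so every triangle met close to y contains
   y and hence shares the edge.\<close>
 define F where "F = \<Union>{\<kappa>\<in>\<T>. y \<notin> \<kappa>}"
 have "closed \<kappa>" if k: "\<kappa> \<in> \<T>" for \<kappa>
 proof -
  obtain p q r where "\<kappa> = tri p q r" by (rule mesh_triangle[OF m(1) k])
  then show ?thesis by (simp add: compact_imp_closed compact_triangle)
 qed
 then have "closed F" unfolding F_def using mesh_finite[OF m(1)] by (intro closed_Union) auto
 then have "open (\<Omega> - F)" using o by (intro open_Diff)
 moreover have "y \<in> \<Omega> - F" using y(2) by (auto simp: F_def)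
 ultimately obtain d where d: "0 < d" "ball y d \<subseteq> \<Omega> - F" by (meson open_contains_ball)
 define k where "k = (d / (2 * (norm (bary_grad p q r) + 1)))"
 have k0: "0 < k" using d by (simp add: k_def add_nonneg_pos)
 \<comment> \<open>A point just beyond the edge: the coordinate of p is negative there, so it lies
   in another triangle.\<close>
 define y' where "y' = y - k *\<^sub>R bary_grad p q r"
 have g0: "bary_grad p q r ~= 0"
  using bary_affine[OF n, of q] bary_vertex(2) by auto
 obtain t where t: "0 < t" "t < 1" "y = (1 - t) *\<^sub>R q + t *\<^sub>R r" using y(1) by (auto simp: in_segment)
 have "bary p q r y = 0"
  by (rule bary_unique[OF n, of 0 "1 - t" t]) (use t in auto)
 then have by': "bary p q r y' < 0"
  using bary_affine'[OF n, of y' y] g0 k0 by (simp add: y'_def)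
 have "norm (k *\<^sub>R bary_grad p q r) < d"
 proof -
  have "N < 2 * (N + 1)" "2 * (N + 1) ~= 0" if "0 <= N" for N :: real using that by simp_all
  from this[OF norm_ge_zero] have N1: "norm (bary_grad p q r) < 2 * (norm (bary_grad p q r) + 1)"
   and N2: "2 * (norm (bary_grad p q r) + 1) ~= 0" .
  have "k * norm (bary_grad p q r) < k * (2 * (norm (bary_grad p q r) + 1))" by (rule mult_strict_left_mono[OF N1 k0])
  also have "\<dots> = d" unfolding k_def by (rule iffD1[OF nonzero_eq_divide_eq[OF N2] refl])
  finally show ?thesis using k0 by simp
 qed
 then have "y' \<in> ball y d" by (simp add: y'_def dist_norm)
 then have "y' \<in> \<Omega> - F" using d by blast
 then obtain \<kappa>' where k': "\<kappa>' \<in> \<T>" "y' \<in> \<kappa>'" "y \<in> \<kappa>'" using cl closure_subset unfolding F_def by blast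
 obtain p' where p': "noncollinear p' q r" "\<kappa>' = tri p' q r"
  by (rule mesh_neighbour[OF m k'(1) n y(1) k'(3)])
 have "0 <= bary p' q r y'" using k'(2) unfolding p'(2) triangle_eq_bary(1)[OF p'(1)] by blast
 \<comment> \<open>That is, p and p' lie on different sides of the edge.\<close>
 then have "bary p' q r p <= 0" unfolding bary_opposite[OF n p'(1), of y'] using by' by (simp add: zero_le_mult_iff)
 obtain u where u: "0 < u" "u < 1" "x = (1 - u) *\<^sub>R q + u *\<^sub>R r" using x(1) by (auto simp: in_segment)
 have x': "bary q r p' x = 1 - u" "bary r p' q x = u"
  using bary_unique[OF noncollinear_rotate[OF p'(1)], of "1 - u" u 0 x]
   bary_unique[OF noncollinear_rotate[OF noncollinear_rotate[OF p'(1)]], of u 0 "1 - u" x] u by auto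
 \<comment> \<open>Here x satisfies strictly all conditions of the two triangles except the sign
   relative to the common edge, and that sign decides which of the two contains a point of
   V.\<close>
 define V where "V = {z. 0 < bary q r p z} \<inter> {z. 0 < bary r p q z} \<inter> {z. 0 < bary q r p' z} \<inter> {z. 0 < bary r p' q z}"
 have ob: "open {z. 0 < bary a b c z}" if "noncollinear a b c" for a b c
  by (rule open_Collect_less[OF continuous_on_const continuous_on_bary[OF that]])
 have "open V" unfolding V_def
  by (intro open_Int ob noncollinear_rotate[OF n] noncollinear_rotate[OF noncollinear_rotate[OF n]]
   noncollinear_rotate[OF p'(1)] noncollinear_rotate[OF noncollinear_rotate[OF p'(1)]])
 moreover have "x \<in> V" using xb x' u by (simp add: V_def)
 moreover have "V \<subseteq> ?k \<union> \<kappa>'"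
 proof
  fix z assume z: "z \<in> V"
  show "z \<in> ?k \<union> \<kappa>'"
  proof (cases "0 <= bary p q r z")
   case True then show ?thesis using z unfolding triangle_eq_bary(1)[OF n] V_def by auto
  next
   case False
   then have "0 <= bary p' q r z" unfolding bary_opposite[OF n p'(1), of z] using \<open>bary p' q r p <= 0\<close> by (simp add: mult_nonpos_nonpos)
   then show ?thesis using z unfolding p'(2) triangle_eq_bary(1)[OF p'(1)] V_def by auto
  qed
 qed
 ultimately have "x \<in> interior (closure \<Omega>)"
  using interior_maximal[of V "closure \<Omega>"] m(2) k'(1) cl by blast
 then show False using x(2) interior_closure_lipschitz[OF b] by simp
qed

section \<open>The companion on the whole mesh as a test function\<close>

definition triangle_companion :: "point => point => point => scalar_field => (2 => scalar_field) => scalar_field" where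
 "triangle_companion p q r v g = (let m = mean_on (open_triangle p q r) v in
   companion p q r m (edge_mean p q r v g - m) (edge_mean q r p v g - m) (edge_mean r p q v g - m))"

lemma open_triangle_swap: "open_triangle p r q = open_triangle p q r"
 by (simp add: open_triangle_def insert_commute)

lemma edge_weight_swap: "edge_weight p r q x = edge_weight p q r x"
proof -
 have "bary r q p = bary r p q" "bary q p r = bary q r p" "bary p r q = bary p q r" by (rule bary_swap)+
 then show ?thesis unfolding edge_weight_def bary_pairs_def by (simp add: mult.commute add.commute add.left_commute)
qed

lemma triangle_companion_rotate: "triangle_companion q r p v g = triangle_companion p q r v g"
 by (rule ext) (simp only: triangle_companion_def companion_def Let_def open_triangle_rotate[where p=p and q=q and r=r] ac_simps)

lemma triangle_companion_swap: "triangle_companion p r q v g = triangle_companion p q r v g"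
proof -
 have e: "edge_mean p r q v g = edge_mean p q r v g" "edge_mean r q p v g = edge_mean r p q v g" "edge_mean q p r v g = edge_mean q r p v g"
  by (rule edge_mean_swap)+
 have w: "edge_weight p r q = edge_weight p q r" "edge_weight r q p = edge_weight r p q" "edge_weight q p r = edge_weight q r p"
  by (rule ext, rule edge_weight_swap)+
 show ?thesis by (rule ext) (simp only: triangle_companion_def companion_def Let_def e w open_triangle_swap[of p r q] ac_simps)
qed

text \<open>Depends only on the triangle as a set: \<open>triangle_companion\<close> is invariant
  under permutations of the vertices, so the choice of their order is immaterial.\<close>

definition mesh_companion :: "point set => scalar_field => (2 => scalar_field) => scalar_field" where
 "mesh_companion \<kappa> v g = (SOME F. \<exists>p q r. noncollinear p q r \<and> \<kappa> = tri p q r \<and> F = triangle_companion p q r v g)"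

lemma triple_cases:
 assumes "{a, b, c} = {p, q, r}" "p ~= q" "p ~= r" "q ~= r"
 shows "a = p \<and> b = q \<and> c = r \<or> a = q \<and> b = r \<and> c = p \<or> a = r \<and> b = p \<and> c = q \<or>
  a = p \<and> b = r \<and> c = q \<or> a = r \<and> b = q \<and> c = p \<or> a = q \<and> b = p \<and> c = r"
proof -
 have "a = p \<or> a = q \<or> a = r" "b = p \<or> b = q \<or> b = r" "c = p \<or> c = q \<or> c = r"
  "p = a \<or> p = b \<or> p = c" "q = a \<or> q = b \<or> q = c" "r = a \<or> r = b \<or> r = c"
  using assms(1) by blast+
 then show ?thesis using assms(2-4) by (smt (verit))
qed

lemma mesh_companion_eq:
 assumes n: "noncollinear p q r"
 shows "mesh_companion (tri p q r) v g = triangle_companion p q r v g"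
 unfolding mesh_companion_def
proof (rule some_equality)
 show "\<exists>p' q' r'. noncollinear p' q' r' \<and> tri p q r = tri p' q' r' \<and> triangle_companion p q r v g = triangle_companion p' q' r' v g"
  using n by blast
 fix F assume "\<exists>p' q' r'. noncollinear p' q' r' \<and> tri p q r = tri p' q' r' \<and> F = triangle_companion p' q' r' v g"
 then obtain a b c where abc: "noncollinear a b c" "tri p q r = tri a b c" "F = triangle_companion a b c v g" by blast
 have s: "{a, b, c} = {p, q, r}"
  using extreme_point_triangle[OF n] extreme_point_triangle[OF abc(1)] unfolding abc(2) by blast
 have d: "p ~= q" "p ~= r" "q ~= r" using n by (auto simp: noncollinear_def cross2_def)
 have rot: "triangle_companion q r p v g = triangle_companion p q r v g" "triangle_companion r p q v g = triangle_companion p q r v g"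
  by (rule triangle_companion_rotate triangle_companion_rotate[symmetric])+
 have swap: "triangle_companion p r q v g = triangle_companion p q r v g"
  "triangle_companion r q p v g = triangle_companion p q r v g" "triangle_companion q p r v g = triangle_companion p q r v g"
  by (rule triangle_companion_swap trans[OF triangle_companion_swap rot(1)] trans[OF triangle_companion_swap rot(2)])+
 show "F = triangle_companion p q r v g" unfolding abc(3) using triple_cases[OF s d]
  by (elim disjE conjE) (simp_all only: rot swap)
qed

text \<open>At an inner point of the edge the weights are 1, 0 and 0. By continuity they stay above
  3/4 and below 1/2 nearby, where the smooth steps are constant. The neighbourhood reaches across
  the edge, as is needed for gluing.\<close>

lemma companion_near_edge:
 assumes n: "noncollinear p q r" and x: "bary p q r x = 0" "0 < bary q r p x" "0 < bary r p q x"
 obtains V where "open V" "x \<in> V" "!!y. y \<in> V ==> companion p q r m dp dq dr y = m + dp"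
proof -
 have n': "noncollinear q r p" "noncollinear r p q" using noncollinear_rotate[OF n] noncollinear_rotate[OF noncollinear_rotate[OF n]] by this+
 have bp: "bary_pairs p q r x = bary q r p x * bary r p q x" "0 < bary_pairs p q r x" using x by (simp_all add: bary_pairs_def)
 define U where "U = {y. 0 < bary_pairs p q r y}"
 have cb: "continuous_on UNIV (bary_pairs p q r)" unfolding bary_pairs_def
  by (intro continuous_intros continuous_on_bary n n')
 have U: "open U" unfolding U_def by (intro open_Collect_less continuous_on_const cb)
 have c: "continuous_on U (edge_weight p q r)" "continuous_on U (edge_weight q r p)" "continuous_on U (edge_weight r p q)"
  unfolding edge_weight_def bary_pairs_rotate[where p=p and q=q and r=r] bary_pairs_rotate[where p=r and q=p and r=q, symmetric]
  by ((intro continuous_intros continuous_on_bary n n' continuous_on_subset[OF cb] subset_UNIV ballI); auto simp: U_def)+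
 define V where "V = {y\<in>U. 3/4 < edge_weight p q r y} \<inter> {y\<in>U. edge_weight q r p y < 1/2} \<inter> {y\<in>U. edge_weight r p q y < 1/2}"
 have cl: "open {y\<in>U. a < k y}" if "continuous_on U k" for a and k :: scalar_field
  using continuous_open_preimage[OF that U open_greaterThan[of a]] by (simp add: vimage_def Int_def)
 have cg: "open {y\<in>U. k y < a}" if "continuous_on U k" for a and k :: scalar_field
  using continuous_open_preimage[OF that U open_lessThan[of a]] by (simp add: vimage_def Int_def)
 show thesis
 proof (rule that[of V])
  show "open V" unfolding V_def by (intro open_Int cl cg c)
  have "edge_weight p q r x = 1" unfolding edge_weight_def bp(1) by (rule right_inverse) (use x in simp)
  moreover have "edge_weight q r p x = 0" "edge_weight r p q x = 0" using x(1) by (simp_all add: edge_weight_def)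
  ultimately show "x \<in> V" using bp(2) by (simp add: V_def U_def)
  fix y assume "y \<in> V"
  then show "companion p q r m dp dq dr y = m + dp" by (simp add: V_def companion_def smooth_step_0 smooth_step_1)
 qed
qed

lemma triangle_cases:
 assumes n: "noncollinear p q r" and x: "x \<in> tri p q r" "x \<notin> {p, q, r}"
 obtains "x \<in> interior (tri p q r)"
 | a b c where "noncollinear a b c" "tri a b c = tri p q r" "bary a b c x = 0" "0 < bary b c a x" "0 < bary c a b x"
proof -
 have n': "noncollinear q r p" "noncollinear r p q" using noncollinear_rotate[OF n] noncollinear_rotate[OF noncollinear_rotate[OF n]] by this+
 have h: "tri q r p = tri p q r" "tri r p q = tri p q r"
  by (simp_all only: insert_commute)
 have nn: "0 <= bary p q r x" "0 <= bary q r p x" "0 <= bary r p q x" using x(1) unfolding triangle_eq_bary(1)[OF n] by blast+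
 have s: "bary p q r x + bary q r p x + bary r p q x = 1" by (rule bary_sum[OF n])
 have c: "bary p q r x *\<^sub>R p + bary q r p x *\<^sub>R q + bary r p q x *\<^sub>R r = x" by (rule bary_comb[OF n])
 have z: "\<not> (bary p q r x = 0 \<and> bary q r p x = 0)" "\<not> (bary q r p x = 0 \<and> bary r p q x = 0)" "\<not> (bary p q r x = 0 \<and> bary r p q x = 0)"
  using s c x(2) by (metis add_0 scale_zero_left scale_one add.right_neutral insertCI)+
 show thesis
 proof (cases "bary p q r x = 0")
  case 1: True
  have "0 < bary q r p x" "0 < bary r p q x" using z(1,3) nn(2,3) 1 by (simp_all add: less_le)
  with n refl 1 show ?thesis by (rule that(2))
 next
  case p: False
  show ?thesis
  proof (cases "bary q r p x = 0")
   case 1: True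
   have "0 < bary r p q x" "0 < bary p q r x" using z(2) nn(1,3) 1 p by (simp_all add: less_le)
   with n'(1) h(1) 1 show ?thesis by (rule that(2))
  next
   case q: False
   show ?thesis
   proof (cases "bary r p q x = 0")
    case 1: True
    have "0 < bary p q r x" "0 < bary q r p x" using nn(1,2) p q by (simp_all add: less_le)
    with n'(2) h(2) 1 show ?thesis by (rule that(2))
   next
    case r: False
    have "x \<in> interior (tri p q r)"
     unfolding triangle_eq_bary(2)[OF n] using nn p q r by (simp add: less_le)
    then show ?thesis by (rule that(1))
   qed
  qed
 qed
qed

text \<open>The information on the interfaces that is extracted from the Crouzeix-Raviart conditions
  and from zero boundary values: edge means agree from both sides and vanish on boundary
  edges.\<close>

definition edge_compatible :: "point set => point set set => scalar_field => (2 => scalar_field) => bool" where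
 "edge_compatible \<Omega> \<T> v g \<longleftrightarrow>
   (\<forall>p q r p'. noncollinear p q r \<and> noncollinear p' q r \<and> tri p q r \<in> \<T> \<and> tri p' q r \<in> \<T> -->
    edge_mean p q r v g = edge_mean p' q r v g) \<and>
   (\<forall>p q r. noncollinear p q r \<and> tri p q r \<in> \<T> \<and> closed_segment q r \<subseteq> frontier \<Omega> --> edge_mean p q r v g = 0)"

lemma edge_compatibleD:
 assumes "edge_compatible \<Omega> \<T> v g" "noncollinear p q r" "tri p q r \<in> \<T>"
 shows "noncollinear p' q r ==> tri p' q r \<in> \<T> ==> edge_mean p' q r v g = edge_mean p q r v g"
  "closed_segment q r \<subseteq> frontier \<Omega> ==> edge_mean p q r v g = 0"
 using assms unfolding edge_compatible_def by metis+

text \<open>The selected triangle is unique at points inside a triangle. At inner points of edges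
  compatibility makes all choices agree, and at vertices the cutoff is zero.\<close>

definition conforming_companion :: "point set => point set set => scalar_field => (2 => scalar_field) => nat => scalar_field" where
 "conforming_companion \<Omega> \<T> v g k x = (if x \<in> closure \<Omega>
   then vertex_cutoff (mesh_vertices \<T>) k x * mesh_companion (SOME \<kappa>. \<kappa> \<in> \<T> \<and> x \<in> \<kappa>) v g x else 0)"

lemma mesh_closed:
 assumes "mesh \<Omega> \<T>" "\<kappa> \<in> \<T>"
 shows "closed \<kappa>"
proof -
 obtain p q r where "\<kappa> = tri p q r" by (rule mesh_triangle[OF assms])
 then show ?thesis by (simp add: compact_imp_closed compact_triangle)
qed

lemma open_edge_coordinates:
 assumes n: "noncollinear p q r" and x: "x \<in> open_segment q r"
 shows "bary p q r x = 0" "0 < bary q r p x" "0 < bary r p q x"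
proof -
 obtain u where u: "0 < u" "u < 1" "x = (1 - u) *\<^sub>R q + u *\<^sub>R r" using x by (auto simp: in_segment)
 show "bary p q r x = 0" by (rule bary_unique[OF n, of 0 "1 - u" u]) (use u in auto)
 have "bary q r p x = 1 - u" "bary r p q x = u"
  using bary_unique[OF noncollinear_rotate[OF n], of "1 - u" u 0 x]
   bary_unique[OF noncollinear_rotate[OF noncollinear_rotate[OF n]], of u 0 "1 - u" x] u by auto
 then show "0 < bary q r p x" "0 < bary r p q x" using u by auto
qed

text \<open>One neighbourhood per triangle is intersected over the finite mesh. A triangle that
  misses x is avoided because it is closed; one that contains x shares the edge and therefore, by
  compatibility, has the same constant there.\<close>

lemma conforming_companion_near_edge:
 assumes m: "mesh \<Omega> \<T>" and c: "edge_compatible \<Omega> \<T> v g"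
  and n: "noncollinear p q r" and k: "tri p q r \<in> \<T>" and x: "x \<in> open_segment q r"
 obtains V where "open V" "x \<in> V" "\<forall>y\<in>V. \<forall>k.
  conforming_companion \<Omega> \<T> v g k y = (if y \<in> closure \<Omega> then vertex_cutoff (mesh_vertices \<T>) k y * edge_mean p q r v g else 0)"
proof -
 have "\<exists>V. open V \<and> x \<in> V \<and> (\<forall>y\<in>V. y \<in> \<kappa> --> mesh_companion \<kappa> v g y = edge_mean p q r v g)" if kT: "\<kappa> \<in> \<T>" for \<kappa>
 proof (cases "x \<in> \<kappa>")
  case False
  then have "open (- \<kappa>) \<and> x \<in> - \<kappa> \<and> (\<forall>y\<in>- \<kappa>. y \<in> \<kappa> --> mesh_companion \<kappa> v g y = edge_mean p q r v g)"
   using mesh_closed[OF m kT] by (simp add: open_Compl)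
  then show ?thesis ..
 next
  case True
  obtain p' where p': "noncollinear p' q r" "\<kappa> = tri p' q r"
   by (rule mesh_neighbour[OF m k kT n x True])
  define mm where "mm = mean_on (open_triangle p' q r) v"
  obtain V where V: "open V" "x \<in> V"
   "!!y. y \<in> V ==> companion p' q r mm (edge_mean p' q r v g - mm) (edge_mean q r p' v g - mm) (edge_mean r p' q v g - mm) y
     = mm + (edge_mean p' q r v g - mm)"
   using companion_near_edge[OF p'(1) open_edge_coordinates[OF p'(1) x]] by metis
  have e: "edge_mean p' q r v g = edge_mean p q r v g"
   by (rule edge_compatibleD(1)[OF c n k p'(1)]) (use kT p'(2) in simp)
  have "mesh_companion \<kappa> v g y = edge_mean p q r v g" if "y \<in> V" for y
   using V(3)[OF that] unfolding p'(2) mesh_companion_eq[OF p'(1)] triangle_companion_def Let_def mm_def[symmetric] e by simp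
  then show ?thesis using V(1,2) by blast
 qed
 then obtain N where N: "\<forall>\<kappa>\<in>\<T>. open (N \<kappa>) \<and> x \<in> N \<kappa> \<and> (\<forall>y\<in>N \<kappa>. y \<in> \<kappa> --> mesh_companion \<kappa> v g y = edge_mean p q r v g)"
  by metis
 show thesis
 proof (rule that[of "\<Inter>\<kappa>\<in>\<T>. N \<kappa>"])
  show "open (\<Inter>\<kappa>\<in>\<T>. N \<kappa>)" using mesh_finite[OF m] N by (intro open_INT) auto
  show "x \<in> (\<Inter>\<kappa>\<in>\<T>. N \<kappa>)" using N by blast
  show "\<forall>y\<in>\<Inter>\<kappa>\<in>\<T>. N \<kappa>. \<forall>k. conforming_companion \<Omega> \<T> v g k y =
   (if y \<in> closure \<Omega> then vertex_cutoff (mesh_vertices \<T>) k y * edge_mean p q r v g else 0)"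
  proof (intro ballI allI)
  fix y k assume y: "y \<in> (\<Inter>\<kappa>\<in>\<T>. N \<kappa>)"
  show "conforming_companion \<Omega> \<T> v g k y = (if y \<in> closure \<Omega> then vertex_cutoff (mesh_vertices \<T>) k y * edge_mean p q r v g else 0)"
  proof (cases "y \<in> closure \<Omega>")
   case True
   then have "\<exists>\<kappa>. \<kappa> \<in> \<T> \<and> y \<in> \<kappa>" using mesh_Union[OF m] by blast
   then have "(SOME \<kappa>. \<kappa> \<in> \<T> \<and> y \<in> \<kappa>) \<in> \<T> \<and> y \<in> (SOME \<kappa>. \<kappa> \<in> \<T> \<and> y \<in> \<kappa>)" by (rule someI_ex)
   then have "mesh_companion (SOME \<kappa>. \<kappa> \<in> \<T> \<and> y \<in> \<kappa>) v g y = edge_mean p q r v g" using N y by blast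
   then show ?thesis using True by (simp add: conforming_companion_def)
  qed (simp add: conforming_companion_def)
  qed
 qed
qed

lemma conforming_companion_interior:
 assumes m: "mesh \<Omega> \<T>" and n: "noncollinear p q r" and k: "tri p q r \<in> \<T>" and x: "x \<in> open_triangle p q r"
 shows "conforming_companion \<Omega> \<T> v g j x = vertex_cutoff (mesh_vertices \<T>) j x * triangle_companion p q r v g x"
proof -
 have xi: "x \<in> interior (tri p q r)" using x by (simp add: open_triangle_def)
 then have xk: "x \<in> tri p q r" using interior_subset by blast
 have "(SOME \<kappa>. \<kappa> \<in> \<T> \<and> x \<in> \<kappa>) = tri p q r"
  by (rule some_equality) (use k xk mesh_interior_disjoint[OF m k _ xi] in blast)+
 moreover have "x \<in> closure \<Omega>" using mesh_Union[OF m] k xk by blast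
 ultimately show ?thesis by (simp add: conforming_companion_def mesh_companion_eq[OF n])
qed

lemma conforming_companion_edge:
 assumes m: "mesh \<Omega> \<T>" and c: "edge_compatible \<Omega> \<T> v g"
  and n: "noncollinear p q r" and k: "tri p q r \<in> \<T>" and t: "t \<in> {0..1}"
 shows "conforming_companion \<Omega> \<T> v g j (linepath q r t) = vertex_cutoff (mesh_vertices \<T>) j (linepath q r t) * edge_mean p q r v g"
proof (cases "t = 0 \<or> t = 1")
 \<comment> \<open>At the end points both sides vanish because of the cutoff.\<close>
 case True
 then have "linepath q r t \<in> {p, q, r}" by (auto simp: linepath_def)
 then have "linepath q r t \<in> mesh_vertices \<T>" using mesh_vertices_triangle(2)[OF m k n] by blast
 then have "vertex_cutoff (mesh_vertices \<T>) j (linepath q r t) = 0"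
  using vertex_cutoff_zero[OF finite_mesh_vertices[OF m], of "linepath q r t" j] by blast
 then show ?thesis by (simp add: conforming_companion_def)
next
 case False
 let ?x = "linepath q r t"
 have qr: "q ~= r" using n by (auto simp: noncollinear_def cross2_def)
 have x: "?x \<in> open_segment q r"
  unfolding in_segment(2) linepath_def using False t qr by (intro conjI exI[of _ t]) auto
 obtain V where V: "open V" "?x \<in> V" "\<forall>y\<in>V. \<forall>k.
  conforming_companion \<Omega> \<T> v g k y = (if y \<in> closure \<Omega> then vertex_cutoff (mesh_vertices \<T>) k y * edge_mean p q r v g else 0)"
  by (rule conforming_companion_near_edge[OF m c n k x])
 have "open_segment q r \<subseteq> tri p q r"
  using hull_mono[of "{q, r}" "{p, q, r}" convex] unfolding segment_convex_hull[symmetric]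
  using segment_open_subset_closed by blast
 then have "?x \<in> closure \<Omega>" using x k mesh_Union[OF m] by blast
 then show ?thesis using V(2,3) by simp
qed

lemma smooth_on_triangle_companion:
 assumes n: "noncollinear p q r"
 shows "smooth_on (open_triangle p q r) (triangle_companion p q r v g)"
 unfolding triangle_companion_def Let_def
 by (rule smooth_on_companion[OF n open_open_triangle]) (use bary_pairs_pos[OF n] in fastforce)

text \<open>Local smoothness is clear inside a triangle, follows from the constant edge value near
  an open edge, and from the vanishing cutoff near a vertex. The last conjunct keeps the support
  inside the open domain: on a boundary edge the edge mean, hence the local value, is zero.\<close>

lemma conforming_companion_local:
 assumes b: "bounded_lipschitz_polygon \<Omega>" and m: "mesh \<Omega> \<T>" and c: "edge_compatible \<Omega> \<T> v g"
 shows "\<exists>V. open V \<and> x \<in> V \<and> smooth_on V (conforming_companion \<Omega> \<T> v g k) \<and>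
  (x \<notin> \<Omega> --> (\<forall>y\<in>V. conforming_companion \<Omega> \<T> v g k y = 0))"
proof -
 let ?E = "conforming_companion \<Omega> \<T> v g k"
 let ?W = "mesh_vertices \<T>"
 have o: "open \<Omega>" using b by (simp add: bounded_lipschitz_polygon_def)
 have zero: ?thesis if V: "open V" "x \<in> V" and z: "\<forall>y\<in>V. ?E y = 0" for V
 proof -
  have "smooth_on V ?E" by (rule smooth_on_cong[OF smooth_on_const[OF V(1), of 0]]) (use z in simp)
  then show ?thesis using V z by blast
 qed
 consider "x \<notin> closure \<Omega>" | "x \<in> closure \<Omega>" "x \<in> ?W" | "x \<in> closure \<Omega>" "x \<notin> ?W" by blast
 then show ?thesis
 proof cases
  case 1
  then show ?thesis by (intro zero[of "- closure \<Omega>"]) (auto simp: conforming_companion_def)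
 next
  case 2
  obtain V where "open V" "x \<in> V" "\<forall>y\<in>V. vertex_cutoff ?W k y = 0"
   using vertex_cutoff_zero[OF finite_mesh_vertices[OF m] 2(2), of k] by blast
  then show ?thesis by (intro zero[of V]) (auto simp: conforming_companion_def)
 next
  case 3
  obtain \<kappa> where k: "\<kappa> \<in> \<T>" "x \<in> \<kappa>" using 3(1) mesh_Union[OF m] by blast
  obtain p q r where n: "noncollinear p q r" "\<kappa> = tri p q r" by (rule mesh_triangle[OF m k(1)])
  have xn: "x \<notin> {p, q, r}" using 3(2) mesh_vertices_triangle(2)[OF m k(1)[unfolded n(2)] n(1)] by blast
  show ?thesis
  proof (rule triangle_cases[OF n(1) k(2)[unfolded n(2)] xn])
   assume xi: "x \<in> interior (tri p q r)"
   have xo: "x \<in> open_triangle p q r" using xi by (simp add: open_triangle_def)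
   have "smooth_on (open_triangle p q r) (%y. vertex_cutoff ?W k y * triangle_companion p q r v g y)"
    by (intro smooth_on_mult smooth_on_triangle_companion n(1) smooth_on_subset[OF smooth_on_vertex_cutoff] open_open_triangle subset_UNIV)
   then have s: "smooth_on (open_triangle p q r) ?E"
    by (rule smooth_on_cong) (simp add: conforming_companion_interior[OF m n(1) k(1)[unfolded n(2)]])
   have "interior \<kappa> \<subseteq> interior (closure \<Omega>)" using k(1) mesh_Union[OF m] by (intro interior_mono) blast
   then have "x \<in> \<Omega>" using xi unfolding n(2) interior_closure_lipschitz[OF b] by blast
   then show ?thesis using s xo open_open_triangle by blast
  next
   fix a b' c' assume n': "noncollinear a b' c'" "tri a b' c' = tri p q r"
    and xb: "bary a b' c' x = 0" "0 < bary b' c' a x" "0 < bary c' a b' x"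
   have k': "tri a b' c' \<in> \<T>" using k(1) n(2) n'(2) by simp
   have x: "x \<in> open_segment b' c'" by (rule open_edge_iff[OF n'(1) xb])
   let ?c = "edge_mean a b' c' v g"
   obtain V where V: "open V" "x \<in> V" "\<forall>y\<in>V. \<forall>k.
     conforming_companion \<Omega> \<T> v g k y = (if y \<in> closure \<Omega> then vertex_cutoff ?W k y * ?c else 0)"
    by (rule conforming_companion_near_edge[OF m c n'(1) k' x])
   show ?thesis
   proof (cases "x \<in> \<Omega>")
    case True
    have oV: "open (V \<inter> \<Omega>)" using V(1) o by (rule open_Int)
    have "smooth_on (V \<inter> \<Omega>) (%y. vertex_cutoff ?W k y * ?c)"
     by (intro smooth_on_mult smooth_on_const oV smooth_on_subset[OF smooth_on_vertex_cutoff] subset_UNIV)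
    then have "smooth_on (V \<inter> \<Omega>) ?E"
    proof (rule smooth_on_cong)
     fix y assume "y \<in> V \<inter> \<Omega>"
     then show "vertex_cutoff ?W k y * ?c = ?E y" using V(3) closure_subset[of \<Omega>] by (auto simp: subset_iff)
    qed
    then show ?thesis using oV V(2) True by blast
   next
    case False
    have "closed_segment b' c' \<subseteq> frontier \<Omega>" by (rule frontier_edge[OF b m k' n'(1) x False xb(2,3)])
    then have "?c = 0" by (rule edge_compatibleD(2)[OF c n'(1) k'])
    then show ?thesis using V by (intro zero[of V]) auto
   qed
  qed
 qed
qed

lemma conforming_companion_test:
 assumes b: "bounded_lipschitz_polygon \<Omega>" and m: "mesh \<Omega> \<T>" and c: "edge_compatible \<Omega> \<T> v g"
 shows "conforming_companion \<Omega> \<T> v g k \<in> test_functions \<Omega>"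
proof (rule test_functionsI)
 let ?E = "conforming_companion \<Omega> \<T> v g k"
 show "smooth_on UNIV ?E"
  by (rule smooth_on_local[OF open_UNIV]) (use conforming_companion_local[OF b m c] in blast)
 have "{x. ?E x ~= 0} \<subseteq> closure \<Omega>" by (auto simp: conforming_companion_def)
 then have "closure {x. ?E x ~= 0} \<subseteq> closure \<Omega>" by (rule closure_minimal) simp
 moreover have "compact (closure \<Omega>)" using b by (simp add: bounded_lipschitz_polygon_def)
 ultimately show "compact (closure {x. ?E x ~= 0})"
  using compact_Int_closed[OF _ closed_closure, of "closure \<Omega>" "{x. ?E x ~= 0}"] by (simp add: Int_absorb1)
 show "closure {x. ?E x ~= 0} \<subseteq> \<Omega>"
 proof
  fix x assume x: "x \<in> closure {x. ?E x ~= 0}"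
  obtain V where V: "open V" "x \<in> V" "x \<notin> \<Omega> --> (\<forall>y\<in>V. ?E y = 0)" using conforming_companion_local[OF b m c, of x k] by blast
  show "x \<in> \<Omega>"
  proof (rule ccontr)
   assume "x \<notin> \<Omega>"
   then have "V \<inter> {x. ?E x ~= 0} = {}" using V(3) by blast
   then have "V \<inter> closure {x. ?E x ~= 0} = {}" by (simp only: open_Int_closure_eq_empty[OF V(1)])
   then show False using V(2) x by blast
  qed
 qed
qed

section \<open>Edge means of functions in the space H(h)\<close>

lemma H10_H1: "z \<in> H10 \<Omega> ==> z \<in> H1 \<Omega>"
 by (simp add: H10_def)

text \<open>One C for all approximations phi and all delta, so that two triangles with the same edge
  can be compared through one common phi.\<close>

lemma H10_edge_mean_approx:
 assumes o: "open \<Omega>" and n: "noncollinear p q r" and A: "open_triangle p q r \<subseteq> \<Omega>" and z: "z \<in> H10 \<Omega>"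
 obtains C where "0 <= C" "!!\<phi> \<delta>. \<phi> \<in> test_functions \<Omega> ==> L2_norm \<Omega> (%x. z x - \<phi> x) < \<delta> ==>
  \<forall>i. L2_norm \<Omega> (%x. weak_partial \<Omega> i z x - partial i \<phi> x) < \<delta> ==>
  \<bar>edge_mean p q r z (%i. weak_partial \<Omega> i z) - (LINT t:{0..1}|lborel. \<phi> (linepath q r t))\<bar> <= C * \<delta>"
proof -
 obtain C where C: "0 <= C" "!!w k. sq_int (leb \<Omega>) w ==> (!!i. sq_int (leb \<Omega>) (k i)) ==>
  \<bar>edge_mean p q r w k\<bar> <= C * (L2_norm \<Omega> w + (\<Sum>i\<in>UNIV. L2_norm \<Omega> (k i)))"
  by (rule edge_mean_le[OF n o A]) blast
 show thesis
 proof (rule that[of "3 * C"])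
  fix \<phi> \<delta> assume p: "\<phi> \<in> test_functions \<Omega>" and d: "L2_norm \<Omega> (%x. z x - \<phi> x) < \<delta>"
   "\<forall>i. L2_norm \<Omega> (%x. weak_partial \<Omega> i z x - partial i \<phi> x) < \<delta>"
  have oS: "\<Omega> \<in> sets lebesgue" "open_triangle p q r \<in> sets lebesgue" using o open_open_triangle[of p q r] by auto
  note zH = H1D[OF o H10_H1[OF z]]
  have pS: "sq_int (leb \<Omega>) \<phi>" "sq_int (leb \<Omega>) (partial i \<phi>)" for i
   by (rule test_function_sq_int[OF _ oS(1)], rule p partial_test_function[OF p])+
  have "edge_mean p q r (%x. z x + (-1) * \<phi> x) (%i x. weak_partial \<Omega> i z x + (-1) * partial i \<phi> x) =
   edge_mean p q r z (%i. weak_partial \<Omega> i z) + (-1) * edge_mean p q r \<phi> (%i. partial i \<phi>)"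
   by (rule edge_mean_add) (rule sq_int_subset[OF _ A oS(2,1)], rule zH pS)+
  then have "\<bar>edge_mean p q r z (%i. weak_partial \<Omega> i z) - (LINT t:{0..1}|lborel. \<phi> (linepath q r t))\<bar> =
   \<bar>edge_mean p q r (%x. z x - \<phi> x) (%i x. weak_partial \<Omega> i z x - partial i \<phi> x)\<bar>"
   unfolding edge_mean_smooth[OF n test_functions_smooth[OF p]] by simp
  also have "\<dots> <= C * (L2_norm \<Omega> (%x. z x - \<phi> x) + (\<Sum>i\<in>UNIV. L2_norm \<Omega> (%x. weak_partial \<Omega> i z x - partial i \<phi> x)))"
   by (rule C(2)) (rule sq_int_diff zH pS)+
  also have "\<dots> <= C * (3 * \<delta>)"
   using d(1) d(2)[THEN spec, of 1] d(2)[THEN spec, of 2] by (intro mult_left_mono C(1)) (simp add: sum_2)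
  finally show "\<bar>edge_mean p q r z (%i. weak_partial \<Omega> i z) - (LINT t:{0..1}|lborel. \<phi> (linepath q r t))\<bar> <= 3 * C * \<delta>" by simp
 qed (use C(1) in simp)
qed

lemma abs_le_all_imp_zero:
 assumes "0 <= C" "!!\<delta>. 0 < \<delta> ==> \<bar>a\<bar> <= C * \<delta>"
 shows "a = (0::real)"
proof (rule ccontr)
 assume "a ~= 0"
 then have d: "0 < \<bar>a\<bar> / (2 * (C + 1))" using assms(1) by simp
 have "\<bar>a\<bar> * (2 * (C + 1)) <= C * \<bar>a\<bar>" using assms(2)[OF d] assms(1) by (simp add: field_simps)
 moreover have "C * \<bar>a\<bar> < \<bar>a\<bar> * (2 * (C + 1))" using assms(1) \<open>a ~= 0\<close> by (simp add: algebra_simps) (intro add_nonneg_pos; simp)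
 ultimately show False by simp
qed

text \<open>For a test function the edge mean is the line integral, which is the same from both
  sides and zero on the frontier; continuity of the edge mean transfers this to limits of test
  functions.\<close>

lemma H10_edge_mean:
 assumes o: "open \<Omega>" and n: "noncollinear p q r" and A: "open_triangle p q r \<subseteq> \<Omega>" and z: "z \<in> H10 \<Omega>"
 shows "noncollinear p' q r ==> open_triangle p' q r \<subseteq> \<Omega> ==>
   edge_mean p q r z (%i. weak_partial \<Omega> i z) = edge_mean p' q r z (%i. weak_partial \<Omega> i z)"
  "closed_segment q r \<subseteq> frontier \<Omega> ==> edge_mean p q r z (%i. weak_partial \<Omega> i z) = 0"
proof -
 obtain C where C: "0 <= C" "!!\<phi> \<delta>. \<phi> \<in> test_functions \<Omega> ==> L2_norm \<Omega> (%x. z x - \<phi> x) < \<delta> ==>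
  \<forall>i. L2_norm \<Omega> (%x. weak_partial \<Omega> i z x - partial i \<phi> x) < \<delta> ==>
  \<bar>edge_mean p q r z (%i. weak_partial \<Omega> i z) - (LINT t:{0..1}|lborel. \<phi> (linepath q r t))\<bar> <= C * \<delta>"
  by (rule H10_edge_mean_approx[OF o n A z]) blast
 {
  assume n': "noncollinear p' q r" and A': "open_triangle p' q r \<subseteq> \<Omega>"
  obtain C' where C': "0 <= C'" "!!\<phi> \<delta>. \<phi> \<in> test_functions \<Omega> ==> L2_norm \<Omega> (%x. z x - \<phi> x) < \<delta> ==>
   \<forall>i. L2_norm \<Omega> (%x. weak_partial \<Omega> i z x - partial i \<phi> x) < \<delta> ==>
   \<bar>edge_mean p' q r z (%i. weak_partial \<Omega> i z) - (LINT t:{0..1}|lborel. \<phi> (linepath q r t))\<bar> <= C' * \<delta>"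
   by (rule H10_edge_mean_approx[OF o n' A' z]) blast
  have "edge_mean p q r z (%i. weak_partial \<Omega> i z) - edge_mean p' q r z (%i. weak_partial \<Omega> i z) = 0"
  proof (rule abs_le_all_imp_zero[of "C + C'"])
   fix \<delta> :: real assume d: "0 < \<delta>"
   obtain \<phi> where p: "\<phi> \<in> test_functions \<Omega>" "L2_norm \<Omega> (%x. z x - \<phi> x) < \<delta>"
    "!!i. L2_norm \<Omega> (%x. weak_partial \<Omega> i z x - partial i \<phi> x) < \<delta>" using H10_approx[OF o z d] by metis
   have "\<forall>i. L2_norm \<Omega> (%x. weak_partial \<Omega> i z x - partial i \<phi> x) < \<delta>" using p(3) by (rule allI)
   from C(2)[OF p(1,2) this] C'(2)[OF p(1,2) this]
   show "\<bar>edge_mean p q r z (%i. weak_partial \<Omega> i z) - edge_mean p' q r z (%i. weak_partial \<Omega> i z)\<bar> <= (C + C') * \<delta>"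
    unfolding distrib_right by linarith
  qed (use C(1) C'(1) in simp)
  then show "edge_mean p q r z (%i. weak_partial \<Omega> i z) = edge_mean p' q r z (%i. weak_partial \<Omega> i z)" by simp
 next
  assume fr: "closed_segment q r \<subseteq> frontier \<Omega>"
  show "edge_mean p q r z (%i. weak_partial \<Omega> i z) = 0"
  proof (rule abs_le_all_imp_zero[OF C(1)])
   fix \<delta> :: real assume d: "0 < \<delta>"
   obtain \<phi> where p: "\<phi> \<in> test_functions \<Omega>" "L2_norm \<Omega> (%x. z x - \<phi> x) < \<delta>"
    "!!i. L2_norm \<Omega> (%x. weak_partial \<Omega> i z x - partial i \<phi> x) < \<delta>" using H10_approx[OF o z d] by metis
   have d': "\<forall>i. L2_norm \<Omega> (%x. weak_partial \<Omega> i z x - partial i \<phi> x) < \<delta>" using p(3) by (rule allI)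
   have "\<phi> (linepath q r t) = 0" if t: "t \<in> {0..1}" for t
   proof (rule test_functions_zero[OF p(1)])
    have "linepath q r t \<in> closed_segment q r" using linepath_in_path[OF t] .
    then show "linepath q r t \<notin> \<Omega>" using fr o by (auto simp: frontier_def interior_open)
   qed
   then have "(LINT t:{0..1}|lborel. \<phi> (linepath q r t)) = (LINT t:{0..1::real}|lborel. 0)"
    by (intro set_lebesgue_integral_cong) auto
   then show "\<bar>edge_mean p q r z (%i. weak_partial \<Omega> i z)\<bar> <= C * \<delta>"
    using C(2)[OF p(1,2) d'] by (simp add: set_lebesgue_integral_def)
  qed
 }
qed

definition broken_partial :: "point set set => 2 => scalar_field => scalar_field" where
 "broken_partial \<T> i u x = (\<Sum>\<kappa>\<in>\<T>. ind (interior \<kappa>) x * weak_partial (interior \<kappa>) i u x)"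

lemma broken_partial_eq:
 assumes m: "mesh \<Omega> \<T>" and k: "\<kappa> \<in> \<T>" and x: "x \<in> interior \<kappa>"
 shows "broken_partial \<T> i u x = weak_partial (interior \<kappa>) i u x"
proof -
 have "ind (interior \<kappa>') x * weak_partial (interior \<kappa>') i u x = 0" if "\<kappa>' \<in> \<T> - {\<kappa>}" for \<kappa>'
 proof -
  have "x \<notin> interior \<kappa>'" using that mesh_interior_disjoint[OF m k _ x, of \<kappa>'] interior_subset by blast
  then show ?thesis by simp
 qed
 then have "(\<Sum>\<kappa>'\<in>\<T> - {\<kappa>}. ind (interior \<kappa>') x * weak_partial (interior \<kappa>') i u x) = 0"
  by (intro sum.neutral ballI)
 then show ?thesis unfolding broken_partial_def sum.remove[OF mesh_finite[OF m] k] using x by simp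
qed

lemma mesh_interior_subset:
 assumes b: "bounded_lipschitz_polygon \<Omega>" and m: "mesh \<Omega> \<T>" and k: "\<kappa> \<in> \<T>"
 shows "interior \<kappa> \<subseteq> \<Omega>"
proof -
 have "interior \<kappa> \<subseteq> interior (closure \<Omega>)" using k mesh_Union[OF m] by (intro interior_mono) blast
 then show ?thesis by (simp add: interior_closure_lipschitz[OF b])
qed

lemma broken_partial_works:
 assumes m: "mesh \<Omega> \<T>" and k: "\<kappa> \<in> \<T>" and g: "has_weak_partial (interior \<kappa>) i v g"
 shows "has_weak_partial (interior \<kappa>) i v (broken_partial \<T> i v)"
  "AE x in leb (interior \<kappa>). broken_partial \<T> i v x = g x"
proof -
 have S: "interior \<kappa> \<in> sets lebesgue" by auto
 have e: "AE x in leb (interior \<kappa>). weak_partial (interior \<kappa>) i v x = broken_partial \<T> i v x"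
  unfolding AE_lebesgue_on_iff[OF S] by (rule AE_I2) (simp add: broken_partial_eq[OF m k])
 show "has_weak_partial (interior \<kappa>) i v (broken_partial \<T> i v)"
  by (rule has_weak_partial_cong_AE[OF open_interior weak_partial_works[OF g] _ e]) simp
 show "AE x in leb (interior \<kappa>). broken_partial \<T> i v x = g x"
  using e weak_partial_AE[OF open_interior g] by eventually_elim simp
qed

text \<open>On a triangle v is an affine function plus z. Its edge mean is therefore the trapezoidal
  value of the affine part plus the edge mean of z, and the defining conditions of both spaces yield
  compatibility.\<close>

lemma crouzeix_raviart_plus_H10:
 assumes b: "bounded_lipschitz_polygon \<Omega>" and m: "mesh \<Omega> \<T>"
  and u: "u \<in> crouzeix_raviart \<Omega> \<T>" and z: "z \<in> H10 \<Omega>"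
 defines "v \<equiv> (%x. u x + z x)"
 shows "sq_int (leb \<Omega>) v"
  "!!\<kappa> i. \<kappa> \<in> \<T> ==> has_weak_partial (interior \<kappa>) i v (broken_partial \<T> i v)"
  "!!\<kappa> i. \<kappa> \<in> \<T> ==> sq_int (leb (interior \<kappa>)) (broken_partial \<T> i v)"
  "edge_compatible \<Omega> \<T> v (%i. broken_partial \<T> i v)"
proof -
 have o: "open \<Omega>" using b by (simp add: bounded_lipschitz_polygon_def)
 have oS: "\<Omega> \<in> sets lebesgue" using o by auto
 have uL: "sq_int (leb \<Omega>) u" using u by (simp add: crouzeix_raviart_def L2_iff)
 note zH = H1D[OF o H10_H1[OF z]]
 show vL: "sq_int (leb \<Omega>) v" unfolding v_def by (rule sq_int_add[OF uL zH(1)])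
 obtain Q :: "point set => scalar_field" where
   Q: "(\<forall>\<kappa>\<in>\<T>. Q \<kappa> \<in> P1 \<and> (AE x in leb (interior \<kappa>). u x = Q \<kappa> x)) \<and>
    (\<forall>e\<in>interior_edges \<Omega> \<T>. \<forall>\<kappa>\<in>\<T>. \<forall>\<kappa>'\<in>\<T>. \<kappa> ~= \<kappa>' \<and> e facet_of \<kappa> \<and> e facet_of \<kappa>' -->
      edge_integral e (%x. Q \<kappa> x - Q \<kappa>' x) = 0) \<and>
    (\<forall>e\<in>boundary_edges \<Omega> \<T>. \<forall>\<kappa>\<in>\<T>. e facet_of \<kappa> --> edge_integral e (Q \<kappa>) = 0)"
  using u[unfolded crouzeix_raviart_def mem_Collect_eq, THEN conjunct2] by (rule exE)
 note Q1 = Q[THEN conjunct1] and Q2 = Q[THEN conjunct2, THEN conjunct1] and Q3 = Q[THEN conjunct2, THEN conjunct2]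
 have "\<forall>\<kappa>\<in>\<T>. \<exists>c d. \<forall>x. Q \<kappa> x = c \<bullet> x + d" using Q1 by (simp add: P1_def)
 then obtain c d where cd: "!!\<kappa>. \<kappa> \<in> \<T> ==> \<forall>x. Q \<kappa> x = c \<kappa> \<bullet> x + d \<kappa>" by metis
 have vQ: "AE x in leb (interior \<kappa>). v x = Q \<kappa> x + 1 * z x" if k: "\<kappa> \<in> \<T>" for \<kappa>
  using Q1[rule_format, OF k, THEN conjunct2] by eventually_elim (simp add: v_def)
 have gw: "has_weak_partial (interior \<kappa>) i v (%x. c \<kappa> $ i + 1 * weak_partial \<Omega> i z x)" if k: "\<kappa> \<in> \<T>" for \<kappa> i
 proof -
  have "has_weak_partial (interior \<kappa>) i (%x. 1 * Q \<kappa> x + 1 * z x) (%x. 1 * partial i (Q \<kappa>) x + 1 * weak_partial \<Omega> i z x)"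
   by (rule has_weak_partial_lincomb[OF open_interior has_weak_partial_smooth[OF open_interior affine_partial(1)[OF cd[OF k]]]
     has_weak_partial_subset[OF o open_interior mesh_interior_subset[OF b m k] zH(2)]])
  then have w: "has_weak_partial (interior \<kappa>) i (%x. Q \<kappa> x + 1 * z x) (%x. c \<kappa> $ i + 1 * weak_partial \<Omega> i z x)"
   by (simp add: affine_partial(2)[OF cd[OF k]])
  have "AE x in leb (interior \<kappa>). Q \<kappa> x + 1 * z x = v x" using vQ[OF k] by eventually_elim simp
  then show ?thesis by (rule has_weak_partial_cong_AE[OF open_interior w]) simp
 qed
 show bw: "has_weak_partial (interior \<kappa>) i v (broken_partial \<T> i v)" if k: "\<kappa> \<in> \<T>" for \<kappa> i
  by (rule broken_partial_works(1)[OF m k gw[OF k]])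
 have bA: "AE x in leb (interior \<kappa>). broken_partial \<T> i v x = c \<kappa> $ i + 1 * weak_partial \<Omega> i z x" if k: "\<kappa> \<in> \<T>" for \<kappa> i
  by (rule broken_partial_works(2)[OF m k gw[OF k]])
 have zk: "sq_int (leb (interior \<kappa>)) z" "sq_int (leb (interior \<kappa>)) (weak_partial \<Omega> i z)" if k: "\<kappa> \<in> \<T>" for \<kappa> i
  by (rule sq_int_subset[OF _ mesh_interior_subset[OF b m k] _ oS], rule zH, simp)+
 have sc: "sq_int (leb (open_triangle p q r)) (%x. c0)" for p q r c0
  by (rule sq_int_bounded[OF open_triangle_finite, of _ _ _ _ "\<bar>c0\<bar>"]) auto
 show "sq_int (leb (interior \<kappa>)) (broken_partial \<T> i v)" if k: "\<kappa> \<in> \<T>" for \<kappa> i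
 proof -
  obtain p q r where n: "noncollinear p q r" "\<kappa> = tri p q r" by (rule mesh_triangle[OF m k])
  have "sq_int (leb (interior \<kappa>)) (%x. c \<kappa> $ i)"
   using sc[of p q r "c \<kappa> $ i"] by (simp add: n(2) open_triangle_def)
  from sq_int_add[OF this sq_int_cmult[OF zk(2)[OF k], of 1 i]]
  have s: "sq_int (leb (interior \<kappa>)) (%x. c \<kappa> $ i + 1 * weak_partial \<Omega> i z x)" .
  have a: "AE x in leb (interior \<kappa>). c \<kappa> $ i + 1 * weak_partial \<Omega> i z x = broken_partial \<T> i v x"
   using bA[OF k, of i] by eventually_elim simp
  show ?thesis
   by (rule sq_int_cong_AE[OF s borel_measurable_cong_AE_lebesgue_on[OF a _ sq_int_measurable[OF s]] a]) simp
 qed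
 have em: "edge_mean p q r v (%i. broken_partial \<T> i v) =
   (Q (tri p q r) q + Q (tri p q r) r) / 2 + edge_mean p q r z (%i. weak_partial \<Omega> i z)"
  if n: "noncollinear p q r" and k: "tri p q r \<in> \<T>" for p q r
 proof -
  let ?k = "tri p q r"
  have I: "interior ?k = open_triangle p q r" by (simp add: open_triangle_def)
  have "edge_mean p q r v (%i. broken_partial \<T> i v) = edge_mean p q r (%x. Q ?k x + 1 * z x) (%i x. c ?k $ i + 1 * weak_partial \<Omega> i z x)"
   by (rule edge_mean_cong_AE) (use vQ[OF k] bA[OF k] in \<open>simp_all only: I\<close>)
  also have "\<dots> = edge_mean p q r (Q ?k) (%i x. c ?k $ i) + 1 * edge_mean p q r z (%i. weak_partial \<Omega> i z)"
   by (rule edge_mean_add)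
    (use sc zk[OF k] smooth_sq_int[OF affine_partial(1)[OF cd[OF k]]] in \<open>simp_all only: I\<close>)
  also have "edge_mean p q r (Q ?k) (%i x. c ?k $ i) = (Q ?k q + Q ?k r) / 2"
   using edge_mean_smooth[OF n affine_partial(1)[OF cd[OF k]]] affine_edge_integral(1)[OF cd[OF k], of q r]
   by (simp add: affine_partial(2)[OF cd[OF k], abs_def])
  finally show ?thesis by simp
 qed
 have sub: "open_triangle p q r \<subseteq> \<Omega>" if "tri p q r \<in> \<T>" for p q r
  using mesh_interior_subset[OF b m that] by (simp add: open_triangle_def)
 have bz: "Q (tri p q r) q + Q (tri p q r) r = 0"
  if n: "noncollinear p q r" and k: "tri p q r \<in> \<T>" and fr: "closed_segment q r \<subseteq> frontier \<Omega>" for p q r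
 proof (rule edge_integral_affine[OF cd[OF k]])
  show "q ~= r" using n by (auto simp: noncollinear_def cross2_def)
  have "closed_segment q r \<in> boundary_edges \<Omega> \<T>" unfolding boundary_edges_def using triangle_facets[OF n] k fr by blast
  then show "edge_integral (closed_segment q r) (Q (tri p q r)) = 0"
   using Q3 k triangle_facets[OF n] by blast
 qed
 show "edge_compatible \<Omega> \<T> v (%i. broken_partial \<T> i v)"
  unfolding edge_compatible_def
 proof (intro conjI allI impI; elim conjE)
  fix p q r assume n: "noncollinear p q r" and k: "tri p q r \<in> \<T>" and fr: "closed_segment q r \<subseteq> frontier \<Omega>"
  show "edge_mean p q r v (%i. broken_partial \<T> i v) = 0"
   unfolding em[OF n k] bz[OF n k fr] H10_edge_mean(2)[OF o n sub[OF k] z fr] by simp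
 next
  fix p q r p' assume n: "noncollinear p q r" "noncollinear p' q r" and k: "tri p q r \<in> \<T>" "tri p' q r \<in> \<T>"
  let ?k = "tri p q r" and ?k' = "tri p' q r"
  have qr: "q ~= r" using n by (auto simp: noncollinear_def cross2_def)
  have "Q ?k q + Q ?k r = Q ?k' q + Q ?k' r"
  \<comment> \<open>Frontier edges and coinciding triangles are settled separately, since the jump
    condition concerns two different triangles at an interior edge.\<close>
  proof (cases "?k = ?k' \<or> closed_segment q r \<subseteq> frontier \<Omega>")
   case True then show ?thesis using bz[OF n(1) k(1)] bz[OF n(2) k(2)] by force
  next
   case False
   have i: "closed_segment q r \<in> interior_edges \<Omega> \<T>" unfolding interior_edges_def using triangle_facets[OF n(1)] k False by blast
   have z: "edge_integral (closed_segment q r) (%x. Q ?k x - Q ?k' x) = 0"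
    by (rule Q2[rule_format, OF i k]) (use False triangle_facets[OF n(1)] triangle_facets[OF n(2)] in blast)
   have a: "\<forall>x. Q ?k x - Q ?k' x = (c ?k - c ?k') \<bullet> x + (d ?k - d ?k')"
    using cd[OF k(1)] cd[OF k(2)] by (simp add: inner_diff_left)
   have "(Q ?k q - Q ?k' q) + (Q ?k r - Q ?k' r) = 0" by (rule edge_integral_affine[OF a z qr])
   then show ?thesis by simp
  qed
  then show "edge_mean p q r v (%i. broken_partial \<T> i v) = edge_mean p' q r v (%i. broken_partial \<T> i v)"
   unfolding em[OF n(1) k(1)] em[OF n(2) k(2)] H10_edge_mean(1)[OF o n(1) sub[OF k(1)] z n(2) sub[OF k(2)]] by simp
 qed
qed

text \<open>The boundaries of the triangles form a null set, so f equals almost everywhere the sum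
  of its restrictions to the open triangles. Integrability over Omega is a conclusion because broken
  gradients are known only piecewise.\<close>

lemma mesh_integral:
 assumes b: "bounded_lipschitz_polygon \<Omega>" and m: "mesh \<Omega> \<T>"
  and f: "!!\<kappa>. \<kappa> \<in> \<T> ==> integrable (leb (interior \<kappa>)) (f :: scalar_field)"
 shows "integrable (leb \<Omega>) f"
  "lint (leb \<Omega>) f = (\<Sum>\<kappa>\<in>\<T>. lint (leb (interior \<kappa>)) f)"
proof -
 have o: "open \<Omega>" using b by (simp add: bounded_lipschitz_polygon_def)
 have oS: "\<Omega> \<in> sets lebesgue" using o by auto
 have iS: "interior \<kappa> \<in> sets lebesgue" for \<kappa> :: "point set" by auto
 define f' where "f' x = (\<Sum>\<kappa>\<in>\<T>. ind (interior \<kappa>) x * f x)" for x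
 have t: "integrable (leb \<Omega>) (%x. ind (interior \<kappa>) x * f x)" if k: "\<kappa> \<in> \<T>" for \<kappa>
 proof -
  have e: "ind \<Omega> x * (ind (interior \<kappa>) x * f x) = ind (interior \<kappa>) x * f x" for x
   using mesh_interior_subset[OF b m k] by (auto simp: indicator_def)
  show ?thesis using f[OF k] unfolding integrable_lebesgue_on_iff[OF oS] integrable_lebesgue_on_iff[OF iS] e .
 qed
 have f'i: "integrable (leb \<Omega>) f'" unfolding f'_def by (rule Bintegrable_sum) (rule t)
 have N: "(\<Union>\<kappa>\<in>\<T>. frontier \<kappa>) \<in> null_sets lebesgue"
 proof (rule null_sets.finite_UN[OF mesh_finite[OF m]])
  fix \<kappa> assume "\<kappa> \<in> \<T>"
  then obtain p q r where "\<kappa> = tri p q r" using mesh_triangle[OF m] by metis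
  then show "frontier \<kappa> \<in> null_sets lebesgue"
   using negligible_convex_frontier[of \<kappa>] by (simp add: negligible_iff_null_sets)
 qed
 have e: "f' x = f x" if x: "x \<in> \<Omega>" "x \<notin> (\<Union>\<kappa>\<in>\<T>. frontier \<kappa>)" for x
 proof -
  obtain \<kappa> where k: "\<kappa> \<in> \<T>" "x \<in> \<kappa>" using x(1) mesh_Union[OF m] closure_subset by blast
  have xi: "x \<in> interior \<kappa>" using k x(2) closure_subset[of \<kappa>] by (auto simp: frontier_def)
  have "ind (interior \<kappa>') x * f x = 0" if "\<kappa>' \<in> \<T> - {\<kappa>}" for \<kappa>'
  proof -
   have "x \<notin> interior \<kappa>'" using that mesh_interior_disjoint[OF m k(1) _ xi, of \<kappa>'] interior_subset by blast
   then show ?thesis by simp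
  qed
  then have "(\<Sum>\<kappa>'\<in>\<T> - {\<kappa>}. ind (interior \<kappa>') x * f x) = 0" by (intro sum.neutral ballI)
  then show ?thesis unfolding f'_def sum.remove[OF mesh_finite[OF m] k(1)] using xi by simp
 qed
 have ae: "AE x in leb \<Omega>. f' x = f x"
  unfolding AE_lebesgue_on_iff[OF oS] using AE_not_in[OF N] by eventually_elim (use e in blast)
 have fm: "f \<in> borel_measurable (leb \<Omega>)"
  by (rule borel_measurable_cong_AE_lebesgue_on[OF ae oS borel_measurable_integrable[OF f'i]])
 show "integrable (leb \<Omega>) f" by (rule integrable_cong_AE_imp[OF f'i fm]) (use ae in eventually_elim, simp)
 have "lint (leb \<Omega>) f = lint (leb \<Omega>) f'"
  by (rule integral_cong_AE_lebesgue_on[OF _ oS]) (use ae in eventually_elim, simp)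
 also have "\<dots> = (\<Sum>\<kappa>\<in>\<T>. lint (leb \<Omega>) (%x. ind (interior \<kappa>) x * f x))"
  unfolding f'_def by (rule Bintegral_sum) (rule t)
 also have "\<dots> = (\<Sum>\<kappa>\<in>\<T>. lint (leb (interior \<kappa>)) f)"
  by (rule sum.cong[OF refl], rule integral_lebesgue_on_subset[OF iS oS], rule mesh_interior_subset[OF b m])
 finally show "lint (leb \<Omega>) f = (\<Sum>\<kappa>\<in>\<T>. lint (leb (interior \<kappa>)) f)" .
qed

section \<open>Mesh regularity and local Sobolev energies\<close>

lemma triangle_diameter_pos:
 assumes "noncollinear p q r"
 shows "0 < diameter (tri p q r)"
proof -
 have "q ~= p" using assms by (auto simp: noncollinear_def cross2_def)
 then have "0 < dist q p" by simp
 also have "\<dots> <= diameter (tri p q r)"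
  by (rule diameter_bounded_bound[OF compact_imp_bounded[OF compact_triangle]]) (auto intro: hull_inc)
 finally show ?thesis .
qed

text \<open>The triangle contains a disc whose radius is comparable with the diameter. The constant
  is the square of 4 nu, and the factor pi in the area of the disc is estimated by 1.\<close>

lemma regular_mesh_area:
 assumes r: "regular_mesh \<nu> \<T>" and k: "tri p q r \<in> \<T>" and n: "noncollinear p q r"
 shows "(diameter (tri p q r))\<^sup>2 <= 16 * \<nu>\<^sup>2 * measure lebesgue (open_triangle p q r)"
proof -
 let ?k = "tri p q r"
 define S where "S = {diameter (cball c r) | c r. 0 < r \<and> cball c r \<subseteq> ?k}"
 have bk: "bounded ?k" by (rule compact_imp_bounded[OF compact_triangle])
 have d0: "0 < diameter ?k" by (rule triangle_diameter_pos[OF n])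
 have dc: "diameter (cball c r) = 2 * r" if "0 < r" for c :: point and r using that by simp
 have bdd: "bdd_above S" using diameter_subset[OF _ bk] unfolding S_def by (intro bdd_aboveI[of _ "diameter ?k"]) blast
 have "interior ?k ~= {}" using measure_open_triangle_pos[OF n] by (auto simp: open_triangle_def)
 then obtain x e where e: "0 < e" "cball x e \<subseteq> ?k" by (auto simp: mem_interior_cball)
 have xS: "2 * e \<in> S" unfolding S_def using e dc[OF e(1), of x] by (metis (mono_tags, lifting) mem_Collect_eq)
 have iS: "inner_diameter ?k = Sup S" by (simp add: inner_diameter_def S_def)
 have pos: "0 < Sup S" using cSup_upper[OF xS bdd] e(1) by linarith
 then have "Sup S / 2 < Sup S" by simp
 \<comment> \<open>Attainment of the supremum is not shown; a disc with more than half of the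
   supremal diameter suffices and gives the factor 4 in front of its radius.\<close>
 then obtain y where y: "y \<in> S" "Sup S / 2 < y" using less_cSup_iff[OF _ bdd] xS by blast
 then obtain c r' where c: "y = diameter (cball c r')" "0 < r'" "cball c r' \<subseteq> ?k" by (auto simp: S_def)
 have "Sup S < 4 * r'" using y(2) unfolding c(1) dc[OF c(2)] by simp
 have "diameter ?k / Sup S <= \<nu>" using r k unfolding regular_mesh_def iS[symmetric] by blast
 then have le: "diameter ?k <= \<nu> * Sup S" using pos by (simp add: pos_divide_le_eq)
 then have "0 < \<nu>" using d0 pos by (metis less_le_trans zero_less_mult_pos2)
 then have "diameter ?k <= \<nu> * (4 * r')" using le \<open>Sup S < 4 * r'\<close> by (meson less_imp_le mult_left_mono order_trans)
 then have "(diameter ?k)\<^sup>2 <= (\<nu> * (4 * r'))\<^sup>2" using d0 by (intro power_mono) auto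
 also have "\<dots> = 16 * \<nu>\<^sup>2 * r'\<^sup>2" by (simp add: power2_eq_square)
 also have "\<dots> <= 16 * \<nu>\<^sup>2 * measure lebesgue (open_triangle p q r)"
 proof (rule mult_left_mono)
  have "r'\<^sup>2 <= r'\<^sup>2 * pi" using pi_gt3 by (simp add: mult_le_cancel_left1)
  also have "\<dots> = measure lebesgue (ball c r')" using circle_area[of r' c] c(2) by (simp add: measure_completion)
  also have "\<dots> <= measure lebesgue (open_triangle p q r)"
  proof (rule measure_mono_fmeasurable[OF _ _ lmeasurable_open_triangle])
   show "ball c r' \<subseteq> open_triangle p q r" unfolding open_triangle_def
    by (rule interior_maximal[OF _ open_ball]) (use ball_subset_cball c(3) in blast)
  qed simp
  finally show "r'\<^sup>2 <= measure lebesgue (open_triangle p q r)" .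
 qed simp
 finally show ?thesis .
qed

lemma corner_finite: "noncollinear p q r ==> finite_measure (leb (corner p q r t))"
 by (rule finite_measure_lebesgue_on[OF lmeasurable_corner])

lemma sq_int_corner:
 assumes "noncollinear p q r" "sq_int (leb (open_triangle p q r)) u"
 shows "sq_int (leb (corner p q r t)) u"
 by (rule sq_int_subset[OF assms(2) corner_subset]) (use open_corner[OF assms(1)] open_open_triangle in auto)

text \<open>Means are linear, and (x + y)^2 <= 2 x^2 + 2 y^2 is applied to the deviations from
  them.\<close>

lemma campanato_lincomb:
 assumes n: "noncollinear p q r" and u: "campanato_at p q r s K u" and v: "campanato_at p q r s L v"
 shows "campanato_at p q r s (2 * \<alpha>\<^sup>2 * K + 2 * \<beta>\<^sup>2 * L) (%x. \<alpha> * u x + \<beta> * v x)"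
 unfolding campanato_at_def
proof (intro conjI allI impI; (elim conjE)?)
 have su: "sq_int (leb (open_triangle p q r)) u" and sv: "sq_int (leb (open_triangle p q r)) v"
  using u v by (simp_all add: campanato_at_def)
 show "sq_int (leb (open_triangle p q r)) (%x. \<alpha> * u x + \<beta> * v x)"
  by (intro sq_int_add sq_int_cmult su sv)
 fix t :: real assume t: "0 < t" "t <= 1"
 let ?M = "leb (corner p q r t)"
 note fin = corner_finite[OF n, of t]
 note cu = sq_int_corner[OF n su, of t] and cv = sq_int_corner[OF n sv, of t]
 let ?mu = "mean_on (corner p q r t) u" and ?mv = "mean_on (corner p q r t) v"
 note iu = sq_int_integrable[OF fin cu] and iv = sq_int_integrable[OF fin cv]
 have const: "sq_int ?M (%x. c)" for c :: real
  by (rule sq_int_bounded[OF fin, of _ "\<bar>c\<bar>"]) auto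
 have du: "integrable ?M (%x. (u x - ?mu)\<^sup>2)" and dv: "integrable ?M (%x. (v x - ?mv)\<^sup>2)"
  by (rule sq_int_square[OF sq_int_diff[OF _ const]], rule cu cv)+
 have me: "mean_on (corner p q r t) (%x. \<alpha> * u x + \<beta> * v x) = \<alpha> * ?mu + \<beta> * ?mv"
  using iu iv by (simp add: add_divide_distrib)
 have "lint ?M (%x. (\<alpha> * u x + \<beta> * v x - (\<alpha> * ?mu + \<beta> * ?mv))\<^sup>2)
   <= lint ?M (%x. 2 * \<alpha>\<^sup>2 * (u x - ?mu)\<^sup>2 + 2 * \<beta>\<^sup>2 * (v x - ?mv)\<^sup>2)"
 proof (rule integral_mono_AE')
  show "integrable ?M (%x. 2 * \<alpha>\<^sup>2 * (u x - ?mu)\<^sup>2 + 2 * \<beta>\<^sup>2 * (v x - ?mv)\<^sup>2)"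
   by (intro Bintegrable_add integrable_mult_right du dv)
  have "(\<alpha> * a + \<beta> * b - (\<alpha> * c + \<beta> * d))\<^sup>2 <= 2 * \<alpha>\<^sup>2 * (a - c)\<^sup>2 + 2 * \<beta>\<^sup>2 * (b - d)\<^sup>2" for a b c d :: real
  proof -
   have "0 <= (\<alpha> * (a - c) - \<beta> * (b - d))\<^sup>2" by simp
   then show ?thesis by (simp add: power2_eq_square algebra_simps)
  qed
  then show "AE x in ?M. (\<alpha> * u x + \<beta> * v x - (\<alpha> * ?mu + \<beta> * ?mv))\<^sup>2 <= 2 * \<alpha>\<^sup>2 * (u x - ?mu)\<^sup>2 + 2 * \<beta>\<^sup>2 * (v x - ?mv)\<^sup>2" by blast
 qed simp
 also have "\<dots> = 2 * \<alpha>\<^sup>2 * lint ?M (%x. (u x - ?mu)\<^sup>2) + 2 * \<beta>\<^sup>2 * lint ?M (%x. (v x - ?mv)\<^sup>2)"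
  using du dv by (simp only: Bintegral_add integrable_mult_right integral_mult_right_zero)
 also have "\<dots> <= 2 * \<alpha>\<^sup>2 * (K * t powr (2 * s)) + 2 * \<beta>\<^sup>2 * (L * t powr (2 * s))"
  using u v t unfolding campanato_at_def by (intro add_mono mult_left_mono) auto
 also have "\<dots> = (2 * \<alpha>\<^sup>2 * K + 2 * \<beta>\<^sup>2 * L) * t powr (2 * s)" by (simp only: distrib_right mult.assoc)
 finally show "lint ?M (%x. (\<alpha> * u x + \<beta> * v x - mean_on (corner p q r t) (%x. \<alpha> * u x + \<beta> * v x))\<^sup>2)
   <= (2 * \<alpha>\<^sup>2 * K + 2 * \<beta>\<^sup>2 * L) * t powr (2 * s)" unfolding me .
qed

lemma campanato_mono:
 assumes "campanato_at p q r s K u" "K <= L"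
 shows "campanato_at p q r s L u"
proof -
 have "K * t powr (2 * s) <= L * t powr (2 * s)" for t by (rule mult_right_mono[OF assms(2)]) simp
 then show ?thesis using assms(1) unfolding campanato_at_def by (meson order_trans)
qed

text \<open>The share of A in the squared seminorm. For s = 1 the factor 4 is the Poincare constant,
  included so that \<open>campanato_Hs\<close> has the same form in both cases.\<close>

definition Hs_energy :: "point set => real => scalar_field => point set => real" where
 "Hs_energy \<Omega> s u A =
   (if s = 1 then 4 * (\<Sum>i\<in>UNIV. lint (leb A) (%x. (weak_partial \<Omega> i u x)\<^sup>2))
   else lint (leb \<Omega> \<Otimes>\<^sub>M leb \<Omega>) (%z. ind (A \<times> A) z * slobodeckij_quotient s u z))"

lemma slobodeckij_quotient_nonneg: "0 <= slobodeckij_quotient s u z"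
 by (auto simp: slobodeckij_quotient_def split: prod.split)

lemma Hs_energy_nonneg: "0 <= Hs_energy \<Omega> s u A"
 unfolding Hs_energy_def
 by (auto intro!: sum_nonneg Bintegral_nonneg simp: slobodeckij_quotient_nonneg)

lemma Hs_sq_int:
 assumes "open \<Omega>" "u \<in> Hs \<Omega> s"
 shows "sq_int (leb \<Omega>) u"
 using assms H1D(1)[of \<Omega> u] by (cases "s = 1") (auto simp: Hs_def L2_iff[symmetric])

lemma slobodeckij_indicator_integrable:
 assumes "A \<subseteq> \<Omega>" "open A" "open \<Omega>" "integrable (leb \<Omega> \<Otimes>\<^sub>M leb \<Omega>) (slobodeckij_quotient s u)"
 shows "integrable (leb \<Omega> \<Otimes>\<^sub>M leb \<Omega>) (%z. ind (A \<times> A) z * slobodeckij_quotient s u z)"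
proof -
 have "A \<in> sets lebesgue" "\<Omega> \<in> sets lebesgue" using assms by auto
 then have "A \<in> sets (leb \<Omega>)" using assms(1) by (simp add: sets_restrict_space_iff)
 then have "A \<times> A \<in> sets (leb \<Omega> \<Otimes>\<^sub>M leb \<Omega>)" by simp
 from integrable_mult_indicator[OF this assms(4)] show ?thesis by simp
qed

text \<open>A corner has diameter at most t h and area t^2 a. Hence the factor (t h)^(2+2s) / (t^2
  a) of the variance bound equals (h^2 / a) (t h)^(2s); for s = 1 the Poincare factor (t h)^4 / (t^2
  a) behaves in the same way.\<close>

lemma campanato_Hs:
 assumes Om: "open \<Omega>" "\<Omega> \<in> lmeasurable" and n: "noncollinear p q r" and A: "open_triangle p q r \<subseteq> \<Omega>"
  and s: "0 < s" "s <= 1" and u: "u \<in> Hs \<Omega> s"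
  and h: "0 < h" "\<forall>x\<in>open_triangle p q r. \<forall>y\<in>open_triangle p q r. norm (x - y) <= h"
   "h\<^sup>2 <= c * measure lebesgue (open_triangle p q r)"
 shows "campanato_at p q r s (c * h powr (2 * s) * Hs_energy \<Omega> s u (open_triangle p q r)) u"
proof -
 let ?A = "open_triangle p q r"
 define a where "a = measure lebesgue ?A"
 have a: "0 < a" unfolding a_def by (rule measure_open_triangle_pos[OF n])
 have ha: "h\<^sup>2 / a <= c" using h(3) a by (simp add: pos_divide_le_eq a_def)
 have S: "?A \<in> sets lebesgue" "\<Omega> \<in> sets lebesgue" using open_open_triangle[of p q r] Om(1) by auto
 have uO: "sq_int (leb \<Omega>) u" by (rule Hs_sq_int[OF Om(1) u])
 have uA: "sq_int (leb ?A) u" by (rule sq_int_subset[OF uO A S])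
 have "lint (leb (corner p q r t)) (%x. (u x - mean_on (corner p q r t) u)\<^sup>2)
   <= (c * h powr (2 * s) * Hs_energy \<Omega> s u ?A) * t powr (2 * s)" if t: "0 < t" "t <= 1" for t
 proof -
  let ?B = "corner p q r t"
  have B: "open ?B" "convex ?B" "?B \<subseteq> ?A" "?B \<in> lmeasurable" "measure lebesgue ?B = t\<^sup>2 * a"
   using open_corner[OF n] convex_corner[OF n t] corner_subset lmeasurable_corner[OF n] measure_corner[OF n t] by (simp_all add: a_def)
  have Bne: "?B ~= {}" using B(5) t a by auto
  have BO: "?B \<subseteq> \<Omega>" using B(3) A by blast
  have BS: "?B \<in> sets lebesgue" using B(1) by auto
  have uB: "sq_int (leb ?B) u" by (rule sq_int_corner[OF n uA])
  have d: "0 <= t * h" "\<forall>x\<in>?B. \<forall>y\<in>?B. norm (x - y) <= t * h" using corner_dist[OF n t h(2)] t h(1) by simp_all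
  have E: "0 <= Hs_energy \<Omega> s u ?A" by (rule Hs_energy_nonneg)
  show ?thesis
  proof (cases "s = 1")
   case True
   have uH: "u \<in> H1 \<Omega>" using u True by (simp add: Hs_def)
   note H = H1D[OF Om(1) uH]
   have gA: "sq_int (leb ?A) (weak_partial \<Omega> i u)" for i by (rule sq_int_subset[OF H(3) A S])
   have gB: "sq_int (leb ?B) (weak_partial \<Omega> i u)" for i by (rule sq_int_corner[OF n gA])
   have bB: "bounded ?B" using B(3) bounded_open_triangle bounded_subset by blast
   have wB: "has_weak_partial ?B i u (weak_partial \<Omega> i u)" for i
    by (rule has_weak_partial_subset[OF Om(1) B(1) BO H(2)])
   have "lint (leb ?B) (%x. (u x - mean_on ?B u)\<^sup>2) <=
    4 * (t * h) ^ 4 * (\<Sum>i\<in>UNIV. lint (leb ?B) (%x. (weak_partial \<Omega> i u x)\<^sup>2)) / measure lebesgue ?B"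
    by (rule poincare_convex[OF B(1,2) bB Bne d uB gB wB])
   also have "\<dots> = (h\<^sup>2 / a) * (h\<^sup>2 * t\<^sup>2 * (4 * (\<Sum>i\<in>UNIV. lint (leb ?B) (%x. (weak_partial \<Omega> i u x)\<^sup>2))))"
    unfolding B(5) using t a by (simp add: field_simps power2_eq_square power4_eq_xxxx)
   also have "\<dots> <= c * (h\<^sup>2 * t\<^sup>2 * Hs_energy \<Omega> s u ?A)"
   proof (rule mult_mono[OF ha])
    have "lint (leb ?B) (%x. (weak_partial \<Omega> i u x)\<^sup>2) <= lint (leb ?A) (%x. (weak_partial \<Omega> i u x)\<^sup>2)" for i
     unfolding integral_lebesgue_on_subset[OF BS S(1) B(3), symmetric]
     by (rule integral_mono_AE'[OF sq_int_square[OF gA]]) (auto simp: indicator_def)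
    then have "4 * (\<Sum>i\<in>UNIV. lint (leb ?B) (%x. (weak_partial \<Omega> i u x)\<^sup>2)) <= Hs_energy \<Omega> s u ?A"
     unfolding Hs_energy_def using True by (simp add: sum_mono)
    then show "h\<^sup>2 * t\<^sup>2 * (4 * (\<Sum>i\<in>UNIV. lint (leb ?B) (%x. (weak_partial \<Omega> i u x)\<^sup>2))) <= h\<^sup>2 * t\<^sup>2 * Hs_energy \<Omega> s u ?A"
     by (rule mult_left_mono) simp
    show "0 <= c" using ha a by (meson divide_nonneg_pos order_trans zero_le_power2)
   qed (intro mult_nonneg_nonneg sum_nonneg Bintegral_nonneg; simp)
   also have "\<dots> = (c * h powr (2 * s) * Hs_energy \<Omega> s u ?A) * t powr (2 * s)" using True t h(1) by (simp add: powr_numeral)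
   finally show ?thesis .
  next
   case False
   have q: "integrable (leb \<Omega> \<Otimes>\<^sub>M leb \<Omega>) (slobodeckij_quotient s u)" using u False by (simp add: Hs_def)
   let ?I = "%A. lint (leb \<Omega> \<Otimes>\<^sub>M leb \<Omega>) (%z. ind (A \<times> A) z * slobodeckij_quotient s u z)"
   have "lint (leb ?B) (%x. (u x - mean_on ?B u)\<^sup>2) <= (t * h) powr (2 + 2 * s) * ?I ?B / measure lebesgue ?B"
    by (rule variance_le_slobodeckij[OF B(1) Bne BO Om(2) d s(1) uB q])
   also have "(t * h) powr (2 + 2 * s) = (t * h)\<^sup>2 * (t powr (2 * s) * h powr (2 * s))"
    using t h(1) by (simp add: powr_add powr_mult powr_numeral power_mult_distrib)
   also have "(t * h)\<^sup>2 * (t powr (2 * s) * h powr (2 * s)) * ?I ?B / measure lebesgue ?B = (h\<^sup>2 / a) * (h powr (2 * s) * t powr (2 * s) * ?I ?B)"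
    unfolding B(5) using t a by (simp add: field_simps)
   also have "\<dots> <= c * (h powr (2 * s) * t powr (2 * s) * Hs_energy \<Omega> s u ?A)"
   proof (rule mult_mono[OF ha])
    have "?I ?B <= ?I ?A"
    proof (rule integral_mono_AE'[OF slobodeckij_indicator_integrable[OF A open_open_triangle Om(1) q]])
     have "ind (?B \<times> ?B) z <= ind (?A \<times> ?A) z" for z using B(3) by (auto simp: indicator_def)
     then show "AE z in leb \<Omega> \<Otimes>\<^sub>M leb \<Omega>. ind (?B \<times> ?B) z * slobodeckij_quotient s u z <= ind (?A \<times> ?A) z * slobodeckij_quotient s u z"
      by (intro AE_I2 mult_right_mono slobodeckij_quotient_nonneg)
    qed (simp add: slobodeckij_quotient_nonneg)
    then show "h powr (2 * s) * t powr (2 * s) * ?I ?B <= h powr (2 * s) * t powr (2 * s) * Hs_energy \<Omega> s u ?A"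
     unfolding Hs_energy_def using False by (simp add: mult_left_mono)
    show "0 <= c" using ha a by (meson divide_nonneg_pos order_trans zero_le_power2)
   qed (intro mult_nonneg_nonneg Bintegral_nonneg; simp add: slobodeckij_quotient_nonneg)
   also have "\<dots> = (c * h powr (2 * s) * Hs_energy \<Omega> s u ?A) * t powr (2 * s)" by (simp add: mult_ac)
   finally show ?thesis .
  qed
 qed
 then show ?thesis using uA by (simp add: campanato_at_def)
qed

lemma Hs_norm_nonneg: "0 <= Hs_norm \<Omega> s u"
 by (auto simp: Hs_norm_def H1_norm_def slobodeckij_quotient_nonneg intro!: add_nonneg_nonneg sum_nonneg Bintegral_nonneg)

text \<open>For s < 1 the products of the open triangles with themselves are disjoint, so their
  shares add up to at most the full double integral. The factor 4 comes from the case s = 1.\<close>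

lemma sum_Hs_energy_le:
 assumes b: "bounded_lipschitz_polygon \<Omega>" and m: "mesh \<Omega> \<T>" and u: "u \<in> Hs \<Omega> s"
 shows "(\<Sum>\<kappa>\<in>\<T>. Hs_energy \<Omega> s u (interior \<kappa>)) <= 4 * (Hs_norm \<Omega> s u)\<^sup>2"
proof (cases "s = 1")
 case True
 have o: "open \<Omega>" using b by (simp add: bounded_lipschitz_polygon_def)
 have oS: "\<Omega> \<in> sets lebesgue" using o by auto
 have uH: "u \<in> H1 \<Omega>" using u True by (simp add: Hs_def)
 have g: "integrable (leb (interior \<kappa>)) (%x. (weak_partial \<Omega> i u x)\<^sup>2)" if "\<kappa> \<in> \<T>" for \<kappa> i
  by (rule integrable_lebesgue_on_subset[OF _ oS mesh_interior_subset[OF b m that] sq_int_square[OF H1D(3)[OF o uH]]]) auto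
 have L: "(L2_norm \<Omega> w)\<^sup>2 = lint (leb \<Omega>) (%x. (w x)\<^sup>2)" for w by (simp add: L2_norm_def)
 have "(\<Sum>\<kappa>\<in>\<T>. Hs_energy \<Omega> s u (interior \<kappa>)) = 4 * (\<Sum>\<kappa>\<in>\<T>. \<Sum>i\<in>UNIV. lint (leb (interior \<kappa>)) (%x. (weak_partial \<Omega> i u x)\<^sup>2))"
  by (simp add: Hs_energy_def True sum_distrib_left)
 also have "(\<Sum>\<kappa>\<in>\<T>. \<Sum>i\<in>UNIV. lint (leb (interior \<kappa>)) (%x. (weak_partial \<Omega> i u x)\<^sup>2)) =
   (\<Sum>i\<in>UNIV. \<Sum>\<kappa>\<in>\<T>. lint (leb (interior \<kappa>)) (%x. (weak_partial \<Omega> i u x)\<^sup>2))" by (rule sum.swap)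
 also have "\<dots> = (\<Sum>i\<in>UNIV. (L2_norm \<Omega> (weak_partial \<Omega> i u))\<^sup>2)"
  unfolding L by (rule sum.cong[OF refl], rule mesh_integral(2)[OF b m, symmetric], rule g)
 also have "4 * (\<Sum>i\<in>UNIV. (L2_norm \<Omega> (weak_partial \<Omega> i u))\<^sup>2) <= 4 * (Hs_norm \<Omega> s u)\<^sup>2"
  by (simp add: Hs_norm_def True H1_norm_def add_nonneg_nonneg sum_nonneg)
 finally show ?thesis .
next
 case False
 have o: "open \<Omega>" using b by (simp add: bounded_lipschitz_polygon_def)
 have q: "integrable (leb \<Omega> \<Otimes>\<^sub>M leb \<Omega>) (slobodeckij_quotient s u)" using u False by (simp add: Hs_def)
 let ?M = "leb \<Omega> \<Otimes>\<^sub>M leb \<Omega>"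
 have i: "integrable ?M (%z. ind (interior \<kappa> \<times> interior \<kappa>) z * slobodeckij_quotient s u z)" if "\<kappa> \<in> \<T>" for \<kappa>
  by (rule slobodeckij_indicator_integrable[OF mesh_interior_subset[OF b m that] open_interior o q])
 have "(\<Sum>\<kappa>\<in>\<T>. Hs_energy \<Omega> s u (interior \<kappa>)) = lint ?M (%z. \<Sum>\<kappa>\<in>\<T>. ind (interior \<kappa> \<times> interior \<kappa>) z * slobodeckij_quotient s u z)"
  unfolding Hs_energy_def using False by (simp add: Bintegral_sum[OF i])
 also have "\<dots> <= lint ?M (slobodeckij_quotient s u)"
 proof (rule integral_mono_AE'[OF q])
  have "(\<Sum>\<kappa>\<in>\<T>. ind (interior \<kappa> \<times> interior \<kappa>) z) <= 1" for z
  proof (cases "\<exists>\<kappa>\<in>\<T>. fst z \<in> interior \<kappa>")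
   case True
   then obtain \<kappa> where k: "\<kappa> \<in> \<T>" "fst z \<in> interior \<kappa>" by blast
   have "ind (interior \<kappa>' \<times> interior \<kappa>') z = 0" if "\<kappa>' \<in> \<T> - {\<kappa>}" for \<kappa>'
   proof -
    have "fst z \<notin> interior \<kappa>'" using that mesh_interior_disjoint[OF m k(1) _ k(2), of \<kappa>'] interior_subset by blast
    then show ?thesis by (auto simp: indicator_def)
   qed
   then have "(\<Sum>\<kappa>'\<in>\<T> - {\<kappa>}. ind (interior \<kappa>' \<times> interior \<kappa>') z) = 0" by (intro sum.neutral ballI)
   then show ?thesis unfolding sum.remove[OF mesh_finite[OF m] k(1)] by (simp add: indicator_def)
  next
   case False
   have "(\<Sum>\<kappa>\<in>\<T>. ind (interior \<kappa> \<times> interior \<kappa>) z) = 0" by (rule sum.neutral) (use False in \<open>auto simp: indicator_def\<close>)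
   then show ?thesis by simp
  qed
  then show "AE z in ?M. (\<Sum>\<kappa>\<in>\<T>. ind (interior \<kappa> \<times> interior \<kappa>) z * slobodeckij_quotient s u z) <= slobodeckij_quotient s u z"
   unfolding sum_distrib_right[symmetric] by (intro AE_I2 mult_left_le_one_le slobodeckij_quotient_nonneg sum_nonneg) auto
 qed (simp add: slobodeckij_quotient_nonneg)
 also have "\<dots> <= (Hs_norm \<Omega> s u)\<^sup>2"
  unfolding Hs_norm_def using False by (simp add: slobodeckij_quotient_nonneg Bintegral_nonneg add_nonneg_nonneg)
 also have "\<dots> <= 4 * (Hs_norm \<Omega> s u)\<^sup>2" by simp
 finally show ?thesis .
qed

text \<open>Applied to the divergence, which must lie in \<open>Hs\<close> in its own right because
  its norm is bounded separately, together with lambda.\<close>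

lemma Hs_add:
 assumes o: "open \<Omega>" and a: "a \<in> Hs \<Omega> s" and b: "b \<in> Hs \<Omega> s"
 shows "(%x. a x + b x) \<in> Hs \<Omega> s"
proof (cases "s = 1")
 case True
 then have H: "a \<in> H1 \<Omega>" "b \<in> H1 \<Omega>" using a b by (simp_all add: Hs_def)
 have "(%x. a x + b x) \<in> H1 \<Omega>"
 proof (rule H1I)
  show "sq_int (leb \<Omega>) (%x. a x + b x)" by (intro sq_int_add H1D(1)[OF o] H)
  show "has_weak_partial \<Omega> i (%x. a x + b x) (%x. weak_partial \<Omega> i a x + weak_partial \<Omega> i b x)" for i
   using has_weak_partial_lincomb[OF o H1D(2)[OF o H(1)] H1D(2)[OF o H(2)], of i 1 1] by simp
  show "sq_int (leb \<Omega>) (%x. weak_partial \<Omega> i a x + weak_partial \<Omega> i b x)" for i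
   by (intro sq_int_add H1D(3)[OF o] H)
 qed
 then show ?thesis using True by (simp add: Hs_def)
next
 case False
 let ?M = "leb \<Omega> \<Otimes>\<^sub>M leb \<Omega>"
 have q: "integrable ?M (slobodeckij_quotient s a)" "integrable ?M (slobodeckij_quotient s b)" using a b False by (simp_all add: Hs_def)
 have sq: "sq_int (leb \<Omega>) (%x. a x + b x)"
  by (rule sq_int_add[OF Hs_sq_int[OF o a] Hs_sq_int[OF o b]])
 have id: "(%x. x) \<in> borel_measurable (leb \<Omega>)"
  by (intro measurable_restrict_space1 measurable_completion) simp
 note m = sq_int_measurable[OF sq]
 have meas: "slobodeckij_quotient s (%x. a x + b x) \<in> borel_measurable ?M"
  unfolding slobodeckij_quotient_def case_prod_beta
  using measurable_compose[OF measurable_fst m] measurable_compose[OF measurable_snd m]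
   measurable_compose[OF measurable_fst id] measurable_compose[OF measurable_snd id]
  by measurable
 have "integrable ?M (slobodeckij_quotient s (%x. a x + b x))"
 proof (rule Bintegrable_bound[OF _ meas])
  show "integrable ?M (%z. 2 * slobodeckij_quotient s a z + 2 * slobodeckij_quotient s b z)"
   using q by simp
  have le: "(x + y - (x' + y'))\<^sup>2 / d <= 2 * ((x - x')\<^sup>2 / d) + 2 * ((y - y')\<^sup>2 / d)" if "0 <= d" for x y x' y' d :: real
  proof -
   have "0 <= ((x - x') - (y - y'))\<^sup>2" by simp
   then have "(x + y - (x' + y'))\<^sup>2 <= 2 * (x - x')\<^sup>2 + 2 * (y - y')\<^sup>2" by (simp add: power2_eq_square algebra_simps)
   then have "(x + y - (x' + y'))\<^sup>2 / d <= (2 * (x - x')\<^sup>2 + 2 * (y - y')\<^sup>2) / d" by (rule divide_right_mono[OF _ that])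
   then show ?thesis by (simp add: add_divide_distrib)
  qed
  have "slobodeckij_quotient s (%x. a x + b x) z <= 2 * slobodeckij_quotient s a z + 2 * slobodeckij_quotient s b z" for z
   unfolding slobodeckij_quotient_def case_prod_beta by (rule le) simp
  then show "AE z in ?M. norm (slobodeckij_quotient s (%x. a x + b x) z) <= norm (2 * slobodeckij_quotient s a z + 2 * slobodeckij_quotient s b z)"
   by (intro AE_I2) (simp add: slobodeckij_quotient_nonneg)
 qed
 then show ?thesis using sq False by (simp add: Hs_def L2_iff)
qed

lemma hardy_const_nonneg:
 assumes "0 < s" "s <= 1"
 shows "0 <= hardy_const s"
proof -
 have "2 powr (0::real) < 2 powr (1 - s / 2)" using assms by (intro powr_less_mono) auto
 moreover have "2 powr (- s / 2) < 2 powr (0::real)" using assms by (intro powr_less_mono) auto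
 ultimately show ?thesis unfolding hardy_const_def by (intro divide_nonneg_pos mult_nonneg_nonneg add_nonneg_nonneg) auto
qed

lemma mesh_size_ge:
 assumes "mesh \<Omega> \<T>" "\<kappa> \<in> \<T>"
 shows "diameter \<kappa> <= mesh_size \<T>"
 unfolding mesh_size_def using mesh_finite[OF assms(1)] assms(2) by (intro Max_ge) auto

text \<open>The stress factor of \<open>triangle_local_limit\<close> after h^2 / a has been replaced
  by its bound 16 nu^2.\<close>

definition element_const :: "real => real => real" where
 "element_const \<nu> s = 1 + 21 * step_bound * hardy_const s * (16 * \<nu>\<^sup>2)"

section \<open>Consistency estimate for one row of the stress\<close>

text \<open>Subtracting the test function E k changes nothing globally by the weak equation but
  makes each local contribution small. The local limits are summed by the Cauchy-Schwarz inequality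
  over the triangles.\<close>

lemma scalar_consistency:
 fixes \<Omega> \<T> \<nu> s and \<tau> g :: "2 => scalar_field" and v f :: scalar_field and K :: "point set => real"
 assumes b: "bounded_lipschitz_polygon \<Omega>" and m: "mesh \<Omega> \<T>" and r: "regular_mesh \<nu> \<T>" and s: "0 < s" "s <= 1"
  and K: "!!\<kappa>. \<kappa> \<in> \<T> ==> 0 <= K \<kappa>"
  and tau: "!!p q r j. noncollinear p q r ==> tri p q r \<in> \<T> ==> campanato_at p q r s (K (tri p q r)) (\<tau> j)"
  and v: "sq_int (leb \<Omega>) v"
  and g: "!!\<kappa> j. \<kappa> \<in> \<T> ==> has_weak_partial (interior \<kappa>) j v (g j)" "!!\<kappa> j. \<kappa> \<in> \<T> ==> sq_int (leb (interior \<kappa>)) (g j)"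
  and ec: "edge_compatible \<Omega> \<T> v g"
  and f: "sq_int (leb \<Omega>) f"
  and weak: "!!\<phi>. \<phi> \<in> test_functions \<Omega> ==>
   lint (leb \<Omega>) (%x. \<Sum>j\<in>UNIV. \<tau> j x * partial j \<phi> x) = lint (leb \<Omega>) (%x. f x * \<phi> x)"
 shows "\<bar>(\<Sum>\<kappa>\<in>\<T>. lint (leb (interior \<kappa>)) (%x. \<Sum>j\<in>UNIV. \<tau> j x * g j x)) - lint (leb \<Omega>) (%x. f x * v x)\<bar>
  <= sqrt (2 * (\<Sum>\<kappa>\<in>\<T>. \<Sum>j\<in>UNIV. lint (leb (interior \<kappa>)) (%x. (g j x)\<^sup>2))) *
   sqrt (8 * (element_const \<nu> s)\<^sup>2 * (\<Sum>\<kappa>\<in>\<T>. K \<kappa>) + 2 * (8 * \<bar>\<nu>\<bar> + 2)\<^sup>2 * (mesh_size \<T>)\<^sup>2 * lint (leb \<Omega>) (%x. (f x)\<^sup>2))"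
proof -
 let ?E = "conforming_companion \<Omega> \<T> v g"
 \<comment> \<open>The second constant is 2 * 4 |nu| + 2, from the bound h^2 / sqrt a <= 4 |nu| h
   inserted in the load term of the local estimate.\<close>
 let ?c1 = "element_const \<nu> s" and ?c2 = "8 * \<bar>\<nu>\<bar> + 2"
 define H where "H = mesh_size \<T>"
 define \<Gamma> where "\<Gamma> \<kappa> = (\<Sum>j\<in>UNIV. sqrt (lint (leb (interior \<kappa>)) (%x. (g j x)\<^sup>2)))" for \<kappa>
 define F where "F \<kappa> = lint (leb (interior \<kappa>)) (%x. (f x)\<^sup>2)" for \<kappa>
 define X where "X \<kappa> = ?c1 * (2 * sqrt (K \<kappa>)) + ?c2 * H * sqrt (F \<kappa>)" for \<kappa>
 define I where "I \<kappa> k = lint (leb (interior \<kappa>)) (%x. (\<Sum>i\<in>UNIV. \<tau> i x * (g i x - partial i (?E k) x)) - f x * (v x - ?E k x))" for \<kappa> k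
 have o: "open \<Omega>" and oS: "\<Omega> \<in> sets lebesgue" using b by (auto simp: bounded_lipschitz_polygon_def)
 have c1: "0 <= ?c1" unfolding element_const_def using step_bound(1) hardy_const_nonneg[OF s] by simp
 have sub: "sq_int (leb (interior \<kappa>)) w" if "\<kappa> \<in> \<T>" "sq_int (leb \<Omega>) w" for \<kappa> w
  by (rule sq_int_subset[OF that(2) mesh_interior_subset[OF b m that(1)] _ oS]) auto
 have test: "?E k \<in> test_functions \<Omega>" for k by (rule conforming_companion_test[OF b m ec])
 have tS: "sq_int (leb (interior \<kappa>)) (\<tau> j)" if k: "\<kappa> \<in> \<T>" for \<kappa> j
 proof -
  obtain p q r where n: "noncollinear p q r" "\<kappa> = tri p q r" by (rule mesh_triangle[OF m k])
  show ?thesis using tau[OF n(1) k[unfolded n(2)], of j] by (simp add: campanato_at_def n(2) open_triangle_def)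
 qed
 have lim: "\<exists>L. I \<kappa> \<longlonglongrightarrow> L \<and> \<bar>L\<bar> <= \<Gamma> \<kappa> * X \<kappa>" if k: "\<kappa> \<in> \<T>" for \<kappa>
 proof -
  obtain p q r where n: "noncollinear p q r" "\<kappa> = tri p q r" by (rule mesh_triangle[OF m k])
  have kT: "tri p q r \<in> \<T>" using k n(2) by simp
  have perm: "tri q r p = tri p q r" "tri r p q = tri p q r"
   by (simp_all only: insert_commute)
  have n': "noncollinear q r p" "noncollinear r p q" using noncollinear_rotate[OF n(1)] noncollinear_rotate[OF noncollinear_rotate[OF n(1)]] .
  have iA: "interior \<kappa> = open_triangle p q r" by (simp add: n(2) open_triangle_def)
  let ?A = "open_triangle p q r"
  define h where "h = diameter \<kappa>"
  define a where "a = measure lebesgue ?A"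
  have a: "0 < a" unfolding a_def by (rule measure_open_triangle_pos[OF n(1)])
  have h0: "0 < h" unfolding h_def n(2) by (rule triangle_diameter_pos[OF n(1)])
  have hH: "h <= H" unfolding h_def H_def by (rule mesh_size_ge[OF m k])
  have hd: "\<forall>x\<in>tri p q r. \<forall>y\<in>tri p q r. norm (x - y) <= h"
   unfolding h_def n(2) dist_norm[symmetric] by (intro ballI diameter_bounded_bound compact_imp_bounded compact_triangle)
  have h2: "h\<^sup>2 <= 16 * \<nu>\<^sup>2 * a" unfolding h_def n(2) a_def by (rule regular_mesh_area[OF r kT n(1)])
  have hq: "h\<^sup>2 / a <= 16 * \<nu>\<^sup>2" using h2 a by (simp add: pos_divide_le_eq)
  have hs: "h\<^sup>2 / sqrt a <= 4 * \<bar>\<nu>\<bar> * h"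
  proof -
   have "h = sqrt (h\<^sup>2)" using h0 by simp
   also have "\<dots> <= sqrt ((4 * \<nu>)\<^sup>2 * a)" using h2 by (intro real_sqrt_le_mono) (simp add: power_mult_distrib)
   also have "\<dots> = 4 * \<bar>\<nu>\<bar> * sqrt a" by (simp add: real_sqrt_mult)
   finally have "h / sqrt a <= 4 * \<bar>\<nu>\<bar>" using a by (simp add: pos_divide_le_eq)
   from mult_right_mono[OF this less_imp_le[OF h0]] show ?thesis by (simp add: power2_eq_square)
  qed
  have "\<exists>L. (%k. lint (leb ?A) (%x. (\<Sum>i\<in>UNIV. \<tau> i x * (g i x - partial i (?E k) x)) - f x * (v x - ?E k x))) \<longlonglongrightarrow> L \<and>
   \<bar>L\<bar> <= (\<Sum>i\<in>UNIV. sqrt (lint (leb ?A) (%x. (g i x)\<^sup>2))) *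
    ((1 + 21 * step_bound * hardy_const s * (h\<^sup>2 / measure lebesgue ?A)) * (\<Sum>i\<in>(UNIV::2 set). sqrt (K \<kappa>)) +
    (2 * (h\<^sup>2 / sqrt (measure lebesgue ?A)) + 2 * h) * sqrt (lint (leb ?A) (%x. (f x)\<^sup>2)))"
  proof (rule triangle_local_limit[OF n(1) s finite_mesh_vertices[OF m] mesh_vertices_triangle(1)[OF m kT n(1)] hd, where K = "%_. K \<kappa>"])
   show "0 <= K \<kappa>" by (rule K[OF k])
   show "campanato_at p q r s (K \<kappa>) (\<tau> i)" for i using tau[OF n(1) kT] n(2) by simp
   show "campanato_at q r p s (K \<kappa>) (\<tau> i)" for i using tau[OF n'(1)] kT n(2) perm by simp
   show "campanato_at r p q s (K \<kappa>) (\<tau> i)" for i using tau[OF n'(2)] kT n(2) perm by simp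
   show "sq_int (leb ?A) v" "sq_int (leb ?A) f" using sub[OF k v] sub[OF k f] by (simp_all only: iA)
   show "sq_int (leb ?A) (g i)" "has_weak_partial ?A i v (g i)" for i using g[OF k] by (simp_all only: iA)
   show "smooth_on UNIV (?E k)" for k by (rule test_functions_smooth[OF test])
   show "?E k x = vertex_cutoff (mesh_vertices \<T>) k x *
    companion p q r (mean_on ?A v) (edge_mean p q r v g - mean_on ?A v) (edge_mean q r p v g - mean_on ?A v) (edge_mean r p q v g - mean_on ?A v) x"
    if "x \<in> ?A" for k x
    unfolding conforming_companion_interior[OF m n(1) kT that] triangle_companion_def Let_def ..
   show "?E k (linepath q r t) = vertex_cutoff (mesh_vertices \<T>) k (linepath q r t) * edge_mean p q r v g" if "t \<in> {0..1}" for k t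
    by (rule conforming_companion_edge[OF m ec n(1) kT that])
   show "?E k (linepath r p t) = vertex_cutoff (mesh_vertices \<T>) k (linepath r p t) * edge_mean q r p v g" if "t \<in> {0..1}" for k t
    by (rule conforming_companion_edge[OF m ec n'(1) _ that]) (use kT perm in simp)
   show "?E k (linepath p q t) = vertex_cutoff (mesh_vertices \<T>) k (linepath p q t) * edge_mean r p q v g" if "t \<in> {0..1}" for k t
    by (rule conforming_companion_edge[OF m ec n'(2) _ that]) (use kT perm in simp)
  qed (rule refl)
  then obtain L where L: "I \<kappa> \<longlonglongrightarrow> L" "\<bar>L\<bar> <= \<Gamma> \<kappa> *
    ((1 + 21 * step_bound * hardy_const s * (h\<^sup>2 / a)) * (2 * sqrt (K \<kappa>)) + (2 * (h\<^sup>2 / sqrt a) + 2 * h) * sqrt (F \<kappa>))"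
   unfolding I_def \<Gamma>_def F_def iA a_def by (auto simp: sum_2)
  have "\<Gamma> \<kappa> * ((1 + 21 * step_bound * hardy_const s * (h\<^sup>2 / a)) * (2 * sqrt (K \<kappa>)) + (2 * (h\<^sup>2 / sqrt a) + 2 * h) * sqrt (F \<kappa>)) <= \<Gamma> \<kappa> * X \<kappa>"
  proof (rule mult_left_mono)
   have "1 + 21 * step_bound * hardy_const s * (h\<^sup>2 / a) <= ?c1" unfolding element_const_def
    using step_bound(1) hardy_const_nonneg[OF s] hq by (intro add_left_mono mult_left_mono) auto
   moreover have "2 * (h\<^sup>2 / sqrt a) + 2 * h <= ?c2 * H"
   proof -
    have "2 * (h\<^sup>2 / sqrt a) + 2 * h <= ?c2 * h" using hs by (simp add: algebra_simps)
    also have "\<dots> <= ?c2 * H" using hH by (intro mult_left_mono) auto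
    finally show ?thesis .
   qed
   ultimately show "(1 + 21 * step_bound * hardy_const s * (h\<^sup>2 / a)) * (2 * sqrt (K \<kappa>)) + (2 * (h\<^sup>2 / sqrt a) + 2 * h) * sqrt (F \<kappa>) <= X \<kappa>"
    unfolding X_def using K[OF k] by (intro add_mono mult_right_mono) (auto simp: F_def)
   show "0 <= \<Gamma> \<kappa>" unfolding \<Gamma>_def by (intro sum_nonneg) simp
  qed
  then show ?thesis using L by (meson order_trans)
 qed
 then obtain L where L: "!!\<kappa>. \<kappa> \<in> \<T> ==> I \<kappa> \<longlonglongrightarrow> L \<kappa>" "!!\<kappa>. \<kappa> \<in> \<T> ==> \<bar>L \<kappa>\<bar> <= \<Gamma> \<kappa> * X \<kappa>" by metis
 let ?D = "(\<Sum>\<kappa>\<in>\<T>. lint (leb (interior \<kappa>)) (%x. \<Sum>j\<in>UNIV. \<tau> j x * g j x)) - lint (leb \<Omega>) (%x. f x * v x)"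
 \<comment> \<open>The sum does not depend on k: the weak equation tested with E k cancels all terms
   that contain it. So the constant sequence equals the sum of the local limits.\<close>
 have D: "(\<Sum>\<kappa>\<in>\<T>. I \<kappa> k) = ?D" for k
 proof -
  have E: "sq_int (leb (interior \<kappa>)) (?E k)" "sq_int (leb (interior \<kappa>)) (partial j (?E k))" for \<kappa> j
   by (rule test_function_sq_int[OF test]) (auto intro: test_function_sq_int[OF partial_test_function[OF test]])
  have i1: "integrable (leb (interior \<kappa>)) (%x. \<Sum>j\<in>UNIV. \<tau> j x * g j x)" if "\<kappa> \<in> \<T>" for \<kappa>
   by (intro Bintegrable_sum sq_int_mult tS g(2) that)
  have i2: "integrable (leb (interior \<kappa>)) (%x. \<Sum>j\<in>UNIV. \<tau> j x * partial j (?E k) x)" if "\<kappa> \<in> \<T>" for \<kappa>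
   by (intro Bintegrable_sum sq_int_mult tS E that)
  have i3: "integrable (leb (interior \<kappa>)) (%x. f x * v x)" if "\<kappa> \<in> \<T>" for \<kappa>
   by (rule sq_int_mult[OF sub[OF that f] sub[OF that v]])
  have i4: "integrable (leb (interior \<kappa>)) (%x. f x * ?E k x)" if "\<kappa> \<in> \<T>" for \<kappa>
   by (rule sq_int_mult[OF sub[OF that f] E(1)])
  have e2: "lint (leb \<Omega>) (%x. \<Sum>j\<in>UNIV. \<tau> j x * partial j (?E k) x) =
    (\<Sum>\<kappa>\<in>\<T>. lint (leb (interior \<kappa>)) (%x. \<Sum>j\<in>UNIV. \<tau> j x * partial j (?E k) x))"
   by (rule mesh_integral(2)[OF b m i2])
  have e3: "lint (leb \<Omega>) (%x. f x * v x) = (\<Sum>\<kappa>\<in>\<T>. lint (leb (interior \<kappa>)) (%x. f x * v x))"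
   by (rule mesh_integral(2)[OF b m i3])
  have e4: "lint (leb \<Omega>) (%x. f x * ?E k x) = (\<Sum>\<kappa>\<in>\<T>. lint (leb (interior \<kappa>)) (%x. f x * ?E k x))"
   by (rule mesh_integral(2)[OF b m i4])
  have "I \<kappa> k = lint (leb (interior \<kappa>)) (%x. \<Sum>j\<in>UNIV. \<tau> j x * g j x) - lint (leb (interior \<kappa>)) (%x. \<Sum>j\<in>UNIV. \<tau> j x * partial j (?E k) x)
    - (lint (leb (interior \<kappa>)) (%x. f x * v x) - lint (leb (interior \<kappa>)) (%x. f x * ?E k x))" if "\<kappa> \<in> \<T>" for \<kappa>
   unfolding I_def right_diff_distrib sum_subtractf using i1[OF that] i2[OF that] i3[OF that] i4[OF that]
   by (simp only: Bintegral_diff Bintegrable_diff)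
  then have "(\<Sum>\<kappa>\<in>\<T>. I \<kappa> k) = (\<Sum>\<kappa>\<in>\<T>. lint (leb (interior \<kappa>)) (%x. \<Sum>j\<in>UNIV. \<tau> j x * g j x) - lint (leb (interior \<kappa>)) (%x. \<Sum>j\<in>UNIV. \<tau> j x * partial j (?E k) x)
    - (lint (leb (interior \<kappa>)) (%x. f x * v x) - lint (leb (interior \<kappa>)) (%x. f x * ?E k x)))"
   by (rule sum.cong[OF refl])
  also have "\<dots> = (\<Sum>\<kappa>\<in>\<T>. lint (leb (interior \<kappa>)) (%x. \<Sum>j\<in>UNIV. \<tau> j x * g j x)) - lint (leb \<Omega>) (%x. \<Sum>j\<in>UNIV. \<tau> j x * partial j (?E k) x)
    - (lint (leb \<Omega>) (%x. f x * v x) - lint (leb \<Omega>) (%x. f x * ?E k x))"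
   by (simp only: sum_subtractf e2 e3 e4)
  also have "\<dots> = ?D" unfolding weak[OF test] by simp
  finally show ?thesis .
 qed
 have "(%k. \<Sum>\<kappa>\<in>\<T>. I \<kappa> k) \<longlonglongrightarrow> (\<Sum>\<kappa>\<in>\<T>. L \<kappa>)" by (rule tendsto_sum) (rule L(1))
 then have "(%k::nat. ?D) \<longlonglongrightarrow> (\<Sum>\<kappa>\<in>\<T>. L \<kappa>)" unfolding D .
 then have DL: "?D = (\<Sum>\<kappa>\<in>\<T>. L \<kappa>)" by (simp only: LIMSEQ_const_iff)
 have G0: "0 <= \<Gamma> \<kappa>" for \<kappa> unfolding \<Gamma>_def by (intro sum_nonneg) simp
 have "\<bar>?D\<bar> <= (\<Sum>\<kappa>\<in>\<T>. \<bar>L \<kappa>\<bar>)" unfolding DL by (rule sum_abs)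
 also have "\<dots> <= (\<Sum>\<kappa>\<in>\<T>. \<bar>\<Gamma> \<kappa>\<bar> * \<bar>X \<kappa>\<bar>)"
 proof (rule sum_mono)
  fix \<kappa> assume "\<kappa> \<in> \<T>"
  from L(2)[OF this] show "\<bar>L \<kappa>\<bar> <= \<bar>\<Gamma> \<kappa>\<bar> * \<bar>X \<kappa>\<bar>" by (metis abs_ge_self abs_mult order_trans)
 qed
 also have "\<dots> <= L2_set \<Gamma> \<T> * L2_set X \<T>" by (rule L2_set_mult_ineq)
 also have "\<dots> <= sqrt (2 * (\<Sum>\<kappa>\<in>\<T>. \<Sum>j\<in>UNIV. lint (leb (interior \<kappa>)) (%x. (g j x)\<^sup>2))) *
   sqrt (8 * ?c1\<^sup>2 * (\<Sum>\<kappa>\<in>\<T>. K \<kappa>) + 2 * ?c2\<^sup>2 * H\<^sup>2 * lint (leb \<Omega>) (%x. (f x)\<^sup>2))"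
 proof (rule mult_mono)
  \<comment> \<open>This inequality produces the factors 2 and, since X contains 2 sqrt K for the
    two entries of the row, the factor 8 = 2 * 2^2.\<close>
  have sq: "(x + y)\<^sup>2 <= 2 * x\<^sup>2 + 2 * y\<^sup>2" for x y :: real
  proof -
   have "0 <= (x - y)\<^sup>2" by simp
   then show ?thesis by (simp add: power2_eq_square algebra_simps)
  qed
  have "(\<Gamma> \<kappa>)\<^sup>2 <= 2 * (\<Sum>j\<in>UNIV. lint (leb (interior \<kappa>)) (%x. (g j x)\<^sup>2))" for \<kappa>
   using sq[of "sqrt (lint (leb (interior \<kappa>)) (%x. (g 1 x)\<^sup>2))" "sqrt (lint (leb (interior \<kappa>)) (%x. (g 2 x)\<^sup>2))"]
   by (simp add: \<Gamma>_def sum_2)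
  then show "L2_set \<Gamma> \<T> <= sqrt (2 * (\<Sum>\<kappa>\<in>\<T>. \<Sum>j\<in>UNIV. lint (leb (interior \<kappa>)) (%x. (g j x)\<^sup>2)))"
   unfolding L2_set_def sum_distrib_left by (intro real_sqrt_le_mono sum_mono) (simp add: sum_distrib_left)
  have "(X \<kappa>)\<^sup>2 <= 8 * ?c1\<^sup>2 * K \<kappa> + 2 * ?c2\<^sup>2 * H\<^sup>2 * F \<kappa>" if "\<kappa> \<in> \<T>" for \<kappa>
   using sq[of "?c1 * (2 * sqrt (K \<kappa>))" "?c2 * H * sqrt (F \<kappa>)"] K[OF that]
   by (simp add: X_def power_mult_distrib F_def)
  then have "(\<Sum>\<kappa>\<in>\<T>. (X \<kappa>)\<^sup>2) <= (\<Sum>\<kappa>\<in>\<T>. 8 * ?c1\<^sup>2 * K \<kappa> + 2 * ?c2\<^sup>2 * H\<^sup>2 * F \<kappa>)" by (rule sum_mono)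
  also have "\<dots> = 8 * ?c1\<^sup>2 * (\<Sum>\<kappa>\<in>\<T>. K \<kappa>) + 2 * ?c2\<^sup>2 * H\<^sup>2 * (\<Sum>\<kappa>\<in>\<T>. F \<kappa>)" by (simp only: sum.distrib sum_distrib_left)
  also have "(\<Sum>\<kappa>\<in>\<T>. F \<kappa>) = lint (leb \<Omega>) (%x. (f x)\<^sup>2)"
   unfolding F_def by (rule mesh_integral(2)[OF b m, symmetric]) (rule sq_int_square[OF sub[OF _ f]])
  finally show "L2_set X \<T> <= sqrt (8 * ?c1\<^sup>2 * (\<Sum>\<kappa>\<in>\<T>. K \<kappa>) + 2 * ?c2\<^sup>2 * H\<^sup>2 * lint (leb \<Omega>) (%x. (f x)\<^sup>2))"
   unfolding L2_set_def by (rule real_sqrt_le_mono)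
 qed (auto intro!: sum_nonneg)
 finally show ?thesis unfolding H_def .
qed

section \<open>Energy forms, stress and uniqueness of the gradient\<close>

text \<open>The combined integrand of \<open>a_form\<close> and \<open>ah_form\<close> with the
  gradients as free arguments, so that weak, broken and difference gradients share the same
  lemmas.\<close>

definition energy_density :: "real => real => (2 => 2 => scalar_field) => (2 => 2 => scalar_field) => scalar_field" where
 "energy_density \<mu> lam P Q x =
   \<mu> * (\<Sum>i\<in>UNIV. \<Sum>j\<in>UNIV. P i j x * Q i j x) + (\<mu> + lam) * ((\<Sum>i\<in>UNIV. P i i x) * (\<Sum>i\<in>UNIV. Q i i x))"

lemma frobenius_sum: "frobenius A B = (\<Sum>i\<in>UNIV. \<Sum>j\<in>UNIV. A $ i $ j * B $ i $ j)"
 by (simp add: frobenius_def trace_def matrix_matrix_mult_def transpose_def)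

lemma a_form_energy_density:
 "a_form \<Omega> \<mu> lam u v = lint (leb \<Omega>)
   (energy_density \<mu> lam (%i j. weak_partial \<Omega> j (%y. u y $ i)) (%i j. weak_partial \<Omega> j (%y. v y $ i)))"
 unfolding a_form_def energy_density_def[abs_def] frobenius_sum weak_grad_def weak_div_def by simp

lemma energy_density_integrable:
 assumes "!!i j. sq_int M (P i j)" "!!i j. sq_int M (Q i j)"
 shows "integrable M (%x. \<Sum>i\<in>UNIV. \<Sum>j\<in>UNIV. P i j x * Q i j x)"
  "integrable M (%x. (\<Sum>i\<in>UNIV. P i i x) * (\<Sum>i\<in>UNIV. Q i i x))"
  "integrable M (energy_density \<mu> lam P Q)"
proof -
 show 1: "integrable M (%x. \<Sum>i\<in>UNIV. \<Sum>j\<in>UNIV. P i j x * Q i j x)"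
  by (intro Bintegrable_sum sq_int_mult assms)
 show 2: "integrable M (%x. (\<Sum>i\<in>UNIV. P i i x) * (\<Sum>i\<in>UNIV. Q i i x))"
  by (intro sq_int_mult sq_int_sum assms)
 show "integrable M (energy_density \<mu> lam P Q)" unfolding energy_density_def[abs_def]
  by (intro Bintegrable_add integrable_mult_right 1 2)
qed

lemma energy_density_ge:
 assumes "0 <= \<mu>" "0 <= lam"
 shows "\<mu> * (\<Sum>i\<in>UNIV. \<Sum>j\<in>UNIV. (P i j x)\<^sup>2) <= energy_density \<mu> lam P P x"
 using assms by (simp add: energy_density_def power2_eq_square[symmetric])

text \<open>The norm bound is available for the solution supplied by the regularity assumption,
  while the estimate concerns a given w. Testing with both solutions shows that the energy of the
  difference is zero, and mu > 0 makes the gradients agree.\<close>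

lemma weak_solution_gradient_unique:
 assumes o: "open \<Omega>" and mu: "0 < \<mu>" "0 < lam" and w: "weak_solution \<Omega> \<mu> lam f w" and w': "weak_solution \<Omega> \<mu> lam f w'"
 shows "AE x in leb \<Omega>. weak_partial \<Omega> j (%y. w y $ i) x = weak_partial \<Omega> j (%y. w' y $ i) x"
proof -
 define G where "G i j = weak_partial \<Omega> j (%y. w y $ i)" for i j
 define G' where "G' i j = weak_partial \<Omega> j (%y. w' y $ i)" for i j
 let ?M = "leb \<Omega>"
 let ?e = "energy_density \<mu> lam"
 have H: "(%y. w y $ i) \<in> H1 \<Omega>" "(%y. w' y $ i) \<in> H1 \<Omega>" for i
  using w w' unfolding weak_solution_def vec_space_def mem_Collect_eq by (blast intro: H10_H1)+
 have s: "sq_int ?M (G i j)" "sq_int ?M (G' i j)" for i j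
  unfolding G_def G'_def by (rule H1D(3)[OF o H(1)], rule H1D(3)[OF o H(2)])
 have wH: "w \<in> vec_space (H10 \<Omega>)" "w' \<in> vec_space (H10 \<Omega>)" using w w' by (simp_all add: weak_solution_def)
 have "a_form \<Omega> \<mu> lam w w = a_form \<Omega> \<mu> lam w' w" "a_form \<Omega> \<mu> lam w w' = a_form \<Omega> \<mu> lam w' w'"
  using w w' wH unfolding weak_solution_def by metis+
 then have eq: "lint ?M (?e G G) = lint ?M (?e G' G)" "lint ?M (?e G G') = lint ?M (?e G' G')"
  unfolding a_form_energy_density G_def[abs_def, symmetric] G'_def[abs_def, symmetric] .
 define P where "P i j x = G i j x - G' i j x" for i j x
 have Ps: "sq_int ?M (P i j)" for i j unfolding P_def[abs_def] by (rule sq_int_diff[OF s])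
 have "?e P P = (%x. ?e G G x - ?e G' G x - (?e G G' x - ?e G' G' x))"
  by (rule ext) (simp add: energy_density_def P_def sum_2 algebra_simps)
 then have "lint ?M (?e P P) = (lint ?M (?e G G) - lint ?M (?e G' G)) - (lint ?M (?e G G') - lint ?M (?e G' G'))"
  using energy_density_integrable(3)[OF s(1) s(1)] energy_density_integrable(3)[OF s(2) s(1)]
   energy_density_integrable(3)[OF s(1) s(2)] energy_density_integrable(3)[OF s(2) s(2)]
  by (simp only: Bintegral_diff Bintegrable_diff)
 then have z: "lint ?M (?e P P) = 0" using eq by simp
 have "lint ?M (%x. \<mu> * (P i j x)\<^sup>2) <= lint ?M (?e P P)"
 proof (rule integral_mono_AE'[OF energy_density_integrable(3)[OF Ps Ps]])
  have "\<mu> * (P i j x)\<^sup>2 <= ?e P P x" for x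
  proof -
   have "(P i j x)\<^sup>2 <= (\<Sum>j\<in>UNIV. (P i j x)\<^sup>2)" by (rule member_le_sum) auto
   also have "\<dots> <= (\<Sum>i\<in>UNIV. \<Sum>j\<in>UNIV. (P i j x)\<^sup>2)"
    by (rule member_le_sum[of i UNIV "%i. \<Sum>j\<in>UNIV. (P i j x)\<^sup>2"]) (auto intro: sum_nonneg)
   finally have "\<mu> * (P i j x)\<^sup>2 <= \<mu> * (\<Sum>i\<in>UNIV. \<Sum>j\<in>UNIV. (P i j x)\<^sup>2)" using mu(1) by (simp add: mult_left_mono)
   also have "\<dots> <= ?e P P x" using mu by (intro energy_density_ge) auto
   finally show ?thesis .
  qed
  then show "AE x in ?M. \<mu> * (P i j x)\<^sup>2 <= ?e P P x" by blast
  show "AE x in ?M. 0 <= ?e P P x"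
  proof (rule AE_I2)
   fix x
   have "0 <= \<mu> * (\<Sum>i\<in>UNIV. \<Sum>j\<in>UNIV. (P i j x)\<^sup>2)" using mu(1) by (intro mult_nonneg_nonneg sum_nonneg) auto
   also have "\<dots> <= ?e P P x" using mu by (intro energy_density_ge) auto
   finally show "0 <= ?e P P x" .
  qed
 qed
 then have "\<mu> * lint ?M (%x. (P i j x)\<^sup>2) <= 0" unfolding z by simp
 then have "lint ?M (%x. (P i j x)\<^sup>2) <= 0" using mu(1) by (simp add: mult_le_0_iff)
 moreover have "0 <= lint ?M (%x. (P i j x)\<^sup>2)" by (rule Bintegral_nonneg) simp
 ultimately have "lint ?M (%x. (P i j x)\<^sup>2) = 0" by simp
 then have "AE x in ?M. (P i j x)\<^sup>2 = 0"
  using integral_nonneg_eq_0_iff_AE[OF sq_int_square[OF Ps]] by simp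
 then show ?thesis by eventually_elim (simp add: P_def G_def G'_def)
qed

text \<open>Entries of mu grad w + (mu + lambda) div w I; \<open>energy_density_stress\<close> is
  its duality with the gradient of the test field.\<close>

definition stress :: "real => real => (2 => 2 => scalar_field) => 2 => 2 => scalar_field" where
 "stress \<mu> lam G i j x = \<mu> * G i j x + (if i = j then (\<mu> + lam) * (\<Sum>k\<in>UNIV. G k k x) else 0)"

lemma energy_density_stress: "energy_density \<mu> lam G Q x = (\<Sum>i\<in>UNIV. \<Sum>j\<in>UNIV. stress \<mu> lam G i j x * Q i j x)"
proof -
 define d where "d = (\<mu> + lam) * (\<Sum>k\<in>UNIV. G k k x)"
 have "stress \<mu> lam G i j x * Q i j x = \<mu> * (G i j x * Q i j x) + (if i = j then d * Q i j x else 0)" for i j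
  by (simp add: stress_def d_def algebra_simps)
 then have "(\<Sum>i\<in>UNIV. \<Sum>j\<in>UNIV. stress \<mu> lam G i j x * Q i j x) =
   \<mu> * (\<Sum>i\<in>UNIV. \<Sum>j\<in>UNIV. G i j x * Q i j x) + d * (\<Sum>i\<in>UNIV. Q i i x)"
  by (simp add: sum.distrib sum_distrib_left sum.delta)
 then show ?thesis by (simp add: energy_density_def d_def mult.assoc)
qed

text \<open>The weak equation is tested with phi times the i-th unit vector, which isolates the i-th
  row.\<close>

lemma weak_solution_stress:
 assumes o: "open \<Omega>" and w: "weak_solution \<Omega> \<mu> lam f w" and p: "\<phi> \<in> test_functions \<Omega>"
 shows "lint (leb \<Omega>) (%x. \<Sum>j\<in>UNIV. stress \<mu> lam (%i j. weak_partial \<Omega> j (%y. w y $ i)) i j x * partial j \<phi> x)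
  = lint (leb \<Omega>) (%x. f x $ i * \<phi> x)"
proof -
 define \<psi> :: vector_field where "\<psi> x = axis i (\<phi> x)" for x
 let ?G = "%i j. weak_partial \<Omega> j (%y. w y $ i)" and ?Q = "%i j. weak_partial \<Omega> j (%y. \<psi> y $ i)"
 have oS: "\<Omega> \<in> sets lebesgue" using o by auto
 define c where "c k x = (if k = i then \<phi> x else 0)" for k x
 have pc: "(%y. \<psi> y $ k) = c k" for k by (rule ext) (simp add: \<psi>_def c_def axis_def)
 have z: "(%x. 0) \<in> test_functions \<Omega>" by (rule test_functionsI[OF smooth_on_const[OF open_UNIV]]) auto
 have ct: "c k \<in> test_functions \<Omega>" for k using p z by (cases "k = i") (simp_all add: c_def[abs_def])
 have "\<psi> \<in> vec_space (H10 \<Omega>)" unfolding vec_space_def using test_function_H10[OF o ct] by (simp add: pc)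
 then have ab: "a_form \<Omega> \<mu> lam w \<psi> = b_form \<Omega> f \<psi>" using w by (simp add: weak_solution_def)
 have "AE x in leb \<Omega>. ?Q k j x = partial j (c k) x" for k j
  unfolding pc by (rule weak_partial_AE[OF o has_weak_partial_smooth[OF o test_functions_smooth[OF ct]]])
 then have "AE x in leb \<Omega>. \<forall>k j. ?Q k j x = partial j (c k) x" by (simp add: AE_all_countable)
 then have "AE x in leb \<Omega>. energy_density \<mu> lam ?G ?Q x = (\<Sum>j\<in>UNIV. stress \<mu> lam ?G i j x * partial j \<phi> x)"
 proof eventually_elim
  case (elim x)
  have c0: "partial j (c k) x = 0" if "k ~= i" for k j using that by (simp add: c_def[abs_def] partial_const)
  have ci: "partial j (c i) x = partial j \<phi> x" for j by (simp add: c_def[abs_def])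
  have "energy_density \<mu> lam ?G ?Q x = (\<Sum>k\<in>UNIV. \<Sum>j\<in>UNIV. stress \<mu> lam ?G k j x * partial j (c k) x)"
   unfolding energy_density_stress using elim by simp
  also have "\<dots> = (\<Sum>j\<in>UNIV. stress \<mu> lam ?G i j x * partial j (c i) x) + (\<Sum>k\<in>UNIV - {i}. \<Sum>j\<in>UNIV. stress \<mu> lam ?G k j x * partial j (c k) x)"
   by (rule sum.remove) auto
  also have "(\<Sum>k\<in>UNIV - {i}. \<Sum>j\<in>UNIV. stress \<mu> lam ?G k j x * partial j (c k) x) = 0"
   by (intro sum.neutral ballI) (simp add: c0)
  finally show ?case by (simp add: ci)
 qed
 from integral_cong_AE_lebesgue_on[OF this oS]
 have "lint (leb \<Omega>) (%x. \<Sum>j\<in>UNIV. stress \<mu> lam ?G i j x * partial j \<phi> x) = b_form \<Omega> f \<psi>"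
  unfolding ab[symmetric] a_form_energy_density by simp
 also have "\<dots> = lint (leb \<Omega>) (%x. f x $ i * \<phi> x)" by (simp add: b_form_def \<psi>_def inner_axis)
 finally show ?thesis .
qed

lemma ah_form_eq:
 assumes b: "bounded_lipschitz_polygon \<Omega>" and m: "mesh \<Omega> \<T>"
  and u: "!!\<kappa> i j. \<kappa> \<in> \<T> ==> sq_int (leb (interior \<kappa>)) (broken_partial \<T> j (%y. u y $ i))"
  and v: "!!\<kappa> i j. \<kappa> \<in> \<T> ==> sq_int (leb (interior \<kappa>)) (broken_partial \<T> j (%y. v y $ i))"
 shows "ah_form \<Omega> \<T> \<mu> lam u v = (\<Sum>\<kappa>\<in>\<T>. lint (leb (interior \<kappa>))
  (energy_density \<mu> lam (%i j. broken_partial \<T> j (%y. u y $ i)) (%i j. broken_partial \<T> j (%y. v y $ i))))"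
proof -
 let ?P = "%i j. broken_partial \<T> j (%y. u y $ i)" and ?Q = "%i j. broken_partial \<T> j (%y. v y $ i)"
 have g: "broken_grad \<T> a x $ i $ j = broken_partial \<T> j (%y. a y $ i) x" for a x i j
  by (simp add: broken_grad_def broken_partial_def weak_grad_def)
 have d: "broken_div \<T> a x = (\<Sum>i\<in>UNIV. broken_partial \<T> i (%y. a y $ i) x)" for a x
  unfolding broken_div_def broken_partial_def weak_div_def sum_distrib_left by (rule sum.swap)
 have i: "integrable (leb (interior \<kappa>)) (%x. \<Sum>i\<in>UNIV. \<Sum>j\<in>UNIV. ?P i j x * ?Q i j x)"
  "integrable (leb (interior \<kappa>)) (%x. (\<Sum>i\<in>UNIV. ?P i i x) * (\<Sum>i\<in>UNIV. ?Q i i x))"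
  "integrable (leb (interior \<kappa>)) (energy_density \<mu> lam ?P ?Q)" if "\<kappa> \<in> \<T>" for \<kappa>
  by (rule energy_density_integrable(1)[of _ ?P ?Q, OF u[OF that] v[OF that]] energy_density_integrable(2)[of _ ?P ?Q, OF u[OF that] v[OF that]]
   energy_density_integrable(3)[of _ ?P ?Q, OF u[OF that] v[OF that]])+
 have "ah_form \<Omega> \<T> \<mu> lam u v = \<mu> * lint (leb \<Omega>) (%x. \<Sum>i\<in>UNIV. \<Sum>j\<in>UNIV. ?P i j x * ?Q i j x)
   + (\<mu> + lam) * lint (leb \<Omega>) (%x. (\<Sum>i\<in>UNIV. ?P i i x) * (\<Sum>i\<in>UNIV. ?Q i i x))"
  unfolding ah_form_def frobenius_sum g d ..
 also have "\<dots> = lint (leb \<Omega>) (energy_density \<mu> lam ?P ?Q)"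
  unfolding energy_density_def[abs_def]
  using mesh_integral(1)[OF b m i(1)] mesh_integral(1)[OF b m i(2)]
  by (simp only: Bintegral_add integrable_mult_right integral_mult_right_zero)
 also have "\<dots> = (\<Sum>\<kappa>\<in>\<T>. lint (leb (interior \<kappa>)) (energy_density \<mu> lam ?P ?Q))"
  by (rule mesh_integral(2)[OF b m i(3)])
 finally show ?thesis .
qed

text \<open>The divergence is used twice with different constants: the part with mu is charged to
  the entries of the gradient, the part with lambda to its own constant \<open>l\<close>. So lambda
  never multiplies a constant of the gradient.\<close>

lemma campanato_stress:
 assumes n: "noncollinear p q r" and G: "!!i j. campanato_at p q r s (k i j) (G i j)" and k: "!!i j. 0 <= k i j"
  and D: "campanato_at p q r s l (%x. \<Sum>i\<in>UNIV. G i i x)" and l: "0 <= l"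
 shows "campanato_at p q r s (12 * (\<mu>\<^sup>2 * (\<Sum>i\<in>UNIV. \<Sum>j\<in>UNIV. k i j) + lam\<^sup>2 * l)) (stress \<mu> lam G i j)"
proof -
 define D where "D x = (\<Sum>i\<in>UNIV. G i i x)" for x
 define \<alpha> where "\<alpha> = (if i = j then \<mu> else 0)"
 define \<beta> where "\<beta> = (if i = j then lam else 0)"
 let ?S = "\<Sum>i\<in>UNIV. \<Sum>j\<in>UNIV. k i j"
 have D1: "campanato_at p q r s l D" using D by (simp add: D_def[abs_def])
 have "campanato_at p q r s (2 * 1\<^sup>2 * k 1 1 + 2 * 1\<^sup>2 * k 2 2) (%x. 1 * G 1 1 x + 1 * G 2 2 x)"
  by (rule campanato_lincomb[OF n G G])
 then have D2: "campanato_at p q r s (2 * k 1 1 + 2 * k 2 2) D" by (simp add: D_def[abs_def] sum_2)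
 have t: "campanato_at p q r s (2 * \<mu>\<^sup>2 * k i j + 2 * 1\<^sup>2 * (2 * \<alpha>\<^sup>2 * (2 * k 1 1 + 2 * k 2 2) + 2 * \<beta>\<^sup>2 * l))
   (%x. \<mu> * G i j x + 1 * (\<alpha> * D x + \<beta> * D x))"
  by (intro campanato_lincomb n G D1 D2)
 have e: "(%x. \<mu> * G i j x + 1 * (\<alpha> * D x + \<beta> * D x)) = stress \<mu> lam G i j"
  by (rule ext) (simp add: stress_def D_def \<alpha>_def \<beta>_def distrib_right)
 have ab: "\<alpha>\<^sup>2 <= \<mu>\<^sup>2" "\<beta>\<^sup>2 <= lam\<^sup>2" by (simp_all add: \<alpha>_def \<beta>_def)
 have kS: "k i j <= ?S"
 proof -
  have "k i j <= (\<Sum>j\<in>UNIV. k i j)" by (rule member_le_sum) (auto simp: k)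
  also have "\<dots> <= ?S" by (rule member_le_sum[of i UNIV "%i. \<Sum>j\<in>UNIV. k i j"]) (auto intro: sum_nonneg k)
  finally show ?thesis .
 qed
 have kD: "k 1 1 + k 2 2 <= ?S" using k[of 1 2] k[of 2 1] by (simp add: sum_2)
 have "\<mu>\<^sup>2 * k i j <= \<mu>\<^sup>2 * ?S" by (rule mult_left_mono[OF kS]) simp
 moreover have "\<alpha>\<^sup>2 * (k 1 1 + k 2 2) <= \<mu>\<^sup>2 * ?S" using k[of 1 1] k[of 2 2] by (intro mult_mono ab kD) auto
 moreover have "\<beta>\<^sup>2 * l <= lam\<^sup>2 * l" by (rule mult_right_mono[OF ab(2) l])
 moreover have "0 <= \<mu>\<^sup>2 * ?S" "0 <= lam\<^sup>2 * l" using k l by (auto intro!: mult_nonneg_nonneg sum_nonneg)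
 \<comment> \<open>The weights 2, 8 and 4 belong to the gradient entry, the mu part and the lambda
   part of the divergence after the nested linear combinations; 12 covers them all.\<close>
 moreover have "2 * a + 8 * b + 4 * c <= 12 * (S + L)" (is "?l <= _") if "a <= S" "b <= S" "c <= L" "0 <= S" "0 <= L" for a b c S L :: real
 proof -
  have "?l <= 12 * S + 12 * L" using that by linarith
  then show ?thesis by simp
 qed
 ultimately have "2 * (\<mu>\<^sup>2 * k i j) + 8 * (\<alpha>\<^sup>2 * (k 1 1 + k 2 2)) + 4 * (\<beta>\<^sup>2 * l) <= 12 * (\<mu>\<^sup>2 * ?S + lam\<^sup>2 * l)"
  by blast
 moreover have "2 * \<mu>\<^sup>2 * k i j + 2 * 1\<^sup>2 * (2 * \<alpha>\<^sup>2 * (2 * k 1 1 + 2 * k 2 2) + 2 * \<beta>\<^sup>2 * l) =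
   2 * (\<mu>\<^sup>2 * k i j) + 8 * (\<alpha>\<^sup>2 * (k 1 1 + k 2 2)) + 4 * (\<beta>\<^sup>2 * l)" by (simp add: algebra_simps)
 ultimately have "2 * \<mu>\<^sup>2 * k i j + 2 * 1\<^sup>2 * (2 * \<alpha>\<^sup>2 * (2 * k 1 1 + 2 * k 2 2) + 2 * \<beta>\<^sup>2 * l) <= 12 * (\<mu>\<^sup>2 * ?S + lam\<^sup>2 * l)"
  by (simp only:)
 from campanato_mono[OF t this] show ?thesis unfolding e .
qed

section \<open>Assembly of the estimate\<close>

lemma AE_lebesgue_on_subset:
 assumes "AE x in leb S. P x" "T \<subseteq> S" "T \<in> sets lebesgue" "S \<in> sets lebesgue"
 shows "AE x in leb T. P x"
 using assms(1) unfolding AE_lebesgue_on_iff[OF assms(3)] AE_lebesgue_on_iff[OF assms(4)]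
 by eventually_elim (use assms(2) in blast)

lemma mesh_size_bounds:
 assumes b: "bounded_lipschitz_polygon \<Omega>" and m: "mesh \<Omega> \<T>"
 shows "0 < mesh_size \<T>" "mesh_size \<T> <= diameter (closure \<Omega>)"
proof -
 have "closure \<Omega> ~= {}" using b by (simp add: bounded_lipschitz_polygon_def)
 then have ne: "\<T> ~= {}" using mesh_Union[OF m] by (metis Union_empty)
 then obtain \<kappa> where k: "\<kappa> \<in> \<T>" by blast
 obtain p q r where n: "noncollinear p q r" "\<kappa> = tri p q r" by (rule mesh_triangle[OF m k])
 show "0 < mesh_size \<T>" using mesh_size_ge[OF m k] triangle_diameter_pos[OF n(1)] unfolding n(2) by linarith
 have bc: "bounded (closure \<Omega>)" using b by (intro bounded_closure) (simp add: bounded_lipschitz_polygon_def)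
 have "diameter \<kappa> <= diameter (closure \<Omega>)" if "\<kappa> \<in> \<T>" for \<kappa>
  using mesh_Union[OF m] that by (intro diameter_subset[OF _ bc]) blast
 then show "mesh_size \<T> <= diameter (closure \<Omega>)"
  unfolding mesh_size_def using mesh_finite[OF m] ne by (intro Max.boundedI) auto
qed

theorem theorem3p4:
  fixes \<Omega> :: "(real^2) set" and \<mu>\<^sub>0 \<mu>\<^sub>1 \<nu> \<epsilon> s :: real
  assumes "bounded_lipschitz_polygon \<Omega>"
    and "0 < \<mu>\<^sub>0" and "\<mu>\<^sub>0 < \<mu>\<^sub>1"
    and "0 < \<epsilon>" and "\<epsilon> < 1/2"
    and "regularity_assumption \<Omega> \<mu>\<^sub>0 \<mu>\<^sub>1 \<epsilon> s"
  shows "\<exists>C>0. \<forall>\<T> \<mu> lam f w v.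
           mesh \<Omega> \<T> \<longrightarrow> regular_mesh \<nu> \<T> \<longrightarrow>
           \<mu> \<in> {\<mu>\<^sub>0..\<mu>\<^sub>1} \<longrightarrow> 0 < lam \<longrightarrow>
           f \<in> vec_space (L2 \<Omega>) \<longrightarrow>
           w \<in> vec_space (H1s \<Omega> s) \<longrightarrow> weak_solution \<Omega> \<mu> lam f w \<longrightarrow>
           v \<in> Hh \<Omega> \<T> \<longrightarrow>
           \<bar>Dh \<Omega> \<T> \<mu> lam f w v\<bar>
             \<le> C * mesh_size \<T> powr s * vec_norm (L2_norm \<Omega>) f * h_norm \<Omega> \<T> \<mu> lam v"
proof -
 note b = assms(1)
 have o: "open \<Omega>" and oS: "\<Omega> \<in> sets lebesgue" using b by (auto simp: bounded_lipschitz_polygon_def)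
 have oL: "\<Omega> \<in> lmeasurable" using b by (simp add: bounded_lipschitz_polygon_def bounded_set_imp_lmeasurable oS)
 \<comment> \<open>Positivity of s comes from 1/2 - epsilon < s and epsilon < 1/2.\<close>
 have s: "0 < s" "s <= 1" using assms(5,6) by (simp_all add: regularity_assumption_def)
 obtain C\<^sub>\<Omega> where C: "C\<^sub>\<Omega> > 0" "\<forall>\<mu>\<in>{\<mu>\<^sub>0..\<mu>\<^sub>1}. \<forall>lam>0. \<forall>f\<in>vec_space (L2 \<Omega>).
    \<exists>w. w \<in> vec_space (H1s \<Omega> s) \<and> w \<in> vec_space (sobolev \<Omega> 2 (2 / (2 - s))) \<and>
      weak_solution \<Omega> \<mu> lam f w \<and>
      vec_norm (H1s_norm \<Omega> s) w + lam * Hs_norm \<Omega> s (weak_div \<Omega> w) <= C\<^sub>\<Omega> * vec_norm (L2_norm \<Omega>) f"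
  using assms(6) unfolding regularity_assumption_def by blast
 define dd where "dd = diameter (closure \<Omega>)"
 let ?c1 = "element_const \<nu> s" and ?c2 = "8 * \<bar>\<nu>\<bar> + 2"
 \<comment> \<open>The first summand takes up the bound \<open>Ksum\<close>, where 768 = 12 * 4 *
   16; in the second the power of the diameter of the domain converts h^2 into h^(2s).\<close>
 define C3 where "C3 = 8 * ?c1\<^sup>2 * (768 * \<nu>\<^sup>2 * (\<mu>\<^sub>1\<^sup>2 + 1) * C\<^sub>\<Omega>\<^sup>2) + 2 * ?c2\<^sup>2 * dd powr (2 - 2 * s)"
 have C30: "0 <= C3" unfolding C3_def by (intro add_nonneg_nonneg mult_nonneg_nonneg) auto
 \<comment> \<open>The factor 2 counts the two rows; adding 1 secures positivity.\<close>
 define CC where "CC = 2 * (sqrt (2 / \<mu>\<^sub>0) * sqrt C3) + 1"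
 have CC: "0 < CC" unfolding CC_def using assms(2) C30 by (intro add_nonneg_pos mult_nonneg_nonneg) auto
 have main: "\<bar>Dh \<Omega> \<T> \<mu> lam f w v\<bar> <= CC * mesh_size \<T> powr s * vec_norm (L2_norm \<Omega>) f * h_norm \<Omega> \<T> \<mu> lam v"
  if m: "mesh \<Omega> \<T>" and r: "regular_mesh \<nu> \<T>" and mu: "\<mu> \<in> {\<mu>\<^sub>0..\<mu>\<^sub>1}" and lam: "0 < lam"
   and f: "f \<in> vec_space (L2 \<Omega>)" and w: "weak_solution \<Omega> \<mu> lam f w" and v: "v \<in> Hh \<Omega> \<T>"
  for \<T> \<mu> lam f w v
 proof -
  define H where "H = mesh_size \<T>"
  define F where "F = vec_norm (L2_norm \<Omega>) f"
  have mup: "0 < \<mu>" using mu assms(2) by simp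
  have H: "0 < H" "H <= dd" using mesh_size_bounds[OF b m] by (simp_all add: H_def dd_def)
  \<comment> \<open>The solution that satisfies the regularity bound. Its gradient serves to build
    the stress, and it agrees almost everywhere with that of w.\<close>
  obtain w' where w': "w' \<in> vec_space (H1s \<Omega> s)" "weak_solution \<Omega> \<mu> lam f w'"
    "vec_norm (H1s_norm \<Omega> s) w' + lam * Hs_norm \<Omega> s (weak_div \<Omega> w') <= C\<^sub>\<Omega> * F"
   using C(2) mu lam f unfolding F_def by metis
  define G where "G = (%i j. weak_partial \<Omega> j (%y. w' y $ i))"
  define g where "g = (%i j. broken_partial \<T> j (%y. v y $ i))"
  let ?\<tau> = "stress \<mu> lam G"
  have GH: "G i j \<in> Hs \<Omega> s" for i j using w'(1) by (simp add: vec_space_def H1s_def G_def)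
  have Gs: "sq_int (leb \<Omega>) (G i j)" for i j by (rule Hs_sq_int[OF o GH])
  have Dw: "weak_div \<Omega> w' = (%x. \<Sum>i\<in>UNIV. G i i x)" by (rule ext) (simp add: weak_div_def G_def)
  have DH: "(%x. \<Sum>i\<in>UNIV. G i i x) \<in> Hs \<Omega> s" unfolding sum_2 by (rule Hs_add[OF o GH GH])
  define N1 where "N1 = vec_norm (H1s_norm \<Omega> s) w'"
  \<comment> \<open>The divergence keeps its factor lambda: only this product is bounded
    independently of lambda.\<close>
  define N2 where "N2 = lam * Hs_norm \<Omega> s (%x. \<Sum>i\<in>UNIV. G i i x)"
  have N: "0 <= N1" "0 <= N2" "N1 + N2 <= C\<^sub>\<Omega> * F"
   using w'(3) lam by (simp_all add: N1_def N2_def Dw vec_norm_def sum_nonneg Hs_norm_nonneg)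
  have f2: "sq_int (leb \<Omega>) (%x. f x $ i)" for i using f by (simp add: vec_space_def L2_iff)
  have F0: "0 <= F" by (simp add: F_def vec_norm_def sum_nonneg)

  have Gsum: "(\<Sum>i\<in>UNIV. \<Sum>j\<in>UNIV. (Hs_norm \<Omega> s (G i j))\<^sup>2) <= N1\<^sup>2"
  proof -
   have "(\<Sum>i\<in>UNIV. \<Sum>j\<in>UNIV. (Hs_norm \<Omega> s (G i j))\<^sup>2) <= (\<Sum>i\<in>UNIV. (H1s_norm \<Omega> s (%x. w' x $ i))\<^sup>2)"
    by (rule sum_mono) (simp add: H1s_norm_def G_def sum_nonneg)
   then show ?thesis by (simp add: N1_def vec_norm_def sum_nonneg)
  qed

  define E where "E u \<kappa> = Hs_energy \<Omega> s u (interior \<kappa>)" for u \<kappa>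
  define c where "c \<kappa> = 16 * \<nu>\<^sup>2 * diameter \<kappa> powr (2 * s)" for \<kappa> :: "point set"
  define K where "K \<kappa> = 12 * (\<mu>\<^sup>2 * (\<Sum>i\<in>UNIV. \<Sum>j\<in>UNIV. c \<kappa> * E (G i j) \<kappa>) + lam\<^sup>2 * (c \<kappa> * E (%x. \<Sum>i\<in>UNIV. G i i x) \<kappa>))" for \<kappa>
  have E0: "0 <= E u \<kappa>" for u \<kappa> unfolding E_def by (rule Hs_energy_nonneg)
  have c0: "0 <= c \<kappa>" for \<kappa> unfolding c_def by simp
  have K0: "0 <= K \<kappa>" for \<kappa> unfolding K_def
   by (intro mult_nonneg_nonneg add_nonneg_nonneg sum_nonneg c0 E0) auto
  have tau: "campanato_at p q r s (K (tri p q r)) (?\<tau> i j)"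
   if n: "noncollinear p q r" and k: "tri p q r \<in> \<T>" for p q r i j
  proof -
   let ?k = "tri p q r"
   have iA: "interior ?k = open_triangle p q r" by (simp add: open_triangle_def)
   have A: "open_triangle p q r \<subseteq> \<Omega>" using mesh_interior_subset[OF b m k] unfolding iA .
   have d: "\<forall>x\<in>open_triangle p q r. \<forall>y\<in>open_triangle p q r. norm (x - y) <= diameter ?k"
    unfolding dist_norm[symmetric] using interior_subset[of ?k] unfolding iA
    by (intro ballI diameter_bounded_bound compact_imp_bounded compact_triangle) auto
   have ca: "campanato_at p q r s (c ?k * E u ?k) u" if "u \<in> Hs \<Omega> s" for u
    using campanato_Hs[OF o oL n A s that triangle_diameter_pos[OF n] d regular_mesh_area[OF r k n]]
    by (simp add: c_def E_def iA)
   show ?thesis unfolding K_def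
    by (rule campanato_stress[where k = "%i j. c ?k * E (G i j) ?k" and G = G, OF n ca[OF GH] _ ca[OF DH]]) (intro mult_nonneg_nonneg c0 E0)+
  qed
  \<comment> \<open>The factors 12, 4 and 16 nu^2 come from \<open>campanato_stress\<close>,
    \<open>sum_Hs_energy_le\<close> and \<open>regular_mesh_area\<close>. Lambda disappears here
    into \<open>N2\<close>.\<close>
  have Ksum: "(\<Sum>\<kappa>\<in>\<T>. K \<kappa>) <= 768 * \<nu>\<^sup>2 * (\<mu>\<^sub>1\<^sup>2 + 1) * C\<^sub>\<Omega>\<^sup>2 * (H powr s * F)\<^sup>2"
  proof -
   define ch where "ch = 16 * \<nu>\<^sup>2 * H powr (2 * s)"
   have ch0: "0 <= ch" by (simp add: ch_def)
   have cch: "c \<kappa> <= ch" if "\<kappa> \<in> \<T>" for \<kappa>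
   proof -
    have "0 <= diameter \<kappa>" using mesh_triangle[OF m that] triangle_diameter_pos by (metis less_imp_le)
    then have "diameter \<kappa> powr (2 * s) <= H powr (2 * s)" using mesh_size_ge[OF m that] s by (intro powr_mono2) (auto simp: H_def)
    then show ?thesis by (simp add: c_def ch_def mult_left_mono)
   qed
   have cE: "(\<Sum>\<kappa>\<in>\<T>. c \<kappa> * E u \<kappa>) <= ch * (4 * (Hs_norm \<Omega> s u)\<^sup>2)" if "u \<in> Hs \<Omega> s" for u
   proof -
    have "(\<Sum>\<kappa>\<in>\<T>. c \<kappa> * E u \<kappa>) <= (\<Sum>\<kappa>\<in>\<T>. ch * E u \<kappa>)" by (intro sum_mono mult_right_mono cch E0)
    also have "\<dots> = ch * (\<Sum>\<kappa>\<in>\<T>. E u \<kappa>)" by (simp only: sum_distrib_left)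
    also have "\<dots> <= ch * (4 * (Hs_norm \<Omega> s u)\<^sup>2)"
     unfolding E_def by (intro mult_left_mono ch0 sum_Hs_energy_le[OF b m that])
    finally show ?thesis .
   qed
   have "(\<Sum>\<kappa>\<in>\<T>. K \<kappa>) = 12 * (\<mu>\<^sup>2 * (\<Sum>\<kappa>\<in>\<T>. \<Sum>i\<in>UNIV. \<Sum>j\<in>UNIV. c \<kappa> * E (G i j) \<kappa>) + lam\<^sup>2 * (\<Sum>\<kappa>\<in>\<T>. c \<kappa> * E (%x. \<Sum>i\<in>UNIV. G i i x) \<kappa>))"
    unfolding K_def by (simp only: sum_distrib_left[symmetric] sum.distrib)
   also have "(\<Sum>\<kappa>\<in>\<T>. \<Sum>i\<in>UNIV. \<Sum>j\<in>UNIV. c \<kappa> * E (G i j) \<kappa>) = (\<Sum>i\<in>UNIV. \<Sum>j\<in>UNIV. \<Sum>\<kappa>\<in>\<T>. c \<kappa> * E (G i j) \<kappa>)"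
    by (simp add: sum_2 sum.distrib)
   also have "12 * (\<mu>\<^sup>2 * (\<Sum>i\<in>UNIV. \<Sum>j\<in>UNIV. \<Sum>\<kappa>\<in>\<T>. c \<kappa> * E (G i j) \<kappa>) + lam\<^sup>2 * (\<Sum>\<kappa>\<in>\<T>. c \<kappa> * E (%x. \<Sum>i\<in>UNIV. G i i x) \<kappa>))
    <= 12 * (\<mu>\<^sub>1\<^sup>2 * (ch * (4 * N1\<^sup>2)) + lam\<^sup>2 * (ch * (4 * (Hs_norm \<Omega> s (%x. \<Sum>i\<in>UNIV. G i i x))\<^sup>2)))"
   proof (intro mult_left_mono[of _ _ 12] add_mono mult_mono[of "\<mu>\<^sup>2"] mult_left_mono[OF cE[OF DH]])
    show "\<mu>\<^sup>2 <= \<mu>\<^sub>1\<^sup>2" using mu mup by (intro power_mono) auto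
    have "(\<Sum>i\<in>UNIV. \<Sum>j\<in>UNIV. \<Sum>\<kappa>\<in>\<T>. c \<kappa> * E (G i j) \<kappa>) <= (\<Sum>i\<in>UNIV. \<Sum>j\<in>UNIV. ch * (4 * (Hs_norm \<Omega> s (G i j))\<^sup>2))"
     by (intro sum_mono cE GH)
    also have "\<dots> = ch * (4 * (\<Sum>i\<in>UNIV. \<Sum>j\<in>UNIV. (Hs_norm \<Omega> s (G i j))\<^sup>2))" by (simp only: sum_distrib_left)
    also have "\<dots> <= ch * (4 * N1\<^sup>2)" using Gsum ch0 by (intro mult_left_mono) auto
    finally show "(\<Sum>i\<in>UNIV. \<Sum>j\<in>UNIV. \<Sum>\<kappa>\<in>\<T>. c \<kappa> * E (G i j) \<kappa>) <= ch * (4 * N1\<^sup>2)" .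
    show "0 <= (\<Sum>i\<in>UNIV. \<Sum>j\<in>UNIV. \<Sum>\<kappa>\<in>\<T>. c \<kappa> * E (G i j) \<kappa>)" by (intro sum_nonneg mult_nonneg_nonneg c0 E0)
   qed auto
   also have "\<dots> = 48 * ch * (\<mu>\<^sub>1\<^sup>2 * N1\<^sup>2 + N2\<^sup>2)" by (simp add: N2_def power_mult_distrib algebra_simps)
   also have "\<dots> <= 48 * ch * ((\<mu>\<^sub>1\<^sup>2 + 1) * (C\<^sub>\<Omega> * F)\<^sup>2)"
   proof (rule mult_left_mono)
    have "N1\<^sup>2 <= (C\<^sub>\<Omega> * F)\<^sup>2" "N2\<^sup>2 <= (C\<^sub>\<Omega> * F)\<^sup>2" using N by (intro power_mono; linarith)+
    then show "\<mu>\<^sub>1\<^sup>2 * N1\<^sup>2 + N2\<^sup>2 <= (\<mu>\<^sub>1\<^sup>2 + 1) * (C\<^sub>\<Omega> * F)\<^sup>2"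
     using mult_left_mono[of "N1\<^sup>2" "(C\<^sub>\<Omega> * F)\<^sup>2" "\<mu>\<^sub>1\<^sup>2"] by (simp add: distrib_right)
   qed (use ch0 in simp)
   also have "\<dots> = 768 * \<nu>\<^sup>2 * (\<mu>\<^sub>1\<^sup>2 + 1) * C\<^sub>\<Omega>\<^sup>2 * (H powr s * F)\<^sup>2"
   proof -
    have "H powr (2 * s) = (H powr s)\<^sup>2" using H(1) by (simp add: powr_power mult.commute)
    then show ?thesis by (simp add: ch_def power_mult_distrib)
   qed
   finally show ?thesis .
  qed

  obtain u z where uz: "v = (%x. u x + z x)" "u \<in> vec_space (crouzeix_raviart \<Omega> \<T>)" "z \<in> vec_space (H10 \<Omega>)"
   using v unfolding Hh_def by blast
  have vi: "(%x. v x $ i) = (%x. u x $ i + z x $ i)" for i by (simp add: uz(1))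
  have ui: "(%x. u x $ i) \<in> crouzeix_raviart \<Omega> \<T>" and zi: "(%x. z x $ i) \<in> H10 \<Omega>" for i
   using uz(2,3) by (simp_all add: vec_space_def)
  note cr = crouzeix_raviart_plus_H10[OF b m ui zi]
  have v2: "sq_int (leb \<Omega>) (%x. v x $ i)" for i unfolding vi by (rule cr(1))
  have g1: "has_weak_partial (interior \<kappa>) j (%x. v x $ i) (g i j)" if "\<kappa> \<in> \<T>" for \<kappa> i j unfolding g_def vi by (rule cr(2)[OF that])
  have g2: "sq_int (leb (interior \<kappa>)) (g i j)" if "\<kappa> \<in> \<T>" for \<kappa> i j unfolding g_def vi by (rule cr(3)[OF that])
  have ec: "edge_compatible \<Omega> \<T> (%x. v x $ i) (g i)" for i unfolding g_def vi by (rule cr(4))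

  define \<Phi> where "\<Phi> i = (\<Sum>\<kappa>\<in>\<T>. \<Sum>j\<in>UNIV. lint (leb (interior \<kappa>)) (%x. (g i j x)\<^sup>2))" for i
  define R where "R i = (\<Sum>\<kappa>\<in>\<T>. lint (leb (interior \<kappa>)) (%x. \<Sum>j\<in>UNIV. ?\<tau> i j x * g i j x)) - lint (leb \<Omega>) (%x. f x $ i * v x $ i)" for i
  \<comment> \<open>The mu part of the energy alone controls the broken gradient; the divergence
    part is nonnegative, so the bound is uniform in lambda.\<close>
  have ha: "\<mu>\<^sub>0 * \<Phi> i <= ah_form \<Omega> \<T> \<mu> lam v v" for i
  proof -
   have "\<mu>\<^sub>0 * \<Phi> i = (\<Sum>\<kappa>\<in>\<T>. lint (leb (interior \<kappa>)) (%x. \<mu>\<^sub>0 * (\<Sum>j\<in>UNIV. (g i j x)\<^sup>2)))"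
    unfolding \<Phi>_def sum_distrib_left[of \<mu>\<^sub>0] using sq_int_square[OF g2]
    by (intro sum.cong refl) (simp add: sum_distrib_left[symmetric])
   also have "\<dots> <= (\<Sum>\<kappa>\<in>\<T>. lint (leb (interior \<kappa>)) (energy_density \<mu> lam g g))"
   proof (intro sum_mono integral_mono_AE')
    fix \<kappa> assume k: "\<kappa> \<in> \<T>"
    show "integrable (leb (interior \<kappa>)) (energy_density \<mu> lam g g)" by (rule energy_density_integrable(3)[OF g2[OF k] g2[OF k]])
    have le: "\<mu>\<^sub>0 * (\<Sum>j\<in>UNIV. (g i j x)\<^sup>2) <= energy_density \<mu> lam g g x" for x
    proof -
     have "(\<Sum>j\<in>UNIV. (g i j x)\<^sup>2) <= (\<Sum>i\<in>UNIV. \<Sum>j\<in>UNIV. (g i j x)\<^sup>2)"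
      by (rule member_le_sum[of i UNIV "%i. \<Sum>j\<in>UNIV. (g i j x)\<^sup>2"]) (auto intro: sum_nonneg)
     then have "\<mu>\<^sub>0 * (\<Sum>j\<in>UNIV. (g i j x)\<^sup>2) <= \<mu> * (\<Sum>i\<in>UNIV. \<Sum>j\<in>UNIV. (g i j x)\<^sup>2)"
      using mu assms(2) by (intro mult_mono sum_nonneg) auto
     also have "\<dots> <= energy_density \<mu> lam g g x" using mup lam by (intro energy_density_ge) auto
     finally show ?thesis .
    qed
    then show "AE x in leb (interior \<kappa>). \<mu>\<^sub>0 * (\<Sum>j\<in>UNIV. (g i j x)\<^sup>2) <= energy_density \<mu> lam g g x" by blast
    have "0 <= energy_density \<mu> lam g g x" for x
     using le[of x] assms(2) by (meson less_imp_le mult_nonneg_nonneg order_trans sum_nonneg zero_le_power2)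
    then show "AE x in leb (interior \<kappa>). 0 <= energy_density \<mu> lam g g x" by blast
   qed
   also have "\<dots> = ah_form \<Omega> \<T> \<mu> lam v v"
    unfolding g_def by (rule ah_form_eq[OF b m, symmetric]) (use g2 in \<open>simp_all add: g_def\<close>)
   finally show ?thesis .
  qed
  have R: "\<bar>R i\<bar> <= sqrt (2 / \<mu>\<^sub>0) * sqrt C3 * (H powr s * F) * h_norm \<Omega> \<T> \<mu> lam v" for i
  proof -
   have "\<bar>R i\<bar> <= sqrt (2 * \<Phi> i) * sqrt (8 * ?c1\<^sup>2 * (\<Sum>\<kappa>\<in>\<T>. K \<kappa>) + 2 * ?c2\<^sup>2 * H\<^sup>2 * lint (leb \<Omega>) (%x. (f x $ i)\<^sup>2))"
    unfolding R_def \<Phi>_def H_def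
   proof (rule scalar_consistency[OF b m r s K0 tau v2 g1 g2 ec f2])
    fix \<phi> assume "\<phi> \<in> test_functions \<Omega>"
    from weak_solution_stress[OF o w'(2) this, of i]
    show "lint (leb \<Omega>) (%x. \<Sum>j\<in>UNIV. ?\<tau> i j x * partial j \<phi> x) = lint (leb \<Omega>) (%x. f x $ i * \<phi> x)"
     by (simp only: G_def)
   qed
   also have "\<dots> <= (sqrt (2 / \<mu>\<^sub>0) * h_norm \<Omega> \<T> \<mu> lam v) * (sqrt C3 * (H powr s * F))"
   proof (rule mult_mono)
    have "2 * \<Phi> i <= (2 / \<mu>\<^sub>0) * ah_form \<Omega> \<T> \<mu> lam v v" using ha[of i] assms(2) by (simp add: field_simps)
    then show "sqrt (2 * \<Phi> i) <= sqrt (2 / \<mu>\<^sub>0) * h_norm \<Omega> \<T> \<mu> lam v"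
     unfolding h_norm_def real_sqrt_mult[symmetric] by (rule real_sqrt_le_mono)
    have Fi: "lint (leb \<Omega>) (%x. (f x $ i)\<^sup>2) <= F\<^sup>2"
    proof -
     have "lint (leb \<Omega>) (%x. (f x $ i)\<^sup>2) = (L2_norm \<Omega> (%x. f x $ i))\<^sup>2" by (simp add: L2_norm_def)
     also have "\<dots> <= (\<Sum>i\<in>UNIV. (L2_norm \<Omega> (%x. f x $ i))\<^sup>2)"
      by (rule member_le_sum[of i UNIV "%i. (L2_norm \<Omega> (%x. f x $ i))\<^sup>2"]) auto
     finally show ?thesis by (simp add: F_def vec_norm_def sum_nonneg)
    qed
    \<comment> \<open>The load term has order h^2 in the square; since 2 - 2s >= 0, the excess power
      of h is bounded by that of the diameter of the domain.\<close>
    have H2: "H\<^sup>2 <= dd powr (2 - 2 * s) * (H powr s)\<^sup>2"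
    proof -
     have "H\<^sup>2 = H powr ((2 - 2 * s) + 2 * s)" using H(1) by (simp add: powr_numeral)
     also have "\<dots> = H powr (2 - 2 * s) * (H powr s)\<^sup>2" unfolding powr_add using H(1) by (simp add: powr_power mult.commute)
     also have "\<dots> <= dd powr (2 - 2 * s) * (H powr s)\<^sup>2" using H s by (intro mult_right_mono powr_mono2) auto
     finally show ?thesis .
    qed
    have "8 * ?c1\<^sup>2 * (\<Sum>\<kappa>\<in>\<T>. K \<kappa>) <= 8 * ?c1\<^sup>2 * (768 * \<nu>\<^sup>2 * (\<mu>\<^sub>1\<^sup>2 + 1) * C\<^sub>\<Omega>\<^sup>2 * (H powr s * F)\<^sup>2)"
     by (rule mult_left_mono[OF Ksum]) simp
    moreover have "H\<^sup>2 * lint (leb \<Omega>) (%x. (f x $ i)\<^sup>2) <= (dd powr (2 - 2 * s) * (H powr s)\<^sup>2) * F\<^sup>2"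
     by (rule mult_mono[OF H2 Fi]) auto
    then have "2 * ?c2\<^sup>2 * (H\<^sup>2 * lint (leb \<Omega>) (%x. (f x $ i)\<^sup>2)) <= 2 * ?c2\<^sup>2 * ((dd powr (2 - 2 * s) * (H powr s)\<^sup>2) * F\<^sup>2)"
     by (rule mult_left_mono) simp
    ultimately have "8 * ?c1\<^sup>2 * (\<Sum>\<kappa>\<in>\<T>. K \<kappa>) + 2 * ?c2\<^sup>2 * (H\<^sup>2 * lint (leb \<Omega>) (%x. (f x $ i)\<^sup>2)) <=
     8 * ?c1\<^sup>2 * (768 * \<nu>\<^sup>2 * (\<mu>\<^sub>1\<^sup>2 + 1) * C\<^sub>\<Omega>\<^sup>2 * (H powr s * F)\<^sup>2) + 2 * ?c2\<^sup>2 * ((dd powr (2 - 2 * s) * (H powr s)\<^sup>2) * F\<^sup>2)"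
     by (rule add_mono)
    also have "\<dots> = C3 * (H powr s * F)\<^sup>2" unfolding C3_def distrib_right power_mult_distrib[of "H powr s" F] by (simp only: mult_ac)
    finally have "sqrt (8 * ?c1\<^sup>2 * (\<Sum>\<kappa>\<in>\<T>. K \<kappa>) + 2 * ?c2\<^sup>2 * H\<^sup>2 * lint (leb \<Omega>) (%x. (f x $ i)\<^sup>2)) <= sqrt (C3 * (H powr s * F)\<^sup>2)"
     by (simp only: mult.assoc real_sqrt_le_mono)
    also have "\<dots> = sqrt C3 * (H powr s * F)" unfolding real_sqrt_mult using F0 by simp
    finally show "sqrt (8 * ?c1\<^sup>2 * (\<Sum>\<kappa>\<in>\<T>. K \<kappa>) + 2 * ?c2\<^sup>2 * H\<^sup>2 * lint (leb \<Omega>) (%x. (f x $ i)\<^sup>2)) <= sqrt C3 * (H powr s * F)" .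
    have "0 <= \<Phi> i" unfolding \<Phi>_def by (intro sum_nonneg Bintegral_nonneg) simp
    then have "0 <= ah_form \<Omega> \<T> \<mu> lam v v" using ha[of i] assms(2) by (meson less_imp_le mult_nonneg_nonneg order_trans)
    then show "0 <= sqrt (2 / \<mu>\<^sub>0) * h_norm \<Omega> \<T> \<mu> lam v" unfolding h_norm_def using assms(2) by (intro mult_nonneg_nonneg) auto
    have "0 <= (\<Sum>\<kappa>\<in>\<T>. K \<kappa>)" by (intro sum_nonneg K0)
    then show "0 <= sqrt (8 * ?c1\<^sup>2 * (\<Sum>\<kappa>\<in>\<T>. K \<kappa>) + 2 * ?c2\<^sup>2 * H\<^sup>2 * lint (leb \<Omega>) (%x. (f x $ i)\<^sup>2))"
     by (intro real_sqrt_ge_zero add_nonneg_nonneg mult_nonneg_nonneg Bintegral_nonneg) auto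
   qed
   finally show ?thesis by (simp only: mult_ac)
  qed

  \<comment> \<open>The gradient of w is exchanged for that of the regular solution almost
    everywhere on each triangle, after which the form splits into the rows of the stress.\<close>
  have D: "Dh \<Omega> \<T> \<mu> lam f w v = (\<Sum>i\<in>UNIV. R i)"
  proof -
   have wH: "(%y. w y $ i) \<in> H1 \<Omega>" for i
    using w unfolding weak_solution_def vec_space_def mem_Collect_eq by (blast intro: H10_H1)
   define gw where "gw = (%i j. broken_partial \<T> j (%y. w y $ i))"
   have Gk: "sq_int (leb (interior \<kappa>)) (G i j)" if "\<kappa> \<in> \<T>" for \<kappa> i j
    by (rule sq_int_subset[OF Gs mesh_interior_subset[OF b m that] _ oS]) auto
   have ae: "AE x in leb (interior \<kappa>). G i j x = gw i j x" if k: "\<kappa> \<in> \<T>" for \<kappa> i j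
   proof -
    have iS: "interior \<kappa> \<in> sets lebesgue" by auto
    have "AE x in leb (interior \<kappa>). gw i j x = weak_partial \<Omega> j (%y. w y $ i) x"
     unfolding gw_def by (rule broken_partial_works(2)[OF m k has_weak_partial_subset[OF o open_interior mesh_interior_subset[OF b m k] H1D(2)[OF o wH]]])
    moreover have "AE x in leb (interior \<kappa>). weak_partial \<Omega> j (%y. w y $ i) x = G i j x"
     unfolding G_def by (rule AE_lebesgue_on_subset[OF weak_solution_gradient_unique[OF o mup lam w w'(2)] mesh_interior_subset[OF b m k] iS oS])
    ultimately show ?thesis by eventually_elim simp
   qed
   have gws: "sq_int (leb (interior \<kappa>)) (gw i j)" if k: "\<kappa> \<in> \<T>" for \<kappa> i j
    by (rule sq_int_cong_AE[OF Gk[OF k] borel_measurable_cong_AE_lebesgue_on[OF ae[OF k] _ sq_int_measurable[OF Gk[OF k]]] ae[OF k]]) auto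
   have "ah_form \<Omega> \<T> \<mu> lam w v = (\<Sum>\<kappa>\<in>\<T>. lint (leb (interior \<kappa>)) (energy_density \<mu> lam gw g))"
    unfolding gw_def g_def by (rule ah_form_eq[OF b m]) (use gws g2 in \<open>simp_all add: g_def gw_def\<close>)
   also have "\<dots> = (\<Sum>\<kappa>\<in>\<T>. \<Sum>i\<in>UNIV. lint (leb (interior \<kappa>)) (%x. \<Sum>j\<in>UNIV. ?\<tau> i j x * g i j x))"
   proof (rule sum.cong[OF refl])
    fix \<kappa> assume k: "\<kappa> \<in> \<T>"
    have iS: "interior \<kappa> \<in> sets lebesgue" by auto
    have "AE x in leb (interior \<kappa>). \<forall>i j. G i j x = gw i j x" using ae[OF k] by (simp add: AE_all_countable)
    then have "AE x in leb (interior \<kappa>). energy_density \<mu> lam gw g x = energy_density \<mu> lam G g x"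
     by eventually_elim (simp add: energy_density_def)
    then have "lint (leb (interior \<kappa>)) (energy_density \<mu> lam gw g) = lint (leb (interior \<kappa>)) (energy_density \<mu> lam G g)"
     by (rule integral_cong_AE_lebesgue_on[OF _ iS])
    also have "\<dots> = lint (leb (interior \<kappa>)) (%x. \<Sum>i\<in>UNIV. \<Sum>j\<in>UNIV. ?\<tau> i j x * g i j x)"
     by (rule arg_cong[of _ _ "lint (leb (interior \<kappa>))"], rule ext) (rule energy_density_stress)
    also have "\<dots> = (\<Sum>i\<in>UNIV. lint (leb (interior \<kappa>)) (%x. \<Sum>j\<in>UNIV. ?\<tau> i j x * g i j x))"
    proof (rule Bintegral_sum)
     fix i
     have "sq_int (leb (interior \<kappa>)) (?\<tau> i j)" for j
     proof -
      obtain p q r where n: "noncollinear p q r" "\<kappa> = tri p q r" by (rule mesh_triangle[OF m k])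
      show ?thesis using tau[OF n(1) k[unfolded n(2)], of i j] by (simp add: campanato_at_def n(2) open_triangle_def)
     qed
     then show "integrable (leb (interior \<kappa>)) (%x. \<Sum>j\<in>UNIV. ?\<tau> i j x * g i j x)"
      by (intro Bintegrable_sum sq_int_mult g2[OF k])
    qed
    finally show "lint (leb (interior \<kappa>)) (energy_density \<mu> lam gw g) =
     (\<Sum>i\<in>UNIV. lint (leb (interior \<kappa>)) (%x. \<Sum>j\<in>UNIV. ?\<tau> i j x * g i j x))" .
   qed
   also have "\<dots> = (\<Sum>i\<in>UNIV. \<Sum>\<kappa>\<in>\<T>. lint (leb (interior \<kappa>)) (%x. \<Sum>j\<in>UNIV. ?\<tau> i j x * g i j x))" by (rule sum.swap)
   finally have A: "ah_form \<Omega> \<T> \<mu> lam w v = (\<Sum>i\<in>UNIV. \<Sum>\<kappa>\<in>\<T>. lint (leb (interior \<kappa>)) (%x. \<Sum>j\<in>UNIV. ?\<tau> i j x * g i j x))" .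
   have "b_form \<Omega> f v = lint (leb \<Omega>) (%x. \<Sum>i\<in>UNIV. f x $ i * v x $ i)" by (simp add: b_form_def inner_vec_def)
   also have "\<dots> = (\<Sum>i\<in>UNIV. lint (leb \<Omega>) (%x. f x $ i * v x $ i))"
    by (rule Bintegral_sum) (rule sq_int_mult[OF f2 v2])
   finally show ?thesis unfolding Dh_def A R_def by (simp only: sum_subtractf)
  qed
  have "\<bar>Dh \<Omega> \<T> \<mu> lam f w v\<bar> <= \<bar>R 1\<bar> + \<bar>R 2\<bar>" unfolding D sum_2 by (rule abs_triangle_ineq)
  also have "\<dots> <= 2 * (sqrt (2 / \<mu>\<^sub>0) * sqrt C3) * ((H powr s * F) * h_norm \<Omega> \<T> \<mu> lam v)"
   using R[of 1] R[of 2] by (simp only: mult.assoc)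
  also have "\<dots> <= CC * ((H powr s * F) * h_norm \<Omega> \<T> \<mu> lam v)"
  proof (rule mult_right_mono)
   have "0 <= \<Phi> 1" unfolding \<Phi>_def by (intro sum_nonneg Bintegral_nonneg) simp
   then have "0 <= ah_form \<Omega> \<T> \<mu> lam v v" using ha[of 1] assms(2) by (meson less_imp_le mult_nonneg_nonneg order_trans)
   then show "0 <= (H powr s * F) * h_norm \<Omega> \<T> \<mu> lam v" unfolding h_norm_def using F0 by (intro mult_nonneg_nonneg) auto
  qed (simp add: CC_def)
  finally show ?thesis unfolding H_def F_def by (simp only: mult.assoc)
 qed
 show ?thesis by (rule exI[of _ CC]) (use CC main in blast)
qed

end
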